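(* Let $\rho\ge0$. Then $\mathcal G$ is a bijection from the space $$\Big\{f\in L^2_{\mathrm{rad}}(H_n)\ :\ \lim_{j\to\infty}\big\|L^jf\big\|_{L^2(H_n)}^{1/j}\le\rho\Big\}$$ onto the space $$\big\{F\in L^2(\Sigma)\ :\ \rho(F)\le\rho\big\}.$$
   Context: Let $n\ge 1$. The Heisenberg group is $H_n=\mathbb C^n\times\mathbb R$ with product $(z,t)(w,u)=(z+w,\,t+u+\tfrac12\operatorname{Im}\langle w|z\rangle)$, $\langle w|z\rangle=\sum_j w_j\bar z_j$, so $(z,t)^{-1}=(-z,-t)$; Lebesgue measure $dm=dz\,dt$ is a Haar measure. Sublaplacian: $L=-2\sum_{j=1}^n(Z_j\bar Z_j+\bar Z_jZ_j)$ with $Z_j=\partial_{z_j}-\frac i4\bar z_j\partial_t$, $\bar Z_j=\partial_{\bar z_j}+\frac i4z_j\partial_t$; $L^jf$ is taken in the sense of distributions, and membership in the first set includes that $L^jf\in L^2(H_n)$ for every $j$ and that the limit exists. A function on $H_n$ is radial if invariant under $(z,t)\mapsto(kz,t)$, $k\in U(n)$; $L^2_{\mathrm{rad}}(H_n)$ is the space of radial functions in $L^2(H_n)$ and $\mathcal S_{\mathrm{rad}}(H_n)$ that of radial Schwartz functions. Spherical functions: for $(\xi,\lambda)\in\mathbb C^2$, $$\Phi_{\xi,\lambda}(z,t)=e^{i\lambda t}e^{-\lambda|z|^2/4}\Big(1+\sum_{k\ge1}\frac{|z|^{2k}}{(n)_k\,k!\,4^k}\prod_{d=0}^{k-1}\big(\lambda(2d+n)-\xi\big)\Big),\qquad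 (n)_k=n(n+1)\cdots(n+k-1).$$ Heisenberg fan: $\Sigma=\{(\xi,\lambda)\in\mathbb R^2:\lambda\neq0,\ \xi=|\lambda|(2j+n),\ j\in\mathbb N\}\cup\{(\xi,0):\xi\ge0\}$, with $0\in\mathbb N$. Plancherel measure $\mu$ on $\Sigma$: $\int_\Sigma\psi\,d\mu=\frac1{(2\pi)^{n+1}}\int_{\mathbb R}\sum_{j\ge0}\binom{j+n-1}{j}\psi(|\lambda|(2j+n),\lambda)|\lambda|^n\,d\lambda$. $L^2(\Sigma)=L^2(\Sigma,\mu)$. For $f\in\mathcal S_{\mathrm{rad}}(H_n)$, $\mathcal Gf(\xi,\lambda)=\int_{H_n}f(x)\Phi_{\xi,\lambda}(x^{-1})\,dx$ on $\Sigma$; $\mathcal G$ extends by the Plancherel formula to a unitary map of $L^2_{\mathrm{rad}}(H_n)$ onto $L^2(\Sigma)$. For $F\in L^2(\Sigma)$, $\rho(F)=\rho(F\mu)=\max\{|\xi|:(\xi,\lambda)\in\operatorname{supp}(F\mu)\}\in[0,\infty]$, with $F\mu$ viewed as a distribution on $\mathbb R^2$ (understood as a supremum, $0$ if $F=0$). *)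

theory Defs
  imports "HOL-Analysis.Analysis"
begin

subsection \<open>Square-integrable functions and their classes\<close>

definition L2_fun :: "'a measure \<Rightarrow> ('a \<Rightarrow> complex) set" where
  "L2_fun M = {f \<in> borel_measurable M. integrable M (\<lambda>x. (cmod (f x))\<^sup>2)}"

definition L2_norm :: "'a measure \<Rightarrow> ('a \<Rightarrow> complex) \<Rightarrow> real" where
  "L2_norm M f = sqrt (\<integral>x. (cmod (f x))\<^sup>2 \<partial>M)"

definition L2_class :: "'a measure \<Rightarrow> ('a \<Rightarrow> complex) \<Rightarrow> ('a \<Rightarrow> complex) set" where
  "L2_class M f = {g \<in> L2_fun M. AE x in M. g x = f x}"

definition L2_tendsto ::
  "'a measure \<Rightarrow> (nat \<Rightarrow> 'a \<Rightarrow> complex) \<Rightarrow> ('a \<Rightarrow> complex) \<Rightarrow> bool" where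
  "L2_tendsto M s f \<longleftrightarrow> (\<forall>k. s k \<in> L2_fun M) \<and> f \<in> L2_fun M \<and>
     (\<lambda>k. L2_norm M (\<lambda>x. s k x - f x)) \<longlonglongrightarrow> 0"


subsection \<open>Smooth functions, test functions, Schwartz functions\<close>

definition dir_deriv :: "'a::euclidean_space \<Rightarrow> ('a \<Rightarrow> complex) \<Rightarrow> 'a \<Rightarrow> complex" where
  "dir_deriv v f = (\<lambda>x. frechet_derivative f (at x) v)"

definition smooth :: "('a::euclidean_space \<Rightarrow> complex) \<Rightarrow> bool" where
  "smooth f \<longleftrightarrow> (\<forall>vs. fold dir_deriv vs f differentiable_on UNIV)"

definition test_fun :: "('a::euclidean_space \<Rightarrow> complex) \<Rightarrow> bool" where
  "test_fun \<phi> \<longleftrightarrow> smooth \<phi> \<and> compact (closure {x. \<phi> x \<noteq> 0})"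

definition schwartz :: "('a::euclidean_space \<Rightarrow> complex) \<Rightarrow> bool" where
  "schwartz f \<longleftrightarrow> smooth f \<and>
     (\<forall>m vs. bounded (range (\<lambda>x. norm x ^ m * cmod (fold dir_deriv vs f x))))"


subsection \<open>Distributions\<close>

text \<open>A distribution is a functional of which only the values on test functions are
  meaningful. Derivatives and products with smooth functions are defined by duality.\<close>

type_synonym 'a distr = "('a \<Rightarrow> complex) \<Rightarrow> complex"

definition distr_eq :: "'a::euclidean_space distr \<Rightarrow> 'a distr \<Rightarrow> bool" where
  "distr_eq S T \<longleftrightarrow> (\<forall>\<phi>. test_fun \<phi> \<longrightarrow> S \<phi> = T \<phi>)"

definition distr_of_fun :: "('a::euclidean_space \<Rightarrow> complex) \<Rightarrow> 'a distr" where
  "distr_of_fun f = (\<lambda>\<phi>. \<integral>x. f x * \<phi> x \<partial>lborel)"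

definition distr_deriv :: "'a::euclidean_space \<Rightarrow> 'a distr \<Rightarrow> 'a distr" where
  "distr_deriv v T = (\<lambda>\<phi>. - T (dir_deriv v \<phi>))"

definition distr_mult :: "('a \<Rightarrow> complex) \<Rightarrow> 'a distr \<Rightarrow> 'a distr" where
  "distr_mult a T = (\<lambda>\<phi>. T (\<lambda>x. a x * \<phi> x))"

definition distr_supp :: "'a::euclidean_space distr \<Rightarrow> 'a set" where
  "distr_supp T = {p. \<forall>U. open U \<and> p \<in> U \<longrightarrow>
     (\<exists>\<phi>. test_fun \<phi> \<and> closure {x. \<phi> x \<noteq> 0} \<subseteq> U \<and> T \<phi> \<noteq> 0)}"


subsection \<open>The Heisenberg group and its sublaplacian\<close>

type_synonym 'n heis = "(complex ^ 'n) \<times> real"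

definition heis_mult :: "'n::finite heis \<Rightarrow> 'n heis \<Rightarrow> 'n heis" where
  "heis_mult x y = (fst x + fst y,
     snd x + snd y + Im (\<Sum>j\<in>UNIV. fst y $ j * cnj (fst x $ j)) / 2)"

definition heis_inv :: "'n::finite heis \<Rightarrow> 'n heis" where
  "heis_inv x = (- fst x, - snd x)"

lemma heis_mult_inv: "heis_mult x (heis_inv x) = (0, 0)" "heis_mult (heis_inv x) x = (0, 0)"
  by (simp_all add: heis_mult_def heis_inv_def sum_negf)

definition distr_Z :: "'n::finite \<Rightarrow> 'n heis distr \<Rightarrow> 'n heis distr" where
  "distr_Z j T = (\<lambda>\<phi>.
     (distr_deriv (axis j 1, 0) T \<phi> - \<i> * distr_deriv (axis j \<i>, 0) T \<phi>) / 2
     - \<i> / 4 * distr_mult (\<lambda>x. cnj (fst x $ j)) (distr_deriv (0, 1) T) \<phi>)"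

definition distr_Zbar :: "'n::finite \<Rightarrow> 'n heis distr \<Rightarrow> 'n heis distr" where
  "distr_Zbar j T = (\<lambda>\<phi>.
     (distr_deriv (axis j 1, 0) T \<phi> + \<i> * distr_deriv (axis j \<i>, 0) T \<phi>) / 2
     + \<i> / 4 * distr_mult (\<lambda>x. fst x $ j) (distr_deriv (0, 1) T) \<phi>)"

definition sublaplacian :: "'n::finite heis distr \<Rightarrow> 'n heis distr" where
  "sublaplacian T = (\<lambda>\<phi>.
     - 2 * (\<Sum>j\<in>UNIV. distr_Z j (distr_Zbar j T) \<phi> + distr_Zbar j (distr_Z j T) \<phi>))"


subsection \<open>Radial functions\<close>

definition unitary :: "complex ^ 'n ^ 'n \<Rightarrow> bool" where
  "unitary k \<longleftrightarrow> k ** (\<chi> i j. cnj (k $ j $ i)) = mat 1 \<and> (\<chi> i j. cnj (k $ j $ i)) ** k = mat 1"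

definition L2_rad :: "('n::finite heis \<Rightarrow> complex) set" where
  "L2_rad = {f \<in> L2_fun lborel.
     \<forall>k. unitary k \<longrightarrow> (AE x in lborel. f (k *v fst x, snd x) = f x)}"

definition schwartz_rad :: "('n::finite heis \<Rightarrow> complex) set" where
  "schwartz_rad = {f. schwartz f \<and> (\<forall>k z t. unitary k \<longrightarrow> f (k *v z, t) = f (z, t))}"


subsection \<open>Spherical functions, Heisenberg fan, Plancherel measure\<close>

text \<open>The central frequency, usually called lambda, is written \<open>\<tau>\<close>.\<close>

definition spherical :: "complex \<Rightarrow> complex \<Rightarrow> 'n::finite heis \<Rightarrow> complex" where
  "spherical \<xi> \<tau> x = (let n = CARD('n); r = norm (fst x) in
     exp (\<i> * \<tau> * of_real (snd x)) * exp (- \<tau> * of_real (r\<^sup>2) / 4) *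
     (1 + (\<Sum>k. let m = Suc k in
        of_real (r ^ (2 * m)) / (pochhammer (of_nat n) m * fact m * 4 ^ m) *
        (\<Prod>d<m. \<tau> * of_nat (2 * d + n) - \<xi>))))"

definition fan :: "nat \<Rightarrow> (real \<times> real) set" where
  "fan n = {(\<xi>, \<tau>). \<tau> \<noteq> 0 \<and> (\<exists>j::nat. \<xi> = \<bar>\<tau>\<bar> * real (2 * j + n))} \<union> {(\<xi>, \<tau>). \<tau> = 0 \<and> \<xi> \<ge> 0}"

text \<open>The measure lives on the fan itself, not on the plane: the values of a function outside the
  fan play no role. The lemma below is the usual integral formula.\<close>

definition plancherel :: "nat \<Rightarrow> (real \<times> real) measure" where
  "plancherel n = distr
     (density (lborel \<Otimes>\<^sub>M count_space UNIV)
       (\<lambda>(\<tau>, j). ennreal (real ((j + n - 1) choose j) * \<bar>\<tau>\<bar> ^ n / (2 * pi) ^ (n + 1))))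
     (restrict_space borel (fan n))
     (\<lambda>(\<tau>, j). (\<bar>\<tau>\<bar> * real (2 * j + n), \<tau>))"

lemma nn_integral_plancherel:
  assumes [measurable]: "\<psi> \<in> borel_measurable (restrict_space borel (fan n))"
  shows "(\<integral>\<^sup>+p. \<psi> p \<partial>plancherel n) =
    ennreal (1 / (2 * pi) ^ (n + 1)) *
    (\<integral>\<^sup>+\<tau>. (\<Sum>j. of_nat ((j + n - 1) choose j) * \<psi> (\<bar>\<tau>\<bar> * real (2 * j + n), \<tau>)) * ennreal (\<bar>\<tau>\<bar> ^ n) \<partial>lborel)"
proof -
  define h where "h = (\<lambda>(\<tau>::real, j::nat). (\<bar>\<tau>\<bar> * real (2 * j + n), \<tau>))"
  define w where "w = (\<lambda>(\<tau>::real, j::nat).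
    ennreal (real ((j + n - 1) choose j) * \<bar>\<tau>\<bar> ^ n / (2 * pi) ^ (n + 1)))"
  have w [measurable]: "w \<in> borel_measurable (lborel \<Otimes>\<^sub>M count_space UNIV)"
    unfolding w_def by measurable
  have "h \<in> borel_measurable (lborel \<Otimes>\<^sub>M count_space UNIV)"
    unfolding h_def by measurable
  moreover have "h \<in> space (lborel \<Otimes>\<^sub>M count_space UNIV) \<rightarrow> fan n"
    by (auto simp: h_def fan_def)
  ultimately have h [measurable]:
    "h \<in> lborel \<Otimes>\<^sub>M count_space UNIV \<rightarrow>\<^sub>M restrict_space borel (fan n)"
    by (intro measurable_restrict_space2) auto
  interpret sigma_finite_measure "count_space (UNIV :: nat set)"
    by (rule sigma_finite_measure_count_space)
  have "(\<integral>\<^sup>+p. \<psi> p \<partial>plancherel n) =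
      (\<integral>\<^sup>+x. w x * \<psi> (h x) \<partial>(lborel \<Otimes>\<^sub>M count_space UNIV))"
    unfolding plancherel_def w_def [symmetric] h_def [symmetric]
    by (simp add: nn_integral_distr nn_integral_density)
  also have "\<dots> = (\<integral>\<^sup>+\<tau>. (\<Sum>j. w (\<tau>, j) * \<psi> (h (\<tau>, j))) \<partial>lborel)"
    by (subst nn_integral_fst [symmetric]) (simp_all add: nn_integral_count_space_nat)
  also have "\<dots> = (\<integral>\<^sup>+\<tau>. ennreal (1 / (2 * pi) ^ (n + 1)) *
      ((\<Sum>j. of_nat ((j + n - 1) choose j) * \<psi> (h (\<tau>, j))) * ennreal (\<bar>\<tau>\<bar> ^ n)) \<partial>lborel)"
  proof (intro nn_integral_cong)
    fix \<tau> :: real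
    have "w (\<tau>, j) * \<psi> (h (\<tau>, j)) = ennreal (1 / (2 * pi) ^ (n + 1)) * ennreal (\<bar>\<tau>\<bar> ^ n) *
      (of_nat ((j + n - 1) choose j) * \<psi> (h (\<tau>, j)))" for j
    proof -
      have "w (\<tau>, j) = ennreal ((1 / (2 * pi) ^ (n + 1)) * \<bar>\<tau>\<bar> ^ n * real ((j + n - 1) choose j))"
        by (simp add: w_def)
      also have "\<dots> = ennreal (1 / (2 * pi) ^ (n + 1)) * ennreal (\<bar>\<tau>\<bar> ^ n) *
          of_nat ((j + n - 1) choose j)"
        by (subst ennreal_mult | simp add: ennreal_of_nat_eq_real_of_nat)+
      finally show ?thesis by (simp add: mult.assoc)
    qed
    then have "(\<Sum>j. w (\<tau>, j) * \<psi> (h (\<tau>, j))) = ennreal (1 / (2 * pi) ^ (n + 1)) * ennreal (\<bar>\<tau>\<bar> ^ n) *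
      (\<Sum>j. of_nat ((j + n - 1) choose j) * \<psi> (h (\<tau>, j)))"
      by (simp only: ennreal_suminf_cmult)
    then show "(\<Sum>j. w (\<tau>, j) * \<psi> (h (\<tau>, j))) = ennreal (1 / (2 * pi) ^ (n + 1)) *
      ((\<Sum>j. of_nat ((j + n - 1) choose j) * \<psi> (h (\<tau>, j))) * ennreal (\<bar>\<tau>\<bar> ^ n))"
      by (simp only: ac_simps)
  qed
  also have "\<dots> = ennreal (1 / (2 * pi) ^ (n + 1)) * (\<integral>\<^sup>+\<tau>.
      (\<Sum>j. of_nat ((j + n - 1) choose j) * \<psi> (h (\<tau>, j))) * ennreal (\<bar>\<tau>\<bar> ^ n) \<partial>lborel)"
    by (rule nn_integral_cmult) measurable
  finally show ?thesis
    by (simp add: h_def)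
qed


subsection \<open>The spherical transform on Schwartz functions and its extension to L2\<close>

definition spherical_transform :: "('n::finite heis \<Rightarrow> complex) \<Rightarrow> real \<times> real \<Rightarrow> complex" where
  "spherical_transform f = (\<lambda>(\<xi>, \<tau>).
     \<integral>x. f x * spherical (of_real \<xi>) (of_real \<tau>) (heis_inv x) \<partial>lborel)"

text \<open>The extension is the L2-closure of the transform of radial Schwartz functions. It maps
  an L2-class X to the set of all limits arising from sequences that converge to an element
  of X; that this set is again an L2-class is part of the Plancherel theorem.\<close>

definition spherical_transform_L2 ::
  "('n::finite heis \<Rightarrow> complex) set \<Rightarrow> (real \<times> real \<Rightarrow> complex) set" where
  "spherical_transform_L2 X = {F. \<exists>f\<in>X. \<exists>s. (\<forall>k. s k \<in> schwartz_rad) \<and>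
     L2_tendsto lborel s f \<and>
     L2_tendsto (plancherel CARD('n)) (\<lambda>k. spherical_transform (s k)) F}"


subsection \<open>The two spaces\<close>

definition spectral_radius_space :: "real \<Rightarrow> ('n::finite heis \<Rightarrow> complex) set set" where
  "spectral_radius_space \<rho> = L2_class lborel ` {f \<in> L2_rad.
     \<exists>g. (\<forall>j. g j \<in> L2_fun lborel \<and>
            distr_eq ((sublaplacian ^^ j) (distr_of_fun f)) (distr_of_fun (g j))) \<and>
         (\<exists>r. (\<lambda>j. root j (L2_norm lborel (g j))) \<longlonglongrightarrow> r \<and> r \<le> \<rho>)}"

definition supp_radius :: "nat \<Rightarrow> (real \<times> real \<Rightarrow> complex) \<Rightarrow> ennreal" where
  "supp_radius n F =
     (SUP (\<xi>, \<tau>) \<in> distr_supp (\<lambda>\<phi>. \<integral>p. F p * \<phi> p \<partial>plancherel n). ennreal \<bar>\<xi>\<bar>)"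

definition supp_radius_space :: "nat \<Rightarrow> real \<Rightarrow> (real \<times> real \<Rightarrow> complex) set set" where
  "supp_radius_space n \<rho> =
     L2_class (plancherel n) ` {F \<in> L2_fun (plancherel n). supp_radius n F \<le> ennreal \<rho>}"

end

theory Submission
  imports Defs "HOL-Probability.Probability"
begin

text \<open>For a test function p supported in the positive half line, a natural number j and a sign s, the
 wave packet \<open>pk s p j\<close> is the inverse transform of the function that is \<open>p (s * t)\<close> at the point of
 the j-th branch of the fan with central frequency t and 0 on the other branches. It is an explicit
 Schwartz function: a finite sum of powers of \<open>norm z\<close> squared times Laplace transforms of test
 functions at the complex number with real part \<open>(norm z) ^ 2 / 4\<close> and imaginary part the central variable up to sign.
 The transform is isometric on the span of the packets, and the sublaplacian multiplies p by the
 coordinate \<open>xi\<close> of the fan.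

 Packets are total on the dual side by the fundamental lemma on each branch. On the group, a
 function orthogonal to all packets has, for almost every central frequency, vanishing Laguerre
 coefficients, hence vanishing moments against a Gaussian; by uniqueness of Fourier transforms it is
 orthogonal to every bounded function of \<open>norm z\<close> and the central variable with bounded support.
 If it is radial, its averages over balls are exactly invariant under the unitary group, so they
 are among the functions just described, and they vanish.

 Hence the transform is unitary. If g is the weak sublaplacian of f, testing against packets cut off
 along the group dilations shows that the transform of g is \<open>xi\<close> times that of f. So the norms of the
 powers of the sublaplacian are those of \<open>xi ^ j * F\<close>, whose j-th roots tend to the
 essential supremum of \<open>xi\<close> where F does not vanish.\<close>

subsection \<open>Square-integrable functions\<close>

text \<open>The obstacle is that the extended transform is only the closure of a graph, so
  existence, uniqueness and isometry of limits have to be proved. Packets make this possible because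
  both sides are explicit: Fubini turns the pairing of any integrable f with a packet into a pairing
  of its transform, so the isometry on packets follows by pairing a packet with itself, and
  orthogonal projection then yields a weak transform of every square-integrable f, radial or not.
  Non-radial functions cannot be avoided: the weak sublaplacian is tested against arbitrary test
  functions, and the functions representing its powers are not assumed radial. Supports in the open
  half line keep packets away from the ray of the fan where the branches accumulate, and give joint
  decay in z and t. Invariance of a radial f holds only almost everywhere, with a null set depending
  on the unitary map, while a function of \<open>norm z\<close> and t is recovered by restriction to
  a null set; averages over balls bridge this gap without integration over the unitary
  group.\<close>

definition l2_inner :: "'a measure => ('a => complex) => ('a => complex) => complex" where
 "l2_inner M f g = (LINT x|M. f x * cnj (g x))"

lemma borel_measurable_cnj' [measurable (raw)]:
 "f \<in> borel_measurable M ==> (\<lambda>x. cnj (f x)) \<in> borel_measurable M"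
 by (rule borel_measurable_continuous_on[where f = cnj]) (auto intro: continuous_intros)

lemma L2_fun_measurable [measurable_dest]: "f \<in> L2_fun M ==> f \<in> borel_measurable M"
 by (simp add: L2_fun_def)

lemma L2_fun_integrable: "f \<in> L2_fun M ==> integrable M (\<lambda>x. (cmod (f x))^2)"
 by (simp add: L2_fun_def)

lemma L2_funI: "f \<in> borel_measurable M ==> integrable M (\<lambda>x. (cmod (f x))^2) ==> f \<in> L2_fun M"
 by (simp add: L2_fun_def)

lemma L2_fun_dominated:
 assumes "f \<in> borel_measurable M" "g \<in> L2_fun M" "AE x in M. cmod (f x) \<le> C * cmod (g x)"
 shows "f \<in> L2_fun M"
proof (rule L2_funI[OF assms(1)])
 show "integrable M (\<lambda>x. (cmod (f x))^2)"
 proof (rule Bochner_Integration.integrable_bound)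
  show "integrable M (\<lambda>x. C^2 * (cmod (g x))^2)" using L2_fun_integrable[OF assms(2)] by simp
  show "AE x in M. norm ((cmod (f x))^2) \<le> norm (C^2 * (cmod (g x))^2)"
   using assms(3)
  proof eventually_elim
   case (elim x)
   have "(cmod (f x))^2 \<le> (C * cmod (g x))^2" using elim by (intro power_mono) auto
   then show ?case by (simp add: power_mult_distrib)
  qed
 qed (use assms(1) in simp)
qed

lemma L2_fun_zero [simp]: "(\<lambda>x. 0) \<in> L2_fun M"
 by (simp add: L2_fun_def)

lemma L2_fun_scale: "f \<in> L2_fun M ==> (\<lambda>x. c * f x) \<in> L2_fun M"
 by (rule L2_fun_dominated[where C = "cmod c" and g = f]) (auto simp: norm_mult)

lemma L2_fun_cnj: "f \<in> L2_fun M ==> (\<lambda>x. cnj (f x)) \<in> L2_fun M"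
 by (rule L2_fun_dominated[where C = 1 and g = f]) (auto)

lemma L2_fun_add:
 assumes "f \<in> L2_fun M" "g \<in> L2_fun M"
 shows "(\<lambda>x. f x + g x) \<in> L2_fun M"
proof (rule L2_funI)
 show "integrable M (\<lambda>x. (cmod (f x + g x))^2)"
 proof (rule Bochner_Integration.integrable_bound)
  show "integrable M (\<lambda>x. 2 * (cmod (f x))^2 + 2 * (cmod (g x))^2)"
   using L2_fun_integrable[OF assms(1)] L2_fun_integrable[OF assms(2)] by simp
  show "AE x in M. norm ((cmod (f x + g x))^2) \<le> norm (2 * (cmod (f x))^2 + 2 * (cmod (g x))^2)"
  proof (rule AE_I2)
   fix x
   have "(cmod (f x + g x))^2 \<le> (cmod (f x) + cmod (g x))^2"
    by (intro power_mono norm_triangle_ineq) auto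
   also have "... \<le> 2 * (cmod (f x))^2 + 2 * (cmod (g x))^2"
    using sum_squares_bound[of "cmod (f x)" "cmod (g x)"] by (simp add: power2_sum)
   finally show "norm ((cmod (f x + g x))^2) \<le> norm (2 * (cmod (f x))^2 + 2 * (cmod (g x))^2)" by simp
  qed
 qed (use assms in measurable)
qed (use assms in measurable)

lemma L2_fun_diff:
 assumes "f \<in> L2_fun M" "g \<in> L2_fun M"
 shows "(\<lambda>x. f x - g x) \<in> L2_fun M"
 using L2_fun_add[OF assms(1) L2_fun_scale[OF assms(2), of "-1"]] by simp

lemma L2_fun_mult_integrable:
 assumes "f \<in> L2_fun M" "g \<in> L2_fun M"
 shows "integrable M (\<lambda>x. f x * g x)"
proof (rule Bochner_Integration.integrable_bound)
 show "integrable M (\<lambda>x. (cmod (f x))^2 + (cmod (g x))^2)"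
  using L2_fun_integrable[OF assms(1)] L2_fun_integrable[OF assms(2)] by simp
 show "AE x in M. norm (f x * g x) \<le> norm ((cmod (f x))^2 + (cmod (g x))^2)"
 proof (rule AE_I2)
  fix x
  have "cmod (f x) * cmod (g x) \<le> (cmod (f x))^2 + (cmod (g x))^2"
   using sum_squares_bound[of "cmod (f x)" "cmod (g x)"] 
    mult_nonneg_nonneg[OF norm_ge_zero norm_ge_zero, of "f x" "g x"] by linarith
  then show "norm (f x * g x) \<le> norm ((cmod (f x))^2 + (cmod (g x))^2)" by (simp add: norm_mult)
 qed
qed (use assms in measurable)

lemma L2_inner_integrable:
 assumes "f \<in> L2_fun M" "g \<in> L2_fun M"
 shows "integrable M (\<lambda>x. f x * cnj (g x))"
 using L2_fun_mult_integrable[OF assms(1) L2_fun_cnj[OF assms(2)]] .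

lemma integrable_mult_bounded:
 fixes f h :: "'a => complex"
 assumes f: "integrable M f" and h: "h \<in> borel_measurable M" and B: "\<And>x. cmod (h x) \<le> B"
 shows "integrable M (\<lambda>x. f x * h x)"
proof (rule Bochner_Integration.integrable_bound[OF integrable_mult_right[OF integrable_norm[OF f], of B]])
 have "B \<ge> 0" using B norm_ge_zero order_trans by blast
 then have "norm (f x * h x) \<le> norm (B * norm (f x))" for x
  using mult_right_mono[OF B[of x] norm_ge_zero[of "f x"]] by (simp add: norm_mult abs_mult mult.commute)
 then show "AE x in M. norm (f x * h x) \<le> norm (B * norm (f x))" by simp
qed (use f h in auto)

lemma L2_norm_nonneg [simp]: "0 \<le> L2_norm M f"
 by (simp add: L2_norm_def)

lemma L2_norm_sq: "(L2_norm M f)^2 = (LINT x|M. (cmod (f x))^2)"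
 by (simp add: L2_norm_def)

lemma L2_norm_scale: "L2_norm M (\<lambda>x. c * f x) = cmod c * L2_norm M f"
 by (simp add: L2_norm_def norm_mult power_mult_distrib real_sqrt_mult)

lemma L2_norm_uminus: "L2_norm M (\<lambda>x. f x - g x) = L2_norm M (\<lambda>x. g x - f x)"
 by (simp add: L2_norm_def norm_minus_commute)

lemma L2_norm_cong_AE:
 assumes "f \<in> borel_measurable M" "g \<in> borel_measurable M" "AE x in M. f x = g x"
 shows "L2_norm M f = L2_norm M g"
 unfolding L2_norm_def
 by (rule arg_cong[where f = sqrt], rule integral_cong_AE) (use assms in auto)

lemma L2_fun_cong_AE:
 assumes "f \<in> borel_measurable M" "g \<in> L2_fun M" "AE x in M. f x = g x"
 shows "f \<in> L2_fun M"
 by (rule L2_fun_dominated[OF assms(1,2), where C = 1]) (use assms(3) in auto)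

lemma L2_norm_eq_0_iff:
 assumes "f \<in> L2_fun M"
 shows "L2_norm M f = 0 \<longleftrightarrow> (AE x in M. f x = 0)"
 unfolding L2_norm_def
 using integral_nonneg_eq_0_iff_AE[OF L2_fun_integrable[OF assms]] by simp

lemma nn_integral_L2:
 assumes "f \<in> L2_fun M"
 shows "(\<integral>\<^sup>+x. ennreal ((cmod (f x))^2) \<partial>M) = ennreal ((L2_norm M f)^2)"
 unfolding L2_norm_sq using L2_fun_integrable[OF assms] by (intro nn_integral_eq_integral) auto

lemma l2_inner_self: "l2_inner M f f = of_real ((L2_norm M f)^2)"
proof -
 have "l2_inner M f f = (LINT x|M. complex_of_real ((cmod (f x))^2))"
  unfolding l2_inner_def by (intro Bochner_Integration.integral_cong) (simp_all add: complex_norm_square del: of_real_power)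
 then show ?thesis by (simp only: L2_norm_sq integral_complex_of_real)
qed

lemma l2_inner_add_left:
 assumes "f \<in> L2_fun M" "g \<in> L2_fun M" "h \<in> L2_fun M"
 shows "l2_inner M (\<lambda>x. f x + g x) h = l2_inner M f h + l2_inner M g h"
 unfolding l2_inner_def using assms
 by (simp add: distrib_right L2_inner_integrable)

lemma l2_inner_diff_left:
 assumes "f \<in> L2_fun M" "g \<in> L2_fun M" "h \<in> L2_fun M"
 shows "l2_inner M (\<lambda>x. f x - g x) h = l2_inner M f h - l2_inner M g h"
 unfolding l2_inner_def using assms
 by (simp add: left_diff_distrib L2_inner_integrable)

lemma l2_inner_scale_left: "l2_inner M (\<lambda>x. c * f x) h = c * l2_inner M f h"
 unfolding l2_inner_def by (simp add: mult.assoc)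

lemma l2_inner_commute: "l2_inner M f g = cnj (l2_inner M g f)"
 unfolding l2_inner_def by (simp flip: Bochner_Integration.integral_cnj add: mult.commute)

lemma l2_inner_add_right:
 assumes "f \<in> L2_fun M" "g \<in> L2_fun M" "h \<in> L2_fun M"
 shows "l2_inner M h (\<lambda>x. f x + g x) = l2_inner M h f + l2_inner M h g"
 using l2_inner_add_left[OF assms] by (metis complex_cnj_add l2_inner_commute)

lemma l2_inner_scale_right: "l2_inner M h (\<lambda>x. c * f x) = cnj c * l2_inner M h f"
 using l2_inner_scale_left by (metis complex_cnj_mult l2_inner_commute)

lemma l2_inner_cong_AE:
 assumes "f \<in> borel_measurable M" "f' \<in> borel_measurable M" "g \<in> borel_measurable M" "AE x in M. f x = f' x"
 shows "l2_inner M f g = l2_inner M f' g"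
 unfolding l2_inner_def
 by (rule integral_cong_AE) (use assms in auto)

lemma L2_norm_add_sq:
 assumes "f \<in> L2_fun M" "g \<in> L2_fun M"
 shows "(L2_norm M (\<lambda>x. f x + g x))^2 = (L2_norm M f)^2 + (L2_norm M g)^2 + 2 * Re (l2_inner M f g)"
proof -
 have "complex_of_real ((L2_norm M (\<lambda>x. f x + g x))^2) =
   l2_inner M f f + l2_inner M g g + (l2_inner M f g + cnj (l2_inner M f g))"
  unfolding l2_inner_self[symmetric]
  by (simp add: l2_inner_add_left l2_inner_add_right assms L2_fun_add flip: l2_inner_commute)
 from arg_cong[OF this, of Re] show ?thesis
  unfolding l2_inner_self by (simp del: of_real_power)
qed

lemma L2_norm_diff_scale_sq:
 assumes "f \<in> L2_fun M" "g \<in> L2_fun M"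
 shows "(L2_norm M (\<lambda>x. f x - c * g x))^2 =
  (L2_norm M f)^2 + (cmod c)^2 * (L2_norm M g)^2 - 2 * Re (cnj c * l2_inner M f g)"
proof -
 have "(\<lambda>x. f x - c * g x) = (\<lambda>x. f x + (-c) * g x)" by simp
 then show ?thesis
  by (simp only: L2_norm_add_sq[OF assms(1) L2_fun_scale[OF assms(2)]] l2_inner_scale_right L2_norm_scale)
   (simp add: power_mult_distrib)
qed

text \<open>If the inner product I were nonzero, a small step along \<open>a\<close> with the phase
  of I would shorten g: the gain is linear in the step, the loss quadratic.\<close>

lemma l2_orthogonalI:
 assumes "g \<in> L2_fun M" "a \<in> L2_fun M"
  and min: "\<And>c. (L2_norm M g)^2 \<le> (L2_norm M (\<lambda>x. g x - c * a x))^2"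
 shows "l2_inner M g a = 0"
proof (rule ccontr)
 define I where "I = l2_inner M g a"
 define A where "A = (L2_norm M a)^2"
 \<comment> \<open>Any t > 0 with t * A < 2 makes the linear term win; A + 1 in the denominator also
   covers A = 0.\<close>
 define t where "t = 1 / (A + 1)"
 have A: "A \<ge> 0" by (simp add: A_def)
 assume "l2_inner M g a \<noteq> 0"
 then have I: "(cmod I)^2 > 0" by (simp add: I_def)
 have "cnj (of_real t * I) * I = of_real (t * (cmod I)^2)"
  by (simp add: complex_norm_square mult.commute[of "cnj I"] del: of_real_power)
 then have "Re (cnj (of_real t * I) * I) = t * (cmod I)^2"
  by (simp only: Re_complex_of_real)
 then have "0 \<le> t^2 * (cmod I)^2 * A - 2 * t * (cmod I)^2"
  using min[of "of_real t * I"] A unfolding L2_norm_diff_scale_sq[OF assms(1,2)] I_def[symmetric] A_def[symmetric]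
  by (simp add: norm_mult power_mult_distrib)
 also have "... = t * (cmod I)^2 * (t * A - 2)" by (simp add: power2_eq_square algebra_simps)
 finally have *: "0 \<le> t * (cmod I)^2 * (t * A - 2)" .
 have "t * A \<le> 1" "t > 0" using A by (auto simp: t_def)
 then have "t * (cmod I)^2 * (t * A - 2) < 0"
  using I by (intro mult_pos_neg) auto
 with * show False by simp
qed

lemma l2_Cauchy_Schwarz:
 assumes "f \<in> L2_fun M" "g \<in> L2_fun M"
 shows "cmod (l2_inner M f g) \<le> L2_norm M f * L2_norm M g"
proof (cases "L2_norm M g = 0")
 case True
 then have "AE x in M. g x = 0" using L2_norm_eq_0_iff[OF assms(2)] by simp
 then have "l2_inner M f g = (LINT x|M. 0)" unfolding l2_inner_def
  using assms by (intro integral_cong_AE) auto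
 then show ?thesis by simp
next
 case False
 define I where "I = l2_inner M f g"
 define B where "B = (L2_norm M g)^2"
 have B: "B > 0" using False by (simp add: B_def)
 have c: "cnj (I / of_real B) * I = of_real ((cmod I)^2 / B)"
  by (simp add: complex_norm_square mult.commute[of "cnj I"] del: of_real_power)
 have "0 \<le> (L2_norm M f)^2 + (cmod (I / of_real B))^2 * B - 2 * Re (cnj (I / of_real B) * I)"
  unfolding B_def I_def L2_norm_diff_scale_sq[OF assms, symmetric] by simp
 also have "... = (L2_norm M f)^2 - (cmod I)^2 / B"
  unfolding c using B by (simp add: norm_divide power_divide power2_eq_square)
 finally have "(cmod I)^2 \<le> (L2_norm M f * L2_norm M g)^2"
  using B by (simp add: field_simps B_def power_mult_distrib)
 then show ?thesis unfolding I_def by (rule power2_le_imp_le) simp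
qed

lemma L2_norm_triangle:
 assumes "f \<in> L2_fun M" "g \<in> L2_fun M"
 shows "L2_norm M (\<lambda>x. f x + g x) \<le> L2_norm M f + L2_norm M g"
proof (rule power2_le_imp_le)
 show "(L2_norm M (\<lambda>x. f x + g x))^2 \<le> (L2_norm M f + L2_norm M g)^2"
  unfolding L2_norm_add_sq[OF assms] power2_sum
  using l2_Cauchy_Schwarz[OF assms] complex_Re_le_cmod[of "l2_inner M f g"] by simp
qed simp

lemma L2_norm_triangle_diff:
 assumes "f \<in> L2_fun M" "g \<in> L2_fun M" "h \<in> L2_fun M"
 shows "L2_norm M (\<lambda>x. f x - h x) \<le> L2_norm M (\<lambda>x. f x - g x) + L2_norm M (\<lambda>x. g x - h x)"
 using L2_norm_triangle[OF L2_fun_diff[OF assms(1,2)] L2_fun_diff[OF assms(2,3)]] by simp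

lemma L2_tendsto_norm:
 assumes "L2_tendsto M s f"
 shows "(\<lambda>k. L2_norm M (s k)) \<longlonglongrightarrow> L2_norm M f"
proof (rule LIM_zero_cancel, rule Lim_null_comparison)
 have s: "s k \<in> L2_fun M" and f: "f \<in> L2_fun M" for k using assms by (auto simp: L2_tendsto_def)
 show "\<forall>\<^sub>F k in sequentially. norm (L2_norm M (s k) - L2_norm M f) \<le> L2_norm M (\<lambda>x. s k x - f x)"
 proof (intro always_eventually allI)
  fix k
  show "norm (L2_norm M (s k) - L2_norm M f) \<le> L2_norm M (\<lambda>x. s k x - f x)"
   using L2_norm_triangle[OF L2_fun_diff[OF s f] f, of k] L2_norm_triangle[OF L2_fun_diff[OF f s[of k]] s[of k]]
   unfolding L2_norm_uminus[of M f "s k"] by simp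
 qed
 show "(\<lambda>k. L2_norm M (\<lambda>x. s k x - f x)) \<longlonglongrightarrow> 0" using assms by (simp add: L2_tendsto_def)
qed

lemma L2_tendsto_inner:
 assumes "L2_tendsto M s f" "h \<in> L2_fun M"
 shows "(\<lambda>k. l2_inner M (s k) h) \<longlonglongrightarrow> l2_inner M f h"
proof (rule LIM_zero_cancel, rule Lim_null_comparison)
 have s: "s k \<in> L2_fun M" and f: "f \<in> L2_fun M" for k using assms by (auto simp: L2_tendsto_def)
 show "\<forall>\<^sub>F k in sequentially. norm (l2_inner M (s k) h - l2_inner M f h) \<le> L2_norm M (\<lambda>x. s k x - f x) * L2_norm M h"
  by (intro always_eventually allI)
   (metis l2_Cauchy_Schwarz[OF L2_fun_diff[OF s f] assms(2)] l2_inner_diff_left[OF s f assms(2)])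
 show "(\<lambda>k. L2_norm M (\<lambda>x. s k x - f x) * L2_norm M h) \<longlonglongrightarrow> 0"
  using assms by (auto simp: L2_tendsto_def intro: tendsto_mult_left_zero)
qed

lemma L2_tendsto_diff_const:
 assumes "L2_tendsto M s f" "h \<in> L2_fun M"
 shows "L2_tendsto M (\<lambda>k x. h x - s k x) (\<lambda>x. h x - f x)"
 using assms by (auto simp: L2_tendsto_def L2_fun_diff L2_norm_uminus)

lemma L2_tendsto_unique_AE:
 assumes "L2_tendsto M s f" "L2_tendsto M s g"
 shows "AE x in M. f x = g x"
proof -
 have s: "s k \<in> L2_fun M" and f: "f \<in> L2_fun M" and g: "g \<in> L2_fun M" for k
  using assms by (auto simp: L2_tendsto_def)
 have "(\<lambda>k. L2_norm M (\<lambda>x. s k x - f x) + L2_norm M (\<lambda>x. s k x - g x)) \<longlonglongrightarrow> 0 + 0"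
  using assms by (intro tendsto_add) (auto simp: L2_tendsto_def)
 then have "L2_norm M (\<lambda>x. f x - g x) \<le> 0 + 0"
  by (rule tendsto_lowerbound)
   (auto intro!: always_eventually simp: L2_norm_triangle_diff[OF f s g] L2_norm_uminus[of M "s _" f])
 then have "L2_norm M (\<lambda>x. f x - g x) = 0" by (simp add: order_antisym)
 then show ?thesis using L2_norm_eq_0_iff[OF L2_fun_diff[OF f g]] by simp
qed

text \<open>Riesz-Fischer. Along a fast subsequence the differences d k have norm at most 4^-k, so
  the sum of 4^k |d k|^2 is integrable, hence finite almost everywhere; this forces |d k| <= C 2^-k
  and pointwise convergence. Fatou's lemma carries the Cauchy estimate to the limit.\<close>

lemma L2_complete:
 assumes s: "\<And>k. s k \<in> L2_fun M"
  and cauchy: "\<And>e. e > 0 ==> \<exists>N. \<forall>m\<ge>N. \<forall>n\<ge>N. L2_norm M (\<lambda>x. s m x - s n x) < e"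
 shows "\<exists>f. L2_tendsto M s f"
proof -
 have [measurable]: "s k \<in> borel_measurable M" for k using s by measurable
 obtain N where N: "\<And>k m n. m \<ge> N k ==> n \<ge> N k ==> L2_norm M (\<lambda>x. s m x - s n x) < (1/4)^k"
 proof -
  have "\<forall>k. \<exists>N. \<forall>m\<ge>N. \<forall>n\<ge>N. L2_norm M (\<lambda>x. s m x - s n x) < (1/4)^k"
   by (intro allI cauchy) simp
  from choice[OF this] show ?thesis using that by blast
 qed
 \<comment> \<open>Cumulative sums make the chosen indices nondecreasing while each still dominates
   its own threshold \<open>N k\<close>.\<close>
 define r where "r k = (\<Sum>i\<le>k. N i)" for k
 have rN: "N k \<le> r k" for k unfolding r_def by (rule member_le_sum) auto
 have rmono: "r k \<le> r l" if "k \<le> l" for k l unfolding r_def using that by (intro sum_mono2) auto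
 define d where "d k x = s (r (Suc k)) x - s (r k) x" for k x
 have d: "d k \<in> L2_fun M" for k unfolding d_def by (intro L2_fun_diff s)
 have [measurable]: "d k \<in> borel_measurable M" for k using d by measurable
 have dn: "L2_norm M (d k) \<le> (1/4)^k" for k
  unfolding d_def using rN[of k] rmono[of k "Suc k"]
  by (intro less_imp_le[OF N]) auto
 have "(\<integral>\<^sup>+x. (\<Sum>k. ennreal (4^k * (cmod (d k x))^2)) \<partial>M) = (\<Sum>k. \<integral>\<^sup>+x. ennreal (4^k * (cmod (d k x))^2) \<partial>M)"
  by (rule nn_integral_suminf) measurable
 also have "... \<le> (\<Sum>k. ennreal ((1/4)^k))"
 proof (intro suminf_le allI)
  fix k
  have "(\<integral>\<^sup>+x. ennreal (4^k * (cmod (d k x))^2) \<partial>M) = ennreal (4^k) * ennreal ((L2_norm M (d k))^2)"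
   unfolding nn_integral_L2[OF d, symmetric]
   by (subst nn_integral_cmult[symmetric]) (auto simp: ennreal_mult)
  also have "... = ennreal (4^k * (L2_norm M (d k))^2)" by (simp add: ennreal_mult)
  also have "4^k * (L2_norm M (d k))^2 \<le> 4^k * ((1/4)^k)^2"
   by (intro mult_left_mono power_mono dn) auto
  also have "4^k * ((1/4)^k)^2 = (1/4::real)^k"
   by (simp add: power2_eq_square power_one_over)
  finally show "(\<integral>\<^sup>+x. ennreal (4^k * (cmod (d k x))^2) \<partial>M) \<le> ennreal ((1/4)^k)"
   by (auto intro: ennreal_leI)
 qed auto
 also have "... < \<infinity>"
  by (subst suminf_ennreal2) (auto simp: summable_geometric)
 finally have "(\<integral>\<^sup>+x. (\<Sum>k. ennreal (4^k * (cmod (d k x))^2)) \<partial>M) \<noteq> \<infinity>" by simp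
 then have "AE x in M. (\<Sum>k. ennreal (4^k * (cmod (d k x))^2)) \<noteq> \<infinity>"
  by (intro nn_integral_PInf_AE) auto
 then have conv: "AE x in M. convergent (\<lambda>k. s (r k) x)"
 proof eventually_elim
  case (elim x)
  have "\<exists>C\<ge>0. a = ennreal C" if "a \<noteq> \<infinity>" for a using that by (cases a) auto
  from this[OF elim] obtain C where
   C: "(\<Sum>k. ennreal (4^k * (cmod (d k x))^2)) = ennreal C" "C \<ge> 0" by blast
  have b: "cmod (d k x) \<le> sqrt C * (1/2)^k" for k
  proof -
   have "ennreal (4^k * (cmod (d k x))^2) \<le> ennreal C"
   proof -
    have "g k \<le> suminf g" for g :: "nat => ennreal" using sum_le_suminf[of g "{k}"] by simp
    from this[of "\<lambda>k. ennreal (4^k * (cmod (d k x))^2)"] show ?thesis by (simp only: C(1))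
   qed
   then have "4^k * (cmod (d k x))^2 \<le> C" by (simp only: ennreal_le_iff[OF C(2)])
   moreover have "(4::real)^k = (2^k)^2" by (simp add: power2_eq_square flip: power_mult_distrib)
   ultimately have "(2^k * cmod (d k x))^2 \<le> (sqrt C)^2" using C by (simp add: power_mult_distrib)
   then have "2^k * cmod (d k x) \<le> sqrt C" by (rule power2_le_imp_le) (simp add: C)
   then show ?thesis by (simp add: field_simps)
  qed
  have "summable (\<lambda>k. d k x)"
   by (rule summable_comparison_test'[OF _ b]) (auto intro: summable_mult summable_geometric)
  then have "convergent (\<lambda>n. \<Sum>k<n. d k x)" by (simp add: summable_iff_convergent)
  moreover have "(\<lambda>n. \<Sum>k<n. d k x) = (\<lambda>n. s (r n) x - s (r 0) x)"
   unfolding d_def using sum_lessThan_telescope[of "\<lambda>n. s (r n) x"] by auto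
  ultimately have "convergent (\<lambda>n. (s (r n) x - s (r 0) x) + s (r 0) x)"
   by (intro convergent_add convergent_const) auto
  then show ?case by simp
 qed
 define f where "f x = lim (\<lambda>k. s (r k) x)" for x
 have [measurable]: "f \<in> borel_measurable M" unfolding f_def by measurable
 have lim: "AE x in M. (\<lambda>k. s (r k) x) \<longlonglongrightarrow> f x"
  using conv by eventually_elim (simp add: f_def convergent_LIMSEQ_iff)
 have est: "(\<integral>\<^sup>+x. ennreal ((cmod (s m x - f x))^2) \<partial>M) \<le> ennreal (((1/4)^k)^2)" if "m \<ge> N k" for m k
 proof -
  have "(\<integral>\<^sup>+x. ennreal ((cmod (s m x - f x))^2) \<partial>M) =
    (\<integral>\<^sup>+x. liminf (\<lambda>l. ennreal ((cmod (s m x - s (r l) x))^2)) \<partial>M)"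
   using lim
  proof (intro nn_integral_cong_AE, eventually_elim)
   case (elim x)
   have "(\<lambda>l. ennreal ((cmod (s m x - s (r l) x))^2)) \<longlonglongrightarrow> ennreal ((cmod (s m x - f x))^2)"
    using elim by (intro tendsto_ennrealI tendsto_intros)
   from lim_imp_Liminf[OF trivial_limit_sequentially this] show ?case by (rule sym)
  qed
  also have "... \<le> liminf (\<lambda>l. \<integral>\<^sup>+x. ennreal ((cmod (s m x - s (r l) x))^2) \<partial>M)"
   by (rule nn_integral_liminf) measurable
  also have "... \<le> liminf (\<lambda>l. ennreal (((1/4)^k)^2))"
  proof (rule Liminf_mono, rule eventually_sequentiallyI[of k])
   fix l assume "l \<ge> k"
   then have "N k \<le> r l" using rN[of k] rmono[of k l] by simp
   then have "L2_norm M (\<lambda>x. s m x - s (r l) x) \<le> (1/4)^k" using that by (intro less_imp_le[OF N]) auto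
   then show "(\<integral>\<^sup>+x. ennreal ((cmod (s m x - s (r l) x))^2) \<partial>M) \<le> ennreal (((1/4)^k)^2)"
    by (subst nn_integral_L2[OF L2_fun_diff[OF s s]]) (auto intro!: ennreal_leI power_mono)
  qed
  finally show ?thesis by (simp add: Liminf_const)
 qed
 have df: "(\<lambda>x. s m x - f x) \<in> L2_fun M" if "m \<ge> N k" for m k
  using est[OF that] by (intro L2_funI) (auto intro!: integrableI_bounded simp: less_top[symmetric] top_unique)
 have "f \<in> L2_fun M"
  using L2_fun_diff[OF s[of "N 0"] df[of 0 "N 0"]] by simp
 moreover have "(\<lambda>k. L2_norm M (\<lambda>x. s k x - f x)) \<longlonglongrightarrow> 0"
 proof (rule LIMSEQ_I)
  fix e :: real assume "e > 0"
  then obtain k where k: "(1/4)^k < e" using real_arch_pow_inv[of e "1/4"] by auto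
  show "\<exists>no. \<forall>n\<ge>no. norm (L2_norm M (\<lambda>x. s n x - f x) - 0) < e"
  proof (intro exI[of _ "N k"] allI impI)
   fix m assume m: "m \<ge> N k"
   have "ennreal ((L2_norm M (\<lambda>x. s m x - f x))^2) \<le> ennreal (((1/4)^k)^2)"
    using est[OF m] nn_integral_L2[OF df[OF m]] by simp
   then have "(L2_norm M (\<lambda>x. s m x - f x))^2 \<le> ((1/4)^k)^2" by (subst (asm) ennreal_le_iff) auto
   then have "L2_norm M (\<lambda>x. s m x - f x) \<le> (1/4)^k" by (rule power2_le_imp_le) simp
   with k show "norm (L2_norm M (\<lambda>x. s m x - f x) - 0) < e" by simp
  qed
 qed
 ultimately show ?thesis using s by (auto simp: L2_tendsto_def)
qed

text \<open>P is the graph of a linear isometry between subspaces, kept as a relation because it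
  will be generated by explicit pairs. It is instantiated twice: with packets and their images on
  the fan, and with the partial Fourier transform in the central variable.\<close>

locale L2_isometry =
 fixes M :: "'a measure" and N :: "'b measure" and P :: "('a => complex) => ('b => complex) => bool"
 assumes left: "P s t ==> s \<in> L2_fun M" and right: "P s t ==> t \<in> L2_fun N"
  and isometric: "P s t ==> L2_norm M s = L2_norm N t"
  and zero: "P (\<lambda>_. 0) (\<lambda>_. 0)"
  and add: "P s t ==> P s' t' ==> P (\<lambda>x. s x + s' x) (\<lambda>y. t y + t' y)"
  and scale: "P s t ==> P (\<lambda>x. c * s x) (\<lambda>y. c * t y)"
begin

lemma diff: "P s t ==> P s' t' ==> P (\<lambda>x. s x - s' x) (\<lambda>y. t y - t' y)"
 using add[OF _ scale[of s' t' "-1"]] by simp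

text \<open>Polarisation: additivity of P makes the norms of s + s' and t + t' agree.\<close>

lemma Re_inner: "P s t ==> P s' t' ==> Re (l2_inner M s s') = Re (l2_inner N t t')"
 using L2_norm_add_sq[of s M s'] L2_norm_add_sq[of t N t'] add[of s t s' t']
 by (simp add: left right isometric)

lemma inner:
 assumes "P s t" "P s' t'"
 shows "l2_inner M s s' = l2_inner N t t'"
proof (rule complex_eqI)
 show "Re (l2_inner M s s') = Re (l2_inner N t t')" using Re_inner assms by simp
 show "Im (l2_inner M s s') = Im (l2_inner N t t')"
  using Re_inner[OF assms(1) scale[OF assms(2), of \<i>]] by (simp add: l2_inner_scale_right)
qed

text \<open>v is the orthogonal projection of h on the closure of the domain of P, and F is the
  image of v under the continuous extension of the isometry. For elements h outside that closure the
  last equation is what survives: F represents h as far as the domain of P can see it.\<close>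

lemma extension:
 assumes h: "h \<in> L2_fun M"
 shows "\<exists>s t v F. (\<forall>k. P (s k) (t k)) \<and> L2_tendsto M s v \<and> L2_tendsto N t F \<and>
  (\<forall>a b. P a b --> l2_inner M (\<lambda>x. h x - v x) a = 0 \<and> l2_inner M h a = l2_inner N F b)"
proof -
 define D where "D = (\<lambda>s. L2_norm M (\<lambda>x. h x - s x)) ` {s. \<exists>t. P s t}"
 have D0: "D \<noteq> {}" using zero unfolding D_def by auto
 have Db: "bdd_below D" unfolding D_def by (rule bdd_belowI[of _ 0]) auto
 define d where "d = Inf D"
 have d: "d \<le> L2_norm M (\<lambda>x. h x - s x)" if "P s t" for s t
  unfolding d_def using Db that by (intro cInf_lower) (auto simp: D_def)
 have d0: "d \<ge> 0" unfolding d_def using D0 by (intro cInf_greatest) (auto simp: D_def)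
 have "\<exists>s t. P s t \<and> L2_norm M (\<lambda>x. h x - s x) < d + 1 / real (Suc k)" for k
  using cInf_lessD[OF D0, of "d + 1 / real (Suc k)"] unfolding d_def[symmetric]
  by (auto simp: D_def)
 then obtain s t where st: "\<And>k. P (s k) (t k)"
  and sd: "\<And>k. L2_norm M (\<lambda>x. h x - s k x) < d + 1 / real (Suc k)" by metis
 \<comment> \<open>Parallelogram law: the midpoint of two almost minimisers is at distance at least
   d from h. With squared distances at most d^2 + 2 (d + 1) / (k + 1), the bound is 2 + 2 times this
   minus 4 d^2.\<close>
 have para: "(L2_norm M (\<lambda>x. s m x - s n x))^2 \<le> 8 * (d + 1) / real (Suc k)" if "m \<ge> k" "n \<ge> k" for m n k
 proof -
  let ?f = "\<lambda>x. h x - s m x" and ?g = "\<lambda>x. h x - s n x"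
  have fg: "?f \<in> L2_fun M" "?g \<in> L2_fun M" using h st left by (auto intro!: L2_fun_diff)
  have "P (\<lambda>x. 1/2 * (s m x + s n x)) (\<lambda>x. 1/2 * (t m x + t n x))" by (intro scale add st)
  then have "d \<le> L2_norm M (\<lambda>x. h x - 1/2 * (s m x + s n x))" by (rule d)
  also have "(\<lambda>x. h x - 1/2 * (s m x + s n x)) = (\<lambda>x. 1/2 * (?f x + ?g x))"
   by (auto simp: algebra_simps)
  also have "L2_norm M ... = 1/2 * L2_norm M (\<lambda>x. ?f x + ?g x)"
   by (subst L2_norm_scale) (simp add: norm_divide)
  finally have "2 * d \<le> L2_norm M (\<lambda>x. ?f x + ?g x)" by simp
  then have "(2 * d)^2 \<le> (L2_norm M (\<lambda>x. ?f x + ?g x))^2" using d0 by (intro power_mono) auto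
  then have 1: "4 * d^2 \<le> (L2_norm M (\<lambda>x. ?f x + ?g x))^2" by simp
  have "(\<lambda>x. s m x - s n x) = (\<lambda>x. ?g x - 1 * ?f x)" by auto
  then have 2: "(L2_norm M (\<lambda>x. s m x - s n x))^2 =
    2 * (L2_norm M ?f)^2 + 2 * (L2_norm M ?g)^2 - (L2_norm M (\<lambda>x. ?f x + ?g x))^2"
   using L2_norm_diff_scale_sq[OF fg(2,1), of 1] L2_norm_add_sq[OF fg]
   by (subst (asm) l2_inner_commute) simp
  have b: "(L2_norm M (\<lambda>x. h x - s l x))^2 \<le> d^2 + 2 * (d + 1) / real (Suc k)" if "l \<ge> k" for l
  proof -
   define e where "e = 1 / real (Suc k)"
   have e: "0 < e" "e \<le> 1" by (auto simp: e_def)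
   have "L2_norm M (\<lambda>x. h x - s l x) \<le> d + e"
   proof -
    have "1 / real (Suc l) \<le> e" unfolding e_def using that by (intro divide_left_mono) auto
    then show ?thesis using sd[of l] by simp
   qed
   then have "(L2_norm M (\<lambda>x. h x - s l x))^2 \<le> (d + e)^2" by (intro power_mono) auto
   also have "... = d^2 + (2 * d + e) * e" by (simp add: power2_eq_square algebra_simps)
   also have "... \<le> d^2 + (2 * (d + 1)) * e" using e d0 by (intro add_left_mono mult_right_mono) auto
   finally show ?thesis by (simp add: e_def)
  qed
  have "8 * (d + 1) / real (Suc k) = 4 * (2 * (d + 1) / real (Suc k))" by simp
  then show ?thesis using 1 2 b[OF that(1)] b[OF that(2)] by linarith
 qed
 have cauchy: "\<exists>N. \<forall>m\<ge>N. \<forall>n\<ge>N. L2_norm M (\<lambda>x. s m x - s n x) < e" if "e > 0" for e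
 proof -
  obtain k where "real (Suc k) > 8 * (d + 1) / e^2" 
   using reals_Archimedean2[of "8 * (d + 1) / e^2"] by (metis lessI less_trans of_nat_less_iff)
  then have k: "8 * (d + 1) / real (Suc k) < e^2" using that by (simp add: field_simps)
  show ?thesis
  proof (intro exI[of _ k] allI impI)
   fix m n assume "k \<le> m" "k \<le> n"
   then have "(L2_norm M (\<lambda>x. s m x - s n x))^2 < e^2" using para k by fastforce
   then show "L2_norm M (\<lambda>x. s m x - s n x) < e" using that by (simp add: power_less_imp_less_base)
  qed
 qed
 have cauchy': "\<exists>k. \<forall>m\<ge>k. \<forall>n\<ge>k. L2_norm N (\<lambda>x. t m x - t n x) < e" if "e > 0" for e
  using cauchy[OF that] isometric[OF diff[OF st st]] by simp
 obtain v where v: "L2_tendsto M s v" using L2_complete[OF left[OF st] cauchy] by blast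
 obtain F where F: "L2_tendsto N t F" using L2_complete[OF right[OF st] cauchy'] by blast
 have vL: "v \<in> L2_fun M" using v by (simp add: L2_tendsto_def)
 have hv: "(\<lambda>x. h x - v x) \<in> L2_fun M" using h vL by (rule L2_fun_diff)
 have vd: "L2_norm M (\<lambda>x. h x - v x) \<le> d"
 proof (rule LIMSEQ_le)
  show "(\<lambda>k. L2_norm M (\<lambda>x. h x - s k x)) \<longlonglongrightarrow> L2_norm M (\<lambda>x. h x - v x)"
   by (rule L2_tendsto_norm[OF L2_tendsto_diff_const[OF v h]])
  show "(\<lambda>k. d + 1 / real (Suc k)) \<longlonglongrightarrow> d"
   using tendsto_add[OF tendsto_const LIMSEQ_inverse_real_of_nat] by (simp add: inverse_eq_divide)
  show "\<exists>N. \<forall>n\<ge>N. L2_norm M (\<lambda>x. h x - s n x) \<le> d + 1 / real (Suc n)"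
   using sd less_imp_le by blast
 qed
 have orth: "l2_inner M (\<lambda>x. h x - v x) a = 0" if ab: "P a b" for a b
 proof (rule l2_orthogonalI[OF hv left[OF ab]])
  fix c
  have "L2_tendsto M (\<lambda>k x. (h x - c * a x) - s k x) (\<lambda>x. (h x - c * a x) - v x)"
   by (intro L2_tendsto_diff_const v L2_fun_diff h L2_fun_scale left[OF ab])
  then have "(\<lambda>k. L2_norm M (\<lambda>x. (h x - c * a x) - s k x)) \<longlonglongrightarrow> L2_norm M (\<lambda>x. (h x - c * a x) - v x)"
   by (rule L2_tendsto_norm)
  then have "d \<le> L2_norm M (\<lambda>x. (h x - c * a x) - v x)"
  proof (rule tendsto_lowerbound)
   show "\<forall>\<^sub>F k in sequentially. d \<le> L2_norm M (\<lambda>x. (h x - c * a x) - s k x)"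
   proof (intro always_eventually allI)
    fix k
    show "d \<le> L2_norm M (\<lambda>x. (h x - c * a x) - s k x)"
     using d[OF add[OF st[of k] scale[OF ab, of c]]] by (simp add: algebra_simps)
   qed
  qed simp
  with vd have "L2_norm M (\<lambda>x. h x - v x) \<le> L2_norm M (\<lambda>x. (h x - c * a x) - v x)" by simp
  then show "(L2_norm M (\<lambda>x. h x - v x))^2 \<le> (L2_norm M (\<lambda>x. h x - v x - c * a x))^2"
   by (intro power_mono) (auto simp: algebra_simps)
 qed
 have "l2_inner M h a = l2_inner N F b" if ab: "P a b" for a b
 proof -
  have "l2_inner M h a = l2_inner M v a"
   using orth[OF ab] l2_inner_diff_left[OF h vL left[OF ab]] by simp
  also have "... = l2_inner N F b"
  proof (rule LIMSEQ_unique)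
   show "(\<lambda>k. l2_inner M (s k) a) \<longlonglongrightarrow> l2_inner M v a" by (rule L2_tendsto_inner[OF v left[OF ab]])
   show "(\<lambda>k. l2_inner M (s k) a) \<longlonglongrightarrow> l2_inner N F b"
    using L2_tendsto_inner[OF F right[OF ab]] by (simp add: inner[OF st ab])
  qed
  finally show ?thesis .
 qed
 with orth st v F show ?thesis by blast
qed

text \<open>Reading the relation backwards makes \<open>extension\<close> produce a function on the
  group from a function on the fan; surjectivity rests on this.\<close>

lemma converse_isometry: "L2_isometry N M (\<lambda>t s. P s t)"
 by unfold_locales (auto simp: left right isometric zero add scale)

end

text \<open>The sets A for which the integral over the preimage of A vanishes form a Dynkin system:
  \<open>total\<close> handles complements, countable additivity disjoint unions. The map X is
  included because the lemma is later applied to sets of pairs (norm z squared, t), pulled back to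
  the group.\<close>

lemma integral_zero_Dynkin:
 fixes v :: "'a => complex"
 assumes v: "integrable M v" and X: "X \<in> M \<rightarrow>\<^sub>M N"
  and E: "Int_stable E" "E \<subseteq> Pow (space N)" "sets N = sigma_sets (space N) E"
  and total: "(LINT x|M. v x) = 0"
  and zero: "\<And>A. A \<in> E ==> (LINT x|M. indicator A (X x) *\<^sub>R v x) = 0"
  and A: "A \<in> sets N"
 shows "(LINT x|M. indicator A (X x) *\<^sub>R v x) = 0"
proof -
 have eq: "(LINT x|M. indicator A (X x) *\<^sub>R v x) = set_lebesgue_integral M (X -` A \<inter> space M) v" for A
  unfolding set_lebesgue_integral_def
  by (intro Bochner_Integration.integral_cong) (auto simp: indicator_def)
 have int: "integrable M (\<lambda>x. indicator A (X x) *\<^sub>R v x)" if "A \<in> sets N" for A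
 proof -
  have "integrable M (\<lambda>x. indicator (X -` A \<inter> space M) x *\<^sub>R v x)"
   using measurable_sets[OF X that] v by (rule integrable_mult_indicator)
  also have "?this \<longleftrightarrow> ?thesis"
   by (intro Bochner_Integration.integrable_cong) (auto simp: indicator_def)
  finally show ?thesis .
 qed
 have "A \<in> sigma_sets (space N) E" using A E by simp
 from E(1,2) this show ?thesis
 proof (induction rule: sigma_sets_induct_disjoint)
  case (basic A) then show ?case by (rule zero)
 next
  case empty then show ?case by simp
 next
  case (compl A)
  then have A: "A \<in> sets N" using E(3) by simp
  have "(LINT x|M. indicator (space N - A) (X x) *\<^sub>R v x) = (LINT x|M. v x - indicator A (X x) *\<^sub>R v x)"
   using measurable_space[OF X] by (intro Bochner_Integration.integral_cong) (auto simp: indicator_def)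
  also have "... = 0" using v int[OF A] compl(2) total
   by (subst Bochner_Integration.integral_diff) auto
  finally show ?case .
 next
  case (union A)
  then have A: "A i \<in> sets N" for i using E(3) by auto
  have "set_lebesgue_integral M (\<Union>i. X -` A i \<inter> space M) v = (\<Sum>i. set_lebesgue_integral M (X -` A i \<inter> space M) v)"
  proof (rule lebesgue_integral_countable_add)
   show "set_integrable M (\<Union>i. X -` A i \<inter> space M) v" unfolding set_integrable_def
    using measurable_sets[OF X A] v by (intro integrable_mult_indicator sets.countable_UN) auto
  qed (use measurable_sets[OF X A] union(1) in \<open>auto simp: disjoint_family_on_def\<close>)
  moreover have "X -` (\<Union>i. A i) \<inter> space M = (\<Union>i. X -` A i \<inter> space M)" by auto
  ultimately show ?case using union unfolding eq by simp
 qed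
qed

lemma (in sigma_finite_measure) integral_zero_pi_system:
 fixes v :: "'a => complex"
 assumes v: "integrable M v" and E: "Int_stable E" "E \<subseteq> Pow (space M)" "sets M = sigma_sets (space M) E"
  and total: "(LINT x|M. v x) = 0"
  and zero: "\<And>A. A \<in> E ==> (LINT x|M. indicator A x *\<^sub>R v x) = 0"
 shows "AE x in M. v x = 0"
proof (rule density_zero[OF v])
 fix A assume "A \<in> sets M"
 then show "set_lebesgue_integral M A v = 0" unfolding set_lebesgue_integral_def
  using integral_zero_Dynkin[OF v, of "\<lambda>x. x" M E A] E total zero by simp
qed

subsection \<open>Smooth functions and test functions\<close>

lemma dir_deriv_eq:
 assumes "(f has_derivative D) (at x)"
 shows "dir_deriv v f x = D v"
 unfolding dir_deriv_def using frechet_derivative_at[OF assms] by simp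

lemma smooth_unfold: "smooth f \<longleftrightarrow> f differentiable_on UNIV \<and> (\<forall>v. smooth (dir_deriv v f))"
proof
 assume f: "smooth f"
 show "f differentiable_on UNIV \<and> (\<forall>v. smooth (dir_deriv v f))"
 proof (intro conjI allI)
  show "f differentiable_on UNIV" using f[unfolded smooth_def, THEN spec, of "[]"] by simp
  show "smooth (dir_deriv v f)" for v
   unfolding smooth_def
  proof
   fix vs show "fold dir_deriv vs (dir_deriv v f) differentiable_on UNIV"
    using f[unfolded smooth_def, THEN spec, of "v # vs"] by simp
  qed
 qed
next
 assume *: "f differentiable_on UNIV \<and> (\<forall>v. smooth (dir_deriv v f))"
 show "smooth f" unfolding smooth_def
 proof
  fix vs show "fold dir_deriv vs f differentiable_on UNIV"
   by (cases vs) (use * in \<open>auto simp: smooth_def\<close>)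
 qed
qed

lemma smooth_dir_deriv: "smooth f ==> smooth (dir_deriv v f)"
 using smooth_unfold by blast

lemma smooth_differentiable: "smooth f ==> f differentiable (at x)"
 using smooth_unfold by (metis UNIV_I differentiable_on_eq_differentiable_at open_UNIV)

lemma smooth_has_derivative: "smooth f ==> (f has_derivative (\<lambda>v. dir_deriv v f x)) (at x)"
 using smooth_differentiable[of f x] unfolding dir_deriv_def
 by (simp add: frechet_derivative_works eta_contract_eq)

text \<open>Coinduction for \<open>smooth\<close>: a class of differentiable functions that contains
  all its directional derivatives consists of smooth functions. Smoothness then follows by
  exhibiting an invariant class, without formulas for higher derivatives.\<close>

lemma smooth_coinduct:
 assumes "P f"
  and "\<And>f. P f ==> \<exists>D. (\<forall>x. (f has_derivative D x) (at x)) \<and> (\<forall>v. P (\<lambda>x. D x v))"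
 shows "smooth f"
proof -
 have *: "P f ==> f differentiable_on UNIV \<and> (\<forall>v. P (dir_deriv v f))" for f
 proof -
  assume "P f"
  from assms(2)[OF this] obtain D where D: "\<And>x. (f has_derivative D x) (at x)" "\<And>v. P (\<lambda>x. D x v)" by blast
  have "dir_deriv v f = (\<lambda>x. D x v)" for v using dir_deriv_eq[OF D(1)] by auto
  then show "f differentiable_on UNIV \<and> (\<forall>v. P (dir_deriv v f))"
   using D unfolding differentiable_on_def differentiable_def by (auto intro: has_derivative_at_withinI)
 qed
 have "fold dir_deriv vs f differentiable_on UNIV" if "P f" for vs
  using that by (induction vs arbitrary: f) (use * in auto)
 then show ?thesis using assms(1) by (auto simp: smooth_def)
qed

text \<open>The derivative of a product is a sum of products, so sums and products have to be
  treated together to obtain a class stable under differentiation.\<close>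

inductive smooth_alg :: "('a::euclidean_space => complex) => bool" where
 base: "smooth f ==> smooth_alg f"
| add: "smooth_alg f ==> smooth_alg g ==> smooth_alg (\<lambda>x. f x + g x)"
| mult: "smooth_alg f ==> smooth_alg g ==> smooth_alg (\<lambda>x. f x * g x)"

lemma smooth_alg_smooth:
 assumes "smooth_alg f"
 shows "smooth f"
proof (rule smooth_coinduct[of smooth_alg, OF assms])
 fix f :: "'a => complex" assume "smooth_alg f"
 then show "\<exists>D. (\<forall>x. (f has_derivative D x) (at x)) \<and> (\<forall>v. smooth_alg (\<lambda>x. D x v))"
 proof induction
  case (base f)
  then show ?case
   by (intro exI[of _ "\<lambda>x v. dir_deriv v f x"])
    (auto intro: smooth_has_derivative smooth_alg.base smooth_dir_deriv)
 next
  case (add f g)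
  then obtain D E where D: "\<And>x. (f has_derivative D x) (at x)" "\<And>v. smooth_alg (\<lambda>x. D x v)"
   and E: "\<And>x. (g has_derivative E x) (at x)" "\<And>v. smooth_alg (\<lambda>x. E x v)" by blast
  show ?case
   by (intro exI[of _ "\<lambda>x v. D x v + E x v"] conjI allI has_derivative_add D(1) E(1) smooth_alg.add D(2) E(2))
 next
  case (mult f g)
  then obtain D E where D: "\<And>x. (f has_derivative D x) (at x)" "\<And>v. smooth_alg (\<lambda>x. D x v)"
   and E: "\<And>x. (g has_derivative E x) (at x)" "\<And>v. smooth_alg (\<lambda>x. E x v)" by blast
  show ?case
   by (intro exI[of _ "\<lambda>x v. f x * E x v + D x v * g x"] conjI allI has_derivative_mult D(1) E(1)
    smooth_alg.add smooth_alg.mult D(2) E(2) mult.hyps)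
 qed
qed

lemma smooth_add: "smooth f ==> smooth g ==> smooth (\<lambda>x. f x + g x)"
 by (rule smooth_alg_smooth[OF smooth_alg.add[OF smooth_alg.base smooth_alg.base]])

lemma smooth_mult: "smooth f ==> smooth g ==> smooth (\<lambda>x. f x * g x)"
 by (rule smooth_alg_smooth[OF smooth_alg.mult[OF smooth_alg.base smooth_alg.base]])

lemma smooth_const [simp]: "smooth (\<lambda>x. c)"
 by (rule smooth_coinduct[where P = "\<lambda>f. \<exists>c. f = (\<lambda>x. c)"])
  (auto intro!: exI[of _ "\<lambda>x v. 0"])

lemma smooth_bounded_linear: "bounded_linear L ==> smooth L"
proof (rule iffD2[OF smooth_unfold], intro conjI allI)
 assume L: "bounded_linear L"
 show "L differentiable_on UNIV" using L by (simp add: bounded_linear_imp_differentiable_on)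
 have "dir_deriv v L = (\<lambda>x. L v)" for v
  by (rule ext) (rule dir_deriv_eq[OF bounded_linear_imp_has_derivative[OF L]])
 then show "smooth (dir_deriv v L)" for v by simp
qed

lemma smooth_cnj: "smooth f ==> smooth (\<lambda>x. cnj (f x))"
proof (rule smooth_coinduct[where P = "\<lambda>g. \<exists>f. smooth f \<and> g = (\<lambda>x. cnj (f x))"])
 fix g :: "'a => complex" assume "\<exists>f. smooth f \<and> g = (\<lambda>x. cnj (f x))"
 then obtain f where f: "smooth f" "g = (\<lambda>x. cnj (f x))" by blast
 show "\<exists>D. (\<forall>x. (g has_derivative D x) (at x)) \<and> (\<forall>v. \<exists>f. smooth f \<and> (\<lambda>x. D x v) = (\<lambda>x. cnj (f x)))"
 proof (intro exI[of _ "\<lambda>x v. cnj (dir_deriv v f x)"] conjI allI)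
  show "(g has_derivative (\<lambda>v. cnj (dir_deriv v f x))) (at x)" for x
   unfolding f(2) by (intro bounded_linear.has_derivative[OF bounded_linear_cnj] smooth_has_derivative f)
  show "\<exists>f'. smooth f' \<and> (\<lambda>x. cnj (dir_deriv v f x)) = (\<lambda>x. cnj (f' x))" for v
   by (intro exI[of _ "dir_deriv v f"]) (simp add: smooth_dir_deriv f)
 qed
qed auto

lemma smooth_power: "smooth f ==> smooth (\<lambda>x. f x ^ k)"
 by (induction k) (auto intro: smooth_mult)

lemma smooth_sum: "finite I ==> (\<And>i. i \<in> I ==> smooth (f i)) ==> smooth (\<lambda>x. \<Sum>i\<in>I. f i x)"
 by (induction rule: finite_induct) (auto intro: smooth_add)

lemma smooth_prod: "finite I ==> (\<And>i. i \<in> I ==> smooth (f i)) ==> smooth (\<lambda>x. \<Prod>i\<in>I. f i x)"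
 by (induction rule: finite_induct) (auto intro: smooth_mult)

lemma dir_deriv_real_affine:
 assumes "smooth g" "bounded_linear L"
 shows "((\<lambda>x. g (L x + b)) has_derivative (\<lambda>v. of_real (L v) * dir_deriv 1 g (L x + b))) (at x)"
proof -
 have "((\<lambda>x. L x + b) has_derivative L) (at x)"
  using bounded_linear_imp_has_derivative[OF assms(2)] by (auto intro!: derivative_eq_intros)
 from has_derivative_compose[OF this smooth_has_derivative[OF assms(1)]]
 have "((\<lambda>x. g (L x + b)) has_derivative (\<lambda>v. dir_deriv (L v) g (L x + b))) (at x)" .
 moreover have "dir_deriv (r::real) g y = of_real r * dir_deriv 1 g y" for r y
  using linear_scale[OF has_derivative_linear[OF smooth_has_derivative[OF assms(1), of y]], of r 1]
  by (simp add: scaleR_conv_of_real)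
 ultimately show ?thesis by (metis (no_types, lifting) has_derivative_eq_rhs ext)
qed

lemma smooth_real_affine:
 fixes L :: "'a::euclidean_space => real"
 assumes "smooth g" "bounded_linear L"
 shows "smooth (\<lambda>x. g (L x + b))"
proof (rule smooth_coinduct[where P = "\<lambda>h. \<exists>g c. smooth g \<and> h = (\<lambda>x. c * g (L x + b))"])
 show "\<exists>g' c. smooth g' \<and> (\<lambda>x. g (L x + b)) = (\<lambda>x. c * g' (L x + b))"
  by (intro exI[of _ g] exI[of _ 1]) (simp add: assms)
next
 fix h :: "'a => complex" assume "\<exists>g c. smooth g \<and> h = (\<lambda>x. c * g (L x + b))"
 then obtain g c where g: "smooth g" "h = (\<lambda>x. c * g (L x + b))" by blast
 show "\<exists>D. (\<forall>x. (h has_derivative D x) (at x)) \<and> (\<forall>v. \<exists>g c. smooth g \<and> (\<lambda>x. D x v) = (\<lambda>x. c * g (L x + b)))"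
 proof (intro exI[of _ "\<lambda>x v. c * (of_real (L v) * dir_deriv 1 g (L x + b))"] conjI allI)
  fix x show "(h has_derivative (\<lambda>v. c * (of_real (L v) * dir_deriv 1 g (L x + b)))) (at x)"
   unfolding g(2) by (intro has_derivative_mult_right dir_deriv_real_affine g assms)
 next
  fix v
  show "\<exists>g' c'. smooth g' \<and> (\<lambda>x. c * (of_real (L v) * dir_deriv 1 g (L x + b))) = (\<lambda>x. c' * g' (L x + b))"
   by (intro exI[of _ "dir_deriv 1 g"] exI[of _ "c * of_real (L v)"])
    (simp add: g smooth_dir_deriv mult.assoc)
 qed
qed

section \<open>Supports and test functions\<close>

definition support :: "('a::topological_space => complex) => 'a set" where
 "support f = closure {x. f x \<noteq> 0}"

lemma support_mult_left: "support (\<lambda>x. f x * g x) \<subseteq> support f"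
 and support_mult_right: "support (\<lambda>x. f x * g x) \<subseteq> support g"
 by (auto simp: support_def intro: closure_mono[THEN subsetD, rotated])

lemma support_add: "support (\<lambda>x. f x + g x) \<subseteq> support f \<union> support g"
 unfolding support_def closure_Un[symmetric] by (intro closure_mono) auto

lemma not_in_support: "x \<notin> support f ==> f x = 0"
 using closure_subset[of "{x. f x \<noteq> 0}"] unfolding support_def by auto

lemma dir_deriv_zero_off_support:
 assumes "x \<notin> support f"
 shows "dir_deriv v f x = 0"
proof -
 have o: "open (- support f)" by (simp add: support_def open_Compl)
 have "((\<lambda>x. 0) has_derivative (\<lambda>v. 0)) (at x)" by simp
 then have "(f has_derivative (\<lambda>v. 0)) (at x)"
  by (rule has_derivative_transform_within_open[OF _ o]) (use assms in \<open>auto simp: not_in_support\<close>)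
 then show ?thesis by (rule dir_deriv_eq)
qed

lemma support_dir_deriv: "support (dir_deriv v f) \<subseteq> support f"
proof -
 have "{x. dir_deriv v f x \<noteq> 0} \<subseteq> support f"
  using dir_deriv_zero_off_support by blast
 then show ?thesis unfolding support_def[of "dir_deriv v f"]
  by (intro closure_minimal) (auto simp: support_def)
qed

lemma test_fun_def': "test_fun f \<longleftrightarrow> smooth f \<and> compact (support f)"
 by (simp add: test_fun_def support_def)

lemma test_fun_smooth: "test_fun f ==> smooth f"
 by (simp add: test_fun_def)

lemma test_funI:
 assumes "smooth f" "compact K" "support f \<subseteq> K"
 shows "test_fun f"
 unfolding test_fun_def'
 using assms compact_Int_closed[of K "support f"] by (auto simp: support_def inf.absorb2)

lemma test_fun_dir_deriv: "test_fun f ==> test_fun (dir_deriv v f)"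
 by (rule test_funI[of _ "support f"]) (auto simp: test_fun_def' smooth_dir_deriv support_dir_deriv)

lemma test_fun_mult_smooth: "test_fun f ==> smooth g ==> test_fun (\<lambda>x. f x * g x)"
 by (rule test_funI[of _ "support f"]) (auto simp: test_fun_def' smooth_mult support_mult_left)

lemma test_fun_smooth_mult: "test_fun f ==> smooth g ==> test_fun (\<lambda>x. g x * f x)"
 using test_fun_mult_smooth[of f g] by (simp add: mult.commute)

lemma test_fun_add: "test_fun f ==> test_fun g ==> test_fun (\<lambda>x. f x + g x)"
 by (rule test_funI[of _ "support f \<union> support g"])
  (use support_add[of f g] in \<open>auto simp: test_fun_def' smooth_add\<close>)

lemma test_fun_zero [simp]: "test_fun (\<lambda>x. 0)"
 by (rule test_funI[of _ "{}"]) (auto simp: support_def)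

lemma test_fun_scale: "test_fun f ==> test_fun (\<lambda>x. c * f x)"
 by (rule test_fun_smooth_mult) auto

lemma test_fun_cnj: "test_fun f ==> test_fun (\<lambda>x. cnj (f x))"
 by (rule test_funI[of _ "support f"]) (auto simp: test_fun_def' smooth_cnj support_def)

lemma smooth_continuous: "smooth f ==> continuous_on S f"
 by (meson continuous_at_imp_continuous_on differentiable_imp_continuous_within smooth_differentiable)

lemma smooth_measurable: "smooth f ==> f \<in> borel_measurable borel"
 by (rule borel_measurable_continuous_onI) (rule smooth_continuous)

lemma smooth_compact_bound:
 assumes "smooth f" "compact K"
 obtains C where "C \<ge> 0" "\<And>x. x \<in> K ==> cmod (f x) \<le> C"
proof -
 have "bounded (f ` K)" using assms by (intro compact_imp_bounded compact_continuous_image smooth_continuous)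
 then obtain C where "\<And>x. x \<in> K ==> cmod (f x) \<le> C" unfolding bounded_iff by auto
 then show ?thesis using that[of "max C 0"] by fastforce
qed

lemma test_fun_bound:
 assumes "test_fun f"
 obtains C where "C \<ge> 0" "\<And>x. cmod (f x) \<le> C"
proof -
 obtain C where "C \<ge> 0" "\<And>x. x \<in> support f ==> cmod (f x) \<le> C"
  using smooth_compact_bound[of f "support f"] assms by (auto simp: test_fun_def')
 then show ?thesis using that[of C] by (metis not_in_support norm_zero)
qed

lemma test_fun_vanish:
 assumes "test_fun f"
 obtains R where "\<And>x. norm x > R ==> f x = 0"
proof -
 have "bounded (support f)" using assms by (auto simp: test_fun_def' compact_imp_bounded)
 then obtain R where "\<And>x. x \<in> support f ==> norm x \<le> R" unfolding bounded_iff by blast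
 then show ?thesis using that not_in_support[of _ f] by (metis not_le)
qed

lemma test_fun_integrable:
 fixes f :: "'a::euclidean_space => complex"
 assumes "test_fun f" "sets M = sets borel" "\<And>K. compact K ==> emeasure M K < \<infinity>"
 shows "integrable M f"
proof -
 obtain C where C: "C \<ge> 0" "\<And>x. cmod (f x) \<le> C" using test_fun_bound[OF assms(1)] by blast
 have K: "compact (support f)" using assms by (simp add: test_fun_def')
 show ?thesis
 proof (rule Bochner_Integration.integrable_bound)
  show "integrable M (\<lambda>x. C * indicator (support f) x)"
   using assms(3)[OF K] compact_imp_closed[OF K] assms(2)
   by (intro integrable_mult_right integrable_real_indicator) auto
  show "f \<in> borel_measurable M"
   using smooth_measurable[of f] assms by (simp add: test_fun_def' measurable_cong_sets[OF assms(2)])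
  show "AE x in M. norm (f x) \<le> norm (C * indicator (support f) x)"
   using C by (intro AE_I2) (auto simp: indicator_def not_in_support)
 qed
qed

lemma test_fun_integrable_lborel: "test_fun f ==> integrable lborel f"
 by (rule test_fun_integrable[OF _ _ emeasure_compact_finite]) auto

lemma test_fun_L2:
 assumes "test_fun f"
 shows "f \<in> L2_fun lborel"
proof (rule L2_funI)
 have "test_fun (\<lambda>x. f x * cnj (f x))" using assms by (intro test_fun_mult_smooth smooth_cnj test_fun_smooth)
 then have "integrable lborel (\<lambda>x. complex_of_real ((cmod (f x))^2))"
  using test_fun_integrable_lborel by (simp only: complex_norm_square)
 then show "integrable lborel (\<lambda>x. (cmod (f x))^2)" by (simp only: complex_of_real_integrable_eq)
 show "f \<in> borel_measurable lborel" using assms by (simp add: smooth_measurable test_fun_smooth)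
qed

section \<open>Bump functions\<close>

lemma poly_exp_tendsto_0: "((\<lambda>y::real. poly q y * exp (- y)) \<longlongrightarrow> 0) at_top"
proof -
 have "((\<lambda>y. \<Sum>i\<le>degree q. coeff q i * (y ^ i / exp y)) \<longlongrightarrow> (\<Sum>i\<le>degree q. coeff q i * 0)) at_top"
  by (intro tendsto_sum tendsto_mult_left tendsto_power_div_exp_0)
 then show ?thesis
  by (simp add: poly_altdef sum_distrib_right sum_divide_distrib exp_minus field_simps)
qed

text \<open>The classical flat function exp (-1/x), with a polynomial in 1/x in front: the
  derivative of p(y) exp (-y) at y = 1/x is y^2 (p - p')(y) exp (-y), so the family is stable under
  differentiation.\<close>

definition bump :: "real poly => real => real" where
 "bump p x = (if x \<le> 0 then 0 else poly p (inverse x) * exp (- inverse x))"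

lemma bump_tendsto_0: "(bump p \<longlongrightarrow> 0) (at 0)"
proof (rule filterlim_split_at)
 have "\<forall>\<^sub>F x in at_left (0::real). x < 0" by (simp add: eventually_at_filter)
 then have "\<forall>\<^sub>F x in at_left 0. 0 = bump p x"
  by (rule eventually_mono) (simp add: bump_def)
 then show "(bump p \<longlongrightarrow> 0) (at_left 0)" by (rule Lim_transform_eventually[OF tendsto_const])
 have "((\<lambda>x. poly p (inverse x) * exp (- inverse x)) \<longlongrightarrow> 0) (at_right 0)"
  by (rule filterlim_compose[OF poly_exp_tendsto_0 filterlim_inverse_at_top_right])
 moreover have "\<forall>\<^sub>F x in at_right (0::real). x > 0" by (simp add: eventually_at_filter)
 then have "\<forall>\<^sub>F x in at_right 0. poly p (inverse x) * exp (- inverse x) = bump p x"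
  by (rule eventually_mono) (simp add: bump_def)
 ultimately show "(bump p \<longlongrightarrow> 0) (at_right 0)" by (rule Lim_transform_eventually)
qed

lemma bump_deriv: "(bump p has_real_derivative bump ([:0, 0, 1:] * (p - pderiv p)) x) (at x)"
proof -
 consider "x < 0" | "x = 0" | "x > 0" by linarith
 then show ?thesis
 proof cases
  case 1
  have "((\<lambda>x. 0) has_real_derivative 0) (at x)" by simp
  then have "(bump p has_real_derivative 0) (at x)"
   by (rule has_field_derivative_transform_within_open[where S = "{..<0}"]) (use 1 in \<open>auto simp: bump_def\<close>)
  then show ?thesis using 1 by (simp add: bump_def)
 next
  case 2
  \<comment> \<open>Dividing by h multiplies the polynomial by its variable, so the difference
    quotient at 0 is again a bump and tends to 0.\<close>
  have "bump (pCons 0 p) h = (bump p (0 + h) - bump p 0) / h" if "h \<noteq> 0" for h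
   using that by (simp add: bump_def field_simps)
  then have "((\<lambda>h. (bump p (0 + h) - bump p 0) / h) \<longlongrightarrow> 0) (at 0)"
   by (intro Lim_transform_eventually[OF bump_tendsto_0[of "pCons 0 p"]])
    (auto simp: eventually_at_filter)
  then show ?thesis using 2 by (simp add: DERIV_def bump_def[of _ 0])
 next
  case 3
  have "((\<lambda>x. poly p (inverse x) * exp (- inverse x)) has_real_derivative
    bump ([:0, 0, 1:] * (p - pderiv p)) x) (at x)"
   using 3 by (auto intro!: derivative_eq_intros DERIV_chain2[OF poly_DERIV] 
    simp: bump_def power2_eq_square algebra_simps)
  then show ?thesis
   by (rule has_field_derivative_transform_within_open[where S = "{0<..}"]) (use 3 in \<open>auto simp: bump_def\<close>)
 qed
qed

lemma smooth_bump: "smooth (\<lambda>x. complex_of_real (bump p x))"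
proof (rule smooth_coinduct[where P = "\<lambda>f. \<exists>p. f = (\<lambda>x. complex_of_real (bump p x))"])
 fix f assume "\<exists>p. f = (\<lambda>x. complex_of_real (bump p x))"
 then obtain p where f: "f = (\<lambda>x. complex_of_real (bump p x))" by blast
 define q where "q = [:0, 0, 1:] * (p - pderiv p)"
 show "\<exists>D. (\<forall>x. (f has_derivative D x) (at x)) \<and> (\<forall>v. \<exists>p. (\<lambda>x. D x v) = (\<lambda>x. complex_of_real (bump p x)))"
 proof (intro exI[of _ "\<lambda>x v. complex_of_real (bump q x * v)"] conjI allI)
  show "(f has_derivative (\<lambda>v. complex_of_real (bump q x * v))) (at x)" for x
   unfolding f using bump_deriv[of p x] unfolding has_field_derivative_def q_def[symmetric]
   by (intro bounded_linear.has_derivative[OF bounded_linear_of_real])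
  show "\<exists>p. (\<lambda>x. complex_of_real (bump q x * v)) = (\<lambda>x. complex_of_real (bump p x))" for v
   by (intro exI[of _ "smult v q"]) (auto simp: bump_def)
 qed
qed auto

lemma bump_1: "0 \<le> bump 1 x" "bump 1 x \<le> 1" "0 < bump 1 x \<longleftrightarrow> 0 < x"
 by (auto simp: bump_def)

lemma box_bump_exists:
 fixes a b :: "'a::euclidean_space"
 obtains ph :: "'a => real" where "test_fun (\<lambda>x. complex_of_real (ph x))"
  "support (\<lambda>x. complex_of_real (ph x)) \<subseteq> cbox a b"
  "\<And>x. 0 \<le> ph x" "\<And>x. ph x \<le> 1" "\<And>x. 0 < ph x \<longleftrightarrow> x \<in> box a b"
proof
 let ?ph = "\<lambda>x. \<Prod>i\<in>Basis. bump 1 (x \<bullet> i - a \<bullet> i) * bump 1 (b \<bullet> i - x \<bullet> i)"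
 show nn: "0 \<le> ?ph x" for x by (intro prod_nonneg ballI mult_nonneg_nonneg bump_1)
 show "?ph x \<le> 1" for x by (intro prod_le_1 conjI mult_nonneg_nonneg mult_le_one bump_1)
 show pos: "0 < ?ph x \<longleftrightarrow> x \<in> box a b" for x
 proof
  assume "0 < ?ph x"
  then have "\<forall>i\<in>Basis. bump 1 (x \<bullet> i - a \<bullet> i) * bump 1 (b \<bullet> i - x \<bullet> i) \<noteq> 0"
   by (metis (no_types, lifting) finite_Basis less_irrefl prod_zero)
  then have "\<forall>i\<in>Basis. bump 1 (x \<bullet> i - a \<bullet> i) \<noteq> 0 \<and> bump 1 (b \<bullet> i - x \<bullet> i) \<noteq> 0"
   by simp
  then have "\<forall>i\<in>Basis. bump 1 (x \<bullet> i - a \<bullet> i) > 0 \<and> bump 1 (b \<bullet> i - x \<bullet> i) > 0"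
   using bump_1(1) by (metis order_le_less)
  then show "x \<in> box a b" by (simp add: bump_1(3) mem_box)
 next
  assume "x \<in> box a b"
  then show "0 < ?ph x" by (intro prod_pos mult_pos_pos) (auto simp: bump_1(3) mem_box)
 qed
 have "smooth (\<lambda>x::'a. complex_of_real (bump 1 (x \<bullet> i - a \<bullet> i)))"
  "smooth (\<lambda>x::'a. complex_of_real (bump 1 (b \<bullet> i - x \<bullet> i)))" for i
  using smooth_real_affine[OF smooth_bump bounded_linear_inner_left, of 1 i "- (a \<bullet> i)"]
   smooth_real_affine[OF smooth_bump bounded_linear_minus[OF bounded_linear_inner_left], of 1 i "b \<bullet> i"]
  by (simp_all add: algebra_simps)
 then have sm: "smooth (\<lambda>x. complex_of_real (?ph x))"
  by (simp only: of_real_prod of_real_mult) (intro smooth_prod smooth_mult, auto)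
 have "{x. complex_of_real (?ph x) \<noteq> 0} \<subseteq> box a b"
  using pos nn by (metis (mono_tags, lifting) mem_Collect_eq of_real_0 order_le_less subsetI)
 then show su: "support (\<lambda>x. complex_of_real (?ph x)) \<subseteq> cbox a b"
  unfolding support_def using box_subset_cbox[of a b] by (intro closure_minimal) auto
 show "test_fun (\<lambda>x. complex_of_real (?ph x))"
  by (rule test_funI[OF sm _ su]) simp
qed

text \<open>With ph strictly between 0 and 1 or equal to 1 on the open box and 0 elsewhere, the
  functions 1 - (1 - ph)^k are test functions supported in the same closed box and converge to the
  indicator of the open box. Dominated convergence works for any Borel measure M, where
  mollification would require translation invariance.\<close>

lemma integral_box_zero:
 fixes u :: "'a::euclidean_space => complex"
 assumes M: "sets M = sets borel" and u [measurable]: "u \<in> borel_measurable borel"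
  and int: "integrable M (\<lambda>x. indicator (cbox a b) x *\<^sub>R u x)"
  and zero: "\<And>ph. test_fun ph ==> support ph \<subseteq> cbox a b ==> (LINT x|M. u x * ph x) = 0"
 shows "(LINT x|M. indicator (box a b) x *\<^sub>R u x) = 0"
proof -
 obtain ph where ph: "test_fun (\<lambda>x. complex_of_real (ph x))"
  "support (\<lambda>x. complex_of_real (ph x)) \<subseteq> cbox a b"
  "\<And>x. 0 \<le> ph x" "\<And>x. ph x \<le> 1" "\<And>x. 0 < ph x \<longleftrightarrow> x \<in> box a b"
  by (rule box_bump_exists[of a b]) blast
 have [measurable_cong]: "sets M = sets borel" by (rule M)
 define g where "g k x = complex_of_real (1 - (1 - ph x) ^ k)" for k x
 have sm: "smooth (g k)" for k
 proof -
  have "g k = (\<lambda>x. 1 + (-1) * (1 + (-1) * complex_of_real (ph x)) ^ k)" by (auto simp: g_def)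
  then show ?thesis
   by (simp only:) (intro smooth_add smooth_mult smooth_power smooth_const test_fun_smooth[OF ph(1)])
 qed
 have "{x. g k x \<noteq> 0} \<subseteq> {x. complex_of_real (ph x) \<noteq> 0}" for k by (auto simp: g_def)
 then have su: "support (g k) \<subseteq> cbox a b" for k
  using ph(2) unfolding support_def by (meson closure_mono order_trans)
 have tf: "test_fun (g k)" for k by (rule test_funI[OF sm _ su]) simp
 have [measurable]: "g k \<in> borel_measurable borel" for k by (rule smooth_measurable[OF sm])
 have "(\<lambda>k. LINT x|M. u x * g k x) \<longlonglongrightarrow> (LINT x|M. indicator (box a b) x *\<^sub>R u x)"
 proof (rule integral_dominated_convergence)
  show "integrable M (\<lambda>x. cmod (indicator (cbox a b) x *\<^sub>R u x))" using int by (rule integrable_norm)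
  show "AE x in M. (\<lambda>k. u x * g k x) \<longlonglongrightarrow> indicator (box a b) x *\<^sub>R u x"
  proof (rule AE_I2)
   fix x
   have "(\<lambda>k. g k x) \<longlonglongrightarrow> indicator (box a b) x"
   proof (cases "x \<in> box a b")
    case True
    then have "0 < ph x" using ph(5) by blast
    then have "norm (1 - ph x) < 1" using ph(4)[of x] by (simp add: abs_less_iff)
    then have "(\<lambda>k. (1 - ph x) ^ k) \<longlonglongrightarrow> 0" by (rule LIMSEQ_power_zero)
    then have "(\<lambda>k. complex_of_real (1 - (1 - ph x) ^ k)) \<longlonglongrightarrow> complex_of_real (1 - 0)"
     by (intro tendsto_of_real tendsto_diff tendsto_const)
    then show ?thesis using True by (simp add: g_def)
   next
    case False
    then have "ph x = 0" using ph(3)[of x] ph(5)[of x] by simp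
    then show ?thesis using False by (simp add: g_def)
   qed
   then have "(\<lambda>k. u x * g k x) \<longlonglongrightarrow> u x * indicator (box a b) x" by (rule tendsto_mult_left)
   then show "(\<lambda>k. u x * g k x) \<longlonglongrightarrow> indicator (box a b) x *\<^sub>R u x"
    by (simp add: indicator_def of_bool_def split: if_splits)
  qed
  show "AE x in M. norm (u x * g k x) \<le> cmod (indicator (cbox a b) x *\<^sub>R u x)" for k
  proof (rule AE_I2)
   fix x
   show "norm (u x * g k x) \<le> cmod (indicator (cbox a b) x *\<^sub>R u x)"
   proof (cases "x \<in> cbox a b")
    case True
    have "0 \<le> (1 - ph x) ^ k" "(1 - ph x) ^ k \<le> 1" using ph(3,4)[of x] by (auto intro: power_le_one)
    then have "cmod (g k x) \<le> 1" unfolding g_def by (subst norm_of_real) auto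
    then show ?thesis using True by (auto simp: norm_mult intro: mult_left_le)
   next
    case False
    then have "g k x = 0" using su[of k] not_in_support[of x "g k"] by auto
    then show ?thesis by simp
   qed
  qed
 qed measurable
 moreover have "(LINT x|M. u x * g k x) = 0" for k by (rule zero[OF tf su])
 ultimately show ?thesis by (simp add: LIMSEQ_const_iff)
qed

lemma box_Int_box:
 fixes a :: "'a::euclidean_space"
 shows "box a b \<inter> box c d = box (\<Sum>i\<in>Basis. max (a \<bullet> i) (c \<bullet> i) *\<^sub>R i) (\<Sum>i\<in>Basis. min (b \<bullet> i) (d \<bullet> i) *\<^sub>R i)"
 by (auto simp: mem_box)

text \<open>u is only locally integrable, so the generator argument is run inside one box at a time:
  boxes are stable under intersection, and cutting with a fixed box inside U stays within the
  hypotheses. Countably many boxes cover U.\<close>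

lemma AE_zero_boxes:
 fixes u :: "'a::euclidean_space => complex"
 assumes sf: "sigma_finite_measure M" and M: "sets M = sets borel" and u: "u \<in> borel_measurable borel" and U: "open U"
  and int: "\<And>a b. cbox a b \<subseteq> U ==> integrable M (\<lambda>x. indicator (cbox a b) x *\<^sub>R u x)"
  and b: "\<And>a b. cbox a b \<subseteq> U ==> (LINT x|M. indicator (box a b) x *\<^sub>R u x) = 0"
 shows "AE x in M. x \<in> U --> u x = 0"
proof -
 have local: "AE x in M. x \<in> box c d --> u x = 0" if cd: "cbox c d \<subseteq> U" for c d
 proof -
  have "AE x in M. indicator (box c d) x *\<^sub>R u x = 0"
  proof (rule sigma_finite_measure.integral_zero_pi_system[OF sf, where E = "range (\<lambda>(a, b). box a b)"])
   have "integrable M (\<lambda>x. indicator (box c d) x *\<^sub>R (indicator (cbox c d) x *\<^sub>R u x))"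
    using M by (intro integrable_mult_indicator[OF _ int[OF cd]]) auto
   also have "(\<lambda>x. indicator (box c d) x *\<^sub>R (indicator (cbox c d) x *\<^sub>R u x)) = (\<lambda>x. indicator (box c d) x *\<^sub>R u x)"
    by (intro ext) (auto simp: indicator_def dest: subsetD[OF box_subset_cbox])
   finally show "integrable M (\<lambda>x. indicator (box c d) x *\<^sub>R u x)" .
   show "Int_stable (range (\<lambda>(a, b). box a (b::'a)))"
    by (auto simp: Int_stable_def box_Int_box image_iff)
   show "sets M = sigma_sets (space M) (range (\<lambda>(a, b). box a b))"
    unfolding sets_eq_imp_space_eq[OF M] unfolding M borel_eq_box by (simp add: sets_measure_of)
   show "(LINT x|M. indicator (box c d) x *\<^sub>R u x) = 0" by (rule b[OF cd])
   fix A assume "A \<in> range (\<lambda>(a, b). box a (b::'a))"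
   then obtain a b' where A: "A = box a b'" by auto
   define e where "e = (\<Sum>i\<in>Basis. max (a \<bullet> i) (c \<bullet> i) *\<^sub>R i)"
   define f where "f = (\<Sum>i\<in>Basis. min (b' \<bullet> i) (d \<bullet> i) *\<^sub>R i)"
   have "box a b' \<inter> box c d = box e f" by (simp add: box_Int_box e_def f_def)
   then have "(\<lambda>x. indicator A x *\<^sub>R indicator (box c d) x *\<^sub>R u x) = (\<lambda>x. indicator (box e f) x *\<^sub>R u x)"
    unfolding A by (intro ext) (auto simp: indicator_def set_eq_iff)
   moreover have "cbox e f \<subseteq> cbox c d" by (auto simp: e_def f_def mem_box)
   ultimately show "(LINT x|M. indicator A x *\<^sub>R indicator (box c d) x *\<^sub>R u x) = 0"
    using b[of e f] cd by simp
  qed (use M sets_eq_imp_space_eq[OF M] in auto)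
  then show ?thesis by eventually_elim (auto simp: indicator_def)
 qed
 define F where "F = {box c d | c d. cbox c d \<subseteq> U}"
 have FU: "\<Union>F = U"
 proof (intro equalityI subsetI)
  fix x assume "x \<in> \<Union>F" then show "x \<in> U" unfolding F_def using box_subset_cbox by blast
 next
  fix x assume "x \<in> U"
  then obtain a b where "cbox a b \<subseteq> U" "x \<in> box a b"
   using open_contains_cbox[of U] U by (metis open_contains_cbox)
  then show "x \<in> \<Union>F" unfolding F_def by blast
 qed
 obtain F' where F': "F' \<subseteq> F" "countable F'" "\<Union>F' = \<Union>F"
  using Lindelof[of F] unfolding F_def by (auto simp: open_box)
 have "AE x in M. \<forall>B\<in>F'. x \<in> B --> u x = 0"
  unfolding AE_ball_countable[OF F'(2)] using F'(1) local unfolding F_def by blast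
 then show ?thesis by eventually_elim (use F' FU in blast)
qed

text \<open>Stated for a general sigma-finite Borel measure, because it is applied both to Lebesgue
  measure on the parameter of a branch and to the Plancherel measure pushed into the plane.\<close>

lemma fundamental_lemma:
 fixes u :: "'a::euclidean_space => complex"
 assumes sf: "sigma_finite_measure M" and M: "sets M = sets borel" and u: "u \<in> borel_measurable borel" and U: "open U"
  and int: "\<And>a b. cbox a b \<subseteq> U ==> integrable M (\<lambda>x. indicator (cbox a b) x *\<^sub>R u x)"
  and zero: "\<And>ph. test_fun ph ==> support ph \<subseteq> U ==> (LINT x|M. u x * ph x) = 0"
 shows "AE x in M. x \<in> U --> u x = 0"
proof (rule AE_zero_boxes[OF sf M u U int])
 show "(LINT x|M. indicator (box a b) x *\<^sub>R u x) = 0" if "cbox a b \<subseteq> U" for a b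
  by (rule integral_box_zero[OF M u int[OF that]]) (use that in \<open>auto intro: zero\<close>)
qed

section \<open>Integration by parts on Euclidean space\<close>

lemma integral_lborel_translate:
 fixes f :: "'a::euclidean_space => complex"
 assumes [measurable]: "f \<in> borel_measurable borel"
 shows "(LBINT x. f (x + c)) = (LBINT x. f x)"
proof -
 have "(LBINT x. f x) = (LINT x|distr lborel borel ((+) c). f x)" by (simp add: lborel_distr_plus)
 also have "... = (LBINT x. f (c + x))" by (rule integral_distr) auto
 finally show ?thesis by (simp add: add.commute)
qed

lemma integrable_product:
 fixes f :: "'a => complex" and g :: "'b => complex"
 assumes "sigma_finite_measure M" "sigma_finite_measure N" and f: "integrable M f" and g: "integrable N g"
 shows "integrable (M \<Otimes>\<^sub>M N) (\<lambda>(x, y). f x * g y)"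
proof -
 interpret M: sigma_finite_measure M by fact
 interpret N: sigma_finite_measure N by fact
 interpret pair_sigma_finite M N ..
 have [measurable]: "f \<in> borel_measurable M" "g \<in> borel_measurable N" using f g by auto
 show ?thesis
 proof (rule integrableI_bounded)
  have "(\<integral>\<^sup>+x. ennreal (norm (case x of (x, y) => f x * g y)) \<partial>(M \<Otimes>\<^sub>M N)) =
    (\<integral>\<^sup>+x. \<integral>\<^sup>+y. ennreal (norm (f x)) * ennreal (norm (g y)) \<partial>N \<partial>M)"
   by (subst N.nn_integral_fst[symmetric]) (auto simp: norm_mult ennreal_mult)
  also have "... = (\<integral>\<^sup>+x. ennreal (norm (f x)) \<partial>M) * (\<integral>\<^sup>+y. ennreal (norm (g y)) \<partial>N)"
   by (simp add: nn_integral_cmult nn_integral_multc)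
  also have "... < \<infinity>"
   using f g by (auto simp: ennreal_mult_less_top integrable_iff_bounded)
  finally show "(\<integral>\<^sup>+x. ennreal (norm (case x of (x, y) => f x * g y)) \<partial>(M \<Otimes>\<^sub>M N)) < \<infinity>" .
 qed measurable
qed

lemma integrable_product_bounded:
 fixes f :: "'a => complex" and g :: "'b => complex"
 assumes "sigma_finite_measure M" "sigma_finite_measure N" and f: "integrable M f" and g: "integrable N g"
  and h [measurable]: "h \<in> borel_measurable (M \<Otimes>\<^sub>M N)" and bound: "\<And>x y. cmod (h (x, y)) \<le> C * (cmod (f x) * cmod (g y))"
 shows "integrable (M \<Otimes>\<^sub>M N) h"
proof (rule Bochner_Integration.integrable_bound[OF integrable_mult_right[OF integrable_product[OF assms(1-4)], of "of_real C"]])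
 show "AE x in M \<Otimes>\<^sub>M N. norm (h x) \<le> norm (complex_of_real C * (case x of (x, y) => f x * g y))"
 proof (rule AE_I2)
  fix p :: "'a \<times> 'b"
  obtain x y where p: "p = (x, y)" by (cases p)
  have "cmod (h p) \<le> C * (cmod (f x) * cmod (g y))" using bound[of x y] p by simp
  also have "... \<le> \<bar>C\<bar> * (cmod (f x) * cmod (g y))" by (intro mult_right_mono) auto
  finally show "norm (h p) \<le> norm (complex_of_real C * (case p of (x, y) => f x * g y))"
   by (simp add: p norm_mult)
 qed
qed fact

text \<open>The derivative is integrated along the segment from x to x + v. By the fundamental
  theorem this gives f (x + v) - f x, whose integral is 0 by translation invariance; by Fubini it
  equals the integral of the derivative. Any direction v is handled at once, without
  coordinates.\<close>

lemma integral_dir_deriv_zero: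
 fixes f :: "'a::euclidean_space => complex"
 assumes f: "test_fun f"
 shows "(LBINT x. dir_deriv v f x) = 0"
proof -
 have sm: "smooth f" using f by (rule test_fun_smooth)
 have [measurable]: "f \<in> borel_measurable borel" "dir_deriv v f \<in> borel_measurable borel"
  using smooth_measurable smooth_dir_deriv sm by blast+
 obtain C where C: "C \<ge> 0" "\<And>x. cmod (dir_deriv v f x) \<le> C"
  using test_fun_bound[OF test_fun_dir_deriv[OF f]] by blast
 obtain R where R: "\<And>x. norm x > R ==> dir_deriv v f x = 0" by (rule test_fun_vanish[OF test_fun_dir_deriv[OF f]]) blast
 define h where "h x s = indicator {0..1} s *\<^sub>R dir_deriv v f (x + s *\<^sub>R v)" for x and s :: real
 have hi: "integrable (lborel \<Otimes>\<^sub>M lborel) (\<lambda>(x, s). h x s)"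
 proof (rule integrable_product_bounded[where C = C])
  show "integrable lborel (\<lambda>x::'a. complex_of_real (indicator (cball 0 (R + norm v)) x))"
   by (intro integrable_of_real integrable_real_indicator) (use emeasure_lborel_cball_finite[of 0 "R + norm v"] in auto)
  show "integrable lborel (\<lambda>s::real. complex_of_real (indicator {0..1} s))"
   by (intro integrable_of_real integrable_real_indicator) auto
  show "cmod (case (x, s) of (x, s) => h x s) \<le> C * (cmod (of_real (indicator (cball 0 (R + norm v)) x)) * cmod (of_real (indicator {0..1} s)))" for x s
  proof (cases "s \<in> {0..1} \<and> norm x > R + norm v")
   case True
   have "norm x \<le> norm (x + s *\<^sub>R v) + norm (s *\<^sub>R v)" using norm_triangle_ineq4[of "x + s *\<^sub>R v" "s *\<^sub>R v"] by simp
   also have "norm (s *\<^sub>R v) \<le> norm v" using True by (simp add: mult_left_le_one_le)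
   finally show ?thesis using True R by (simp add: h_def)
  qed (use C in \<open>auto simp: h_def indicator_def\<close>)
  show "(\<lambda>(x, s). h x s) \<in> borel_measurable (lborel \<Otimes>\<^sub>M lborel)" unfolding h_def by measurable
 qed (simp_all add: lborel.sigma_finite_measure_axioms)
 have "(LBINT x. h x s) = indicator {0..1} s *\<^sub>R (LBINT x. dir_deriv v f x)" for s
  by (simp add: h_def integral_lborel_translate)
 moreover have "(LBINT s. h x s) = f (x + v) - f x" for x
 proof -
  have d: "((\<lambda>s. f (x + s *\<^sub>R v)) has_vector_derivative dir_deriv v f (x + s *\<^sub>R v)) (at s within {0..1})" for s
  proof -
   have "((\<lambda>t. x + t *\<^sub>R v) has_derivative (\<lambda>t. t *\<^sub>R v)) (at s within {0..1})" by (auto intro!: derivative_eq_intros)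
   from has_derivative_compose[OF this smooth_has_derivative[OF sm]] show ?thesis
    unfolding has_vector_derivative_def
    by (simp add: linear_scale[OF has_derivative_linear[OF smooth_has_derivative[OF sm]]])
  qed
  have "continuous_on {0..1} (\<lambda>s. dir_deriv v f (x + s *\<^sub>R v))"
   by (intro continuous_on_compose2[OF smooth_continuous[OF smooth_dir_deriv[OF sm], of UNIV]] continuous_intros) auto
  from integral_FTC_atLeastAtMost[OF _ d this] show ?thesis by (simp add: h_def)
 qed
 ultimately have "(LBINT x. dir_deriv v f x) = (LBINT x. f (x + v) - f x)"
  using lborel_pair.Fubini_integral[OF hi] by simp
 also have "... = 0"
 proof -
  have i: "integrable lborel f" by (rule test_fun_integrable_lborel[OF f])
  then have "integrable (distr lborel borel ((+) v)) f" by (simp add: lborel_distr_plus)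
  then have "integrable lborel (\<lambda>x. f (x + v))"
   by (subst (asm) integrable_distr_eq) (auto simp: add.commute)
  then show ?thesis using i by (simp add: integral_lborel_translate)
 qed
 finally show ?thesis .
qed

lemma dir_deriv_mult:
 "smooth f ==> smooth g ==> dir_deriv v (\<lambda>x. f x * g x) x = f x * dir_deriv v g x + dir_deriv v f x * g x"
 by (rule dir_deriv_eq) (intro has_derivative_mult smooth_has_derivative)

lemma dir_deriv_add:
 "smooth f ==> smooth g ==> dir_deriv v (\<lambda>x. f x + g x) x = dir_deriv v f x + dir_deriv v g x"
 by (rule dir_deriv_eq) (intro has_derivative_add smooth_has_derivative)

lemma dir_deriv_scale:
 "smooth f ==> dir_deriv v (\<lambda>x. c * f x) x = c * dir_deriv v f x"
 by (rule dir_deriv_eq) (intro has_derivative_mult_right smooth_has_derivative)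

lemma dir_deriv_direction_scale:
 "smooth f ==> dir_deriv (r *\<^sub>R v) f x = of_real r * dir_deriv v f x"
 using linear_scale[OF has_derivative_linear[OF smooth_has_derivative[of f x]], of r v]
 by (simp add: scaleR_conv_of_real)

lemma integral_by_parts:
 assumes "test_fun f" "smooth g"
 shows "(LBINT x. dir_deriv v f x * g x) = - (LBINT x. f x * dir_deriv v g x)"
proof -
 have i: "integrable lborel (\<lambda>x. f x * dir_deriv v g x)" "integrable lborel (\<lambda>x. dir_deriv v f x * g x)"
  by (intro test_fun_integrable_lborel test_fun_mult_smooth test_fun_dir_deriv smooth_dir_deriv assms)+
 have "0 = (LBINT x. f x * dir_deriv v g x + dir_deriv v f x * g x)"
  using integral_dir_deriv_zero[OF test_fun_mult_smooth[OF assms], of v]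
  by (simp add: dir_deriv_mult test_fun_smooth assms)
 also have "... = (LBINT x. f x * dir_deriv v g x) + (LBINT x. dir_deriv v f x * g x)"
  using i by simp
 finally show ?thesis by (simp add: eq_neg_iff_add_eq_0 add.commute)
qed

subsection \<open>Laplace and Fourier transforms of test functions\<close>

lemma lborel_pair_measurable:
 "borel_measurable (lborel \<Otimes>\<^sub>M lborel) = borel_measurable (borel \<Otimes>\<^sub>M borel)"
 by (intro measurable_cong_sets sets_pair_measure_cong) auto

text \<open>One transform of a complex variable serves as the Fourier transform, on the imaginary
  axis, and as the profile of wave packets, in the right half plane; the same integration by parts
  gives decay in both cases.\<close>

definition lap :: "(real => complex) => complex => complex" where
 "lap ps w = (LBINT ta. ps ta * exp (- (of_real ta * w)))"

lemma exp_of_real_has_derivative: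
 "((\<lambda>x. exp (of_real x * c)) has_derivative (\<lambda>v. of_real v * (c * exp (of_real x * c)))) (at x)" for x :: real and c :: complex
proof -
 have "((\<lambda>x. exp (of_real x * c)) has_vector_derivative (c * exp (of_real x * c))) (at x)"
  by (rule has_vector_derivative_real_field) (auto intro!: derivative_eq_intros)
 then show ?thesis by (simp add: has_vector_derivative_def scaleR_conv_of_real)
qed

lemma smooth_exp_of_real: "smooth (\<lambda>x::real. exp (of_real x * c))"
proof (rule smooth_coinduct[where P = "\<lambda>f. \<exists>d. f = (\<lambda>x. d * exp (of_real x * c))"])
 show "\<exists>d. (\<lambda>x::real. exp (of_real x * c)) = (\<lambda>x. d * exp (of_real x * c))" by (intro exI[of _ 1]) simp
next
 fix f :: "real => complex" assume "\<exists>d. f = (\<lambda>x. d * exp (of_real x * c))"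
 then obtain d where f: "f = (\<lambda>x. d * exp (of_real x * c))" by blast
 show "\<exists>D. (\<forall>x. (f has_derivative D x) (at x)) \<and> (\<forall>v. \<exists>d. (\<lambda>x. D x v) = (\<lambda>x. d * exp (of_real x * c)))"
 proof (intro exI[of _ "\<lambda>x v. d * (of_real v * (c * exp (of_real x * c)))"] conjI allI)
  show "(f has_derivative (\<lambda>v. d * (of_real v * (c * exp (of_real x * c))))) (at x)" for x
   unfolding f by (intro has_derivative_mult_right exp_of_real_has_derivative)
  show "\<exists>d'. (\<lambda>x. d * (of_real v * (c * exp (of_real x * c)))) = (\<lambda>x. d' * exp (of_real x * c))" for v
   by (intro exI[of _ "d * of_real v * c"]) (simp add: mult.assoc)
 qed
qed

lemma dir_deriv_exp_of_real: "dir_deriv 1 (\<lambda>x::real. exp (of_real x * c)) x = c * exp (of_real x * c)"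
 using dir_deriv_eq[OF exp_of_real_has_derivative] by simp

lemma smooth_of_real: "smooth (\<lambda>x::real. complex_of_real x)"
 by (rule smooth_bounded_linear) (rule bounded_linear_of_real)

lemma lap_integrable: "test_fun ps ==> integrable lborel (\<lambda>ta. ps ta * exp (- (of_real ta * w)))"
 using test_fun_integrable_lborel[OF test_fun_mult_smooth[OF _ smooth_exp_of_real[of "- w"]]] by simp

lemma lap_mult_arg:
 assumes "test_fun ps"
 shows "w * lap ps w = lap (dir_deriv 1 ps) w"
proof -
 have "lap (dir_deriv 1 ps) w = (LBINT ta. dir_deriv 1 ps ta * exp (of_real ta * (- w)))"
  by (simp add: lap_def)
 also have "... = - (LBINT ta. ps ta * (- w * exp (of_real ta * (- w))))"
  unfolding integral_by_parts[OF assms smooth_exp_of_real] dir_deriv_exp_of_real by simp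
 also have "... = w * lap ps w"
  unfolding lap_def by (simp flip: integral_mult_right_zero integral_minus add: mult.assoc mult.left_commute)
 finally show ?thesis by simp
qed

lemma lap_power_mult_arg:
 assumes "test_fun ps"
 shows "w ^ k * lap ps w = lap ((dir_deriv 1 ^^ k) ps) w \<and> test_fun ((dir_deriv 1 ^^ k) ps) \<and>
  support ((dir_deriv 1 ^^ k) ps) \<subseteq> support ps"
proof (induction k)
 case (Suc k)
 have "w ^ Suc k * lap ps w = w * lap ((dir_deriv 1 ^^ k) ps) w" using Suc by (simp add: mult.assoc)
 also have "... = lap ((dir_deriv 1 ^^ Suc k) ps) w" using Suc by (simp add: lap_mult_arg)
 finally show ?case using Suc support_dir_deriv[of 1 "(dir_deriv 1 ^^ k) ps"] by (auto intro: test_fun_dir_deriv)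
qed (use assms in auto)

lemma lap_bound:
 assumes "test_fun ps" "\<And>ta. ta \<in> support ps ==> ta * Re w \<ge> 0"
 shows "cmod (lap ps w) \<le> (LBINT ta. cmod (ps ta))"
proof -
 have "cmod (lap ps w) \<le> (LBINT ta. cmod (ps ta * exp (- (of_real ta * w))))"
  unfolding lap_def by (rule integral_norm_bound)
 also have "... \<le> (LBINT ta. cmod (ps ta))"
 proof (rule integral_mono)
  show "integrable lborel (\<lambda>ta. cmod (ps ta * exp (- (of_real ta * w))))"
   using lap_integrable[OF assms(1)] by (rule integrable_norm)
  show "integrable lborel (\<lambda>ta. cmod (ps ta))"
   using test_fun_integrable_lborel[OF assms(1)] by (rule integrable_norm)
  show "cmod (ps ta * exp (- (of_real ta * w))) \<le> cmod (ps ta)" for ta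
  proof (cases "ta \<in> support ps")
   case True
   then show ?thesis using assms(2)[OF True] by (auto simp: norm_mult norm_exp_eq_Re intro: mult_left_le)
  qed (simp add: not_in_support)
 qed
 finally show ?thesis .
qed

text \<open>Multiplication by w^k amounts to differentiating \<open>ps\<close> k times, and the
  exponential has modulus at most 1 on the support under the stated sign condition. The bound is
  therefore uniform in w, which for packets yields decay in z and t together.\<close>

lemma lap_decay:
 assumes "test_fun ps"
 obtains C where "C \<ge> 0" "\<And>w. (\<And>ta. ta \<in> support ps ==> ta * Re w \<ge> 0) ==> cmod w ^ k * cmod (lap ps w) \<le> C"
proof
 let ?ps = "(dir_deriv 1 ^^ k) ps"
 show "(LBINT ta. cmod (?ps ta)) \<ge> 0" by simp
 fix w assume w: "\<And>ta. ta \<in> support ps ==> ta * Re w \<ge> 0"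
 have "cmod w ^ k * cmod (lap ps w) = cmod (lap ?ps w)"
  using lap_power_mult_arg[OF assms, of w k] by (metis norm_mult norm_power)
 also have "... \<le> (LBINT ta. cmod (?ps ta))"
  using lap_power_mult_arg[OF assms, of w k] w by (intro lap_bound) auto
 finally show "cmod w ^ k * cmod (lap ps w) \<le> (LBINT ta. cmod (?ps ta))" .
qed

text \<open>The integrand vanishes off the compact support, so the integral runs over a fixed
  interval, where the Leibniz rule for continuous integrands applies.\<close>

lemma lap_has_field_derivative:
 assumes "test_fun ps"
 shows "(lap ps has_field_derivative - lap (\<lambda>ta. of_real ta * ps ta) w) (at w)"
proof -
 have "bounded (support ps)" using assms by (auto simp: test_fun_def' compact_imp_bounded)
 then obtain a b where ab: "support ps \<subseteq> cbox a b" using bounded_subset_cbox_symmetric by metis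
 have c: "(LBINT ta. f ta) = integral (cbox a b) f" "f integrable_on cbox a b"
  if "integrable lborel f" "\<And>x. x \<notin> support ps ==> f x = 0" for f :: "real => complex"
 proof -
  have eq: "f = (\<lambda>x. if x \<in> cbox a b then f x else 0)"
  proof (rule ext)
   show "f x = (if x \<in> cbox a b then f x else 0)" for x
    using ab that(2)[of x] by (cases "x \<in> support ps") auto
  qed
  have "(LBINT ta. f ta) = integral UNIV f" using integral_lborel[OF that(1)] by simp
  also have "... = integral (cbox a b) f" by (subst eq) (rule integral_restrict_UNIV)
  finally show "(LBINT ta. f ta) = integral (cbox a b) f" .
  have "f integrable_on UNIV" using integrable_on_lborel[OF that(1)] .
  then show "f integrable_on cbox a b" by (rule integrable_on_subcbox) auto
 qed
 have tf: "test_fun (\<lambda>ta. of_real ta * ps ta)" by (intro test_fun_smooth_mult assms smooth_of_real)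
 have 1: "lap ps w = integral (cbox a b) (\<lambda>ta. ps ta * exp (- (of_real ta * w)))" for w
  unfolding lap_def by (rule c(1)[OF lap_integrable[OF assms]]) (simp add: not_in_support)
 have 2: "- lap (\<lambda>ta. of_real ta * ps ta) w = integral (cbox a b) (\<lambda>ta. - (of_real ta * ps ta * exp (- (of_real ta * w))))" for w
  unfolding lap_def using c[OF lap_integrable[OF tf]]
  by (simp add: not_in_support)
 have "((\<lambda>w. integral (cbox a b) (\<lambda>ta. ps ta * exp (- (of_real ta * w)))) has_field_derivative
   integral (cbox a b) (\<lambda>ta. - (of_real ta * ps ta * exp (- (of_real ta * w))))) (at w within UNIV)"
 proof (rule leibniz_rule_field_derivative)
  show "((\<lambda>w. ps ta * exp (- (of_real ta * w))) has_field_derivative - (of_real ta * ps ta * exp (- (of_real ta * w)))) (at w within UNIV)" for w ta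
   by (auto intro!: derivative_eq_intros)
  show "(\<lambda>ta. ps ta * exp (- (of_real ta * w))) integrable_on cbox a b" for w
   by (rule c(2)[OF lap_integrable[OF assms]]) (simp add: not_in_support)
  have "continuous_on UNIV ps" using assms by (intro smooth_continuous test_fun_smooth)
  then show "continuous_on (UNIV \<times> cbox a b) (\<lambda>(w, ta). - (of_real ta * ps ta * exp (- (of_real ta * w))))"
   unfolding split_beta by (intro continuous_intros continuous_on_compose2[OF _ continuous_on_snd]) auto
 qed auto
 then show ?thesis unfolding 1[abs_def] 2 by simp
qed

lemma lap_continuous: "test_fun ps ==> continuous_on S (lap ps)"
 by (meson DERIV_isCont continuous_at_imp_continuous_on lap_has_field_derivative)

lemma lap_measurable: "test_fun ps ==> lap ps \<in> borel_measurable borel"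
 by (intro borel_measurable_continuous_onI lap_continuous)

section \<open>Fourier transforms of test functions on the line\<close>

definition ft :: "(real => complex) => real => complex" where
 "ft ps t = (LBINT ta. ps ta * iexp (ta * t))"

lemma ft_lap: "ft ps t = lap ps (- (\<i> * of_real t))"
 unfolding ft_def lap_def by (intro Bochner_Integration.integral_cong) (auto simp: algebra_simps)

lemma ft_measurable: "test_fun ps ==> ft ps \<in> borel_measurable borel"
 unfolding ft_lap[abs_def] using lap_measurable[measurable] by measurable

lemma ft_bound: "test_fun ps ==> cmod (ft ps t) \<le> (LBINT ta. cmod (ps ta))"
 unfolding ft_lap by (rule lap_bound) auto

lemma integrable_inverse_square: "integrable lborel (\<lambda>t::real. inverse (1 + t^2))"
 using integrable_inverse_1_plus_square by (simp add: einterval_def set_integrable_def)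

lemma ft_decay:
 assumes "test_fun ps"
 obtains C where "C \<ge> 0" "\<And>t. cmod (ft ps t) \<le> C * inverse (1 + t^2)"
proof -
 obtain C where C: "C \<ge> 0" "\<And>w. (\<And>ta. ta \<in> support ps ==> ta * Re w \<ge> 0) ==> cmod w ^ 2 * cmod (lap ps w) \<le> C"
  by (rule lap_decay[OF assms, of 2]) blast
 define D where "D = (LBINT ta. cmod (ps ta))"
 have "cmod (ft ps t) \<le> (D + C) * inverse (1 + t^2)" for t
 proof -
  have "t^2 * cmod (ft ps t) \<le> C" using C(2)[of "- (\<i> * of_real t)"] by (simp add: ft_lap norm_mult)
  moreover have "cmod (ft ps t) \<le> D" unfolding D_def by (rule ft_bound[OF assms])
  ultimately have "(1 + t^2) * cmod (ft ps t) \<le> D + C" by (simp add: algebra_simps)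
  moreover have "1 + t^2 > 0" by (simp add: add_pos_nonneg)
  ultimately show ?thesis by (simp add: field_simps)
 qed
 moreover have "D + C \<ge> 0" using C by (simp add: D_def)
 ultimately show ?thesis using that by blast
qed

lemma ft_integrable:
 assumes "test_fun ps"
 shows "integrable lborel (ft ps)"
proof -
 obtain C where C: "C \<ge> 0" "\<And>t. cmod (ft ps t) \<le> C * inverse (1 + t^2)" by (rule ft_decay[OF assms]) blast
 show ?thesis
  by (rule Bochner_Integration.integrable_bound[OF integrable_mult_right[OF integrable_inverse_square, of C]])
   (use C ft_measurable[OF assms] in \<open>auto simp: abs_mult intro!: order_trans[OF C(2)]\<close>)
qed

lemma gaussian_ft:
 "integrable lborel (\<lambda>x. std_normal_density x)"
 "(LBINT x. of_real (std_normal_density x) * iexp (s * x)) = complex_of_real (exp (- s\<^sup>2 / 2))"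
proof -
 show "integrable lborel (\<lambda>x. std_normal_density x)" by (rule integrable_normal_density) simp
 have "complex_of_real (exp (- s\<^sup>2 / 2)) = char std_normal_distribution s" by (simp add: char_std_normal_distribution)
 also have "... = (LBINT x. std_normal_density x *\<^sub>R iexp (s * x))"
  unfolding char_def by (subst integral_density) (auto simp: normal_density_nonneg)
 finally show "(LBINT x. of_real (std_normal_density x) * iexp (s * x)) = complex_of_real (exp (- s\<^sup>2 / 2))"
  by (simp add: scaleR_conv_of_real)
qed

text \<open>Damping the inversion integral by a Gaussian makes Fubini legitimate, and since the
  Gaussian is its own Fourier transform the result is an average of \<open>ps\<close> near
  \<open>ta\<close> at scale e. The factor sqrt (2 pi) is the quotient of exp (-y^2 / 2) by the
  normal density.\<close>

lemma gaussian_regularized_inversion: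
 assumes ps: "test_fun ps" and e: "e > 0"
 shows "(LBINT t. ft ps t * exp (- (\<i> * of_real (ta * t))) * of_real (std_normal_density (e * t))) =
  of_real (sqrt (2 * pi)) * (LBINT y. ps (ta + e * y) * of_real (std_normal_density y))"
proof -
 have [measurable]: "ps \<in> borel_measurable borel" using smooth_measurable[OF test_fun_smooth[OF ps]] .
 define g where "g t = complex_of_real (std_normal_density (e * t))" for t
 have [measurable]: "g \<in> borel_measurable borel" unfolding g_def by measurable
 have gi: "integrable lborel g" unfolding g_def
  using lborel_integrable_real_affine[OF gaussian_ft(1), of e 0] e by (simp add: integrable_of_real)
 have fub: "integrable (lborel \<Otimes>\<^sub>M lborel) (\<lambda>(t, l). g t * ps l * iexp ((l - ta) * t))"
  by (rule integrable_product_bounded[OF _ _ gi test_fun_integrable_lborel[OF ps], where C = 1])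
   (auto simp: norm_mult norm_exp_eq_Re lborel.sigma_finite_measure_axioms)
 have "(LBINT t. ft ps t * exp (- (\<i> * of_real (ta * t))) * of_real (std_normal_density (e * t))) =
   (LBINT t. LBINT l. g t * ps l * iexp ((l - ta) * t))"
 proof (intro Bochner_Integration.integral_cong refl)
  fix t
  have "ft ps t * exp (- (\<i> * of_real (ta * t))) * g t = (LBINT l. ps l * iexp (l * t) * (exp (- (\<i> * of_real (ta * t))) * g t))"
   by (subst integral_mult_left_zero) (simp only: ft_def mult.assoc)
  also have "... = (LBINT l. g t * ps l * iexp ((l - ta) * t))"
  proof (intro Bochner_Integration.integral_cong refl)
   fix l
   have "iexp (l * t) * exp (- (\<i> * of_real (ta * t))) = iexp ((l - ta) * t)"
    unfolding exp_add[symmetric] by (simp add: algebra_simps)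
   from this[symmetric] show "ps l * iexp (l * t) * (exp (- (\<i> * of_real (ta * t))) * g t) = g t * ps l * iexp ((l - ta) * t)"
    by (simp only: mult_ac)
  qed
  finally show "ft ps t * exp (- (\<i> * of_real (ta * t))) * of_real (std_normal_density (e * t)) =
   (LBINT l. g t * ps l * iexp ((l - ta) * t))" by (simp add: g_def)
 qed
 also have "... = (LBINT l. LBINT t. g t * ps l * iexp ((l - ta) * t))"
  by (rule lborel_pair.Fubini_integral[symmetric]) (use fub in simp)
 also have "... = (LBINT l. ps l * of_real (exp (- ((l - ta) / e)\<^sup>2 / 2) / e))"
 proof (intro Bochner_Integration.integral_cong refl)
  fix l
  have "(LBINT t. g t * ps l * iexp ((l - ta) * t)) =
    ps l * (LBINT t. g t * iexp ((l - ta) * t))"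
   by (simp flip: integral_mult_right_zero add: mult.assoc mult.left_commute)
  also have "(LBINT t. g t * iexp ((l - ta) * t)) =
    (1 / e) *\<^sub>R (LBINT x. of_real (std_normal_density x) * iexp ((l - ta) / e * x))"
   using e by (subst lborel_integral_real_affine[where c = "1 / e" and t = 0]) (auto simp: g_def)
  also have "... = of_real (exp (- ((l - ta) / e)\<^sup>2 / 2) / e)"
   unfolding gaussian_ft(2) by (simp add: scaleR_conv_of_real)
  finally show "(LBINT t. g t * ps l * iexp ((l - ta) * t)) = ps l * of_real (exp (- ((l - ta) / e)\<^sup>2 / 2) / e)" .
 qed
 also have "... = (LBINT y. ps (ta + e * y) * of_real (exp (- y\<^sup>2 / 2)))"
 proof -
  have "(LBINT l. ps l * of_real (exp (- ((l - ta) / e)\<^sup>2 / 2) / e)) =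
    \<bar>e\<bar> *\<^sub>R (LBINT y. ps (ta + e * y) * of_real (exp (- ((ta + e * y - ta) / e)\<^sup>2 / 2) / e))"
   using e by (intro lborel_integral_real_affine) simp
  also have "... = (LBINT y. \<bar>e\<bar> *\<^sub>R (ps (ta + e * y) * of_real (exp (- ((ta + e * y - ta) / e)\<^sup>2 / 2) / e)))"
   by (rule integral_scaleR_right[symmetric])
  also have "... = (LBINT y. ps (ta + e * y) * of_real (exp (- y\<^sup>2 / 2)))"
   using e by (intro Bochner_Integration.integral_cong) (auto simp: scaleR_conv_of_real)
  finally show ?thesis .
 qed
 also have "... = (LBINT y. of_real (sqrt (2 * pi)) * (ps (ta + e * y) * of_real (std_normal_density y)))"
  by (intro Bochner_Integration.integral_cong refl) (simp add: std_normal_density_def field_simps flip: of_real_mult)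
 finally show ?thesis by simp
qed

text \<open>Both sides of the regularised identity converge as e tends to 0. The normal density at 0
  contributes 1 / sqrt (2 pi) on the left, so that two factors sqrt (2 pi) combine to 2 pi.\<close>

lemma ft_inversion:
 assumes ps: "test_fun ps"
 shows "(LBINT t. ft ps t * exp (- (\<i> * of_real (ta * t)))) = of_real (2 * pi) * ps ta"
proof -
 have [measurable]: "ps \<in> borel_measurable borel" using smooth_measurable[OF test_fun_smooth[OF ps]] .
 have [measurable]: "ft ps \<in> borel_measurable borel" by (rule ft_measurable[OF ps])
 obtain B where B: "B \<ge> 0" "\<And>x. cmod (ps x) \<le> B" using test_fun_bound[OF ps] by blast
 define e where "e k = 1 / real (Suc k)" for k
 have e: "e k > 0" for k by (simp add: e_def)
 have e0: "e \<longlonglongrightarrow> 0" unfolding e_def using LIMSEQ_inverse_real_of_nat by (simp add: inverse_eq_divide)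
 have nd: "std_normal_density x \<le> 1 / sqrt (2 * pi)" for x
  by (simp add: std_normal_density_def divide_right_mono)
 have nd0: "continuous_on UNIV std_normal_density" unfolding std_normal_density_def by (intro continuous_intros) auto
 have l1: "(\<lambda>k. LBINT t. ft ps t * exp (- (\<i> * of_real (ta * t))) * of_real (std_normal_density (e k * t)))
   \<longlonglongrightarrow> (LBINT t. ft ps t * exp (- (\<i> * of_real (ta * t))) * of_real (std_normal_density 0))"
 proof (rule integral_dominated_convergence)
  show "integrable lborel (\<lambda>t. cmod (ft ps t) * (1 / sqrt (2 * pi)))"
   using ft_integrable[OF ps] by (intro integrable_mult_left integrable_norm)
  show "AE t in lborel. (\<lambda>k. ft ps t * exp (- (\<i> * of_real (ta * t))) * of_real (std_normal_density (e k * t)))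
    \<longlonglongrightarrow> ft ps t * exp (- (\<i> * of_real (ta * t))) * of_real (std_normal_density 0)"
  proof (rule AE_I2)
   fix t :: real
   have "(\<lambda>k. e k * t) \<longlonglongrightarrow> 0 * t" by (intro tendsto_mult e0 tendsto_const)
   then have "(\<lambda>k. std_normal_density (e k * t)) \<longlonglongrightarrow> std_normal_density 0"
    by (intro continuous_on_tendsto_compose[OF nd0]) auto
   then show "(\<lambda>k. ft ps t * exp (- (\<i> * of_real (ta * t))) * of_real (std_normal_density (e k * t)))
    \<longlonglongrightarrow> ft ps t * exp (- (\<i> * of_real (ta * t))) * of_real (std_normal_density 0)"
    by (intro tendsto_mult tendsto_const tendsto_of_real)
  qed
  show "AE t in lborel. norm (ft ps t * exp (- (\<i> * of_real (ta * t))) * of_real (std_normal_density (e k * t))) \<le> cmod (ft ps t) * (1 / sqrt (2 * pi))" for k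
   by (intro AE_I2) (simp add: norm_mult norm_exp_eq_Re normal_density_nonneg mult_left_mono[OF nd] del: times_divide_eq_right)
 qed measurable
 have l2: "(\<lambda>k. LBINT y. ps (ta + e k * y) * of_real (std_normal_density y))
   \<longlonglongrightarrow> (LBINT y. ps ta * of_real (std_normal_density y))"
 proof (rule integral_dominated_convergence)
  show "integrable lborel (\<lambda>y. B * std_normal_density y)" by (intro integrable_mult_right gaussian_ft)
  show "AE y in lborel. (\<lambda>k. ps (ta + e k * y) * of_real (std_normal_density y)) \<longlonglongrightarrow> ps ta * of_real (std_normal_density y)"
  proof (rule AE_I2)
   fix y :: real
   have "(\<lambda>k. ta + e k * y) \<longlonglongrightarrow> ta + 0 * y" by (intro tendsto_intros e0)
   then have "(\<lambda>k. ps (ta + e k * y)) \<longlonglongrightarrow> ps ta"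
    by (intro continuous_on_tendsto_compose[OF smooth_continuous[OF test_fun_smooth[OF ps], of UNIV]]) auto
   then show "(\<lambda>k. ps (ta + e k * y) * of_real (std_normal_density y)) \<longlonglongrightarrow> ps ta * of_real (std_normal_density y)"
    by (intro tendsto_mult tendsto_const)
  qed
  show "AE y in lborel. norm (ps (ta + e k * y) * of_real (std_normal_density y)) \<le> B * std_normal_density y" for k
   by (intro AE_I2) (simp add: norm_mult normal_density_nonneg mult_right_mono B)
 qed measurable
 have "(LBINT y. ps ta * of_real (std_normal_density y)) = ps ta"
  using gaussian_ft(2)[of 0] by simp
 moreover have "(LBINT t. ft ps t * exp (- (\<i> * of_real (ta * t))) * of_real (std_normal_density 0)) =
   of_real (sqrt (2 * pi)) * (LBINT y. ps ta * of_real (std_normal_density y))"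
  using LIMSEQ_unique[OF l1] tendsto_mult_left[OF l2, of "of_real (sqrt (2 * pi))"]
  unfolding gaussian_regularized_inversion[OF ps e] by blast
 ultimately have "(LBINT t. ft ps t * exp (- (\<i> * of_real (ta * t)))) * of_real (1 / sqrt (2 * pi)) = of_real (sqrt (2 * pi)) * ps ta"
  by (simp add: std_normal_density_def)
 then have "(LBINT t. ft ps t * exp (- (\<i> * of_real (ta * t)))) * (of_real (1 / sqrt (2 * pi)) * of_real (sqrt (2 * pi))) =
   of_real (sqrt (2 * pi)) * of_real (sqrt (2 * pi)) * ps ta"
  by (simp only: mult.assoc[symmetric]) (simp only: mult_ac)
 moreover have "of_real (1 / sqrt (2 * pi)) * of_real (sqrt (2 * pi)) = (1::complex)"
  by (simp flip: of_real_mult)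
 moreover have "complex_of_real (sqrt (2 * pi)) * complex_of_real (sqrt (2 * pi)) = of_real (2 * pi)"
  by (simp flip: of_real_mult)
 ultimately show ?thesis by (simp only: mult_1_right)
qed

text \<open>One factor of |ft ps|^2 is written as an integral, and after exchanging the integrals
  the inner one is the inversion formula. The constant 2 pi is the reason for the factor 1 / sqrt (2
  pi) in the partial Fourier transform below.\<close>

lemma ft_Plancherel:
 assumes ps: "test_fun ps"
 shows "(LBINT t. (cmod (ft ps t))^2) = 2 * pi * (LBINT ta. (cmod (ps ta))^2)"
  and "integrable lborel (\<lambda>t. (cmod (ft ps t))^2)"
proof -
 have [measurable]: "ps \<in> borel_measurable borel" using smooth_measurable[OF test_fun_smooth[OF ps]] .
 have [measurable]: "ft ps \<in> borel_measurable borel" by (rule ft_measurable[OF ps])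
 have fub: "integrable (lborel \<Otimes>\<^sub>M lborel) (\<lambda>(t, l). ft ps t * (cnj (ps l) * exp (- (\<i> * of_real (l * t)))))"
  by (rule integrable_product_bounded[OF _ _ ft_integrable[OF ps] test_fun_integrable_lborel[OF ps], where C = 1])
   (auto simp: norm_mult norm_exp_eq_Re lborel.sigma_finite_measure_axioms)
 have cn: "cnj (ft ps t) = (LBINT l. cnj (ps l) * exp (- (\<i> * of_real (l * t))))" for t
  unfolding ft_def by (simp flip: Bochner_Integration.integral_cnj add: exp_cnj)
 have sq: "complex_of_real ((cmod (ft ps t))^2) = (LBINT l. ft ps t * (cnj (ps l) * exp (- (\<i> * of_real (l * t)))))" for t
  by (simp only: complex_norm_square cn integral_mult_right_zero)
 have "integrable lborel (\<lambda>t. complex_of_real ((cmod (ft ps t))^2))"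
  unfolding sq using lborel_pair.integrable_fst'[OF fub] by simp
 then show "integrable lborel (\<lambda>t. (cmod (ft ps t))^2)" by (simp only: complex_of_real_integrable_eq)
 have "complex_of_real (LBINT t. (cmod (ft ps t))^2) = (LBINT t. LBINT l. ft ps t * (cnj (ps l) * exp (- (\<i> * of_real (l * t)))))"
  by (simp only: integral_complex_of_real[symmetric] sq)
 also have "... = (LBINT l. LBINT t. ft ps t * (cnj (ps l) * exp (- (\<i> * of_real (l * t)))))"
  by (rule lborel_pair.Fubini_integral[symmetric]) (use fub in simp)
 also have "... = (LBINT l. of_real (2 * pi * (cmod (ps l))^2))"
 proof (intro Bochner_Integration.integral_cong refl)
  fix l
  have "(LBINT t. ft ps t * (cnj (ps l) * exp (- (\<i> * of_real (l * t))))) = cnj (ps l) * (LBINT t. ft ps t * exp (- (\<i> * of_real (l * t))))"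
   by (simp flip: integral_mult_right_zero add: mult.left_commute)
  also have "... = of_real (2 * pi * (cmod (ps l))^2)"
   unfolding ft_inversion[OF ps] by (simp only: of_real_mult complex_norm_square mult_ac)
  finally show "(LBINT t. ft ps t * (cnj (ps l) * exp (- (\<i> * of_real (l * t))))) = of_real (2 * pi * (cmod (ps l))^2)" .
 qed
 also have "... = of_real (2 * pi * (LBINT ta. (cmod (ps ta))^2))"
  by (simp only: integral_complex_of_real integral_mult_right_zero)
 finally show "(LBINT t. (cmod (ft ps t))^2) = 2 * pi * (LBINT ta. (cmod (ps ta))^2)"
  by (simp only: of_real_eq_iff)
qed

text \<open>The positive and negative parts of u have the same total mass c, by the frequency 0. If
  c > 0, dividing by c and pushing forward under X gives two probability distributions with the same
  characteristic function, which coincide by Levy's theorem; if c = 0, u vanishes almost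
  everywhere.\<close>

lemma real_fourier_uniqueness:
 fixes u :: "'a => real"
 assumes u: "integrable M u" and X [measurable]: "X \<in> borel_measurable M"
  and zero: "\<And>\<eta>. (LINT x|M. of_real (u x) * iexp (\<eta> * X x)) = (0::complex)"
  and B: "B \<in> sets borel"
 shows "(LINT x|M. u x * indicator B (X x)) = 0"
proof -
 have [measurable]: "u \<in> borel_measurable M" using u by auto
 have [measurable]: "B \<in> sets borel" by fact
 define p where "p x = max (u x) 0" for x
 define q where "q x = max (- u x) 0" for x
 have [measurable]: "p \<in> borel_measurable M" "q \<in> borel_measurable M" unfolding p_def q_def by measurable
 have pq: "p x \<ge> 0" "q x \<ge> 0" "u x = p x - q x" for x by (auto simp: p_def q_def)
 have ip: "integrable M p" unfolding p_def using u by (intro integrable_max) auto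
 have iq: "integrable M q" unfolding q_def using u by (intro integrable_max) auto
 have ie: "integrable M (\<lambda>x. of_real (v x) * iexp (\<eta> * X x))" if "integrable M v" for v and \<eta>
  by (rule Bochner_Integration.integrable_bound[OF integrable_norm[OF that]])
   (use that in \<open>auto simp: norm_mult norm_exp_eq_Re\<close>)
 have eq: "(LINT x|M. of_real (p x) * iexp (\<eta> * X x)) = (LINT x|M. of_real (q x) * iexp (\<eta> * X x))" for \<eta>
  using zero[of \<eta>] ie[OF ip, of \<eta>] ie[OF iq, of \<eta>] unfolding pq(3) of_real_diff left_diff_distrib by simp
 define c where "c = (LINT x|M. p x)"
 have cq: "c = (LINT x|M. q x)"
  using eq[of 0] unfolding c_def by (simp del: integral_complex_of_real add: integral_complex_of_real)
 have c0: "c \<ge> 0" unfolding c_def using pq by (intro Bochner_Integration.integral_nonneg) auto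
 have iB: "integrable M (\<lambda>x. v x * indicator B (X x))" if "integrable M v" for v :: "'a => real"
  by (rule Bochner_Integration.integrable_bound[OF that]) (use that in \<open>auto simp: indicator_def\<close>)
 show ?thesis
 proof (cases "c = 0")
  case True
  have "AE x in M. p x = 0" using integral_nonneg_eq_0_iff_AE[OF ip] pq True by (auto simp: c_def)
  moreover have "AE x in M. q x = 0" using integral_nonneg_eq_0_iff_AE[OF iq] pq True by (auto simp: cq)
  ultimately have "AE x in M. u x * indicator B (X x) = 0" by eventually_elim (simp add: pq)
  then show ?thesis by (subst integral_cong_AE[where g = "\<lambda>_. 0"]) auto
 next
  case False
  then have c: "c > 0" using c0 by simp
  define D where "D v = distr (density M (\<lambda>x. ennreal (v x / c))) borel X" for v :: "'a => real"
  have D: "real_distribution (D v)" "char (D v) \<eta> = (LINT x|M. of_real (v x) * iexp (\<eta> * X x)) / of_real c"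
    "measure (D v) B = (LINT x|M. v x * indicator B (X x)) / c"
   if v: "integrable M v" "\<And>x. v x \<ge> 0" "(LINT x|M. v x) = c" for v \<eta>
  proof -
   have [measurable]: "v \<in> borel_measurable M" using v by auto
    have "emeasure (density M (\<lambda>x. ennreal (v x / c))) (space M) = (\<integral>\<^sup>+x. ennreal (v x / c) \<partial>M)"
    by (subst emeasure_density) (auto intro!: nn_integral_cong simp: indicator_def)
   also have "... = ennreal (LINT x|M. v x / c)" using v c by (intro nn_integral_eq_integral) auto
   finally have "prob_space (density M (\<lambda>x. ennreal (v x / c)))"
    using v c by (intro prob_spaceI) simp
   then interpret d: prob_space "density M (\<lambda>x. ennreal (v x / c))" .
   have "prob_space (D v)" unfolding D_def by (rule d.prob_space_distr) auto
   then show "real_distribution (D v)"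
    by (simp add: real_distribution_def real_distribution_axioms_def D_def)
   have "char (D v) \<eta> = (LINT x|M. (v x / c) *\<^sub>R iexp (\<eta> * X x))"
    unfolding char_def D_def using v c by (subst integral_distr) (auto simp: integral_density)
   also have "... = (LINT x|M. of_real (v x) * iexp (\<eta> * X x) / of_real c)"
    by (intro Bochner_Integration.integral_cong) (auto simp: scaleR_conv_of_real)
   finally show "char (D v) \<eta> = (LINT x|M. of_real (v x) * iexp (\<eta> * X x)) / of_real c" by simp
   have "measure (D v) B = (LINT x|D v. indicator B x)" by (simp add: D_def)
   also have "... = (LINT x|M. (v x / c) *\<^sub>R indicator B (X x))"
    unfolding D_def using v c by (subst integral_distr) (auto simp: integral_density)
   finally show "measure (D v) B = (LINT x|M. v x * indicator B (X x)) / c" by simp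
  qed
  have "D p = D q"
   by (rule Levy_uniqueness) (use D(1) D(2)[OF ip] D(2)[OF iq] ip iq pq eq c_def cq in auto)
  then have "(LINT x|M. p x * indicator B (X x)) = (LINT x|M. q x * indicator B (X x))"
   using D(3)[OF ip] D(3)[OF iq] pq c_def cq c by simp
  then show ?thesis using iB[OF ip] iB[OF iq] by (simp add: pq(3) left_diff_distrib)
 qed
qed

text \<open>The hypothesis at the frequency -eta, conjugated, is the hypothesis for the conjugate of
  w, so it passes to the real and imaginary parts.\<close>

lemma fourier_uniqueness:
 fixes w :: "'a => complex"
 assumes w: "integrable M w" and X: "X \<in> borel_measurable M"
  and zero: "\<And>\<eta>. (LINT x|M. w x * iexp (\<eta> * X x)) = 0"
  and B [measurable]: "B \<in> sets borel"
 shows "(LINT x|M. w x * indicator B (X x)) = 0"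
proof -
 have [measurable]: "w \<in> borel_measurable M" "X \<in> borel_measurable M" using w X by auto
 have ie: "integrable M (\<lambda>x. v x * iexp (\<eta> * X x))" if "integrable M v" for v and \<eta>
  by (rule Bochner_Integration.integrable_bound[OF integrable_norm[OF that]])
   (use that in \<open>auto simp: norm_mult norm_exp_eq_Re\<close>)
 have zero': "(LINT x|M. cnj (w x) * iexp (\<eta> * X x)) = 0" for \<eta>
 proof -
  have "(LINT x|M. cnj (w x) * iexp (\<eta> * X x)) = cnj (LINT x|M. w x * iexp (- \<eta> * X x))"
   by (simp flip: Bochner_Integration.integral_cnj add: exp_cnj)
  then show ?thesis using zero[of "-\<eta>"] by simp
 qed
 have wc: "integrable M (\<lambda>x. cnj (w x))" using w by simp
 have zr: "(LINT x|M. complex_of_real (Re (w x)) * iexp (\<eta> * X x)) = 0" for \<eta>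
 proof -
  have "(\<lambda>x. complex_of_real (Re (w x)) * iexp (\<eta> * X x)) =
    (\<lambda>x. (w x * iexp (\<eta> * X x) + cnj (w x) * iexp (\<eta> * X x)) / 2)"
   by (simp flip: distrib_right add: complex_add_cnj)
  then show ?thesis using ie[OF w] ie[OF wc] zero zero' by simp
 qed
 have zi: "(LINT x|M. complex_of_real (Im (w x)) * iexp (\<eta> * X x)) = 0" for \<eta>
 proof -
  have "(\<lambda>x. complex_of_real (Im (w x)) * iexp (\<eta> * X x)) =
    (\<lambda>x. (w x * iexp (\<eta> * X x) - cnj (w x) * iexp (\<eta> * X x)) / (2 * \<i>))"
  proof (rule ext)
   fix x
   have "complex_of_real (Im (w x)) = (w x - cnj (w x)) / (2 * \<i>)" by (simp add: complex_eq_iff)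
   then show "complex_of_real (Im (w x)) * iexp (\<eta> * X x) =
    (w x * iexp (\<eta> * X x) - cnj (w x) * iexp (\<eta> * X x)) / (2 * \<i>)"
    by (simp only: left_diff_distrib times_divide_eq_left)
  qed
  then show ?thesis using ie[OF w] ie[OF wc] zero zero' by simp
 qed
 have iw: "integrable M (\<lambda>x. w x * indicator B (X x))"
  by (rule Bochner_Integration.integrable_bound[OF w]) (auto simp: indicator_def)
 have "Re (LINT x|M. w x * indicator B (X x)) = (LINT x|M. Re (w x) * indicator B (X x))"
  using integral_Re[OF iw, symmetric]
  by (simp add: indicator_def of_bool_def if_distrib cong: if_cong)
 moreover have "Im (LINT x|M. w x * indicator B (X x)) = (LINT x|M. Im (w x) * indicator B (X x))"
  using integral_Im[OF iw, symmetric]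
  by (simp add: indicator_def of_bool_def if_distrib cong: if_cong)
 ultimately show ?thesis
  using real_fourier_uniqueness[OF _ X zr B] real_fourier_uniqueness[OF _ X zi B] w
  by (intro complex_eqI) auto
qed

subsection \<open>Laguerre polynomials, radial integration and unitary maps\<close>

text \<open>\<open>lag n j\<close> is the confluent hypergeometric polynomial 1F1(-j; n; x), that
  is, the Laguerre polynomial of degree j and type n - 1 normalised to the value 1 at 0.\<close>

definition lagc :: "nat => nat => nat => real" where
 "lagc n j m = pochhammer (- real j) m / (fact m * pochhammer (real n) m)"

definition lag :: "nat => nat => real => real" where
 "lag n j x = (\<Sum>m\<le>j. lagc n j m * x ^ m)"

lemma lagc_0 [simp]: "lagc n j 0 = 1"
 by (simp add: lagc_def)

lemma lagc_eq_0: "m > j ==> lagc n j m = 0"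
 by (simp add: lagc_def pochhammer_of_nat_eq_0_lemma)

lemma lagc_nonzero: "n > 0 ==> m \<le> j ==> lagc n j m \<noteq> 0"
 using pochhammer_of_nat_eq_0_lemma'[of m j, where 'a = real] pochhammer_pos[of "real n" m]
 by (simp add: lagc_def)

lemma lag_sums: "(\<lambda>m. lagc n j m * x ^ m) sums lag n j x"
 unfolding lag_def by (rule sums_finite) (auto simp: lagc_eq_0 not_le)

lemma lag_measurable [measurable]: "lag n j \<in> borel_measurable borel"
 unfolding lag_def[abs_def] by measurable

text \<open>\<open>pochhammer (- real m) k\<close> is (-1)^k m! / (m - k)! for m >= k and 0 for m <
  k, so the series is an exponential series shifted by k.\<close>

lemma pochhammer_minus_nat_sums:
 "(\<lambda>m. x ^ m / fact m * pochhammer (- real m) k) sums ((- x) ^ k * exp x)"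
proof -
 have "(\<lambda>m. (- x) ^ k * (x ^ m /\<^sub>R fact m)) sums ((- x) ^ k * exp x)"
  by (intro sums_mult exp_converges)
 moreover have "x ^ (m + k) / fact (m + k) * pochhammer (- real (m + k)) k = (- x) ^ k * (x ^ m /\<^sub>R fact m)" for m
 proof -
  have "pochhammer (- real (m + k)) k = (-1) ^ k * (fact (m + k) / fact m)"
  proof -
   have "fact (m + k) = (fact m * pochhammer (real m + 1) k :: real)"
    using pochhammer_product'[of "1::real" m k] by (simp add: pochhammer_fact add.commute)
   then show ?thesis unfolding pochhammer_minus by simp
  qed
  then show ?thesis
   by (simp add: power_add divide_inverse power_minus[of x] mult_ac)
 qed
 ultimately have "(\<lambda>m. x ^ (m + k) / fact (m + k) * pochhammer (- real (m + k)) k) sums ((- x) ^ k * exp x)" by simp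
 then show ?thesis
  by (subst (asm) sums_zero_iff_shift) (auto simp: pochhammer_of_nat_eq_0_lemma)
qed

text \<open>Kummer's transformation 1F1(n + j; n; x) = exp x * 1F1(-j; n; -x). The Vandermonde
  identity expands the quotient of Pochhammer symbols into terms of the preceding series. It sums
  the spherical series for negative central frequency, where the series does not terminate.\<close>

lemma Kummer_sums:
 assumes "n > 0"
 shows "(\<lambda>m. x ^ m / fact m * (pochhammer (real n + real j) m / pochhammer (real n) m)) sums (exp x * lag n j (- x))"
proof -
 have V: "pochhammer (real n + real j) m / pochhammer (real n) m = (\<Sum>k\<le>j. lagc n j k * pochhammer (- real m) k)" for m
 proof -
  have "(\<Sum>k\<in>{0..m}. pochhammer (- real j) k * pochhammer (- real m) k / (of_nat (fact k) * pochhammer (real n) k)) =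
    pochhammer (real n - - real j) m / pochhammer (real n) m"
   by (rule Vandermonde_pochhammer) (use assms in auto)
  then have "pochhammer (real n + real j) m / pochhammer (real n) m = (\<Sum>k\<le>m. lagc n j k * pochhammer (- real m) k)"
   by (simp add: lagc_def atMost_atLeast0 mult_ac)
  also have "... = (\<Sum>k\<le>m + j. lagc n j k * pochhammer (- real m) k)"
   by (rule sum.mono_neutral_left) (auto simp: pochhammer_of_nat_eq_0_lemma not_le)
  also have "... = (\<Sum>k\<le>j. lagc n j k * pochhammer (- real m) k)"
   by (rule sum.mono_neutral_right) (auto simp: lagc_eq_0 not_le)
  finally show ?thesis .
 qed
 have "(\<lambda>m. \<Sum>k\<le>j. lagc n j k * (x ^ m / fact m * pochhammer (- real m) k)) sums (\<Sum>k\<le>j. lagc n j k * ((- x) ^ k * exp x))"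
  by (intro sums_sum sums_mult pochhammer_minus_nat_sums)
 then show ?thesis
  unfolding V by (simp add: lag_def sum_distrib_left mult_ac)
qed

text \<open>On branch j the product over d is (2 ta)^m times \<open>pochhammer (- j) m\<close> for
  ta > 0, so that the series is a Laguerre polynomial, and (2 ta)^m times
  \<open>pochhammer (n + j) m\<close> for ta < 0, where Kummer's transformation gives the same
  polynomial in the absolute value of ta.\<close>

lemma spherical_fan:
 fixes x :: "'n::finite heis"
 assumes "ta \<noteq> 0"
 shows "spherical (of_real (\<bar>ta\<bar> * real (2 * j + CARD('n)))) (of_real ta) x =
  iexp (ta * snd x) *
  of_real (exp (- (\<bar>ta\<bar> * (norm (fst x))^2 / 4)) * lag CARD('n) j (\<bar>ta\<bar> * (norm (fst x))^2 / 2))"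
proof -
 define n where "n = CARD('n)"
 have n: "n > 0" by (simp add: n_def)
 define r where "r = norm (fst x)"
 define \<xi> where "\<xi> = \<bar>ta\<bar> * real (2 * j + n)"
 define y where "y = \<bar>ta\<bar> * r^2 / 2"
 define G where "G m = r ^ (2 * m) / (pochhammer (real n) m * fact m * 4 ^ m) * (\<Prod>d<m. ta * real (2 * d + n) - \<xi>)" for m
 \<comment> \<open>For negative \<open>ta\<close> the extra factor exp (- y) turns the growing
   prefactor exp (- ta * r^2 / 4) into the decaying exp (- |ta| * r^2 / 4).\<close>
 define S where "S = (if ta > 0 then lag n j y else exp (- y) * lag n j y)"
 have pm: "(\<Prod>d<m. c * (a + real d)) = c ^ m * pochhammer a m" for c a :: real and m
  by (simp add: pochhammer_prod prod.distrib atLeast0LessThan)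
 have rm: "r ^ (2 * m) = (r^2) ^ m" for m by (simp add: power_mult)
 have "G sums S"
 proof (cases "ta > 0")
  case True
  have "G m = lagc n j m * y ^ m" for m
  proof -
   have "(\<Prod>d<m. ta * real (2 * d + n) - \<xi>) = (\<Prod>d<m. (2 * ta) * (- real j + real d))"
    using True by (intro prod.cong) (auto simp: \<xi>_def algebra_simps)
   then have "G m = (r^2) ^ m * (2 * ta) ^ m / 4 ^ m * lagc n j m"
    unfolding G_def pm rm lagc_def by (simp add: mult_ac)
   also have "(r^2) ^ m * (2 * ta) ^ m / 4 ^ m = y ^ m"
   proof -
    have "r^2 * (2 * ta) / 4 = y" using True by (simp add: y_def)
    then show ?thesis by (simp only: power_mult_distrib[symmetric] power_divide[symmetric])
   qed
   finally show ?thesis by simp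
  qed
  then have "G = (\<lambda>m. lagc n j m * y ^ m)" by (intro ext)
  then show ?thesis using True lag_sums[of n j y] by (simp add: S_def)
 next
  case False
  with assms have neg: "ta < 0" by simp
  have "G m = (- y) ^ m / fact m * (pochhammer (real n + real j) m / pochhammer (real n) m)" for m
  proof -
   have "(\<Prod>d<m. ta * real (2 * d + n) - \<xi>) = (\<Prod>d<m. (2 * ta) * ((real n + real j) + real d))"
    using neg by (intro prod.cong) (auto simp: \<xi>_def algebra_simps)
   then have "G m = (r^2) ^ m * (2 * ta) ^ m / 4 ^ m / fact m * (pochhammer (real n + real j) m / pochhammer (real n) m)"
    unfolding G_def pm rm by (simp add: mult_ac)
   also have "(r^2) ^ m * (2 * ta) ^ m / 4 ^ m = (- y) ^ m"
   proof -
    have "r^2 * (2 * ta) / 4 = - y" using neg by (simp add: y_def)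
    then show ?thesis by (simp only: power_mult_distrib[symmetric] power_divide[symmetric])
   qed
   finally show ?thesis by simp
  qed
  then have "G = (\<lambda>m. (- y) ^ m / fact m * (pochhammer (real n + real j) m / pochhammer (real n) m))" by (intro ext)
  then show ?thesis using False Kummer_sums[OF n, of "- y" j] by (simp add: S_def)
 qed
 then have Gs: "(\<lambda>m. complex_of_real (G m)) sums of_real S" by (rule sums_of_real)
 have G0: "G 0 = 1" by (simp add: G_def)
 have c: "of_real (r ^ (2 * m)) / (pochhammer (of_nat n) m * fact m * 4 ^ m) *
   (\<Prod>d<m. complex_of_real ta * of_nat (2 * d + n) - of_real \<xi>) = complex_of_real (G m)" for m
 proof -
  have "pochhammer (of_nat n) m = complex_of_real (pochhammer (real n) m)"
   by (metis of_real_of_nat_eq pochhammer_of_real)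
  then show ?thesis by (simp add: G_def)
 qed
 have "(\<Sum>k. complex_of_real (G (Suc k))) = of_real S - of_real (G 0)"
  using suminf_split_head[OF sums_summable[OF Gs]] sums_unique[OF Gs] by simp
 then have "spherical (of_real \<xi>) (of_real ta) x =
   exp (\<i> * of_real ta * of_real (snd x)) * (exp (- of_real ta * of_real (r^2) / 4) * of_real S)"
  unfolding spherical_def Let_def n_def[symmetric] r_def[symmetric] c G0 by simp
 also have "exp (- of_real ta * of_real (r^2) / 4) * complex_of_real S = of_real (exp (- (\<bar>ta\<bar> * r^2 / 4)) * lag n j y)"
 proof -
  have "exp (- complex_of_real ta * of_real (r^2) / 4) = of_real (exp (- ta * r^2 / 4))"
   by (simp add: exp_of_real flip: of_real_mult of_real_minus of_real_divide) (simp add: exp_of_real[symmetric])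
  moreover have "exp (- ta * r^2 / 4) * S = exp (- (\<bar>ta\<bar> * r^2 / 4)) * lag n j y"
  proof (cases "ta > 0")
   case False
   have "exp (- ta * r^2 / 4) * exp (- y) = exp (- (\<bar>ta\<bar> * r^2 / 4))"
    unfolding exp_add[symmetric] using False by (simp add: y_def field_simps)
   then show ?thesis using False by (simp add: S_def mult.assoc[symmetric])
  qed (simp add: S_def)
  ultimately show ?thesis by (metis of_real_mult)
 qed
 finally show ?thesis
  by (simp add: \<xi>_def n_def y_def r_def mult.assoc)
qed

lemma lag_moment:
 "has_bochner_integral lborel (\<lambda>x. x ^ k * lag n j x * exp (- x) * indicator {0..} x)
  (\<Sum>m\<le>j. lagc n j m * fact (k + m))"
proof -
 have "has_bochner_integral lborel (\<lambda>x::real. \<Sum>m\<le>j. lagc n j m * (x ^ (k + m) * exp (- x) * indicator {0..} x))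
   (\<Sum>m\<le>j. lagc n j m * fact (k + m))"
  by (intro has_bochner_integral_sum has_bochner_integral_mult_right has_bochner_integral_I0i_power_exp_m')
 then show ?thesis
  by (simp add: lag_def power_add sum_distrib_left sum_distrib_right mult_ac)
qed

text \<open>Chu-Vandermonde summation. The factor \<open>pochhammer (- real k) j\<close> vanishes
  for k < j: this is the orthogonality of the Laguerre polynomial to all lower powers.\<close>

lemma lag_moment_value:
 assumes "n > 0"
 shows "(\<Sum>m\<le>j. lagc n j m * fact (n - 1 + k + m)) =
  fact (n - 1 + k) * pochhammer (- real k) j / pochhammer (real n) j"
proof -
 have f: "fact (n - 1 + k + m) = (fact (n - 1 + k) * pochhammer (real n + real k) m :: real)" for m
  using pochhammer_product'[of "1::real" "n - 1 + k" m] assms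
  by (simp add: pochhammer_fact of_nat_diff algebra_simps)
 have "(\<Sum>m\<in>{0..j}. pochhammer (real n + real k) m * pochhammer (- real j) m / (of_nat (fact m) * pochhammer (real n) m)) =
   pochhammer (real n - (real n + real k)) j / pochhammer (real n) j"
  by (rule Vandermonde_pochhammer) (use assms in auto)
 then have "(\<Sum>m\<le>j. lagc n j m * pochhammer (real n + real k) m) = pochhammer (- real k) j / pochhammer (real n) j"
  by (simp add: lagc_def atMost_atLeast0 mult_ac)
 then show ?thesis unfolding f
  by (simp add: sum_distrib_left[symmetric] mult.left_commute[of _ "fact _"])
qed

text \<open>Only the polynomial of lower degree i is expanded; of its powers at most the one with k
  = j has a nonzero moment.\<close>

lemma lag_orthogonal_le:
 assumes n: "n > 0" and ij: "i \<le> j"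
 shows "has_bochner_integral lborel (\<lambda>x. x ^ (n - 1) * (lag n i x * lag n j x * exp (- x)) * indicator {0..} x)
  (if i = j then fact (n - 1) / real ((j + n - 1) choose j) else 0)"
proof -
 have "has_bochner_integral lborel
   (\<lambda>x. \<Sum>k\<le>i. lagc n i k * (x ^ (n - 1 + k) * lag n j x * exp (- x) * indicator {0..} x))
   (\<Sum>k\<le>i. lagc n i k * (fact (n - 1 + k) * pochhammer (- real k) j / pochhammer (real n) j))"
  unfolding lag_moment_value[OF n, symmetric]
  by (intro has_bochner_integral_sum has_bochner_integral_mult_right lag_moment)
 moreover have "(\<Sum>k\<le>i. lagc n i k * (fact (n - 1 + k) * pochhammer (- real k) j / pochhammer (real n) j)) =
   (if i = j then fact (n - 1) / real ((j + n - 1) choose j) else 0)"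
 proof (cases "i = j")
  case False
  then have "pochhammer (- real k) j = 0" if "k \<le> i" for k
   using that ij by (intro pochhammer_of_nat_eq_0_lemma) auto
  then show ?thesis using False by simp
 next
  case True
  have "(\<Sum>k\<le>j. lagc n j k * (fact (n - 1 + k) * pochhammer (- real k) j / pochhammer (real n) j)) =
    (\<Sum>k\<in>{j}. lagc n j k * (fact (n - 1 + k) * pochhammer (- real k) j / pochhammer (real n) j))"
   by (rule sum.mono_neutral_right) (auto simp: pochhammer_of_nat_eq_0_lemma)
  also have "... = lagc n j j * (fact (n - 1 + j) * ((-1) ^ j * fact j) / pochhammer (real n) j)"
   by (simp add: pochhammer_same)
  also have "... = fact (n - 1 + j) * fact j / (pochhammer (real n) j)^2"
   by (cases "even j") (simp_all add: lagc_def pochhammer_same power2_eq_square)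
  also have "fact (n - 1 + j) = (fact (n - 1) * pochhammer (real n) j :: real)"
   using pochhammer_product'[of "1::real" "n - 1" j] n by (simp add: pochhammer_fact of_nat_diff)
  also have "fact (n - 1) * pochhammer (real n) j * fact j / (pochhammer (real n) j)^2 = fact (n - 1) / (pochhammer (real n) j / fact j)"
   using pochhammer_pos[of "real n" j] n by (simp add: power2_eq_square)
  also have "pochhammer (real n) j / fact j = real ((j + n - 1) choose j)"
   unfolding binomial_gbinomial gbinomial_pochhammer' using n by (simp add: of_nat_diff)
  finally show ?thesis using True by simp
 qed
 ultimately show ?thesis
  by (simp add: lag_def[of n i] power_add sum_distrib_left sum_distrib_right mult_ac)
qed

lemma lag_orthogonal:
 assumes n: "n > 0"
 shows "has_bochner_integral lborel (\<lambda>x. x ^ (n - 1) * (lag n i x * lag n j x * exp (- x)) * indicator {0..} x)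
  (if i = j then fact (n - 1) / real ((j + n - 1) choose j) else 0)"
 using lag_orthogonal_le[OF n, of i j] lag_orthogonal_le[OF n, of j i]
 by (cases "i \<le> j") (auto simp: mult_ac)

text \<open>Both measures give the half line up to a the volume pi^n a^n / n! of the ball of radius
  sqrt a in real dimension 2n; half lines are a generator stable under intersection.\<close>

lemma distr_norm_sq:
 "distr lborel borel (\<lambda>z::complex ^ 'n::finite. (norm z)^2) =
  density lborel (\<lambda>x. ennreal (pi ^ CARD('n) / fact (CARD('n) - 1) * x ^ (CARD('n) - 1)) * indicator {0..} x)"
proof -
 define n where "n = CARD('n)"
 have n: "n > 0" by (simp add: n_def)
 define g where "g x = ennreal (pi ^ n / fact (n - 1) * x ^ (n - 1)) * indicator {0..} x" for x :: real
 have [measurable]: "g \<in> borel_measurable borel" unfolding g_def by measurable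
 define c where "c = pi ^ n / fact n"
 have M: "emeasure (distr lborel borel (\<lambda>z::complex ^ 'n. (norm z)^2)) {..a} = (if a \<ge> 0 then ennreal (c * a ^ n) else 0)" for a
 proof -
  have "(\<lambda>z::complex ^ 'n. (norm z)^2) -` {..a} = (if a \<ge> 0 then cball 0 (sqrt a) else {})"
  proof (cases "a \<ge> 0")
   case True
   have "(norm z)^2 \<le> a \<longleftrightarrow> norm z \<le> sqrt a" for z :: "complex ^ 'n"
    using True by (metis norm_ge_zero real_le_rsqrt real_sqrt_le_iff real_sqrt_pow2 power_mono)
   then show ?thesis using True by auto
  next
   case False
   then have "\<not> (norm z)^2 \<le> a" for z :: "complex ^ 'n" using zero_le_power2[of "norm z"] by linarith
   then show ?thesis using False by auto
  qed
  then have "emeasure (distr lborel borel (\<lambda>z::complex ^ 'n. (norm z)^2)) {..a} =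
    (if a \<ge> 0 then emeasure lborel (cball (0::complex ^ 'n) (sqrt a)) else 0)"
   by (subst emeasure_distr) auto
  moreover have "emeasure lborel (cball (0::complex ^ 'n) (sqrt a)) = ennreal (c * a ^ n)" if "a \<ge> 0"
  proof -
   have d: "DIM(complex ^ 'n) = 2 * n" by (simp add: n_def)
   have "sqrt a ^ (2 * n) = a ^ n" using that by (simp add: power_mult)
   moreover have "emeasure lborel (cball (0::complex ^ 'n) (sqrt a)) =
     ennreal (unit_ball_vol (real DIM(complex ^ 'n)) * sqrt a ^ DIM(complex ^ 'n))"
    using that by (intro emeasure_cball) simp
   ultimately show ?thesis by (simp only: d unit_ball_vol_even c_def)
  qed
  ultimately show ?thesis by simp
 qed
 have N: "emeasure (density lborel g) {..a} = (if a \<ge> 0 then ennreal (c * a ^ n) else 0)" for a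
 proof (cases "a \<ge> 0")
  case True
  have "emeasure (density lborel g) {..a} = (\<integral>\<^sup>+x. ennreal (pi ^ n / fact (n - 1) * x ^ (n - 1)) * indicator {0..a} x \<partial>lborel)"
   by (subst emeasure_density) (auto simp: g_def indicator_def intro!: nn_integral_cong)
  also have "... = ennreal (c * a ^ n - c * 0 ^ n)"
  proof (rule nn_integral_FTC_Icc)
   fix x :: real
   have "pi ^ n / fact (n - 1) = c * real n" unfolding c_def using n by (simp add: fact_reduce[of n])
   then show "((\<lambda>x. c * x ^ n) has_field_derivative pi ^ n / fact (n - 1) * x ^ (n - 1)) (at x)"
    by (auto intro!: derivative_eq_intros)
  qed (use True in auto)
  finally show ?thesis using True n by (simp add: zero_power)
 next
  case False
  then have "g x * indicator {..a} x = 0" for x by (auto simp: g_def indicator_def)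
  moreover have "emeasure (density lborel g) {..a} = (\<integral>\<^sup>+x. g x * indicator {..a} x \<partial>lborel)"
   by (rule emeasure_density) auto
  ultimately have "emeasure (density lborel g) {..a} = 0" by (simp only:) simp
  then show ?thesis using False by simp
 qed
 have "distr lborel borel (\<lambda>z::complex ^ 'n. (norm z)^2) = density lborel g"
 proof (rule measure_eqI_generator_eq[where E = "range atMost" and \<Omega> = UNIV and A = "\<lambda>i. {..real i}"])
  show "Int_stable (range (atMost :: real => real set))"
   by (auto simp: Int_stable_def)
  show "sets (distr lborel borel (\<lambda>z::complex ^ 'n. (norm z)^2)) = sigma_sets UNIV (range atMost)"
   by (simp add: borel_eq_atMost) 
  show "sets (density lborel g) = sigma_sets UNIV (range atMost)"
   by (simp add: borel_eq_atMost) 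
  show "(\<Union>i. {..real i}) = (UNIV :: real set)" using real_arch_simple by auto
 qed (auto simp: M N)
 then show ?thesis unfolding g_def n_def .
qed

lemma radial_integral:
 fixes g :: "real => real"
 assumes [measurable]: "g \<in> borel_measurable borel"
  and I: "has_bochner_integral lborel (\<lambda>x. x ^ (CARD('n) - 1) * g x * indicator {0..} x) I"
 shows "has_bochner_integral lborel (\<lambda>z::complex ^ 'n::finite. g ((norm z)^2)) (pi ^ CARD('n) / fact (CARD('n) - 1) * I)"
proof -
 define n where "n = CARD('n)"
 define k where "k x = pi ^ n / fact (n - 1) * x ^ (n - 1) * indicator {0..} x" for x :: real
 have [measurable]: "k \<in> borel_measurable borel" unfolding k_def by measurable
 have k0: "k x \<ge> 0" for x by (auto simp: k_def indicator_def)
 have D: "distr lborel borel (\<lambda>z::complex ^ 'n. (norm z)^2) = density lborel (\<lambda>x. ennreal (k x))"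
  unfolding distr_norm_sq n_def[symmetric] 
  by (rule density_cong) (auto simp: k_def indicator_def)
 have "has_bochner_integral lborel (\<lambda>x. pi ^ n / fact (n - 1) * (x ^ (n - 1) * g x * indicator {0..} x)) (pi ^ n / fact (n - 1) * I)"
  using I unfolding n_def by (rule has_bochner_integral_mult_right)
 also have "(\<lambda>x. pi ^ n / fact (n - 1) * (x ^ (n - 1) * g x * indicator {0..} x)) = (\<lambda>x. k x *\<^sub>R g x)"
  by (auto simp: k_def mult_ac)
 finally have "has_bochner_integral (density lborel (\<lambda>x. ennreal (k x))) g (pi ^ n / fact (n - 1) * I)"
  by (intro has_bochner_integral_density) (auto simp: k0)
 then have "has_bochner_integral (distr lborel borel (\<lambda>z::complex ^ 'n. (norm z)^2)) g (pi ^ n / fact (n - 1) * I)"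
  unfolding D .
 then show ?thesis unfolding n_def
  by (auto simp: has_bochner_integral_iff integrable_distr_eq integral_distr)
qed

text \<open>The scale is a = |ta|. The squared norm is, up to powers of 2 pi, the inverse of the
  Plancherel weight binomial * |ta|^n, and therefore cancels against it in the transform of a
  packet.\<close>

lemma lag_orthogonal_space:
 assumes a: "a > 0"
 shows "has_bochner_integral lborel (\<lambda>z::complex ^ 'n::finite.
   (exp (- (a * (norm z)^2 / 4)) * lag CARD('n) i (a * (norm z)^2 / 2)) *
   (exp (- (a * (norm z)^2 / 4)) * lag CARD('n) j (a * (norm z)^2 / 2)))
  (if i = j then (2 * pi / a) ^ CARD('n) / real ((j + CARD('n) - 1) choose j) else 0)"
proof -
 define n where "n = CARD('n)"
 have n: "n > 0" by (simp add: n_def)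
 define g where "g x = (exp (- (a * x / 4)) * lag n i (a * x / 2)) * (exp (- (a * x / 4)) * lag n j (a * x / 2))" for x
 define v where "v = (if i = j then fact (n - 1) / real ((j + n - 1) choose j) else 0)"
 define h where "h x = x ^ (n - 1) * (lag n i x * lag n j x * exp (- x)) * indicator {0..} x" for x :: real
 have ge: "g x = lag n i (a / 2 * x) * lag n j (a / 2 * x) * exp (- (a / 2 * x))" for x
 proof -
  have "exp (- (a * x / 4)) * exp (- (a * x / 4)) = exp (- (a / 2 * x))"
   unfolding exp_add[symmetric] by (simp add: field_simps)
  then show ?thesis unfolding g_def by (simp add: mult_ac)
 qed
 have "has_bochner_integral lborel h v" unfolding h_def v_def by (rule lag_orthogonal[OF n])
 then have "has_bochner_integral lborel (\<lambda>x. h (0 + a / 2 * x)) (v /\<^sub>R \<bar>a / 2\<bar>)"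
  using a by (subst (asm) lborel_has_bochner_integral_real_affine_iff[where c = "a / 2" and t = 0]) auto
 then have "has_bochner_integral lborel (\<lambda>x. (2 / a) ^ (n - 1) * h (0 + a / 2 * x)) ((2 / a) ^ (n - 1) * (v /\<^sub>R \<bar>a / 2\<bar>))"
  by (rule has_bochner_integral_mult_right)
 moreover have "(2 / a) ^ (n - 1) * h (0 + a / 2 * x) = x ^ (n - 1) * g x * indicator {0..} x" for x
 proof -
  have "(2 / a) ^ (n - 1) * (a / 2 * x) ^ (n - 1) = x ^ (n - 1)"
   using a by (subst power_mult_distrib[symmetric]) simp
  moreover have "(indicator {0..} (a / 2 * x) :: real) = indicator {0..} x"
   using a by (auto simp: indicator_def zero_le_mult_iff)
  ultimately show ?thesis unfolding h_def ge by (simp only: add_0_left mult.assoc[symmetric])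
 qed
 moreover have "(2 / a) ^ (n - 1) * (v /\<^sub>R \<bar>a / 2\<bar>) = (2 / a) ^ n * v"
  using a n by (simp add: power_eq_if[of _ n] field_simps)
 ultimately have *: "has_bochner_integral lborel (\<lambda>x. x ^ (n - 1) * g x * indicator {0..} x) ((2 / a) ^ n * v)"
  by simp
 have gm: "g \<in> borel_measurable borel" unfolding g_def by measurable
 have "has_bochner_integral lborel (\<lambda>z::complex ^ 'n. g ((norm z)^2)) (pi ^ n / fact (n - 1) * ((2 / a) ^ n * v))"
  unfolding n_def by (rule radial_integral[OF gm]) (use * in \<open>simp add: n_def\<close>)
 moreover have "pi ^ n / fact (n - 1) * ((2 / a) ^ n * v) = (if i = j then (2 * pi / a) ^ n / real ((j + n - 1) choose j) else 0)"
  by (simp add: v_def power_divide power_mult_distrib mult_ac)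
 ultimately show ?thesis unfolding g_def n_def by simp
qed

lemma integrable_norm_power_gaussian:
 assumes b: "b > 0"
 shows "integrable lborel (\<lambda>z::complex ^ 'n::finite. ((norm z)^2) ^ m * exp (- (b * (norm z)^2)))"
proof -
 have "has_bochner_integral lborel (\<lambda>x. (0 + b * x) ^ (CARD('n) - 1 + m) * exp (- (0 + b * x)) * indicator {0..} (0 + b * x)) (fact (CARD('n) - 1 + m) /\<^sub>R \<bar>b\<bar>)"
  using b lborel_has_bochner_integral_real_affine_iff[where c = b and t = 0] has_bochner_integral_I0i_power_exp_m'[of "CARD('n) - 1 + m"]
  by fastforce
 then have "has_bochner_integral lborel (\<lambda>x. (1 / b) ^ (CARD('n) - 1 + m) * ((0 + b * x) ^ (CARD('n) - 1 + m) * exp (- (0 + b * x)) * indicator {0..} (0 + b * x)))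
   ((1 / b) ^ (CARD('n) - 1 + m) * (fact (CARD('n) - 1 + m) /\<^sub>R \<bar>b\<bar>))"
  by (rule has_bochner_integral_mult_right)
 moreover have "(1 / b) ^ (CARD('n) - 1 + m) * ((0 + b * x) ^ (CARD('n) - 1 + m) * exp (- (0 + b * x)) * indicator {0..} (0 + b * x)) =
   x ^ (CARD('n) - 1) * (x ^ m * exp (- (b * x))) * indicator {0..} x" for x :: real
 proof -
  have "(1 / b) ^ (CARD('n) - 1 + m) * (b * x) ^ (CARD('n) - 1 + m) = x ^ (CARD('n) - 1 + m)"
   using b by (subst power_mult_distrib[symmetric]) simp
  moreover have "(indicator {0..} (b * x) :: real) = indicator {0..} x"
   using b by (auto simp: indicator_def zero_le_mult_iff)
  ultimately show ?thesis by (simp only: add_0_left mult.assoc[symmetric] power_add)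
 qed
 ultimately have "has_bochner_integral lborel (\<lambda>x. x ^ (CARD('n) - 1) * (x ^ m * exp (- (b * x))) * indicator {0..} x)
   ((1 / b) ^ (CARD('n) - 1 + m) * (fact (CARD('n) - 1 + m) /\<^sub>R \<bar>b\<bar>))" by (simp only:)
 from radial_integral[OF _ this] show ?thesis by (auto simp: has_bochner_integral_iff)
qed

section \<open>Unitary maps and invariance of Lebesgue measure\<close>

definition rot :: "complex ^ 'n ^ 'n => 'n::finite heis => 'n heis" where
 "rot k x = (k *v fst x, snd x)"

definition adj :: "complex ^ 'n ^ 'n => complex ^ 'n ^ 'n" where
 "adj k = (\<chi> i j. cnj (k $ j $ i))"

lemma adj_mult: "unitary k ==> adj k *v (k *v z) = z" "unitary k ==> k *v (adj k *v z) = z"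
 unfolding unitary_def adj_def by (simp_all add: matrix_vector_mul_assoc)

lemma norm_sq_vec: "complex_of_real ((norm z)^2) = (\<Sum>i\<in>UNIV. z $ i * cnj (z $ i))" for z :: "complex ^ 'n::finite"
 by (simp add: norm_vec_def L2_set_def sum_nonneg complex_norm_square[symmetric] del: of_real_power flip: of_real_sum)

lemma inner_unitary:
 fixes z w :: "complex ^ 'n::finite"
 assumes "unitary k"
 shows "(\<Sum>i\<in>UNIV. (k *v z) $ i * cnj ((k *v w) $ i)) = (\<Sum>i\<in>UNIV. z $ i * cnj (w $ i))"
proof -
 have o: "(\<Sum>i\<in>UNIV. cnj (k $ i $ l) * k $ i $ j) = (if l = j then 1 else 0)" for l j
  using assms[unfolded unitary_def, THEN conjunct2, THEN arg_cong[where f = "\<lambda>A. A $ l $ j"]]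
  by (simp add: matrix_matrix_mult_def mat_def)
 have "(\<Sum>i\<in>UNIV. (k *v z) $ i * cnj ((k *v w) $ i)) =
   (\<Sum>i\<in>UNIV. \<Sum>l\<in>UNIV. \<Sum>j\<in>UNIV. z $ j * cnj (w $ l) * (cnj (k $ i $ l) * k $ i $ j))"
  by (simp add: matrix_vector_mult_def sum_distrib_left sum_distrib_right mult_ac)
 also have "... = (\<Sum>l\<in>UNIV. \<Sum>j\<in>UNIV. z $ j * cnj (w $ l) * (\<Sum>i\<in>UNIV. cnj (k $ i $ l) * k $ i $ j))"
  by (subst sum.swap, rule sum.cong[OF refl], subst sum.swap) (simp add: sum_distrib_left)
 also have "... = (\<Sum>i\<in>UNIV. z $ i * cnj (w $ i))"
  unfolding o by (simp add: if_distrib cong: if_cong)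
 finally show ?thesis .
qed

lemma norm_unitary:
 assumes "unitary k"
 shows "norm (k *v z) = norm (z :: complex ^ 'n::finite)"
proof -
 have "complex_of_real ((norm (k *v z))^2) = of_real ((norm z)^2)"
  unfolding norm_sq_vec by (rule inner_unitary[OF assms])
 then show ?thesis by (simp only: of_real_eq_iff) simp
qed

text \<open>A complex Householder map: the identity minus v v^H / alpha with v = z - z' and alpha
  the inner product of z with v. Equality of the norms gives |v|^2 = alpha + cnj alpha, which is
  exactly the condition for unitarity, and alpha is chosen so that z is moved by -v.\<close>

lemma unitary_transitive:
 fixes z z' :: "complex ^ 'n::finite"
 assumes eq: "norm z = norm z'"
 shows "\<exists>k. unitary k \<and> k *v z = z'"
proof (cases "z = z'")
 case True
 have "(\<chi> i j. cnj ((mat 1 :: complex ^ 'n ^ 'n) $ j $ i)) = mat 1"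
  by (simp add: mat_def vec_eq_iff)
 then show ?thesis using True by (intro exI[of _ "mat 1"]) (simp add: unitary_def)
next
 case False
 define v where "v = z - z'"
 define \<alpha> where "\<alpha> = (\<Sum>j\<in>UNIV. cnj (v $ j) * z $ j)"
 define k :: "complex ^ 'n ^ 'n" where "k = (\<chi> i j. (if i = j then 1 else 0) - v $ i * cnj (v $ j) / \<alpha>)"
 have zz: "(\<Sum>j\<in>UNIV. z $ j * cnj (z $ j)) = (\<Sum>j\<in>UNIV. z' $ j * cnj (z' $ j))"
  using eq by (simp flip: norm_sq_vec)
 have N: "(\<Sum>j\<in>UNIV. v $ j * cnj (v $ j)) = \<alpha> + cnj \<alpha>"
  using zz by (simp add: \<alpha>_def v_def algebra_simps sum.distrib sum_subtractf)
 have "\<alpha> \<noteq> 0"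
 proof
  assume "\<alpha> = 0"
  then have "norm v = 0" using N norm_sq_vec[of v] by simp
  then show False using False by (simp add: v_def)
 qed
 have "k ** (\<chi> i j. cnj (k $ j $ i)) = mat 1"
 proof -
  have "(k ** (\<chi> i j. cnj (k $ j $ i))) $ i $ l = mat 1 $ i $ l" for i l
  proof -
   have "(k ** (\<chi> i j. cnj (k $ j $ i))) $ i $ l =
     (\<Sum>j\<in>UNIV. ((if i = j then 1 else 0) - v $ i * cnj (v $ j) / \<alpha>) * ((if l = j then 1 else 0) - cnj (v $ l) * v $ j / cnj \<alpha>))"
    unfolding k_def matrix_matrix_mult_def by (simp only: vec_lambda_beta) (intro sum.cong refl, auto)
   also have "... = (\<Sum>j\<in>UNIV. (if i = j then (if l = j then 1 else 0) else 0)
     - (if i = j then cnj (v $ l) * v $ j / cnj \<alpha> else 0)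
     - (if l = j then v $ i * cnj (v $ j) / \<alpha> else 0)
     + (v $ i * cnj (v $ l) / (\<alpha> * cnj \<alpha>)) * (v $ j * cnj (v $ j)))"
    by (intro sum.cong refl) (auto simp: algebra_simps)
   also have "... = (if l = i then 1 else 0) - cnj (v $ l) * v $ i / cnj \<alpha> - v $ i * cnj (v $ l) / \<alpha>
     + (v $ i * cnj (v $ l) / (\<alpha> * cnj \<alpha>)) * (\<alpha> + cnj \<alpha>)"
    unfolding N[symmetric] by (simp add: sum.distrib sum_subtractf sum_distrib_left)
   also have "... = (if l = i then 1 else 0)"
    using \<open>\<alpha> \<noteq> 0\<close> by (simp add: field_simps)
   finally show ?thesis by (simp add: mat_def)
  qed
  then show ?thesis by (simp add: vec_eq_iff)
 qed
 then have "unitary k" unfolding unitary_def using matrix_left_right_inverse by blast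
 moreover have "k *v z = z'"
 proof -
  have "(k *v z) $ i = z' $ i" for i
  proof -
   have "(k *v z) $ i = (\<Sum>j\<in>UNIV. (if i = j then z $ j else 0) - v $ i / \<alpha> * (cnj (v $ j) * z $ j))"
    unfolding k_def matrix_vector_mult_def by (simp, intro sum.cong refl) (auto simp: algebra_simps)
   also have "... = z $ i - v $ i / \<alpha> * \<alpha>"
    unfolding \<alpha>_def sum_subtractf sum_distrib_left by simp
   also have "... = z' $ i" using \<open>\<alpha> \<noteq> 0\<close> by (simp add: v_def)
   finally show ?thesis .
  qed
  then show ?thesis by (simp add: vec_eq_iff)
 qed
 ultimately show ?thesis by blast
qed

lemma nn_integral_lborel_translate:
 fixes f :: "'a::euclidean_space => ennreal"
 assumes [measurable]: "f \<in> borel_measurable borel"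
 shows "(\<integral>\<^sup>+x. f (x + c) \<partial>lborel) = (\<integral>\<^sup>+x. f x \<partial>lborel)"
proof -
 have "(\<integral>\<^sup>+x. f x \<partial>lborel) = (\<integral>\<^sup>+x. f x \<partial>distr lborel borel ((+) c))" by (simp add: lborel_distr_plus)
 also have "... = (\<integral>\<^sup>+x. f (c + x) \<partial>lborel)" by (rule nn_integral_distr) auto
 finally show ?thesis by (simp add: add.commute)
qed

text \<open>Both measures are translation invariant and agree on the unit ball.\<close>

lemma lborel_distr_linear_isometry:
 fixes T S :: "'a::euclidean_space => 'a"
 assumes T: "linear T" "\<And>x. norm (T x) = norm x" and TS: "\<And>x. T (S x) = x"
 shows "distr lborel borel T = lborel"
proof (rule measure_eqI)
 show "sets (distr lborel borel T) = sets lborel" by simp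
 have Tm [measurable]: "T \<in> borel_measurable borel"
  by (intro borel_measurable_continuous_onI linear_continuous_on linear_conv_bounded_linear[THEN iffD1] T)
 define B where "B = ball (0::'a) 1"
 have [measurable]: "B \<in> sets borel" by (simp add: B_def)
 fix A :: "'a set" assume "A \<in> sets (distr lborel borel T)"
 then have A [measurable]: "A \<in> sets borel" by simp
 \<comment> \<open>The integral of the indicators of y in B and y + T x in A is evaluated in both
   orders. For fixed y, translation gives the image measure of A; after replacing y by y - T x, what
   remains for each y in A is the volume of a unit ball in x, as T preserves norms.\<close>
 have "emeasure lborel B * emeasure (distr lborel borel T) A = (\<integral>\<^sup>+y. indicator B y * (\<integral>\<^sup>+x. indicator A (T x) \<partial>lborel) \<partial>lborel)"
  using nn_integral_distr[of T lborel borel "indicator A"] by (simp add: nn_integral_multc mult.commute)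
 also have "... = (\<integral>\<^sup>+y. \<integral>\<^sup>+x. indicator B y * indicator A (y + T x) \<partial>lborel \<partial>lborel)"
 proof (rule nn_integral_cong)
  fix y
  have "(\<integral>\<^sup>+x. indicator A (T x) \<partial>lborel) = (\<integral>\<^sup>+x. indicator A (T (x + S y)) \<partial>lborel :: ennreal)"
   by (rule nn_integral_lborel_translate[symmetric]) measurable
  also have "... = (\<integral>\<^sup>+x. indicator A (y + T x) \<partial>lborel)"
   by (simp add: linear_add[OF T(1)] TS add.commute)
  finally show "indicator B y * (\<integral>\<^sup>+x. indicator A (T x) \<partial>lborel) = (\<integral>\<^sup>+x. indicator B y * indicator A (y + T x) \<partial>lborel :: ennreal)"
   by (simp add: nn_integral_cmult)
 qed
 also have "... = (\<integral>\<^sup>+x. \<integral>\<^sup>+y. indicator B y * indicator A (y + T x) \<partial>lborel \<partial>lborel)"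
  by (rule lborel_pair.Fubini') measurable
 also have "... = (\<integral>\<^sup>+x. \<integral>\<^sup>+y. indicator B (y - T x) * indicator A y \<partial>lborel \<partial>lborel)"
 proof (rule nn_integral_cong)
  fix x
  show "(\<integral>\<^sup>+y. indicator B y * indicator A (y + T x) \<partial>lborel) = (\<integral>\<^sup>+y. indicator B (y - T x) * indicator A y \<partial>lborel :: ennreal)"
   using nn_integral_lborel_translate[of "\<lambda>y. indicator B (y - T x) * indicator A y :: ennreal" "T x"] by simp
 qed
 also have "... = (\<integral>\<^sup>+y. \<integral>\<^sup>+x. indicator B (y - T x) * indicator A y \<partial>lborel \<partial>lborel)"
  by (rule lborel_pair.Fubini') measurable
 also have "... = (\<integral>\<^sup>+y. emeasure lborel B * indicator A y \<partial>lborel)"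
 proof (rule nn_integral_cong)
  fix y
  have "indicator B (y - T x) = (indicator (ball (S y) 1) x :: ennreal)" for x
  proof -
   have "norm (y - T x) = norm (S y - x)"
    using T(2)[of "S y - x"] linear_diff[OF T(1), of "S y" x] by (simp add: TS)
   then show ?thesis by (simp add: B_def indicator_def dist_norm norm_minus_commute[of "T x" y])
  qed
  then have "(\<integral>\<^sup>+x. indicator B (y - T x) * indicator A y \<partial>lborel) = (\<integral>\<^sup>+x. indicator (ball (S y) 1) x * indicator A y \<partial>lborel)"
   by (simp only:)
  also have "... = emeasure lborel (ball (S y) 1) * indicator A y"
   by (subst nn_integral_multc) (auto intro!: borel_measurable_indicator)
  also have "emeasure lborel (ball (S y) 1) = emeasure lborel B" by (simp add: B_def emeasure_ball)
  finally show "(\<integral>\<^sup>+x. indicator B (y - T x) * indicator A y \<partial>lborel) = emeasure lborel B * indicator A y" .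
 qed
 also have "... = emeasure lborel B * emeasure lborel A" by (simp add: nn_integral_cmult)
 finally have "emeasure lborel B * emeasure (distr lborel borel T) A = emeasure lborel B * emeasure lborel A" .
 moreover have "emeasure lborel B = ennreal (unit_ball_vol DIM('a))" by (simp add: B_def emeasure_ball)
 moreover have "unit_ball_vol DIM('a) > 0" by simp
 ultimately show "emeasure (distr lborel borel T) A = emeasure lborel A"
  by (simp add: ennreal_mult_cancel_left)
qed

lemma norm_rot: "unitary k ==> norm (rot k x) = norm x"
 by (simp add: rot_def norm_Pair norm_unitary) (simp add: norm_prod_def)

lemma linear_rot: "linear (rot k)"
proof (rule linearI)
 show "rot k (x + y) = rot k x + rot k y" for x y
  by (simp add: rot_def matrix_vector_right_distrib)
 show "rot k (r *\<^sub>R x) = r *\<^sub>R rot k x" for r x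
  by (simp add: rot_def vec_eq_iff matrix_vector_mult_def scaleR_sum_right)
qed

lemma rot_adj: "unitary k ==> rot k (rot (adj k) x) = x" "unitary k ==> rot (adj k) (rot k x) = x"
 by (simp_all add: rot_def adj_mult)

lemma rot_measurable [measurable]: "rot k \<in> borel_measurable borel"
 by (intro borel_measurable_continuous_onI linear_continuous_on linear_conv_bounded_linear[THEN iffD1] linear_rot)

lemma lborel_distr_rot: "unitary k ==> distr lborel borel (rot k) = lborel"
 by (rule lborel_distr_linear_isometry[OF linear_rot norm_rot rot_adj(1)])

subsection \<open>Wave packets\<close>

lemma borel_measurable_fst' [measurable (raw)]:
 fixes f :: "'a => 'b::second_countable_topology \<times> 'c::second_countable_topology"
 assumes "f \<in> borel_measurable M"
 shows "(\<lambda>x. fst (f x)) \<in> borel_measurable M" "(\<lambda>x. snd (f x)) \<in> borel_measurable M"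
 using assms by (auto intro!: measurable_compose[OF assms] borel_measurable_continuous_onI continuous_intros)

lemma one_plus_power_le:
 fixes b :: real
 assumes "b \<ge> 0"
 shows "(1 + b) ^ m \<le> 2 ^ m * (1 + b ^ m)"
proof (cases "b \<le> 1")
 case True
 have "(1 + b) ^ m \<le> 2 ^ m" using assms True by (intro power_mono) auto
 also have "... \<le> 2 ^ m * (1 + b ^ m)" using assms by simp
 finally show ?thesis .
next
 case False
 have "(1 + b) ^ m \<le> (2 * b) ^ m" using False by (intro power_mono) auto
 also have "... = 2 ^ m * b ^ m" by (rule power_mult_distrib)
 also have "... \<le> 2 ^ m * (1 + b ^ m)" by (intro mult_left_mono) auto
 finally show ?thesis .
qed

lemma integrable_prod_inverse:
 "integrable lborel (\<lambda>x::'a::euclidean_space. \<Prod>b\<in>Basis. inverse (1 + (x \<bullet> b)^2))"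
proof -
 interpret product_sigma_finite "\<lambda>_::'a. lborel :: real measure" by standard
 have "integrable (\<Pi>\<^sub>M b\<in>(Basis :: 'a set). (lborel :: real measure)) (\<lambda>f. \<Prod>b\<in>Basis. inverse (1 + (f b)^2))"
  using product_integrable_prod[of "Basis :: 'a set" "\<lambda>_ t. inverse (1 + t^2)"] by (simp add: integrable_inverse_square)
 then show ?thesis
  by (subst lborel_eq, subst integrable_distr_eq) (simp_all add: inner_sum_left_Basis)
qed

text \<open>The product over the basis of 1 + (x . b)^2 is at most (1 + |x|^2)^D, hence controlled
  by the powers 0 and 2D of the norm. Comparison with the inverse of this product reduces
  integrability to dimension one.\<close>

lemma decay_integrable:
 fixes f :: "'a::euclidean_space => complex"
 assumes [measurable]: "f \<in> borel_measurable borel" and b: "\<And>m. bounded (range (\<lambda>x. norm x ^ m * cmod (f x)))"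
 shows "integrable lborel f" "f \<in> L2_fun lborel"
proof -
 have "\<exists>B\<ge>0. \<forall>x. norm x ^ m * cmod (f x) \<le> B" for m
 proof -
  obtain B where "\<forall>x. norm (norm x ^ m * cmod (f x)) \<le> B" using b[of m] unfolding bounded_iff by auto
  then show ?thesis by (intro exI[of _ "max B 0"]) (simp add: le_max_iff_disj)
 qed
 then obtain B where B: "\<And>m. B m \<ge> 0" "\<And>m x. norm x ^ m * cmod (f x) \<le> B m" by metis
 define D where "D = DIM('a)"
 define C where "C = 2 ^ D * (B 0 + B (2 * D))"
 have bd: "cmod (f x) \<le> C * (\<Prod>b\<in>Basis. inverse (1 + (x \<bullet> b)^2))" for x
 proof -
  define P where "P = (\<Prod>b\<in>Basis. 1 + (x \<bullet> b)^2)"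
  have P: "P > 0" unfolding P_def by (intro prod_pos) (simp add: add_pos_nonneg)
  have "P \<le> (\<Prod>b\<in>(Basis :: 'a set). 1 + (norm x)^2)" unfolding P_def
   by (intro prod_mono) (auto simp: abs_le_square_iff[symmetric] Basis_le_norm)
  also have "... \<le> 2 ^ D * (1 + norm x ^ (2 * D))"
   using one_plus_power_le[of "(norm x)^2" D] by (simp add: D_def power_mult)
  finally have "P * cmod (f x) \<le> 2 ^ D * (1 + norm x ^ (2 * D)) * cmod (f x)" by (intro mult_right_mono) auto
  also have "... = 2 ^ D * (norm x ^ 0 * cmod (f x) + norm x ^ (2 * D) * cmod (f x))" by (simp add: algebra_simps)
  also have "... \<le> C" unfolding C_def by (intro mult_left_mono add_mono B) auto
  finally have "cmod (f x) \<le> C * inverse P" using P by (simp add: field_simps)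
  then show ?thesis by (simp add: P_def prod_inversef[symmetric] o_def)
 qed
 have C: "C \<ge> 0" using B(1) by (simp add: C_def)
 show i: "integrable lborel f"
  by (rule Bochner_Integration.integrable_bound[OF integrable_mult_right[OF integrable_prod_inverse, of C]])
   (measurable, intro AE_I2 order_trans[OF bd], simp)
 show "f \<in> L2_fun lborel"
 proof (rule L2_funI)
  show "integrable lborel (\<lambda>x. (cmod (f x))^2)"
  proof (rule Bochner_Integration.integrable_bound)
   show "integrable lborel (\<lambda>x. B 0 * cmod (f x))" using i by simp
   show "AE x in lborel. norm ((cmod (f x))^2) \<le> norm (B 0 * cmod (f x))"
    using B(2)[of _ 0] B(1)[of 0] by (intro AE_I2) (simp add: power2_eq_square mult_right_mono)
  qed measurable
 qed measurable
qed

lemma schwartz_integrable: "schwartz f ==> integrable lborel f" "schwartz f ==> f \<in> L2_fun lborel"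
proof -
 assume f: "schwartz f"
 have "bounded (range (\<lambda>x. norm x ^ m * cmod (f x)))" for m
  using f[unfolded schwartz_def, THEN conjunct2, rule_format, of m "[]"] by simp
 moreover have "f \<in> borel_measurable borel" using f by (simp add: schwartz_def smooth_measurable)
 ultimately show "integrable lborel f" "f \<in> L2_fun lborel" using decay_integrable by blast+
qed

text \<open>For l > 0 the function exp (- l * hw sg x) is the spherical function of the lowest
  branch at central frequency sg * l.\<close>

definition hw :: "real => 'n::finite heis => complex" where
 "hw sg x = of_real ((norm (fst x))^2 / 4) - \<i> * of_real (sg * snd x)"

lemma hw_has_derivative:
 "(hw sg has_derivative (\<lambda>v. of_real (fst x \<bullet> fst v / 2) - \<i> * of_real (sg * snd v))) (at x)"
proof -
 have "((\<lambda>x::'a heis. (fst x \<bullet> fst x) / 4) has_derivative (\<lambda>v. (fst x \<bullet> fst v + fst v \<bullet> fst x) / 4)) (at x)"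
  by (auto intro!: derivative_eq_intros simp: inner_commute)
 then have 1: "((\<lambda>x::'a heis. (norm (fst x))^2 / 4) has_derivative (\<lambda>v. fst x \<bullet> fst v / 2)) (at x)"
  by (simp add: power2_norm_eq_inner inner_commute)
 have 2: "((\<lambda>x::'a heis. sg * snd x) has_derivative (\<lambda>v. sg * snd v)) (at x)"
  by (auto intro!: derivative_eq_intros)
 show ?thesis unfolding hw_def[abs_def]
  by (intro has_derivative_diff has_derivative_mult_right bounded_linear.has_derivative[OF bounded_linear_of_real] 1 2)
qed

lemma lap_hw_has_derivative:
 assumes "test_fun ps"
 shows "((\<lambda>x. lap ps (hw sg x)) has_derivative
  (\<lambda>v. - lap (\<lambda>l. of_real l * ps l) (hw sg x) * (of_real (fst x \<bullet> fst v / 2) - \<i> * of_real (sg * snd v)))) (at x)"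
 using has_derivative_compose[OF hw_has_derivative lap_has_field_derivative[OF assms, unfolded has_field_derivative_def]] .

text \<open>Differentiating a Laplace transform at \<open>hw\<close> produces a linear function of x
  times another such transform. Closing under linear factors therefore gives a class stable under
  differentiation, all of whose members turn out to be Schwartz functions.\<close>

inductive wave :: "real => ('n::finite heis => complex) => bool" for sg where
 base: "test_fun ps ==> support ps \<subseteq> {0<..} ==> wave sg (\<lambda>x. lap ps (hw sg x))"
| add: "wave sg f ==> wave sg g ==> wave sg (\<lambda>x. f x + g x)"
| scale: "wave sg f ==> wave sg (\<lambda>x. c * f x)"
| linear: "wave sg f ==> bounded_linear L ==> wave sg (\<lambda>x. L x * f x)"

lemma test_fun_mult_var:
 assumes "test_fun ps"
 shows "test_fun (\<lambda>l. of_real l * ps l)" "support (\<lambda>l. of_real l * ps l) \<subseteq> support ps"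
 using assms by (auto intro!: test_fun_smooth_mult smooth_of_real dest: support_mult_right[THEN subsetD])

lemma wave_derivative:
 assumes "wave sg f"
 shows "\<exists>D. (\<forall>x. (f has_derivative D x) (at x)) \<and> (\<forall>v. wave sg (\<lambda>x. D x v))"
 using assms
proof induction
 case (base ps)
 let ?ps = "\<lambda>l. of_real l * ps l"
 show ?case
 proof (intro exI conjI allI)
  show "((\<lambda>x. lap ps (hw sg x)) has_derivative
   (\<lambda>v. - lap ?ps (hw sg x) * (of_real (fst x \<bullet> fst v / 2) - \<i> * of_real (sg * snd v)))) (at x)" for x
   by (rule lap_hw_has_derivative[OF base(1)])
  fix v :: "'a heis"
  have "wave sg (\<lambda>x. lap ?ps (hw sg x))"
   by (rule wave.base) (use test_fun_mult_var[OF base(1)] base(2) in auto)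
  moreover have "bounded_linear (\<lambda>x::'a heis. complex_of_real (fst x \<bullet> fst v / 2))"
   by (rule bounded_linear_compose[OF bounded_linear_of_real])
    (intro bounded_linear_compose[OF bounded_linear_divide] bounded_linear_compose[OF bounded_linear_inner_left] bounded_linear_fst)
  ultimately have "wave sg (\<lambda>x. (-1) * (complex_of_real (fst x \<bullet> fst v / 2) * lap ?ps (hw sg x)) + (\<i> * of_real (sg * snd v)) * lap ?ps (hw sg x))"
   by (intro wave.add wave.scale wave.linear)
  then show "wave sg (\<lambda>x. - lap ?ps (hw sg x) * (of_real (fst x \<bullet> fst v / 2) - \<i> * of_real (sg * snd v)))"
   by (simp add: algebra_simps)
 qed
next
 case (add f g)
 then obtain D E where D: "\<And>x. (f has_derivative D x) (at x)" "\<And>v. wave sg (\<lambda>x. D x v)"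
  and E: "\<And>x. (g has_derivative E x) (at x)" "\<And>v. wave sg (\<lambda>x. E x v)" by blast
 show ?case
  by (intro exI[of _ "\<lambda>x v. D x v + E x v"] conjI allI has_derivative_add D(1) E(1) wave.add D(2) E(2))
next
 case (scale f c)
 then obtain D where D: "\<And>x. (f has_derivative D x) (at x)" "\<And>v. wave sg (\<lambda>x. D x v)" by blast
 show ?case
  by (intro exI[of _ "\<lambda>x v. c * D x v"] conjI allI has_derivative_mult_right D(1) wave.scale D(2))
next
 case (linear f L)
 then obtain D where D: "\<And>x. (f has_derivative D x) (at x)" "\<And>v. wave sg (\<lambda>x. D x v)" by blast
 show ?case
  by (intro exI[of _ "\<lambda>x v. L x * D x v + L v * f x"] conjI allI has_derivative_mult D(1)
    bounded_linear_imp_has_derivative linear.hyps wave.add wave.scale wave.linear D(2))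
qed

text \<open>\<open>norm z\<close> is at most (1 + |z|^2) / 2 and t is the imaginary part up to sign,
  so decay in \<open>hw\<close> is decay in x.\<close>

lemma norm_le_hw: "norm x \<le> 1 + 5 * cmod (hw sg x)" if "\<bar>sg\<bar> = 1" for x :: "'n::finite heis"
proof -
 have "\<bar>Re (hw sg x)\<bar> \<le> cmod (hw sg x)" "\<bar>Im (hw sg x)\<bar> \<le> cmod (hw sg x)"
  by (rule abs_Re_le_cmod abs_Im_le_cmod)+
 then have "(norm (fst x))^2 \<le> 4 * cmod (hw sg x)" "\<bar>snd x\<bar> \<le> cmod (hw sg x)"
  using that by (auto simp: hw_def abs_mult)
 moreover have "2 * norm (fst x) \<le> 1 + (norm (fst x))^2"
  using zero_le_power2[of "norm (fst x) - 1"] by (simp add: power2_diff)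
 moreover have "0 \<le> norm (fst x)" by simp
 moreover have "norm x \<le> norm (fst x) + \<bar>snd x\<bar>" using norm_Pair_le[of "fst x" "snd x"] by simp
 ultimately show ?thesis by linarith
qed

text \<open>The power m stays general in the induction because a linear factor costs one more power
  of the norm.\<close>

lemma wave_bounded:
 assumes sg: "\<bar>sg\<bar> = 1" and "wave sg f"
 shows "\<exists>B. \<forall>x. norm x ^ m * cmod (f x) \<le> B"
 using assms(2)
proof (induction arbitrary: m)
 case (base ps)
 have pos: "\<And>l. l \<in> support ps ==> l * Re (hw sg x) \<ge> 0" for x using base(2) by (auto simp: hw_def)
 obtain C where C: "\<And>w. (\<And>l. l \<in> support ps ==> l * Re w \<ge> 0) ==> cmod w ^ m * cmod (lap ps w) \<le> C"
  by (rule lap_decay[OF base(1), of m]) blast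
 obtain C0 where C0: "\<And>w. (\<And>l. l \<in> support ps ==> l * Re w \<ge> 0) ==> cmod w ^ 0 * cmod (lap ps w) \<le> C0"
  by (rule lap_decay[OF base(1), of 0]) blast
 show ?case
 proof (intro exI allI)
  fix x
  let ?w = "hw sg x"
  have "norm x ^ m \<le> (1 + 5 * cmod ?w) ^ m" using norm_le_hw[OF sg, of x] by (intro power_mono) auto
  also have "... \<le> 2 ^ m * (1 + (5 * cmod ?w) ^ m)" by (rule one_plus_power_le) simp
  finally have "norm x ^ m * cmod (lap ps ?w) \<le> 2 ^ m * (1 + (5 * cmod ?w) ^ m) * cmod (lap ps ?w)"
   by (intro mult_right_mono) auto
  also have "... = 2 ^ m * (cmod ?w ^ 0 * cmod (lap ps ?w) + 5 ^ m * (cmod ?w ^ m * cmod (lap ps ?w)))"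
   by (simp add: power_mult_distrib algebra_simps)
  also have "... \<le> 2 ^ m * (C0 + 5 ^ m * C)"
   by (intro mult_left_mono add_mono C C0 pos) auto
  finally show "norm x ^ m * cmod (lap ps ?w) \<le> 2 ^ m * (C0 + 5 ^ m * C)" .
 qed
next
 case (add f g)
 obtain B B' where B: "\<And>x. norm x ^ m * cmod (f x) \<le> B" "\<And>x. norm x ^ m * cmod (g x) \<le> B'"
  using add.IH by metis
 show ?case
 proof (intro exI allI)
  fix x
  have "norm x ^ m * cmod (f x + g x) \<le> norm x ^ m * (cmod (f x) + cmod (g x))"
   by (intro mult_left_mono norm_triangle_ineq) auto
  also have "... \<le> B + B'" using B[of x] by (simp add: distrib_left)
  finally show "norm x ^ m * cmod (f x + g x) \<le> B + B'" .
 qed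
next
 case (scale f c)
 obtain B where B: "\<And>x. norm x ^ m * cmod (f x) \<le> B" using scale.IH by metis
 show ?case
 proof (intro exI allI)
  fix x
  show "norm x ^ m * cmod (c * f x) \<le> cmod c * B"
   using mult_left_mono[OF B[of x], of "cmod c"] by (simp add: norm_mult mult_ac)
 qed
next
 case (linear f L)
 obtain B where B: "\<And>x. norm x ^ Suc m * cmod (f x) \<le> B" using linear.IH by metis
 obtain K where K: "K \<ge> 0" "\<And>x. cmod (L x) \<le> norm x * K"
  using bounded_linear.nonneg_bounded[OF linear.hyps(2)] by blast
 show ?case
 proof (intro exI allI)
  fix x
  have "norm x ^ m * cmod (L x * f x) \<le> norm x ^ m * ((norm x * K) * cmod (f x))"
   using K by (simp add: norm_mult mult_left_mono mult_right_mono)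
  also have "... = K * (norm x ^ Suc m * cmod (f x))" by (simp add: mult_ac)
  also have "... \<le> K * B" using K B by (intro mult_left_mono) auto
  finally show "norm x ^ m * cmod (L x * f x) \<le> K * B" .
 qed
qed

lemma wave_dir_deriv: "wave sg f ==> wave sg (dir_deriv v f)"
proof -
 assume "wave sg f"
 then obtain D where D: "\<And>x. (f has_derivative D x) (at x)" "\<And>v. wave sg (\<lambda>x. D x v)"
  using wave_derivative by blast
 have "dir_deriv v f = (\<lambda>x. D x v)" by (intro ext dir_deriv_eq D(1))
 then show ?thesis using D(2) by simp
qed

lemma wave_smooth:
 assumes "wave sg f"
 shows "smooth f"
 using assms by (rule smooth_coinduct[of "wave sg"]) (rule wave_derivative)

lemma wave_schwartz:
 assumes "\<bar>sg\<bar> = 1" "wave sg f"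
 shows "schwartz f"
 unfolding schwartz_def
proof (intro conjI allI)
 show "smooth f" by (rule wave_smooth[OF assms(2)])
 fix m vs
 have "wave sg (fold dir_deriv vs f)"
  using assms(2) by (induction vs arbitrary: f) (auto intro: wave_dir_deriv)
 then obtain B where "\<And>x. norm x ^ m * cmod (fold dir_deriv vs f x) \<le> B" using wave_bounded[OF assms(1)] by blast
 then show "bounded (range (\<lambda>x. norm x ^ m * cmod (fold dir_deriv vs f x)))"
  by (intro boundedI[of _ B]) auto
qed

text \<open>The squared norm is a sum of squares of real coordinates, each of which is a linear
  factor applied twice.\<close>

lemma wave_norm_power: "wave sg f ==> wave sg (\<lambda>x. of_real ((norm (fst x))^2) ^ m * f x)"
proof (induction m)
 case (Suc m)
 let ?g = "\<lambda>x. of_real ((norm (fst x))^2) ^ m * f x"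
 have bl: "bounded_linear (\<lambda>x::'a heis. complex_of_real (fst x \<bullet> b))" for b
  by (rule bounded_linear_compose[OF bounded_linear_of_real])
   (intro bounded_linear_compose[OF bounded_linear_inner_left] bounded_linear_fst)
 have s: "wave sg (\<lambda>x. \<Sum>b\<in>B. complex_of_real (fst x \<bullet> b) * (complex_of_real (fst x \<bullet> b) * ?g x))" if "finite B" for B
  using that
 proof (induction B)
  case empty
  show ?case using wave.scale[OF Suc.IH[OF Suc.prems], of 0] by simp
 next
  case (insert b B)
  show ?case unfolding sum.insert[OF insert.hyps]
   by (intro wave.add insert.IH wave.linear[OF wave.linear[OF Suc.IH[OF Suc.prems] bl] bl])
 qed
 have "(norm (fst x))^2 = (\<Sum>b\<in>Basis. (fst x \<bullet> b) * (fst x \<bullet> b))" for x :: "'a heis"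
  unfolding power2_norm_eq_inner by (rule euclidean_inner)
 then have 1: "complex_of_real ((norm (fst x))^2) = (\<Sum>b\<in>Basis. of_real (fst x \<bullet> b) * of_real (fst x \<bullet> b))" for x :: "'a heis"
  by (simp only: of_real_sum of_real_mult)
 have "of_real ((norm (fst x))^2) ^ Suc m * f x = (\<Sum>b\<in>Basis. complex_of_real (fst x \<bullet> b) * (complex_of_real (fst x \<bullet> b) * ?g x))" for x
 proof -
  have "of_real ((norm (fst x))^2) ^ Suc m * f x = of_real ((norm (fst x))^2) * ?g x" by (simp only: power_Suc mult.assoc)
  also have "... = (\<Sum>b\<in>Basis. of_real (fst x \<bullet> b) * of_real (fst x \<bullet> b)) * ?g x" by (simp only: 1)
  finally show ?thesis by (simp only: sum_distrib_right mult.assoc)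
 qed
 then show ?case using s[OF finite_Basis] by (simp only:)
qed simp

lemma wave_sum:
 assumes "finite I" "\<And>i. i \<in> I ==> wave sg (f i)" "I \<noteq> {}"
 shows "wave sg (\<lambda>x. \<Sum>i\<in>I. f i x)"
 using assms(1,3,2)
 by (induction rule: finite_ne_induct) (auto intro: wave.add)

lemma test_fun_mult_power:
 assumes "test_fun ps"
 shows "test_fun (\<lambda>l. of_real l ^ k * ps l)" "support (\<lambda>l. of_real l ^ k * ps l) \<subseteq> support ps"
 using assms by (auto intro!: test_fun_smooth_mult smooth_power smooth_of_real dest: support_mult_right[THEN subsetD])

text \<open>The density of the Plancherel measure on branch j with respect to |ta|^n d ta.\<close>

definition pconst :: "nat => nat => real" where
 "pconst n j = real ((j + n - 1) choose j) / (2 * pi) ^ (n + 1)"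

lemma pconst_pos: "n > 0 ==> pconst n j > 0"
 by (simp add: pconst_def)

text \<open>The inversion integral over one half branch: p(l) times the spherical function at
  frequency sg * l, integrated against the Plancherel density. The Laguerre polynomial in l |z|^2 /
  2 is expanded, so that every summand is a power of |z|^2 times a Laplace transform and hence a
  wave.\<close>

definition pk :: "real => (real => complex) => nat => 'n::finite heis => complex" where
 "pk sg ps j x = (\<Sum>m\<le>j. of_real (pconst CARD('n) j * lagc CARD('n) j m / 2 ^ m) *
   (of_real ((norm (fst x))^2) ^ m * lap (\<lambda>l. of_real l ^ (CARD('n) + m) * ps l) (hw sg x)))"

text \<open>The Laguerre function: at y = |ta| |z|^2 / 2 it is the radial factor of the spherical
  function of branch j.\<close>

definition lf :: "nat => nat => real => real" where
 "lf n j y = exp (- (y / 2)) * lag n j y"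

lemma lf_measurable [measurable]: "lf n j \<in> borel_measurable borel"
 unfolding lf_def[abs_def] by measurable

lemma power_exp_bound: "y \<ge> 0 ==> y ^ m * exp (- (y / 2)) \<le> 2 ^ m * fact m" for y :: real
proof -
 assume y: "y \<ge> 0"
 have "(\<lambda>k. (y / 2) ^ k /\<^sub>R fact k) sums exp (y / 2)" by (rule exp_converges)
 then have "(y / 2) ^ m /\<^sub>R fact m \<le> exp (y / 2)"
  using sum_le_suminf[of "\<lambda>k. (y / 2) ^ k /\<^sub>R fact k" "{m}"] y by (auto simp: sums_iff)
 then have "y ^ m \<le> 2 ^ m * fact m * exp (y / 2)" by (simp add: power_divide field_simps)
 then show ?thesis by (simp add: exp_minus field_simps)
qed

lemma lf_bounded: "\<exists>B. \<forall>y\<ge>0. \<bar>lf n j y\<bar> \<le> B"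
proof (intro exI allI impI)
 fix y :: real assume y: "y \<ge> 0"
 have "\<bar>lf n j y\<bar> = \<bar>\<Sum>m\<le>j. lagc n j m * (y ^ m * exp (- (y / 2)))\<bar>"
  by (simp add: lf_def lag_def sum_distrib_left mult_ac)
 also have "... \<le> (\<Sum>m\<le>j. \<bar>lagc n j m * (y ^ m * exp (- (y / 2)))\<bar>)" by (rule sum_abs)
 also have "... \<le> (\<Sum>m\<le>j. \<bar>lagc n j m\<bar> * (2 ^ m * fact m))"
  using power_exp_bound[OF y] y by (intro sum_mono) (simp add: abs_mult mult_left_mono)
 finally show "\<bar>lf n j y\<bar> \<le> (\<Sum>m\<le>j. \<bar>lagc n j m\<bar> * (2 ^ m * fact m))" .
qed

lemma spherical_fan_inv:
 fixes x :: "'n::finite heis"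
 assumes "ta \<noteq> 0"
 shows "spherical (of_real (\<bar>ta\<bar> * real (2 * j + CARD('n)))) (of_real ta) (heis_inv x) =
  exp (- (\<i> * of_real (ta * snd x))) * of_real (lf CARD('n) j (\<bar>ta\<bar> * (norm (fst x))^2 / 2))"
 using spherical_fan[OF assms, of j "heis_inv x"] by (simp add: heis_inv_def lf_def)

lemma pk_wave:
 assumes "test_fun ps" "support ps \<subseteq> {0<..}"
 shows "wave sg (pk sg ps j :: 'n::finite heis => complex)"
 unfolding pk_def[abs_def]
 by (intro wave_sum wave.scale wave_norm_power wave.base)
  (use assms test_fun_mult_power[OF assms(1)] in auto)

lemma test_fun_lf:
 assumes "test_fun ps"
 shows "test_fun (\<lambda>l. ps l * of_real (l ^ n * lf n j (l * u / 2)))"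
proof -
 have "(\<lambda>l. complex_of_real (l ^ n * lf n j (l * u / 2))) =
   (\<lambda>l. of_real l ^ n * (exp (of_real l * of_real (- u / 4)) * (\<Sum>m\<le>j. of_real (lagc n j m * (u / 2) ^ m) * of_real l ^ m)))"
  by (auto simp: lf_def lag_def exp_of_real[symmetric] power_mult_distrib power_divide sum_distrib_left field_simps)
 then have "smooth (\<lambda>l. complex_of_real (l ^ n * lf n j (l * u / 2)))"
  by (simp only:) (intro smooth_mult smooth_power smooth_of_real smooth_exp_of_real smooth_sum smooth_const finite_atMost)
 then show ?thesis by (rule test_fun_mult_smooth[OF assms])
qed

lemma pk_integral:
 fixes x :: "'n::finite heis"
 assumes ps: "test_fun ps"
 shows "pk sg ps j x = of_real (pconst CARD('n) j) *
  ft (\<lambda>l. ps l * of_real (l ^ CARD('n) * lf CARD('n) j (l * (norm (fst x))^2 / 2))) (sg * snd x)"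
proof -
 define n u where "n = CARD('n)" and "u = (norm (fst x))^2"
 have i: "integrable lborel (\<lambda>l. (of_real l ^ (n + m) * ps l) * exp (- (of_real l * hw sg x)))" for m
  by (rule lap_integrable[OF test_fun_mult_power(1)[OF ps]])
 have "pk sg ps j x = (LBINT l. (\<Sum>m\<le>j. of_real (pconst n j * lagc n j m / 2 ^ m) * (of_real u ^ m * ((of_real l ^ (n + m) * ps l) * exp (- (of_real l * hw sg x))))))"
  unfolding pk_def lap_def n_def[symmetric] u_def[symmetric]
  by (subst Bochner_Integration.integral_sum) (auto intro!: integrable_mult_right i sum.cong)
 also have "... = (LBINT l. of_real (pconst n j) * (ps l * of_real (l ^ n * lf n j (l * u / 2)) * iexp (l * (sg * snd x))))"
 proof (intro Bochner_Integration.integral_cong refl)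
  fix l
  have e: "exp (- (of_real l * hw sg x)) = of_real (exp (- (l * u / 4))) * iexp (l * (sg * snd x))"
  proof -
   have "- (of_real l * hw sg x) = of_real (- (l * u / 4)) + \<i> * of_real (l * (sg * snd x))"
    by (simp add: hw_def u_def algebra_simps)
   then show ?thesis by (simp only: exp_add exp_of_real)
  qed
  have "(\<Sum>m\<le>j. of_real (pconst n j * lagc n j m / 2 ^ m) * (of_real u ^ m * ((of_real l ^ (n + m) * ps l) * exp (- (of_real l * hw sg x))))) =
    of_real (pconst n j) * (ps l * exp (- (of_real l * hw sg x)) * of_real (l ^ n) * of_real (\<Sum>m\<le>j. lagc n j m * (l * u / 2) ^ m))"
   by (simp add: sum_distrib_left sum_distrib_right power_add power_mult_distrib power_divide mult_ac)
  also have "(\<Sum>m\<le>j. lagc n j m * (l * u / 2) ^ m) = lag n j (l * u / 2)" by (simp add: lag_def)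
  finally show "(\<Sum>m\<le>j. of_real (pconst n j * lagc n j m / 2 ^ m) * (of_real u ^ m * ((of_real l ^ (n + m) * ps l) * exp (- (of_real l * hw sg x))))) =
    of_real (pconst n j) * (ps l * of_real (l ^ n * lf n j (l * u / 2)) * iexp (l * (sg * snd x)))"
   unfolding e by (simp add: lf_def mult_ac)
 qed
 finally show ?thesis unfolding ft_def n_def u_def by simp
qed

lemma pk_schwartz_rad:
 assumes "\<bar>sg\<bar> = 1" "test_fun ps" "support ps \<subseteq> {0<..}"
 shows "(pk sg ps j :: 'n::finite heis => complex) \<in> schwartz_rad"
 unfolding schwartz_rad_def
 using wave_schwartz[OF assms(1) pk_wave[OF assms(2,3)]]
 by (auto simp: pk_def hw_def norm_unitary)

lemma transform_at_fan:
 fixes f :: "'n::finite heis => complex"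
 assumes "ta \<noteq> 0"
 shows "spherical_transform f (\<bar>ta\<bar> * real (2 * j + CARD('n)), ta) =
  (LBINT x. f x * (exp (- (\<i> * of_real (ta * snd x))) * of_real (lf CARD('n) j (\<bar>ta\<bar> * (norm (fst x))^2 / 2))))"
 by (simp only: spherical_transform_def prod.case spherical_fan_inv[OF assms])

lemma ft_inversion_sign:
 assumes "test_fun ph" "\<bar>sg\<bar> = 1"
 shows "(LBINT t. ft ph (sg * t) * exp (- (\<i> * of_real (ta * t)))) = of_real (2 * pi) * ph (sg * ta)"
proof -
 have s: "sg * sg = 1" "sg \<noteq> 0" using assms(2) by (auto simp: abs_if split: if_splits)
 have "(LBINT t. ft ph (sg * t) * exp (- (\<i> * of_real (ta * t)))) =
   \<bar>sg\<bar> *\<^sub>R (LBINT t. ft ph (sg * (0 + sg * t)) * exp (- (\<i> * of_real (ta * (0 + sg * t)))))"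
  by (rule lborel_integral_real_affine) (rule s(2))
 also have "... = (LBINT t. ft ph t * exp (- (\<i> * of_real ((sg * ta) * t))))"
 proof -
  have "sg * (0 + sg * t) = (sg * sg) * t" "ta * (0 + sg * t) = (sg * ta) * t" for t
   by (simp_all only: add_0_left mult_ac)
  then have "sg * (0 + sg * t) = t" "ta * (0 + sg * t) = (sg * ta) * t" for t
   by (simp_all only: s(1) mult_1_left)
  then show ?thesis using assms(2) by (simp only: scaleR_one)
 qed
 also have "... = of_real (2 * pi) * ph (sg * ta)" by (rule ft_inversion[OF assms(1)])
 finally show ?thesis .
qed

text \<open>Integrating over t first inverts the Fourier integral of the packet and produces its
  profile at sg * ta times two Laguerre functions at the same scale |ta|. Orthogonality over z then
  selects the branch, and the constants cancel by the choice of \<open>pconst\<close>.\<close>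

lemma pk_transform:
 assumes sg: "\<bar>sg\<bar> = 1" and ps: "test_fun ps" "support ps \<subseteq> {0<..}" and ta: "ta \<noteq> 0"
 shows "spherical_transform (pk sg ps j :: 'n::finite heis => complex) (\<bar>ta\<bar> * real (2 * i + CARD('n)), ta) =
  (if i = j then ps (sg * ta) else 0)"
proof -
 define n where "n = CARD('n)"
 have n: "n > 0" by (simp add: n_def)
 define s where "s = (pk sg ps j :: 'n heis => complex)"
 have si: "integrable lborel s" unfolding s_def
  using pk_schwartz_rad[OF sg ps] by (auto simp: schwartz_rad_def intro: schwartz_integrable)
 have [measurable]: "s \<in> borel_measurable borel" using si by auto
 define h where "h x = s x * (exp (- (\<i> * of_real (ta * snd x))) * of_real (lf n i (\<bar>ta\<bar> * (norm (fst x))^2 / 2)))" for x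
 obtain B where B: "\<And>y. y \<ge> 0 ==> \<bar>lf n i y\<bar> \<le> B" using lf_bounded by blast
 have hi: "integrable (lborel \<Otimes>\<^sub>M lborel) h"
 proof -
  have "integrable lborel h" unfolding h_def[abs_def]
   by (rule integrable_mult_bounded[OF si, where B = B]) (auto simp: norm_mult norm_exp_eq_Re B)
  then show ?thesis by (simp add: lborel_prod)
 qed
 have "spherical_transform s (\<bar>ta\<bar> * real (2 * i + n), ta) = (LINT x|(lborel \<Otimes>\<^sub>M lborel). h x)"
  unfolding n_def transform_at_fan[OF ta] h_def lborel_prod ..
 also have "... = (LBINT z. LBINT t. h (z, t))"
  using lborel_pair.integral_fst'[OF hi] by simp
 also have "... = (LBINT z. of_real (pconst n j * (2 * pi)) * ps (sg * ta) *
   of_real ((sg * ta) ^ n * (lf n j (sg * ta * (norm (z::complex ^ 'n))^2 / 2) * lf n i (\<bar>ta\<bar> * (norm z)^2 / 2))))"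
 proof (intro Bochner_Integration.integral_cong refl)
  fix z :: "complex ^ 'n"
  define ph where "ph l = ps l * of_real (l ^ n * lf n j (l * (norm z)^2 / 2))" for l
  have ph: "test_fun ph" unfolding ph_def by (rule test_fun_lf[OF ps(1)])
  have "h (z, t) = of_real (pconst n j * lf n i (\<bar>ta\<bar> * (norm z)^2 / 2)) * (ft ph (sg * t) * exp (- (\<i> * of_real (ta * t))))" for t
   unfolding h_def s_def pk_integral[OF ps(1)] n_def[symmetric] ph_def by simp
  then have "(LBINT t. h (z, t)) = of_real (pconst n j * lf n i (\<bar>ta\<bar> * (norm z)^2 / 2)) * (of_real (2 * pi) * ph (sg * ta))"
   by (simp only: integral_mult_right_zero ft_inversion_sign[OF ph sg])
  then show "(LBINT t. h (z, t)) = of_real (pconst n j * (2 * pi)) * ps (sg * ta) *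
   of_real ((sg * ta) ^ n * (lf n j (sg * ta * (norm z)^2 / 2) * lf n i (\<bar>ta\<bar> * (norm z)^2 / 2)))"
   by (simp add: ph_def mult_ac)
 qed
 also have "... = (if i = j then ps (sg * ta) else 0)"
 proof (cases "sg * ta > 0")
  case False
  then have "sg * ta \<notin> support ps" using ps(2) by auto
  then show ?thesis by (simp add: not_in_support)
 next
  case True
  then have st: "sg * ta = \<bar>ta\<bar>" using sg by (metis abs_mult abs_of_pos mult_1)
  have "has_bochner_integral lborel (\<lambda>z::complex ^ 'n. lf n j (\<bar>ta\<bar> * (norm z)^2 / 2) * lf n i (\<bar>ta\<bar> * (norm z)^2 / 2))
    (if j = i then (2 * pi / \<bar>ta\<bar>) ^ n / real ((i + n - 1) choose i) else 0)"
  proof -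
   have e: "y / 2 / 2 = y / 4" for y :: real by simp
   have "\<bar>ta\<bar> > 0" using ta by simp
   from lag_orthogonal_space[OF this, of j i, where 'n = 'n] show ?thesis
    by (simp only: lf_def n_def e)
  qed
  from has_bochner_integral_integral_eq[OF this]
  have "(LBINT z. of_real (pconst n j * (2 * pi)) * ps (sg * ta) *
   of_real ((sg * ta) ^ n * (lf n j (sg * ta * (norm (z::complex ^ 'n))^2 / 2) * lf n i (\<bar>ta\<bar> * (norm z)^2 / 2)))) =
   of_real (pconst n j * (2 * pi)) * ps (sg * ta) * of_real (\<bar>ta\<bar> ^ n * (if j = i then (2 * pi / \<bar>ta\<bar>) ^ n / real ((i + n - 1) choose i) else 0))"
   unfolding st by (simp only: integral_mult_right_zero integral_complex_of_real)
  also have "... = (if i = j then ps (sg * ta) else 0)"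
  proof (cases "i = j")
   case True
   have "real ((j + n - 1) choose j) \<noteq> 0" using n by simp
   then have "pconst n j * (2 * pi) * (\<bar>ta\<bar> ^ n * ((2 * pi / \<bar>ta\<bar>) ^ n / real ((j + n - 1) choose j))) = 1"
    using ta by (simp add: pconst_def power_divide power_mult_distrib)
   then have "complex_of_real (pconst n j * (2 * pi)) * of_real (\<bar>ta\<bar> ^ n * ((2 * pi / \<bar>ta\<bar>) ^ n / real ((j + n - 1) choose j))) = 1"
    by (simp only: of_real_mult[symmetric]) simp
   then show ?thesis using True by (simp add: mult_ac del: of_real_mult of_real_divide of_real_power)
  qed simp
  finally show ?thesis .
 qed
 finally show ?thesis unfolding s_def n_def .
qed

lemma transform_measurable:
 fixes f :: "'n::finite heis => complex"
 assumes [measurable]: "f \<in> borel_measurable borel"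
 shows "spherical_transform f \<in> borel_measurable borel"
proof -
 have "(\<lambda>(p, x). f x * spherical (of_real (fst p)) (of_real (snd p)) (heis_inv x)) \<in>
   borel_measurable ((borel :: (real \<times> real) measure) \<Otimes>\<^sub>M (borel :: 'n heis measure))"
  unfolding spherical_def Let_def heis_inv_def fst_conv snd_conv by measurable
 also have "borel_measurable ((borel :: (real \<times> real) measure) \<Otimes>\<^sub>M (borel :: 'n heis measure)) =
   borel_measurable (borel \<Otimes>\<^sub>M (lborel :: 'n heis measure))"
  by (intro measurable_cong_sets sets_pair_measure_cong) auto
 finally have "(\<lambda>p. LBINT x. f x * spherical (of_real (fst p)) (of_real (snd p)) (heis_inv x)) \<in> borel_measurable borel"
  by (rule lborel.borel_measurable_lebesgue_integral)
 then show ?thesis by (simp add: spherical_transform_def split_beta')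
qed

subsection \<open>The spherical transform of wave packets\<close>

text \<open>A parametrisation of branch j. With sg = 1 and all real l it covers the branch; with l >
  0 and sg = 1 or -1 it covers its two halves, which is how packets use it.\<close>

definition fb :: "nat => nat => real => real => real \<times> real" where
 "fb n j sg l = (\<bar>l\<bar> * real (2 * j + n), sg * l)"

abbreviation fan_borel :: "nat => (real \<times> real) measure" where
 "fan_borel n \<equiv> restrict_space borel (fan n)"

lemma fb_in_fan: "\<bar>sg\<bar> = 1 ==> fb n j sg l \<in> fan n"
 by (cases "l = 0") (auto simp: fb_def fan_def abs_mult)

lemma fb_measurable: "\<bar>sg\<bar> = 1 ==> fb n j sg \<in> borel \<rightarrow>\<^sub>M fan_borel n"
 by (rule measurable_restrict_space2) (auto simp: fb_in_fan, auto simp: fb_def[abs_def])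

lemma sets_plancherel: "sets (plancherel n) = sets (fan_borel n)"
 by (simp add: plancherel_def)

lemma space_plancherel: "space (plancherel n) = fan n"
 by (simp add: plancherel_def space_restrict_space)

lemma measurable_plancherel [simp]: "borel_measurable (plancherel n) = borel_measurable (fan_borel n)"
 by (rule measurable_cong_sets) (auto simp: sets_plancherel)

lemma comp_fb_measurable:
 assumes "F \<in> borel_measurable (fan_borel n)" "\<bar>sg\<bar> = 1"
 shows "(\<lambda>l. F (fb n j sg l)) \<in> borel_measurable borel"
 using measurable_compose[OF fb_measurable[OF assms(2)] assms(1)] .

text \<open>The origin, the common endpoint of the branches, is excluded, so that distinct branches
  are disjoint.\<close>

definition on_branch :: "nat => nat => real \<times> real => bool" where
 "on_branch n j p \<longleftrightarrow> snd p \<noteq> 0 \<and> fst p = \<bar>snd p\<bar> * real (2 * j + n)"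

lemma on_branch_sets: "{p. on_branch n j p} \<in> sets borel"
proof -
 have "closed {p :: real \<times> real. fst p = \<bar>snd p\<bar> * real (2 * j + n)}" "closed {p :: real \<times> real. snd p = 0}"
  by (intro closed_Collect_eq continuous_intros)+
 moreover have "{p. on_branch n j p} = {p. fst p = \<bar>snd p\<bar> * real (2 * j + n)} - {p. snd p = 0}"
  by (auto simp: on_branch_def)
 ultimately show ?thesis by (auto intro: sets.Diff)
qed

text \<open>By disjointness the sum over i in the Plancherel integral collapses to i = j. At
  frequency 0, where the collapse fails, the weight |ta|^n is 0 since n > 0.\<close>

lemma density_branch:
 assumes n: "n > 0"
 shows "density (plancherel n) (indicator {p. on_branch n j p}) =
  distr (density lborel (\<lambda>ta. ennreal (pconst n j * \<bar>ta\<bar> ^ n))) (fan_borel n) (fb n j 1)"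
  (is "?L = ?R")
proof (rule measure_eqI)
 show s: "sets ?L = sets ?R" by (simp add: sets_plancherel)
 fix A assume "A \<in> sets ?L"
 then have A [measurable]: "A \<in> sets (fan_borel n)" by (simp add: sets_plancherel)
 have fbm [measurable]: "fb n j 1 \<in> borel \<rightarrow>\<^sub>M fan_borel n" by (rule fb_measurable) simp
 have bm: "(indicator {p. on_branch n j p} :: real \<times> real => ennreal) \<in> borel_measurable (fan_borel n)"
 proof (rule measurable_restrict_space1)
  show "(indicator {p. on_branch n j p} :: real \<times> real => ennreal) \<in> borel_measurable borel"
   by (rule borel_measurable_indicator[OF on_branch_sets])
 qed
 have "emeasure ?L A = (\<integral>\<^sup>+p. indicator {p. on_branch n j p} p * indicator A p \<partial>plancherel n)"
  by (rule emeasure_density) (use A bm in \<open>simp_all add: sets_plancherel\<close>)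
 also have "... = ennreal (1 / (2 * pi) ^ (n + 1)) * (\<integral>\<^sup>+ta. (\<Sum>i. of_nat ((i + n - 1) choose i) *
   (indicator {p. on_branch n j p} (\<bar>ta\<bar> * real (2 * i + n), ta) * indicator A (\<bar>ta\<bar> * real (2 * i + n), ta))) * ennreal (\<bar>ta\<bar> ^ n) \<partial>lborel)"
  by (rule nn_integral_plancherel) (intro borel_measurable_times_ennreal bm borel_measurable_indicator A)
 also have "... = ennreal (1 / (2 * pi) ^ (n + 1)) * (\<integral>\<^sup>+ta. ennreal (real ((j + n - 1) choose j) * \<bar>ta\<bar> ^ n) * indicator A (fb n j 1 ta) \<partial>lborel)"
 proof (intro arg_cong[where f = "\<lambda>x. ennreal (1 / (2 * pi) ^ (n + 1)) * x"] nn_integral_cong)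
  fix ta :: real
  show "(\<Sum>i. of_nat ((i + n - 1) choose i) *
   (indicator {p. on_branch n j p} (\<bar>ta\<bar> * real (2 * i + n), ta) * indicator A (\<bar>ta\<bar> * real (2 * i + n), ta))) * ennreal (\<bar>ta\<bar> ^ n) =
   ennreal (real ((j + n - 1) choose j) * \<bar>ta\<bar> ^ n) * indicator A (fb n j 1 ta)"
  proof (cases "ta = 0")
   case True then show ?thesis using n by (simp add: zero_power)
  next
   case False
   then have ob: "on_branch n j (\<bar>ta\<bar> * real (2 * i + n), ta) \<longleftrightarrow> i = j" for i
    by (auto simp: on_branch_def)
   have "(\<Sum>i. of_nat ((i + n - 1) choose i) *
     (indicator {p. on_branch n j p} (\<bar>ta\<bar> * real (2 * i + n), ta) * indicator A (\<bar>ta\<bar> * real (2 * i + n), ta))) =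
     (\<Sum>i\<in>{j}. of_nat ((i + n - 1) choose i) *
     (indicator {p. on_branch n j p} (\<bar>ta\<bar> * real (2 * i + n), ta) * indicator A (\<bar>ta\<bar> * real (2 * i + n), ta)) :: ennreal)"
   proof (rule suminf_finite)
    fix i assume "i \<notin> {j}"
    then have "i \<noteq> j" by simp
    then have "(indicator {p. on_branch n j p} (\<bar>ta\<bar> * real (2 * i + n), ta) :: ennreal) = 0"
     by (simp only: indicator_def mem_Collect_eq of_bool_eq_0_iff ob not_False_eq_True)
    then show "of_nat ((i + n - 1) choose i) *
     (indicator {p. on_branch n j p} (\<bar>ta\<bar> * real (2 * i + n), ta) * indicator A (\<bar>ta\<bar> * real (2 * i + n), ta)) = (0 :: ennreal)"
     by (simp only: mult_zero_left mult_zero_right)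
   qed simp
   also have "... = of_nat ((j + n - 1) choose j) * indicator A (fb n j 1 ta)"
   proof -
    have "(indicator {p. on_branch n j p} (\<bar>ta\<bar> * real (2 * j + n), ta) :: ennreal) = 1"
     by (simp only: indicator_def mem_Collect_eq ob) simp
    then show ?thesis
     by (simp only: fb_def mult_1_left sum.insert finite.emptyI empty_iff sum.empty add_0_right not_False_eq_True)
   qed
   finally show ?thesis
    by (simp add: ennreal_mult ennreal_of_nat_eq_real_of_nat mult_ac)
  qed
 qed
 also have "... = (\<integral>\<^sup>+ta. ennreal (pconst n j * \<bar>ta\<bar> ^ n) * indicator A (fb n j 1 ta) \<partial>lborel)"
  by (subst nn_integral_cmult[symmetric])
   (auto simp: pconst_def ennreal_mult[symmetric] mult.assoc[symmetric] intro!: nn_integral_cong)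
 also have "... = emeasure ?R A"
 proof -
  have fA: "fb n j 1 -` A \<in> sets borel" using measurable_sets[OF fbm A] by simp
  have "emeasure ?R A = emeasure (density lborel (\<lambda>ta. ennreal (pconst n j * \<bar>ta\<bar> ^ n))) (fb n j 1 -` A)"
   using fbm A by (subst emeasure_distr) auto
  also have "... = (\<integral>\<^sup>+ta. ennreal (pconst n j * \<bar>ta\<bar> ^ n) * indicator (fb n j 1 -` A) ta \<partial>lborel)"
   using fA by (subst emeasure_density) auto
  also have "... = (\<integral>\<^sup>+ta. ennreal (pconst n j * \<bar>ta\<bar> ^ n) * indicator A (fb n j 1 ta) \<partial>lborel)"
   by (intro nn_integral_cong) (auto simp: indicator_def)
  finally show ?thesis by simp
 qed
 finally show "emeasure ?L A = emeasure ?R A" .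
qed

lemma plancherel_branch:
 fixes h :: "real \<times> real => 'a::{banach, second_countable_topology}"
 assumes n: "n > 0" and h: "h \<in> borel_measurable (fan_borel n)"
  and off: "\<And>p. p \<in> fan n ==> \<not> on_branch n j p ==> h p = 0"
 shows "integrable (plancherel n) h \<longleftrightarrow> integrable lborel (\<lambda>ta. (pconst n j * \<bar>ta\<bar> ^ n) *\<^sub>R h (fb n j 1 ta))"
  and "(LINT p|plancherel n. h p) = (LBINT ta. (pconst n j * \<bar>ta\<bar> ^ n) *\<^sub>R h (fb n j 1 ta))"
proof -
 have fbm: "fb n j 1 \<in> borel \<rightarrow>\<^sub>M fan_borel n" by (rule fb_measurable) simp
 have hf: "(\<lambda>l. h (fb n j 1 l)) \<in> borel_measurable borel" by (rule comp_fb_measurable[OF h]) simp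
 have hp: "h \<in> borel_measurable (plancherel n)" using h by simp
 have bm: "(indicator {p. on_branch n j p} :: real \<times> real => real) \<in> borel_measurable (fan_borel n)"
 proof (rule measurable_restrict_space1)
  show "(indicator {p. on_branch n j p} :: real \<times> real => real) \<in> borel_measurable borel"
   by (rule borel_measurable_indicator[OF on_branch_sets])
 qed
 have bmp: "(indicator {p. on_branch n j p} :: real \<times> real => real) \<in> borel_measurable (plancherel n)" using bm by simp
 have off': "indicator {p. on_branch n j p} p *\<^sub>R h p = h p" if "p \<in> space (plancherel n)" for p
  using off[of p] that by (auto simp: space_plancherel indicator_def)
 have d: "density (plancherel n) (indicator {p. on_branch n j p}) = density (plancherel n) (\<lambda>p. ennreal (indicator {p. on_branch n j p} p))"
  by (simp add: ennreal_indicator)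
 have w: "pconst n j * \<bar>ta\<bar> ^ n \<ge> 0" for ta using pconst_pos[OF n, of j] by simp
 have "integrable (plancherel n) h \<longleftrightarrow> integrable (plancherel n) (\<lambda>p. indicator {p. on_branch n j p} p *\<^sub>R h p)"
  by (rule Bochner_Integration.integrable_cong) (simp_all add: off')
 also have "... \<longleftrightarrow> integrable (density (plancherel n) (\<lambda>p. ennreal (indicator {p. on_branch n j p} p))) h"
  by (rule integrable_density[symmetric]) (use hp bmp in auto)
 also have "... \<longleftrightarrow> integrable (density lborel (\<lambda>ta. ennreal (pconst n j * \<bar>ta\<bar> ^ n))) (\<lambda>ta. h (fb n j 1 ta))"
  unfolding d[symmetric] density_branch[OF n] by (rule integrable_distr_eq) (use fbm h in simp_all)
 also have "... \<longleftrightarrow> integrable lborel (\<lambda>ta. (pconst n j * \<bar>ta\<bar> ^ n) *\<^sub>R h (fb n j 1 ta))"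
  by (rule integrable_density) (use hf w in auto)
 finally show "integrable (plancherel n) h \<longleftrightarrow> integrable lborel (\<lambda>ta. (pconst n j * \<bar>ta\<bar> ^ n) *\<^sub>R h (fb n j 1 ta))" .
 have "(LINT p|plancherel n. h p) = (LINT p|plancherel n. indicator {p. on_branch n j p} p *\<^sub>R h p)"
  by (rule Bochner_Integration.integral_cong) (simp_all add: off')
 also have "... = integral\<^sup>L (density (plancherel n) (\<lambda>p. ennreal (indicator {p. on_branch n j p} p))) h"
  by (rule integral_density[symmetric]) (use hp bmp in auto)
 also have "... = integral\<^sup>L (density lborel (\<lambda>ta. ennreal (pconst n j * \<bar>ta\<bar> ^ n))) (\<lambda>ta. h (fb n j 1 ta))"
  unfolding d[symmetric] density_branch[OF n] by (rule integral_distr) (use fbm h in simp_all)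
 also have "... = (LBINT ta. (pconst n j * \<bar>ta\<bar> ^ n) *\<^sub>R h (fb n j 1 ta))"
  by (rule integral_density) (use hf w in auto)
 finally show "(LINT p|plancherel n. h p) = (LBINT ta. (pconst n j * \<bar>ta\<bar> ^ n) *\<^sub>R h (fb n j 1 ta))" .
qed

text \<open>The measure is an image of weighted copies of the line, so the ray at frequency 0
  carries no mass and a property may be checked on each branch off the origin.\<close>

lemma AE_plancherelI:
 assumes P: "Measurable.pred (fan_borel n) P"
  and ae: "\<And>j. AE ta in lborel. ta \<noteq> 0 --> P (fb n j 1 ta)" and n: "n > 0"
 shows "AE p in plancherel n. P p"
proof -
 define Nl where "Nl = {p \<in> fan n. \<not> P p}"
 have N [measurable]: "Nl \<in> sets (fan_borel n)"
 proof -
  have "{p \<in> space (fan_borel n). \<not> P p} \<in> sets (fan_borel n)" using P by measurable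
  then show ?thesis by (simp add: Nl_def space_restrict_space)
 qed
 have "emeasure (plancherel n) Nl = (\<integral>\<^sup>+p. indicator Nl p \<partial>plancherel n)"
  using N by (simp add: sets_plancherel)
 also have "... = ennreal (1 / (2 * pi) ^ (n + 1)) * (\<integral>\<^sup>+ta. (\<Sum>i. of_nat ((i + n - 1) choose i) *
   indicator Nl (\<bar>ta\<bar> * real (2 * i + n), ta)) * ennreal (\<bar>ta\<bar> ^ n) \<partial>lborel)"
  by (rule nn_integral_plancherel) (intro borel_measurable_indicator N)
 also have "(\<integral>\<^sup>+ta. (\<Sum>i. of_nat ((i + n - 1) choose i) *
   indicator Nl (\<bar>ta\<bar> * real (2 * i + n), ta)) * ennreal (\<bar>ta\<bar> ^ n) \<partial>lborel) = (\<integral>\<^sup>+ta. 0 \<partial>(lborel :: real measure))"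
 proof (rule nn_integral_cong_AE)
  have "AE ta in lborel. \<forall>j. ta \<noteq> 0 --> P (fb n j 1 ta)" unfolding AE_all_countable using ae by blast
  then show "AE ta in lborel. (\<Sum>i. of_nat ((i + n - 1) choose i) *
   indicator Nl (\<bar>ta\<bar> * real (2 * i + n), ta)) * ennreal (\<bar>ta\<bar> ^ n) = 0"
  proof eventually_elim
   case (elim ta)
   show ?case
   proof (cases "ta = 0")
    case True then show ?thesis using n by (simp add: zero_power)
   next
    case False
    then have "(indicator Nl (\<bar>ta\<bar> * real (2 * i + n), ta) :: ennreal) = 0" for i
     using elim by (simp add: Nl_def fb_def)
    then show ?thesis by simp
   qed
  qed
 qed
 finally have "emeasure (plancherel n) Nl = 0" by simp
 moreover have "{p \<in> space (plancherel n). \<not> P p} \<subseteq> Nl" by (simp add: space_plancherel Nl_def)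
 ultimately show ?thesis using N by (intro AE_I) (auto simp: sets_plancherel)
qed

text \<open>The image of a packet. The condition also admits the origin, but a profile supported in
  the open half line vanishes there.\<close>

definition pks :: "nat => real => (real => complex) => nat => real \<times> real => complex" where
 "pks n sg ps j p = (if fst p = \<bar>snd p\<bar> * real (2 * j + n) then ps (sg * snd p) else 0)"

lemma positive_support_zero:
 fixes ps :: "real => complex"
 assumes "support ps \<subseteq> {0<..}" "l \<le> 0"
 shows "ps l = 0"
proof -
 have "l \<notin> support ps" using assms by auto
 then show ?thesis by (rule not_in_support)
qed

lemma pks_measurable:
 assumes "test_fun ps"
 shows "pks n sg ps j \<in> borel_measurable (fan_borel n)"
proof (rule measurable_restrict_space1)
 have [measurable]: "ps \<in> borel_measurable borel" using assms by (simp add: smooth_measurable test_fun_smooth)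
 show "pks n sg ps j \<in> borel_measurable borel" 
 proof -
  have S: "{p :: real \<times> real. fst p = \<bar>snd p\<bar> * real (2 * j + n)} \<inter> space borel \<in> sets borel"
   by (auto intro!: borel_closed closed_Collect_eq continuous_intros)
  have "(\<lambda>p :: real \<times> real. ps (sg * snd p)) \<in> borel_measurable borel" by measurable
  from measurable_If_set[OF this measurable_const S, of 0] show ?thesis
   by (simp add: pks_def[abs_def])
 qed
qed

lemma pks_off_branch:
 assumes "support ps \<subseteq> {0<..}" "\<not> on_branch n j p"
 shows "pks n sg ps j p = 0"
 using assms(2) positive_support_zero[OF assms(1), of 0] by (auto simp: pks_def on_branch_def)

lemma integrable_const_mult_iff:
 fixes f :: "'a => complex"
 assumes "c \<noteq> 0"
 shows "integrable M (\<lambda>x. c * f x) \<longleftrightarrow> integrable M f"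
proof
 assume "integrable M (\<lambda>x. c * f x)"
 then have "integrable M (\<lambda>x. inverse c * (c * f x))" by (rule integrable_mult_right)
 then show "integrable M f" using assms by (simp add: mult.assoc[symmetric])
qed (rule integrable_mult_right)

text \<open>The substitution ta = sg * l brings both halves of a branch to an integral over positive
  l. Integrability is stated as an equivalence, because for transforms of integrable functions it is
  known first on the l side.\<close>

lemma pks_inner:
 fixes F :: "real \<times> real => complex"
 assumes n: "n > 0" and sg: "\<bar>sg\<bar> = 1" and ps: "test_fun ps" "support ps \<subseteq> {0<..}"
  and F: "F \<in> borel_measurable (fan_borel n)"
 shows "integrable (plancherel n) (\<lambda>p. F p * cnj (pks n sg ps j p)) \<longleftrightarrow>
   integrable lborel (\<lambda>l. of_real (\<bar>l\<bar> ^ n) * F (fb n j sg l) * cnj (ps l))"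
  and "l2_inner (plancherel n) F (pks n sg ps j) =
   of_real (pconst n j) * (LBINT l. of_real (\<bar>l\<bar> ^ n) * F (fb n j sg l) * cnj (ps l))"
proof -
 define h where "h p = F p * cnj (pks n sg ps j p)" for p
 have hm: "h \<in> borel_measurable (fan_borel n)" unfolding h_def using F pks_measurable[OF ps(1)] by measurable
 have off: "h p = 0" if "\<not> on_branch n j p" for p using pks_off_branch[OF ps(2) that] by (simp add: h_def)
 have s: "sg * sg = 1" "sg \<noteq> 0" using sg by (auto simp: abs_if split: if_splits)
 define g where "g ta = (pconst n j * \<bar>ta\<bar> ^ n) *\<^sub>R h (fb n j 1 ta)" for ta
 have "fb n j 1 (sg * l) = fb n j sg l" for l using sg by (simp add: fb_def abs_mult)
 moreover have "pks n sg ps j (fb n j sg l) = ps l" for l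
  using sg s by (simp add: pks_def fb_def abs_mult mult.assoc[symmetric])
 ultimately have g: "g (0 + sg * l) = of_real (pconst n j) * (of_real (\<bar>l\<bar> ^ n) * F (fb n j sg l) * cnj (ps l))" for l
  using sg by (simp add: g_def h_def scaleR_conv_of_real abs_mult)
 have "integrable (plancherel n) h \<longleftrightarrow> integrable lborel g" unfolding g_def
  by (rule plancherel_branch(1)[OF n hm]) (rule off)
 also have "... \<longleftrightarrow> integrable lborel (\<lambda>l. g (0 + sg * l))"
  using lborel_integrable_real_affine_iff[OF s(2), of g 0] by simp
 also have "... \<longleftrightarrow> integrable lborel (\<lambda>l. of_real (\<bar>l\<bar> ^ n) * F (fb n j sg l) * cnj (ps l))"
  unfolding g using pconst_pos[OF n, of j] by (intro integrable_const_mult_iff) auto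
 finally show "integrable (plancherel n) (\<lambda>p. F p * cnj (pks n sg ps j p)) \<longleftrightarrow>
   integrable lborel (\<lambda>l. of_real (\<bar>l\<bar> ^ n) * F (fb n j sg l) * cnj (ps l))" unfolding h_def .
 have "l2_inner (plancherel n) F (pks n sg ps j) = (LBINT ta. g ta)" unfolding l2_inner_def g_def h_def[symmetric]
  by (rule plancherel_branch(2)[OF n hm]) (rule off)
 also have "... = \<bar>sg\<bar> *\<^sub>R (LBINT l. g (0 + sg * l))" by (rule lborel_integral_real_affine) (rule s(2))
 also have "... = of_real (pconst n j) * (LBINT l. of_real (\<bar>l\<bar> ^ n) * F (fb n j sg l) * cnj (ps l))"
  unfolding g sg by simp
 finally show "l2_inner (plancherel n) F (pks n sg ps j) =
   of_real (pconst n j) * (LBINT l. of_real (\<bar>l\<bar> ^ n) * F (fb n j sg l) * cnj (ps l))" .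
qed

lemma smooth_abs_power_mult:
 assumes "test_fun ps" "support ps \<subseteq> {0<..}"
 shows "(\<lambda>l. of_real (\<bar>l\<bar> ^ n) * ps l) = (\<lambda>l. of_real l ^ n * ps l)"
proof (rule ext)
 fix l
 show "of_real (\<bar>l\<bar> ^ n) * ps l = of_real l ^ n * ps l"
  using positive_support_zero[OF assms(2), of l] by (cases "l \<le> 0") auto
qed

lemma pks_L2:
 assumes n: "n > 0" and sg: "\<bar>sg\<bar> = 1" and ps: "test_fun ps" "support ps \<subseteq> {0<..}"
 shows "pks n sg ps j \<in> L2_fun (plancherel n)"
proof (rule L2_funI)
 have m: "pks n sg ps j \<in> borel_measurable (fan_borel n)" by (rule pks_measurable[OF ps(1)])
 then show "pks n sg ps j \<in> borel_measurable (plancherel n)" by simp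
 have s: "sg * sg = 1" using sg by (auto simp: abs_if split: if_splits)
 have p: "pks n sg ps j (fb n j sg l) = ps l" for l
  using sg s by (simp add: pks_def fb_def abs_mult mult.assoc[symmetric])
 have "integrable lborel (\<lambda>l. (of_real l ^ n * ps l) * cnj (ps l))"
  by (intro test_fun_integrable_lborel test_fun_mult_smooth test_fun_mult_power ps smooth_cnj test_fun_smooth)
 then have "integrable lborel (\<lambda>l. of_real (\<bar>l\<bar> ^ n) * pks n sg ps j (fb n j sg l) * cnj (ps l))"
  unfolding p smooth_abs_power_mult[OF ps, THEN fun_cong] .
 then have "integrable (plancherel n) (\<lambda>p. pks n sg ps j p * cnj (pks n sg ps j p))"
  using pks_inner(1)[OF n sg ps m, of j] by simp
 then have "integrable (plancherel n) (\<lambda>p. complex_of_real ((cmod (pks n sg ps j p))^2))"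
  by (simp only: complex_norm_square)
 then show "integrable (plancherel n) (\<lambda>p. (cmod (pks n sg ps j p))^2)" by (simp only: complex_of_real_integrable_eq)
qed

lemma transform_fb:
 fixes f :: "'n::finite heis => complex"
 assumes "l \<noteq> 0" "\<bar>sg\<bar> = 1"
 shows "spherical_transform f (fb CARD('n) j sg l) =
  (LBINT x. f x * (exp (- (\<i> * of_real (sg * l * snd x))) * of_real (lf CARD('n) j (\<bar>l\<bar> * (norm (fst x))^2 / 2))))"
proof -
 have "sg * l \<noteq> 0" using assms by auto
 from transform_at_fan[OF this, of f j] show ?thesis using assms by (simp add: fb_def abs_mult)
qed

text \<open>Fubini for f x times the packet written as an integral over l. Only integrability of f
  is used: at this stage nothing is known about square-integrability of its transform.\<close>

lemma pk_pairing:
 fixes f :: "'n::finite heis => complex"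
 assumes sg: "\<bar>sg\<bar> = 1" and ps: "test_fun ps" "support ps \<subseteq> {0<..}" and f: "integrable lborel f"
 shows "l2_inner lborel f (pk sg ps j) = l2_inner (plancherel CARD('n)) (spherical_transform f) (pks CARD('n) sg ps j)"
  and "integrable (plancherel CARD('n)) (\<lambda>p. spherical_transform f p * cnj (pks CARD('n) sg ps j p))"
proof -
 define n where "n = CARD('n)"
 have n: "n > 0" by (simp add: n_def)
 have fm [measurable]: "f \<in> borel_measurable borel" using f by auto
 have [measurable]: "ps \<in> borel_measurable borel" using ps by (simp add: smooth_measurable test_fun_smooth)
 obtain B where B: "\<And>y. y \<ge> 0 ==> \<bar>lf n j y\<bar> \<le> B" using lf_bounded by blast
 \<comment> \<open>K is the conjugate of the packet's integrand; integrated against f in x it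
   becomes the transform of f on the half branch, and integrated in l it becomes the conjugate
   packet.\<close>
 define K where "K x l = cnj (ps l) * of_real (\<bar>l\<bar> ^ n) * (exp (- (\<i> * of_real (sg * l * snd x))) * of_real (lf n j (\<bar>l\<bar> * (norm (fst x))^2 / 2)))"
  for x :: "'n heis" and l
 have Gm: "spherical_transform f \<in> borel_measurable (fan_borel n)"
  by (rule measurable_restrict_space1[OF transform_measurable[OF fm]])
 have psn: "integrable lborel (\<lambda>l. of_real l ^ n * ps l)"
  by (intro test_fun_integrable_lborel test_fun_mult_power ps)
 have fub: "integrable (lborel \<Otimes>\<^sub>M lborel) (\<lambda>(x, l). f x * K x l)"
 proof (rule integrable_product_bounded[OF _ _ f psn, where C = B])
  have "(\<lambda>(x, l). f x * K x l) \<in> borel_measurable ((borel :: 'n heis measure) \<Otimes>\<^sub>M (borel :: real measure))"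
   unfolding K_def by measurable
  then show "(\<lambda>(x, l). f x * K x l) \<in> borel_measurable ((lborel :: 'n heis measure) \<Otimes>\<^sub>M (lborel :: real measure))" unfolding lborel_pair_measurable .
  fix x :: "'n heis" and l :: real
  have "cmod (f x * K x l) = cmod (f x) * (cmod (ps l) * \<bar>l\<bar> ^ n) * \<bar>lf n j (\<bar>l\<bar> * (norm (fst x))^2 / 2)\<bar>"
   by (simp add: K_def norm_mult norm_power norm_exp_eq_Re)
  also have "... \<le> cmod (f x) * (cmod (ps l) * \<bar>l\<bar> ^ n) * B"
   by (intro mult_left_mono B) auto
  also have "... = B * (cmod (f x) * cmod (of_real l ^ n * ps l))" by (simp add: norm_mult norm_power)
  finally show "cmod (case (x, l) of (x, l) => f x * K x l) \<le> B * (cmod (f x) * cmod (of_real l ^ n * ps l))" by simp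
 qed (simp_all add: lborel.sigma_finite_measure_axioms)
 have fst_int: "(LBINT x. f x * K x l) = of_real (\<bar>l\<bar> ^ n) * spherical_transform f (fb n j sg l) * cnj (ps l)" for l
 proof (cases "l = 0")
  case True then show ?thesis using n by (simp add: K_def zero_power)
 next
  case False
  show ?thesis unfolding n_def transform_fb[OF False sg]
   by (simp add: K_def n_def mult_ac flip: integral_mult_right_zero)
 qed
 have "integrable lborel (\<lambda>l. LBINT x. f x * K x l)"
  using lborel_pair.integrable_snd[of "\<lambda>x l. f x * K x l"] fub by simp
 then show "integrable (plancherel CARD('n)) (\<lambda>p. spherical_transform f p * cnj (pks CARD('n) sg ps j p))"
  using pks_inner(1)[OF n sg ps Gm, of j] unfolding fst_int n_def by simp
 have "l2_inner lborel f (pk sg ps j) = (LBINT x. of_real (pconst n j) * (LBINT l. f x * K x l))"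
  unfolding l2_inner_def
 proof (intro Bochner_Integration.integral_cong refl)
  fix x :: "'n heis"
  define u where "u = (norm (fst x))^2"
  have "cnj (pk sg ps j x) = of_real (pconst n j) * (LBINT l. cnj (ps l * of_real (l ^ n * lf n j (l * u / 2)) * iexp (l * (sg * snd x))))"
   unfolding pk_integral[OF ps(1)] ft_def n_def[symmetric] u_def[symmetric] Bochner_Integration.integral_cnj by simp
  also have "(LBINT l. cnj (ps l * of_real (l ^ n * lf n j (l * u / 2)) * iexp (l * (sg * snd x)))) = (LBINT l. K x l)"
  proof (intro Bochner_Integration.integral_cong refl)
   fix l
   show "cnj (ps l * of_real (l ^ n * lf n j (l * u / 2)) * iexp (l * (sg * snd x))) = K x l"
   proof (cases "l \<le> 0")
    case True
    then have "ps l = 0" by (rule positive_support_zero[OF ps(2)])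
    then show ?thesis by (simp add: K_def)
   next
    case False
    then show ?thesis by (simp add: K_def u_def exp_cnj mult_ac)
   qed
  qed
  finally have "f x * cnj (pk sg ps j x) = of_real (pconst n j) * (f x * (LBINT l. K x l))" by simp
  also have "f x * (LBINT l. K x l) = (LBINT l. f x * K x l)" by simp
  finally show "f x * cnj (pk sg ps j x) = of_real (pconst n j) * (LBINT l. f x * K x l)" .
 qed
 also have "... = of_real (pconst n j) * (LBINT x. LBINT l. f x * K x l)" by simp
 also have "(LBINT x. LBINT l. f x * K x l) = (LBINT l. LBINT x. f x * K x l)"
  using lborel_pair.Fubini_integral[of "\<lambda>x l. f x * K x l"] fub by simp
 also have "of_real (pconst n j) * (LBINT l. LBINT x. f x * K x l) = l2_inner (plancherel n) (spherical_transform f) (pks n sg ps j)"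
  unfolding fst_int pks_inner(2)[OF n sg ps Gm] ..
 finally show "l2_inner lborel f (pk sg ps j) = l2_inner (plancherel CARD('n)) (spherical_transform f) (pks CARD('n) sg ps j)"
  by (simp add: n_def)
qed

text \<open>The linear span of the pairs (packet, image), as a relation that carries a function and
  its transform together.\<close>

inductive packet :: "('n::finite heis => complex) => (real \<times> real => complex) => bool" where
 gen: "\<bar>sg\<bar> = 1 ==> test_fun ps ==> support ps \<subseteq> {0<..} ==> packet (pk sg ps j) (pks CARD('n) sg ps j)"
| add: "packet s t ==> packet s' t' ==> packet (\<lambda>x. s x + s' x) (\<lambda>p. t p + t' p)"
| scale: "packet s t ==> packet (\<lambda>x. c * s x) (\<lambda>p. c * t p)"

lemma fold_dir_deriv_add:
 "smooth f ==> smooth g ==> fold dir_deriv vs (\<lambda>x. f x + g x) = (\<lambda>x. fold dir_deriv vs f x + fold dir_deriv vs g x)"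
proof (induction vs arbitrary: f g)
 case (Cons v vs)
 have "dir_deriv v (\<lambda>x. f x + g x) = (\<lambda>x. dir_deriv v f x + dir_deriv v g x)"
  using dir_deriv_add[OF Cons.prems] by auto
 then show ?case using Cons.IH[OF smooth_dir_deriv smooth_dir_deriv, OF Cons.prems] by simp
qed simp

lemma fold_dir_deriv_scale:
 "smooth f ==> fold dir_deriv vs (\<lambda>x. c * f x) = (\<lambda>x. c * fold dir_deriv vs f x)"
proof (induction vs arbitrary: f)
 case (Cons v vs)
 have "dir_deriv v (\<lambda>x. c * f x) = (\<lambda>x. c * dir_deriv v f x)"
  using dir_deriv_scale[OF Cons.prems] by auto
 then show ?case using Cons.IH[OF smooth_dir_deriv, OF Cons.prems] by simp
qed simp

lemma bounded_range_bound:
 "bounded (range (\<lambda>x. norm x ^ m * cmod (g x))) ==> \<exists>B. \<forall>x. norm x ^ m * cmod (g x) \<le> B"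
 by (auto simp: bounded_iff abs_mult)

lemma schwartz_add: "schwartz f ==> schwartz g ==> schwartz (\<lambda>x. f x + g x)"
 unfolding schwartz_def
proof (elim conjE, intro conjI allI)
 assume f: "smooth f" "\<forall>m vs. bounded (range (\<lambda>x. norm x ^ m * cmod (fold dir_deriv vs f x)))"
  and g: "smooth g" "\<forall>m vs. bounded (range (\<lambda>x. norm x ^ m * cmod (fold dir_deriv vs g x)))"
 show "smooth (\<lambda>x. f x + g x)" by (rule smooth_add[OF f(1) g(1)])
 fix m vs
 obtain A B where A: "\<And>x. norm x ^ m * cmod (fold dir_deriv vs f x) \<le> A" and B: "\<And>x. norm x ^ m * cmod (fold dir_deriv vs g x) \<le> B"
  using bounded_range_bound[OF f(2)[rule_format, of m vs]] bounded_range_bound[OF g(2)[rule_format, of m vs]] by blast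
 have "norm (norm x ^ m * cmod (fold dir_deriv vs f x + fold dir_deriv vs g x)) \<le> A + B" for x
 proof -
  have "norm (norm x ^ m * cmod (fold dir_deriv vs f x + fold dir_deriv vs g x)) =
    norm x ^ m * cmod (fold dir_deriv vs f x + fold dir_deriv vs g x)" by (simp add: abs_mult)
  also have "... \<le> norm x ^ m * (cmod (fold dir_deriv vs f x) + cmod (fold dir_deriv vs g x))"
   by (intro mult_left_mono norm_triangle_ineq) auto
  also have "... \<le> A + B" using A[of x] B[of x] by (simp add: distrib_left)
  finally show ?thesis .
 qed
 then show "bounded (range (\<lambda>x. norm x ^ m * cmod (fold dir_deriv vs (\<lambda>x. f x + g x) x)))"
  unfolding fold_dir_deriv_add[OF f(1) g(1)] bounded_iff by blast
qed

lemma schwartz_scale: "schwartz f ==> schwartz (\<lambda>x. c * f x)"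
 unfolding schwartz_def
proof (elim conjE, intro conjI allI)
 assume f: "smooth f" "\<forall>m vs. bounded (range (\<lambda>x. norm x ^ m * cmod (fold dir_deriv vs f x)))"
 show "smooth (\<lambda>x. c * f x)" by (intro smooth_mult smooth_const f)
 fix m vs
 obtain A where A: "\<And>x. norm x ^ m * cmod (fold dir_deriv vs f x) \<le> A"
  using bounded_range_bound[OF f(2)[rule_format, of m vs]] by blast
 have "norm (norm x ^ m * cmod (c * fold dir_deriv vs f x)) \<le> cmod c * A" for x
  using mult_left_mono[OF A[of x], of "cmod c"] by (simp add: norm_mult abs_mult mult_ac)
 then show "bounded (range (\<lambda>x. norm x ^ m * cmod (fold dir_deriv vs (\<lambda>x. c * f x) x)))"
  unfolding fold_dir_deriv_scale[OF f(1)] bounded_iff by blast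
qed

lemma packet_schwartz_rad: "packet s t ==> s \<in> schwartz_rad"
proof (induction rule: packet.induct)
 case (gen sg ps j) then show ?case by (rule pk_schwartz_rad)
qed (auto simp: schwartz_rad_def intro: schwartz_add schwartz_scale)

lemma schwartz_rad_integrable: "f \<in> schwartz_rad ==> integrable lborel f" "f \<in> schwartz_rad ==> f \<in> L2_fun lborel"
 by (auto simp: schwartz_rad_def intro: schwartz_integrable)

lemma packet_L2: "packet (s :: 'n::finite heis => complex) t ==> t \<in> L2_fun (plancherel CARD('n))"
 by (induction rule: packet.induct) (auto intro: pks_L2 L2_fun_add L2_fun_scale)

lemma schwartz_mult_integrable:
 assumes f: "integrable lborel f" and s: "schwartz s"
 shows "integrable lborel (\<lambda>x. f x * cnj (s x))"
proof -
 obtain B where B: "\<And>x. cmod (s x) \<le> B"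
  using s[unfolded schwartz_def, THEN conjunct2, rule_format, of 0 "[]"] unfolding bounded_iff by auto
 have [measurable]: "s \<in> borel_measurable borel" using s by (simp add: schwartz_def smooth_measurable)
 have [measurable]: "f \<in> borel_measurable borel" using f by auto
 show ?thesis by (rule integrable_mult_bounded[OF f, where B = B]) (use B in auto)
qed

lemma packet_pairing:
 fixes f :: "'n::finite heis => complex"
 assumes f: "integrable lborel f" and "packet s t"
 shows "l2_inner lborel f s = l2_inner (plancherel CARD('n)) (spherical_transform f) t \<and>
  integrable (plancherel CARD('n)) (\<lambda>p. spherical_transform f p * cnj (t p))"
 using assms(2)
proof (induction rule: packet.induct)
 case (gen sg ps j) then show ?case using pk_pairing f by blast
next
 case (add s t s' t')
 have "integrable lborel (\<lambda>x. f x * cnj (s x))" "integrable lborel (\<lambda>x. f x * cnj (s' x))"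
  using packet_schwartz_rad[OF add.hyps(1)] packet_schwartz_rad[OF add.hyps(2)] f
  by (auto simp: schwartz_rad_def intro: schwartz_mult_integrable)
 then show ?case using add.IH by (simp add: l2_inner_def distrib_left)
next
 case (scale s t c)
 have "integrable (plancherel CARD('n)) (\<lambda>p. cnj c * (spherical_transform f p * cnj (t p)))"
  using scale.IH by (intro integrable_mult_right) auto
 then show ?case using scale.IH by (simp add: l2_inner_scale_right mult_ac)
qed

lemma packet_transform:
 assumes "packet (s :: 'n::finite heis => complex) t" "ta \<noteq> 0"
 shows "spherical_transform s (fb CARD('n) i 1 ta) = t (fb CARD('n) i 1 ta)"
 using assms(1)
proof (induction rule: packet.induct)
 case (gen sg ps j)
 then show ?case using pk_transform[OF gen assms(2), of j i] assms(2)
  by (auto simp: fb_def pks_def)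
next
 case (add s t s' t')
 have i: "integrable lborel (\<lambda>x. s x * (exp (- (\<i> * of_real (1 * ta * snd x))) * of_real (lf CARD('n) i (\<bar>ta\<bar> * (norm (fst x))^2 / 2))))"
  if "packet s t" for s :: "'n heis => complex" and t
 proof -
  obtain B where B: "\<And>y. y \<ge> 0 ==> \<bar>lf CARD('n) i y\<bar> \<le> B" using lf_bounded by blast
  have si: "integrable lborel s" using packet_schwartz_rad[OF that] by (rule schwartz_rad_integrable)
  then have [measurable]: "s \<in> borel_measurable borel" by auto
  show ?thesis by (rule integrable_mult_bounded[OF si, where B = B]) (auto simp: norm_mult norm_exp_eq_Re B)
 qed
 have "spherical_transform (\<lambda>x. s x + s' x) (fb CARD('n) i 1 ta) =
   spherical_transform s (fb CARD('n) i 1 ta) + spherical_transform s' (fb CARD('n) i 1 ta)"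
  unfolding transform_fb[OF assms(2) abs_one] distrib_right
  by (rule Bochner_Integration.integral_add[OF i[OF add.hyps(1)] i[OF add.hyps(2)]])
 then show ?case using add.IH by simp
next
 case (scale s t c)
 then show ?case unfolding transform_fb[OF assms(2) abs_one] by (simp add: mult.assoc)
qed

lemma packet_transform_AE:
 assumes "packet (s :: 'n::finite heis => complex) t"
 shows "AE p in plancherel CARD('n). spherical_transform s p = t p"
proof (rule AE_plancherelI)
 have "s \<in> borel_measurable borel" using schwartz_rad_integrable(1)[OF packet_schwartz_rad[OF assms]] by auto
 then have "spherical_transform s \<in> borel_measurable (fan_borel CARD('n))"
  by (intro measurable_restrict_space1 transform_measurable)
 moreover have "t \<in> borel_measurable (fan_borel CARD('n))" using packet_L2[OF assms] by (simp add: L2_fun_def)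
 ultimately show "Measurable.pred (fan_borel CARD('n)) (\<lambda>p. spherical_transform s p = t p)" by measurable
 show "AE ta in lborel. ta \<noteq> 0 --> spherical_transform s (fb CARD('n) j 1 ta) = t (fb CARD('n) j 1 ta)" for j
  using packet_transform[OF assms] by (intro AE_I2) auto
qed simp

text \<open>The isometry costs nothing beyond the pairing formula: paired with itself, s gives the
  pairing of its transform with t, and the transform is t almost everywhere.\<close>

interpretation pkt: L2_isometry "lborel :: 'n::finite heis measure" "plancherel CARD('n)" packet
proof
 fix s :: "'n heis => complex" and t assume st: "packet s t"
 show s: "s \<in> L2_fun lborel" by (rule schwartz_rad_integrable[OF packet_schwartz_rad[OF st]])
 show t: "t \<in> L2_fun (plancherel CARD('n))" by (rule packet_L2[OF st])
 have si: "integrable lborel s" by (rule schwartz_rad_integrable[OF packet_schwartz_rad[OF st]])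
 have "spherical_transform s \<in> borel_measurable (fan_borel CARD('n))"
  using si by (intro measurable_restrict_space1 transform_measurable) auto
 then have "l2_inner (plancherel CARD('n)) (spherical_transform s) t = l2_inner (plancherel CARD('n)) t t"
  using t by (intro l2_inner_cong_AE packet_transform_AE[OF st]) (auto simp: L2_fun_def)
 then have "l2_inner lborel s s = l2_inner (plancherel CARD('n)) t t"
  using packet_pairing[OF si st] by simp
 then have "(L2_norm lborel s)^2 = (L2_norm (plancherel CARD('n)) t)^2"
  unfolding l2_inner_self of_real_eq_iff .
 then show "L2_norm lborel s = L2_norm (plancherel CARD('n)) t" by simp
 show "packet (\<lambda>x. c * s x) (\<lambda>y. c * t y)" for c using st by (rule packet.scale)
next
 have "packet (pk 1 (\<lambda>l. 0) 0 :: 'n heis => complex) (pks CARD('n) 1 (\<lambda>l. 0) 0)"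
  by (rule packet.gen) (auto simp: support_def)
 from packet.scale[OF this, of 0] show "packet (\<lambda>_ :: 'n heis. 0) (\<lambda>_. 0)" by simp
qed (rule packet.add)

text \<open>A weak form of local integrability along the branches. It covers square-integrable
  functions, transforms of integrable functions, and xi times a square-integrable function, so that
  all of these can be compared through their pairings with packets.\<close>

definition loc_int :: "nat => (real \<times> real => complex) => bool" where
 "loc_int n F \<longleftrightarrow> F \<in> borel_measurable (fan_borel n) \<and>
   (\<forall>sg ps j. \<bar>sg\<bar> = 1 --> test_fun ps --> support ps \<subseteq> {0<..} -->
    integrable (plancherel n) (\<lambda>p. F p * cnj (pks n sg ps j p)))"

lemma loc_int_diff: "loc_int n F ==> loc_int n G ==> loc_int n (\<lambda>p. F p - G p)"
 by (simp add: loc_int_def left_diff_distrib borel_measurable_diff)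

lemma loc_int_L2: "n > 0 ==> F \<in> L2_fun (plancherel n) ==> loc_int n F"
 unfolding loc_int_def by (auto intro!: L2_inner_integrable pks_L2) (simp add: L2_fun_def)

lemma loc_int_transform:
 fixes f :: "'n::finite heis => complex"
 assumes "integrable lborel f"
 shows "loc_int CARD('n) (spherical_transform f)"
 unfolding loc_int_def using assms
 by (auto intro!: measurable_restrict_space1 transform_measurable pk_pairing(2))

text \<open>A bump that is positive on the box has a positive minimum there by compactness; divided
  by this minimum it dominates the indicator of the box.\<close>

lemma loc_int_cbox:
 fixes a b :: real
 assumes n: "n > 0" and F: "loc_int n F" and sg: "\<bar>sg\<bar> = 1" and ab: "cbox a b \<subseteq> {0<..}"
 shows "integrable lborel (\<lambda>l. indicator (cbox a b) l *\<^sub>R (of_real (\<bar>l\<bar> ^ n) * F (fb n j sg l)))"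
proof (cases "cbox a b = {}")
 case False
 have Fm: "F \<in> borel_measurable (fan_borel n)" using F by (simp add: loc_int_def)
 have [measurable]: "(\<lambda>l. F (fb n j sg l)) \<in> borel_measurable borel" by (rule comp_fb_measurable[OF Fm sg])
 have a: "0 < a" "a \<le> b" using False ab by auto
 obtain ph :: "real => real" where ph: "test_fun (\<lambda>x. complex_of_real (ph x))"
  "support (\<lambda>x. complex_of_real (ph x)) \<subseteq> cbox (a / 2) (b + 1)" "\<And>x. 0 < ph x \<longleftrightarrow> x \<in> box (a / 2) (b + 1)"
  by (rule box_bump_exists[of "a / 2" "b + 1"]) blast
 have "continuous_on (cbox a b) (\<lambda>x. Re (of_real (ph x)))"
  by (intro continuous_intros smooth_continuous test_fun_smooth ph(1))
 then obtain x0 where x0: "x0 \<in> cbox a b" "\<And>y. y \<in> cbox a b ==> ph x0 \<le> ph y"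
  using continuous_attains_inf[OF compact_cbox False, of ph] by auto
 have m: "ph x0 > 0" using x0(1) a ph(3) by auto
 have "support (\<lambda>x. complex_of_real (ph x)) \<subseteq> {0<..}" using ph(2) a by force
 then have "integrable lborel (\<lambda>l. of_real (\<bar>l\<bar> ^ n) * F (fb n j sg l) * cnj (of_real (ph l)))"
  using F sg ph(1) pks_inner(1)[OF n sg ph(1) _ Fm, of j] unfolding loc_int_def by blast
 then show ?thesis
 proof (rule Bochner_Integration.integrable_bound[OF integrable_mult_right[of "of_real (1 / ph x0)"]])
  show "AE l in lborel. norm (indicator (cbox a b) l *\<^sub>R (of_real (\<bar>l\<bar> ^ n) * F (fb n j sg l))) \<le>
    norm (of_real (1 / ph x0) * (of_real (\<bar>l\<bar> ^ n) * F (fb n j sg l) * cnj (of_real (ph l))))"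
  proof (rule AE_I2)
   fix l
   define X where "X = cmod (of_real (\<bar>l\<bar> ^ n) * F (fb n j sg l))"
   have "indicator (cbox a b) l * X \<le> \<bar>ph l\<bar> / ph x0 * X"
    using x0(2)[of l] m by (intro mult_right_mono) (auto simp: X_def indicator_def)
   then show "norm (indicator (cbox a b) l *\<^sub>R (of_real (\<bar>l\<bar> ^ n) * F (fb n j sg l))) \<le>
    norm (of_real (1 / ph x0) * (of_real (\<bar>l\<bar> ^ n) * F (fb n j sg l) * cnj (of_real (ph l))))"
    using m unfolding norm_scaleR norm_mult[of "of_real (1 / ph x0)"] norm_mult[of _ "cnj _"] X_def[symmetric]
    by (simp add: norm_divide mult_ac)
  qed
 qed measurable
qed simp

text \<open>On each half branch the packet images run through the test functions in l, up to
  conjugation and the positive constant \<open>pconst\<close>, so the fundamental lemma in one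
  variable applies.\<close>

lemma packet_total_dual:
 assumes n: "n > 0" and F: "loc_int n F"
  and zero: "\<And>sg ps j. \<bar>sg\<bar> = 1 ==> test_fun ps ==> support ps \<subseteq> {0<..} ==> support ps \<subseteq> U j ==>
   l2_inner (plancherel n) F (pks n sg ps j) = 0"
  and U: "\<And>j. open (U j)"
 shows "AE p in plancherel n. (\<forall>j. on_branch n j p --> \<bar>snd p\<bar> \<in> U j) --> F p = 0"
proof (rule AE_plancherelI[OF _ _ n])
 have Fm: "F \<in> borel_measurable (fan_borel n)" using F by (simp add: loc_int_def)
 have m: "Measurable.pred (fan_borel n) (\<lambda>p. \<forall>j. on_branch n j p --> \<bar>snd p\<bar> \<in> U j)"
 proof (rule measurable_restrict_space1)
  have [measurable]: "U j \<in> sets borel" for j using U by auto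
  have [measurable]: "Measurable.pred borel (on_branch n j)" for j
   using on_branch_sets[of n j] by (simp add: pred_def)
  show "Measurable.pred borel (\<lambda>p :: real \<times> real. \<forall>j. on_branch n j p --> \<bar>snd p\<bar> \<in> U j)"
   by measurable
 qed
 then show "Measurable.pred (fan_borel n) (\<lambda>p. (\<forall>j. on_branch n j p --> \<bar>snd p\<bar> \<in> U j) --> F p = 0)"
  using Fm by measurable
 fix j
 have half: "AE l in lborel. l \<in> {0<..} \<inter> U j --> of_real (\<bar>l\<bar> ^ n) * F (fb n j sg l) = 0" if sg: "\<bar>sg\<bar> = 1" for sg
 proof (rule fundamental_lemma)
  show "(\<lambda>l. of_real (\<bar>l\<bar> ^ n) * F (fb n j sg l)) \<in> borel_measurable borel"
   using comp_fb_measurable[OF Fm sg] by measurable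
  show "open ({0<..} \<inter> U j)" using U by auto
  show "integrable lborel (\<lambda>l. indicator (cbox a b) l *\<^sub>R (of_real (\<bar>l\<bar> ^ n) * F (fb n j sg l)))" if "cbox a b \<subseteq> {0<..} \<inter> U j" for a b
   using that by (intro loc_int_cbox n F sg) auto
  fix ph assume ph: "test_fun ph" "support ph \<subseteq> {0<..} \<inter> U j"
  have c: "test_fun (\<lambda>l. cnj (ph l))" "support (\<lambda>l. cnj (ph l)) \<subseteq> {0<..}" "support (\<lambda>l. cnj (ph l)) \<subseteq> U j"
   using ph test_fun_cnj by (auto simp: support_def)
  have "of_real (pconst n j) * (LBINT l. of_real (\<bar>l\<bar> ^ n) * F (fb n j sg l) * ph l) = 0"
   using zero[OF sg c] pks_inner(2)[OF n sg c(1,2) Fm, of j] by simp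
  then show "(LBINT l. of_real (\<bar>l\<bar> ^ n) * F (fb n j sg l) * ph l) = 0"
   using pconst_pos[OF n, of j] by simp
 qed (simp_all add: lborel.sigma_finite_measure_axioms)
 \<comment> \<open>The statement for sg = -1 is pulled back along reflection, which preserves
   Lebesgue measure and takes the negative half of the branch to positive l.\<close>
 have "AE l in lborel. - l \<in> {0<..} \<inter> U j --> of_real (\<bar>l\<bar> ^ n) * F (fb n j (-1) (- l)) = 0"
 proof -
  have [measurable]: "U j \<in> sets borel" using U by auto
  have [measurable]: "(\<lambda>l. F (fb n j (-1) l)) \<in> borel_measurable borel" by (rule comp_fb_measurable[OF Fm]) simp
  have "AE x in distr lborel borel uminus. x \<in> {0<..} \<inter> U j --> complex_of_real (\<bar>x\<bar> ^ n) * F (fb n j (-1) x) = 0"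
   unfolding lborel_distr_uminus by (rule half) simp
  moreover have "{x \<in> space borel. x \<in> {0<..} \<inter> U j --> complex_of_real (\<bar>x\<bar> ^ n) * F (fb n j (-1) x) = 0} \<in> sets borel"
   by measurable
  ultimately have "AE l in lborel. - l \<in> {0<..} \<inter> U j --> complex_of_real (\<bar>- l\<bar> ^ n) * F (fb n j (-1) (- l)) = 0"
   by (subst (asm) AE_distr_iff) auto
  then show ?thesis by (simp only: abs_minus_cancel)
 qed
 with half[OF abs_one] show "AE ta in lborel. ta \<noteq> 0 --> ((\<forall>i. on_branch n i (fb n j 1 ta) --> \<bar>snd (fb n j 1 ta)\<bar> \<in> U i) --> F (fb n j 1 ta) = 0)"
 proof eventually_elim
  case (elim ta)
  show ?case
  proof (intro impI)
   assume ta: "ta \<noteq> 0" and u: "\<forall>i. on_branch n i (fb n j 1 ta) --> \<bar>snd (fb n j 1 ta)\<bar> \<in> U i"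
   have "\<bar>ta\<bar> \<in> U j" using u[rule_format, of j] ta by (simp add: on_branch_def fb_def)
   then show "F (fb n j 1 ta) = 0"
    using elim ta by (cases "ta > 0") (auto simp: fb_def)
  qed
 qed
qed

text \<open>Passes from indicators of sets of values of X to functions of X: simple functions
  dominated by 2 |ph| approximate ph.\<close>

lemma integral_zero_compose:
 fixes w :: "'a => complex" and ph :: "'b => complex"
 assumes w: "integrable M w" and X: "X \<in> M \<rightarrow>\<^sub>M N" and ph: "ph \<in> borel_measurable N"
  and int: "integrable M (\<lambda>x. w x * ph (X x))"
  and zero: "\<And>B. B \<in> sets N ==> (LINT x|M. indicator B (X x) *\<^sub>R w x) = 0"
 shows "(LINT x|M. w x * ph (X x)) = 0"
proof -
 have wm [measurable]: "w \<in> borel_measurable M" using w by auto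
 obtain S where S: "\<And>i. simple_function N (S i)"
  and lim: "\<And>y. y \<in> space N ==> (\<lambda>i. S i y) \<longlonglongrightarrow> ph y"
  and bd: "\<And>i y. y \<in> space N ==> dist (S i y) 0 \<le> 2 * dist (ph y) 0"
  using borel_measurable_implies_sequence_metric[OF ph, of 0] by blast
 have iB: "integrable M (\<lambda>x. indicator B (X x) *\<^sub>R w x)" if "B \<in> sets N" for B
 proof -
  have "integrable M (\<lambda>x. indicator (X -` B \<inter> space M) x *\<^sub>R w x)"
   using measurable_sets[OF X that] w by (rule integrable_mult_indicator)
  also have "?this \<longleftrightarrow> ?thesis"
   by (intro Bochner_Integration.integrable_cong) (auto simp: indicator_def)
  finally show ?thesis .
 qed
 have Sz: "(LINT x|M. w x * S i (X x)) = 0" for i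
 proof -
  define B where "B y = S i -` {y} \<inter> space N" for y
  have fin: "finite (S i ` space N)" using S by (rule simple_functionD)
  have B: "B y \<in> sets N" for y unfolding B_def using S[of i] by (rule simple_functionD)
  have "w x * S i (X x) = (\<Sum>y\<in>S i ` space N. y * (indicator (B y) (X x) *\<^sub>R w x))" if "x \<in> space M" for x
  proof -
   have Xx: "X x \<in> space N" using measurable_space[OF X that] .
   have "(\<Sum>y\<in>S i ` space N. y * (indicator (B y) (X x) *\<^sub>R w x)) = (\<Sum>y\<in>{S i (X x)}. y * (indicator (B y) (X x) *\<^sub>R w x))"
    using fin Xx by (intro sum.mono_neutral_right) (auto simp: B_def)
   then show ?thesis using Xx by (simp add: B_def mult.commute)
  qed
  then have "(LINT x|M. w x * S i (X x)) = (LINT x|M. (\<Sum>y\<in>S i ` space N. y * (indicator (B y) (X x) *\<^sub>R w x)))"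
   by (intro Bochner_Integration.integral_cong) auto
  also have "... = (\<Sum>y\<in>S i ` space N. LINT x|M. y * (indicator (B y) (X x) *\<^sub>R w x))"
   by (intro Bochner_Integration.integral_sum integrable_mult_right iB B)
  also have "... = (\<Sum>y\<in>S i ` space N. y * (LINT x|M. indicator (B y) (X x) *\<^sub>R w x))"
   by (simp only: integral_mult_right_zero)
  also have "... = 0" using zero[OF B] by simp
  finally show ?thesis .
 qed
 have "(\<lambda>i. LINT x|M. w x * S i (X x)) \<longlonglongrightarrow> (LINT x|M. w x * ph (X x))"
 proof (rule integral_dominated_convergence)
  show "integrable M (\<lambda>x. 2 * norm (w x * ph (X x)))" using int by simp
  show "(\<lambda>x. w x * ph (X x)) \<in> borel_measurable M" using int by auto
  show "(\<lambda>x. w x * S i (X x)) \<in> borel_measurable M" for i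
   using measurable_compose[OF X borel_measurable_simple_function[OF S]] by measurable
  show "AE x in M. (\<lambda>i. w x * S i (X x)) \<longlonglongrightarrow> w x * ph (X x)"
   using lim measurable_space[OF X] by (intro AE_I2 tendsto_mult_left) auto
  show "AE x in M. norm (w x * S i (X x)) \<le> 2 * norm (w x * ph (X x))" for i
  proof (rule AE_I2)
   fix x assume "x \<in> space M"
   then have "cmod (S i (X x)) \<le> 2 * cmod (ph (X x))" using bd[of "X x" i] measurable_space[OF X] by (auto simp: dist_norm)
   then have "cmod (w x) * cmod (S i (X x)) \<le> cmod (w x) * (2 * cmod (ph (X x)))" by (intro mult_left_mono) auto
   then show "norm (w x * S i (X x)) \<le> 2 * norm (w x * ph (X x))" by (simp add: norm_mult)
  qed
 qed
 then show ?thesis unfolding Sz by (simp add: LIMSEQ_const_iff)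
qed

subsection \<open>Moments against Laguerre functions\<close>

lemma gaussian_power_L2:
 assumes b: "b > 0"
 shows "(\<lambda>z::complex ^ 'n::finite. of_real (((norm z)^2) ^ m * exp (- (b * (norm z)^2)))) \<in> L2_fun lborel"
proof (rule L2_funI)
 have "(cmod (of_real (((norm z)^2) ^ m * exp (- (b * (norm z)^2)))))^2 =
   ((norm z)^2) ^ (2 * m) * exp (- ((2 * b) * (norm z)^2))" for z :: "complex ^ 'n"
 proof -
  have "(cmod (of_real (((norm z)^2) ^ m * exp (- (b * (norm z)^2)))))^2 = (((norm z)^2) ^ m)^2 * (exp (- (b * (norm z)^2)))^2"
   unfolding norm_of_real power2_abs power_mult_distrib ..
  also have "(exp (- (b * (norm z)^2)))^2 = exp (- ((2 * b) * (norm z)^2))"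
   by (simp add: exp_of_nat_mult[of 2, symmetric] del: exp_of_nat_mult)
  also have "(((norm z)^2) ^ m)^2 = ((norm z)^2) ^ (2 * m)" by (simp only: power_mult[of "(norm z)^2" m 2, symmetric] mult.commute[of m 2])
  finally show ?thesis .
 qed
 then show "integrable lborel (\<lambda>z::complex ^ 'n. (cmod (of_real (((norm z)^2) ^ m * exp (- (b * (norm z)^2)))))^2)"
  using integrable_norm_power_gaussian[of "2 * b" "2 * m", where 'n = 'n] b by simp
qed measurable

lemma moment_integrable:
 fixes g :: "complex ^ 'n::finite => complex"
 assumes "g \<in> L2_fun lborel" "b > 0"
 shows "integrable lborel (\<lambda>z. g z * of_real (((norm z)^2) ^ m * exp (- (b * (norm z)^2))))"
 using L2_fun_mult_integrable[OF assms(1) gaussian_power_L2[OF assms(2)]] .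

text \<open>A triangular system: the Laguerre polynomial of degree m has a nonzero leading
  coefficient, so once the lower moments vanish its coefficient condition isolates the moment
  m.\<close>

lemma moments_vanish:
 fixes g :: "complex ^ 'n::finite => complex"
 assumes g: "g \<in> L2_fun lborel" and a: "a > 0"
  and zero: "\<And>j. (LBINT z. g z * of_real (lf CARD('n) j (a * (norm z)^2 / 2))) = 0"
 shows "(LBINT z. g z * of_real (((norm z)^2) ^ m * exp (- (a / 4 * (norm z)^2)))) = 0"
proof (induction m rule: less_induct)
 case (less m)
 define n where "n = CARD('n)"
 define c where "c i = lagc n m i * (a / 2) ^ i" for i
 have cm: "c m \<noteq> 0" using lagc_nonzero[of n m m] a by (simp add: c_def n_def)
 define h where "h i z = g z * of_real (((norm z)^2) ^ i * exp (- (a / 4 * (norm z)^2)))" for i and z :: "complex ^ 'n"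
 have hi: "integrable lborel (h i)" for i unfolding h_def using a by (intro moment_integrable g) auto
 have "g z * of_real (lf n m (a * (norm z)^2 / 2)) = (\<Sum>i\<le>m. of_real (c i) * h i z)" for z
 proof -
  have "lf n m (a * (norm z)^2 / 2) = (\<Sum>i\<le>m. c i * (((norm z)^2) ^ i * exp (- (a / 4 * (norm z)^2))))"
  proof -
   have "(a * (norm z)^2 / 2) ^ i = (a / 2) ^ i * ((norm z)^2) ^ i" for i
    by (subst power_mult_distrib[symmetric]) simp
   then show ?thesis by (simp add: lf_def lag_def c_def sum_distrib_left mult_ac)
  qed
  then show ?thesis by (simp add: h_def sum_distrib_left mult_ac)
 qed
 then have "0 = (LBINT z. (\<Sum>i\<le>m. of_real (c i) * h i z))" using zero[of m] by (simp add: n_def)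
 also have "... = (\<Sum>i\<le>m. of_real (c i) * (LBINT z. h i z))"
  using hi by (subst Bochner_Integration.integral_sum) (auto intro!: integrable_mult_right)
 also have "... = (\<Sum>i\<in>{m}. of_real (c i) * (LBINT z. h i z))"
  using less.IH by (intro sum.mono_neutral_right) (auto simp: h_def)
 finally show ?case using cm by (simp add: h_def)
qed

text \<open>Vanishing moments kill the partial sums of the power series of exp (i delta |z|^2), but
  the series is dominated only while |delta| <= b / 2, where half of the Gaussian absorbs it. The
  frequency theta is therefore reached in finitely many small steps; each step yields all moments at
  the new frequency, which is what the next one requires. This plays the part of analytic
  continuation.\<close>

lemma gaussian_fourier_vanish:
 fixes g :: "complex ^ 'n::finite => complex"
 assumes g: "g \<in> L2_fun lborel" and b: "b > 0"
  and zero: "\<And>m. (LBINT z. g z * of_real (((norm z)^2) ^ m * exp (- (b * (norm z)^2)))) = 0"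
 shows "(LBINT z. (g z * of_real (exp (- (b * (norm z)^2)))) * iexp (\<theta> * (norm z)^2)) = 0"
proof -
 have [measurable]: "g \<in> borel_measurable borel" using g by (simp add: L2_fun_def)
 define h where "h \<theta> m z = g z * of_real (((norm z)^2) ^ m * exp (- (b * (norm z)^2))) * iexp (\<theta> * (norm z)^2)"
  for \<theta> m and z :: "complex ^ 'n"
 have hm [measurable]: "h \<theta> m \<in> borel_measurable borel" for \<theta> m unfolding h_def by measurable
 have step: "(LBINT z. h (\<theta> + \<delta>) m z) = 0"
  if \<theta>: "\<And>m. (LBINT z. h \<theta> m z) = 0" and \<delta>: "\<bar>\<delta>\<bar> \<le> b / 2" for \<theta> \<delta> m
 proof -
  have hint: "integrable lborel (h \<theta> m)" for m
   by (rule Bochner_Integration.integrable_bound[OF integrable_norm[OF moment_integrable[OF g b, of m]]])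
    (auto simp: h_def norm_mult norm_exp_eq_Re)
  define S where "S K z = (\<Sum>k<K. ((\<i> * of_real \<delta>) ^ k / fact k) * h \<theta> (m + k) z)" for K z
  have S0: "(LBINT z. S K z) = 0" for K
   unfolding S_def using hint \<theta> by (subst Bochner_Integration.integral_sum) (auto intro!: integrable_mult_right)
  have "(\<lambda>K. LBINT z. S K z) \<longlonglongrightarrow> (LBINT z. h (\<theta> + \<delta>) m z)"
  proof (rule integral_dominated_convergence)
   show "integrable lborel (\<lambda>z. norm (g z * of_real (((norm z)^2) ^ m * exp (- (b / 2 * (norm z)^2)))))"
    using b by (intro integrable_norm moment_integrable g) auto
   show "S K \<in> borel_measurable lborel" for K unfolding S_def[abs_def] by measurable
   have hk: "((\<i> * of_real \<delta>) ^ k / fact k) * h \<theta> (m + k) z =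
     h \<theta> m z * ((\<i> * of_real (\<delta> * (norm z)^2)) ^ k /\<^sub>R fact k)" for k z
    by (simp add: h_def power_add power_mult_distrib scaleR_conv_of_real divide_inverse mult_ac)
   show "AE z in lborel. (\<lambda>K. S K z) \<longlonglongrightarrow> h (\<theta> + \<delta>) m z"
   proof (rule AE_I2)
    fix z :: "complex ^ 'n"
    have "(\<lambda>k. h \<theta> m z * ((\<i> * of_real (\<delta> * (norm z)^2)) ^ k /\<^sub>R fact k)) sums (h \<theta> m z * iexp (\<delta> * (norm z)^2))"
     by (intro sums_mult exp_converges)
    moreover have "h \<theta> m z * iexp (\<delta> * (norm z)^2) = h (\<theta> + \<delta>) m z"
    proof -
     have "iexp (\<theta> * (norm z)^2) * iexp (\<delta> * (norm z)^2) = iexp ((\<theta> + \<delta>) * (norm z)^2)"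
      unfolding exp_add[symmetric] by (simp add: algebra_simps)
     then show ?thesis by (simp only: h_def mult.assoc)
    qed
    ultimately show "(\<lambda>K. S K z) \<longlonglongrightarrow> h (\<theta> + \<delta>) m z"
     unfolding S_def hk sums_def by simp
   qed
   show "AE z in lborel. norm (S K z) \<le> norm (g z * of_real (((norm z)^2) ^ m * exp (- (b / 2 * (norm z)^2))))" for K
   proof (rule AE_I2)
    fix z :: "complex ^ 'n"
    define y where "y = b / 2 * (norm z)^2"
    have y: "y \<ge> 0" using b by (simp add: y_def)
    have dy: "\<bar>\<delta> * (norm z)^2\<bar> \<le> y" 
    proof -
     have "\<bar>\<delta>\<bar> * (norm z)^2 \<le> b / 2 * (norm z)^2" using \<delta> by (intro mult_right_mono) auto
     then show ?thesis by (simp add: abs_mult y_def)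
    qed
    have "norm (S K z) \<le> (\<Sum>k<K. norm (h \<theta> m z * ((\<i> * of_real (\<delta> * (norm z)^2)) ^ k /\<^sub>R fact k)))"
     unfolding S_def hk by (rule norm_sum)
    also have "... = norm (h \<theta> m z) * (\<Sum>k<K. \<bar>\<delta> * (norm z)^2\<bar> ^ k /\<^sub>R fact k)"
     by (simp add: norm_mult norm_power sum_distrib_left abs_mult mult_ac)
    also have "(\<Sum>k<K. \<bar>\<delta> * (norm z)^2\<bar> ^ k /\<^sub>R fact k) \<le> (\<Sum>k<K. y ^ k /\<^sub>R fact k)"
     using dy by (intro sum_mono scaleR_left_mono power_mono) auto
    also have "(\<Sum>k<K. y ^ k /\<^sub>R fact k) \<le> exp y"
     using exp_converges[of y] y sum_le_suminf[of "\<lambda>k. y ^ k /\<^sub>R fact k" "{..<K}"] by (auto simp: sums_iff)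
    also have "norm (h \<theta> m z) * exp y = norm (g z * of_real (((norm z)^2) ^ m * exp (- (b / 2 * (norm z)^2))))"
    proof -
     have "exp (- (b * (norm z)^2)) * exp y = exp (- (b / 2 * (norm z)^2))"
      unfolding exp_add[symmetric] y_def by (simp add: field_simps)
     then show ?thesis by (simp add: h_def norm_mult norm_power norm_exp_eq_Re mult.assoc)
    qed
    finally show "norm (S K z) \<le> norm (g z * of_real (((norm z)^2) ^ m * exp (- (b / 2 * (norm z)^2))))"
     by (simp add: mult_left_mono)
   qed
  qed measurable
  then show ?thesis unfolding S0 by (simp add: LIMSEQ_const_iff)
 qed
 \<comment> \<open>Splits theta into N + 1 equal steps of length at most b / 2; N + 1 avoids
   division by zero.\<close>
 obtain N where "real N > \<bar>\<theta>\<bar> / (b / 2)" using reals_Archimedean2 by blast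
 then have N: "\<bar>\<theta> / real (Suc N)\<bar> \<le> b / 2"
  using b by (simp add: field_simps abs_mult)
 have "(LBINT z. h (real i * (\<theta> / real (Suc N))) m z) = 0" for i m
 proof (induction i arbitrary: m)
  case 0
  show ?case using zero[of m] by (simp add: h_def)
 next
  case (Suc i)
  have eq: "real i * (\<theta> / real (Suc N)) + \<theta> / real (Suc N) = real (Suc i) * (\<theta> / real (Suc N))"
   by (simp only: of_nat_Suc distrib_right mult_1_left add.commute)
  show ?case using step[OF Suc.IH N, of m] unfolding eq .
 qed
 from this[of "Suc N" 0] have "(LBINT z. h \<theta> 0 z) = 0" by simp
 then show ?thesis by (simp add: h_def)
qed

text \<open>Fourier uniqueness for X = |z|^2 applies to g times a Gaussian, which is integrable
  although g need not be.\<close>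

lemma radial_pairing_vanish:
 fixes g :: "complex ^ 'n::finite => complex"
 assumes g: "g \<in> L2_fun lborel" and a: "a > 0"
  and zero: "\<And>j. (LBINT z. g z * of_real (lf CARD('n) j (a * (norm z)^2 / 2))) = 0"
  and B: "B \<in> sets borel" "B \<subseteq> {..R}"
 shows "(LBINT z. g z * indicator B ((norm z)^2)) = 0"
proof -
 have [measurable]: "g \<in> borel_measurable borel" using g by (simp add: L2_fun_def)
 have [measurable]: "B \<in> sets borel" by (rule B(1))
 define b where "b = a / 4"
 have b: "b > 0" using a by (simp add: b_def)
 define w where "w z = g z * of_real (exp (- (b * (norm z)^2)))" for z
 have wi: "integrable lborel w" unfolding w_def using moment_integrable[OF g b, of 0] by simp
 have X: "(\<lambda>z::complex ^ 'n. (norm z)^2) \<in> borel_measurable lborel" by measurable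
 have m0: "\<And>m. (LBINT z. g z * of_real (((norm z)^2) ^ m * exp (- (b * (norm z)^2)))) = 0"
  unfolding b_def by (rule moments_vanish[OF g a zero])
 have wz: "(LBINT z. w z * indicator C ((norm z)^2)) = 0" if "C \<in> sets borel" for C
  by (rule fourier_uniqueness[OF wi X _ that]) (unfold w_def, rule gaussian_fourier_vanish[OF g b m0])
 \<comment> \<open>Undoes the Gaussian weight; exp (b * x) is bounded on B because B is bounded
   above and b > 0.\<close>
 define ph where "ph x = complex_of_real (exp (b * x) * indicator B x)" for x
 have phm: "ph \<in> borel_measurable borel" unfolding ph_def by measurable
 have eq: "w z * ph ((norm z)^2) = g z * indicator B ((norm z)^2)" for z
 proof -
  have "complex_of_real (exp (- (b * (norm z)^2))) * of_real (exp (b * (norm z)^2)) = 1"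
   by (simp add: exp_add[symmetric] flip: of_real_mult)
  moreover have "complex_of_real (indicator B ((norm z)^2)) = indicator B ((norm z)^2)" by (simp add: indicator_def)
  ultimately show ?thesis by (simp add: w_def ph_def mult.assoc)
 qed
 have "(LBINT z. w z * ph ((norm z)^2)) = 0"
 proof (rule integral_zero_compose[OF wi X phm])
  show "integrable lborel (\<lambda>z. w z * ph ((norm z)^2))"
  proof (rule Bochner_Integration.integrable_bound[OF integrable_mult_right[OF integrable_norm[OF wi], of "exp (b * R)"]])
   show "AE z in lborel. norm (w z * ph ((norm z)^2)) \<le> norm (exp (b * R) * norm (w z))"
   proof (rule AE_I2)
    fix z :: "complex ^ 'n"
    have "norm (ph ((norm z)^2)) \<le> exp (b * R)"
     using B(2) b by (auto simp: ph_def indicator_def norm_mult)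
    then have "norm (w z) * norm (ph ((norm z)^2)) \<le> norm (w z) * exp (b * R)" by (intro mult_left_mono) auto
    then show "norm (w z * ph ((norm z)^2)) \<le> norm (exp (b * R) * norm (w z))" by (simp add: norm_mult abs_mult mult.commute)
   qed
   show "(\<lambda>z. w z * ph ((norm z)^2)) \<in> borel_measurable lborel"
    using phm wi by measurable
  qed
  show "(LBINT z. indicator C ((norm z)^2) *\<^sub>R w z) = 0" if "C \<in> sets borel" for C
  proof -
   have "(\<lambda>z. indicator C ((norm z)^2) *\<^sub>R w z) = (\<lambda>z. w z * indicator C ((norm z)^2))"
    by (auto simp: indicator_def)
   then show ?thesis using wz[OF that] by simp
  qed
 qed
 then show ?thesis by (simp add: eq)
qed

subsection \<open>The partial Fourier transform\<close>

lemma test_fun_affine: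
 fixes sg b :: real
 assumes "test_fun ph" "\<bar>sg\<bar> = 1"
 shows "test_fun (\<lambda>l. ph (sg * l + b))"
proof -
 have bl: "bounded_linear (\<lambda>l. sg * l)" by (rule bounded_linear_mult_right)
 have sm: "smooth (\<lambda>l. ph (sg * l + b))" by (rule smooth_real_affine[OF test_fun_smooth[OF assms(1)] bl])
 have s: "sg * sg = 1" using assms(2) by (auto simp: abs_if split: if_splits)
 have K: "compact ((\<lambda>y. sg * (y - b)) ` support ph)"
  using assms(1) by (intro compact_continuous_image continuous_intros) (simp add: test_fun_def')
 have "{l. ph (sg * l + b) \<noteq> 0} \<subseteq> (\<lambda>y. sg * (y - b)) ` support ph"
 proof
  fix l assume "l \<in> {l. ph (sg * l + b) \<noteq> 0}"
  then have "sg * l + b \<in> support ph" using not_in_support by blast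
  moreover have "l = sg * ((sg * l + b) - b)" using s by (simp add: mult.assoc[symmetric])
  ultimately show "l \<in> (\<lambda>y. sg * (y - b)) ` support ph" by blast
 qed
 then have "support (\<lambda>l. ph (sg * l + b)) \<subseteq> (\<lambda>y. sg * (y - b)) ` support ph"
  unfolding support_def[of "\<lambda>l. ph (sg * l + b)"] by (rule closure_minimal) (rule compact_imp_closed[OF K])
 then show ?thesis by (rule test_funI[OF sm K])
qed

lemma ft_sign: "\<bar>sg\<bar> = 1 ==> ft ph (sg * t) = ft (\<lambda>l. ph (sg * l)) t"
proof -
 assume sg: "\<bar>sg\<bar> = 1"
 have s: "sg * sg = 1" "sg \<noteq> 0" using sg by (auto simp: abs_if split: if_splits)
 have 1: "ft ph (sg * t) = \<bar>sg\<bar> *\<^sub>R (LBINT l. ph (0 + sg * l) * iexp ((0 + sg * l) * (sg * t)))"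
  unfolding ft_def by (rule lborel_integral_real_affine) (rule s(2))
 have e: "(0 + sg * l) * (sg * t) = l * t" for l
 proof -
  have "(0 + sg * l) * (sg * t) = (sg * sg) * (l * t)" by (simp only: add_0_left mult_ac)
  then show ?thesis by (simp only: s(1) mult_1_left)
 qed
 show ?thesis unfolding 1 e sg by (simp add: ft_def)
qed

lemma ft_shift: "ft (\<lambda>l. ph (1 * l + b)) t = exp (- (\<i> * of_real (b * t))) * ft ph t"
proof -
 have "ft (\<lambda>l. ph (1 * l + b)) t = \<bar>1\<bar> *\<^sub>R (LBINT l. ph (1 * (- b + 1 * l) + b) * iexp ((- b + 1 * l) * t))"
  unfolding ft_def by (rule lborel_integral_real_affine) simp
 also have "... = (LBINT l. exp (- (\<i> * of_real (b * t))) * (ph l * iexp (l * t)))"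
 proof -
  have "iexp ((- b + 1 * l) * t) = exp (- (\<i> * of_real (b * t))) * iexp (l * t)" for l
   unfolding exp_add[symmetric] by (simp add: algebra_simps)
  then show ?thesis by (simp add: mult_ac)
 qed
 finally show ?thesis by (simp add: ft_def)
qed

text \<open>s is the unitary partial Fourier transform of ka in the central variable. Sections are
  required to be test functions so that the one-dimensional Plancherel formula applies to each; for
  general f the extension of the isometry supplies a g with the pairings of the inverse partial
  transform.\<close>

definition pft :: "('n::finite heis => complex) => ('n heis => complex) => bool" where
 "pft s ka \<longleftrightarrow> ka \<in> L2_fun lborel \<and> (\<forall>z. test_fun (\<lambda>l. ka (z, l))) \<and>
   s = (\<lambda>x. of_real (1 / sqrt (2 * pi)) * ft (\<lambda>l. ka (fst x, l)) (snd x))"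

text \<open>Plancherel on each line over fixed z. The computation is done with nonnegative
  integrals, since square-integrability of s is part of the conclusion.\<close>

lemma pft_L2:
 fixes s :: "'n::finite heis => complex"
 assumes "pft s ka"
 shows "s \<in> L2_fun lborel" "L2_norm lborel s = L2_norm lborel ka"
proof -
 have ka: "ka \<in> L2_fun lborel" "\<And>z. test_fun (\<lambda>l. ka (z, l))"
  and s: "s = (\<lambda>x. of_real (1 / sqrt (2 * pi)) * ft (\<lambda>l. ka (fst x, l)) (snd x))"
  using assms unfolding pft_def by blast+
 have kam [measurable]: "ka \<in> borel_measurable borel" using ka(1) by (simp add: L2_fun_def)
 have km2: "ka \<in> borel_measurable (borel \<Otimes>\<^sub>M borel)" using kam by (simp add: borel_prod)
 have sm [measurable]: "s \<in> borel_measurable borel"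
 proof -
  have "(\<lambda>p :: 'n heis \<times> real. ka (fst (fst p), snd p)) \<in> borel_measurable ((borel :: 'n heis measure) \<Otimes>\<^sub>M (borel :: real measure))"
   by (rule measurable_compose[OF _ km2]) measurable
  then have "(\<lambda>(x, l). ka (fst x, l) * iexp (l * snd x)) \<in> borel_measurable ((borel :: 'n heis measure) \<Otimes>\<^sub>M (borel :: real measure))"
   unfolding split_beta' by measurable
  also have "borel_measurable ((borel :: 'n heis measure) \<Otimes>\<^sub>M (borel :: real measure)) = borel_measurable (borel \<Otimes>\<^sub>M lborel)"
   by (intro measurable_cong_sets sets_pair_measure_cong) auto
  finally have "(\<lambda>x :: 'n heis. LBINT l. ka (fst x, l) * iexp (l * snd x)) \<in> borel_measurable borel"
   by (rule lborel.borel_measurable_lebesgue_integral)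
  then show ?thesis unfolding s ft_def by (intro borel_measurable_times) auto
 qed
 have in2: "(\<integral>\<^sup>+x. ennreal ((cmod (f x))^2) \<partial>lborel) = (\<integral>\<^sup>+z. \<integral>\<^sup>+l. ennreal ((cmod (f (z, l)))^2) \<partial>lborel \<partial>lborel)"
  if [measurable]: "f \<in> borel_measurable borel" for f :: "'n heis => complex"
 proof -
  have "(\<lambda>x. ennreal ((cmod (f x))^2)) \<in> borel_measurable ((lborel :: (complex ^ 'n) measure) \<Otimes>\<^sub>M (lborel :: real measure))"
   unfolding lborel_prod by measurable
  from lborel.nn_integral_fst[OF this] show ?thesis by (simp add: lborel_prod)
 qed
 have sec: "(\<integral>\<^sup>+t. ennreal ((cmod (s (z, t)))^2) \<partial>lborel) = (\<integral>\<^sup>+l. ennreal ((cmod (ka (z, l)))^2) \<partial>lborel)" for z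
 proof -
  let ?ph = "\<lambda>l. ka (z, l)"
  have "(cmod (s (z, t)))^2 = 1 / (2 * pi) * (cmod (ft ?ph t))^2" for t
   unfolding s by (simp add: norm_mult power_mult_distrib power_divide del: of_real_divide)
  then have "(\<integral>\<^sup>+t. ennreal ((cmod (s (z, t)))^2) \<partial>lborel) = (\<integral>\<^sup>+t. ennreal (1 / (2 * pi) * (cmod (ft ?ph t))^2) \<partial>lborel)" by simp
  also have "... = ennreal (LBINT t. 1 / (2 * pi) * (cmod (ft ?ph t))^2)"
   using ft_Plancherel(2)[OF ka(2)[of z]] by (intro nn_integral_eq_integral) auto
  also have "(LBINT t. 1 / (2 * pi) * (cmod (ft ?ph t))^2) = (LBINT l. (cmod (?ph l))^2)"
   using ft_Plancherel(1)[OF ka(2)[of z]] by simp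
  also have "ennreal (LBINT l. (cmod (?ph l))^2) = (\<integral>\<^sup>+l. ennreal ((cmod (?ph l))^2) \<partial>lborel)"
   using L2_fun_integrable[OF test_fun_L2[OF ka(2)[of z]]] by (intro nn_integral_eq_integral[symmetric]) auto
  finally show ?thesis .
 qed
 have eq: "(\<integral>\<^sup>+x. ennreal ((cmod (s x))^2) \<partial>lborel) = (\<integral>\<^sup>+x. ennreal ((cmod (ka x))^2) \<partial>lborel)"
  unfolding in2[OF sm] in2[OF kam] sec ..
 show sL: "s \<in> L2_fun lborel"
 proof (rule L2_funI)
  show "integrable lborel (\<lambda>x. (cmod (s x))^2)"
   by (rule integrableI_bounded) (use eq nn_integral_L2[OF ka(1)] in auto)
 qed measurable
 show "L2_norm lborel s = L2_norm lborel ka"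
  using eq unfolding nn_integral_L2[OF sL] nn_integral_L2[OF ka(1)] by simp
qed

interpretation pf: L2_isometry "lborel :: 'n::finite heis measure" "lborel :: 'n heis measure" pft
proof
 fix s :: "'n heis => complex" and ka assume p: "pft s ka"
 show "s \<in> L2_fun lborel" "L2_norm lborel s = L2_norm lborel ka" using pft_L2[OF p] by auto
 show "ka \<in> L2_fun lborel" using p by (simp add: pft_def)
 have sc: "ft (\<lambda>l. c * ph l) t = c * ft ph t" for c ph t by (simp add: ft_def mult.assoc)
 show "pft (\<lambda>x. c * s x) (\<lambda>y. c * ka y)" for c
  using p by (auto simp: pft_def L2_fun_scale test_fun_scale sc)
 fix s' :: "'n heis => complex" and ka' assume p': "pft s' ka'"
 have i: "integrable lborel (\<lambda>l. ph l * iexp (l * t))" if "test_fun ph" for ph t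
  using lap_integrable[OF that, of "- (\<i> * of_real t)"] by (simp add: mult_ac)
 show "pft (\<lambda>x. s x + s' x) (\<lambda>y. ka y + ka' y)"
  unfolding pft_def
 proof (intro conjI allI)
  show "(\<lambda>y. ka y + ka' y) \<in> L2_fun lborel" "test_fun (\<lambda>l. ka (z, l) + ka' (z, l))" for z
   using p p' by (auto simp: pft_def intro: L2_fun_add test_fun_add)
  have "ft (\<lambda>l. ka (z, l) + ka' (z, l)) t = ft (\<lambda>l. ka (z, l)) t + ft (\<lambda>l. ka' (z, l)) t" for z t
   using p p' i unfolding pft_def ft_def distrib_right by (intro Bochner_Integration.integral_add) auto
  then show "(\<lambda>x. s x + s' x) = (\<lambda>x. of_real (1 / sqrt (2 * pi)) * ft (\<lambda>l. ka (fst x, l) + ka' (fst x, l)) (snd x))"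
   using p p' by (auto simp: pft_def distrib_left)
 qed
next
 show "pft (\<lambda>_ :: 'n heis. 0) (\<lambda>_. 0)" by (auto simp: pft_def ft_def)
qed

subsection \<open>Functions orthogonal to all wave packets\<close>

lemma nn_integral_heis:
 assumes "f \<in> borel_measurable borel"
 shows "(\<integral>\<^sup>+x. f x \<partial>(lborel :: 'n::finite heis measure)) = (\<integral>\<^sup>+l. \<integral>\<^sup>+z. f (z, l) \<partial>lborel \<partial>lborel)"
proof -
 have "f \<in> borel_measurable ((lborel :: (complex ^ 'n) measure) \<Otimes>\<^sub>M (lborel :: real measure))"
  unfolding lborel_prod using assms by simp
 from lborel_pair.nn_integral_snd[OF this] show ?thesis by (simp add: lborel_prod)
qed

text \<open>The Laguerre function at scale |l| has squared norm of order |l|^-n in z, so the weight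
  |l|^n in the kernel leaves |l|^n in the squared section norm: bounded, also near l = 0, on the
  bounded set where nu lives.\<close>

lemma kernel_L2:
 assumes [measurable]: "\<nu> \<in> borel_measurable borel" and B: "\<And>l. cmod (\<nu> l) \<le> B" and R: "\<And>l. \<bar>l\<bar> > R ==> \<nu> l = 0"
 shows "(\<lambda>x::'n::finite heis. \<nu> (snd x) * of_real (\<bar>snd x\<bar> ^ CARD('n) * lf CARD('n) j (\<bar>snd x\<bar> * (norm (fst x))^2 / 2))) \<in> L2_fun lborel"
proof (rule L2_funI)
 define n where "n = CARD('n)"
 have n: "n > 0" by (simp add: n_def)
 define K where "K x = \<nu> (snd x) * of_real (\<bar>snd x\<bar> ^ n * lf n j (\<bar>snd x\<bar> * (norm (fst x))^2 / 2))" for x :: "'n heis"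
 have [measurable]: "K \<in> borel_measurable borel" unfolding K_def by measurable
 define C where "C = B^2 * \<bar>R\<bar> ^ n * ((2 * pi) ^ n / real ((j + n - 1) choose j))"
 have sec: "(\<integral>\<^sup>+z. ennreal ((cmod (K (z, l)))^2) \<partial>lborel) \<le> ennreal C * indicator {-\<bar>R\<bar>..\<bar>R\<bar>} l" for l
 proof (cases "l = 0 \<or> \<bar>l\<bar> > R")
  case True
  then have "K (z, l) = 0" for z using R n by (auto simp: K_def zero_power)
  then show ?thesis by simp
 next
  case False
  then have l: "l \<noteq> 0" "\<bar>l\<bar> \<le> \<bar>R\<bar>" by auto
  have hb: "has_bochner_integral lborel (\<lambda>z::complex ^ 'n. lf n j (\<bar>l\<bar> * (norm z)^2 / 2) * lf n j (\<bar>l\<bar> * (norm z)^2 / 2))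
    ((2 * pi / \<bar>l\<bar>) ^ n / real ((j + n - 1) choose j))"
  proof -
   have e: "y / 2 / 2 = y / 4" for y :: real by simp
   have "\<bar>l\<bar> > 0" using l by simp
   from lag_orthogonal_space[OF this, of j j, where 'n = 'n] show ?thesis
    by (simp only: lf_def n_def e if_True refl simp_thms)
  qed
  have "(\<integral>\<^sup>+z. ennreal ((cmod (K (z, l)))^2) \<partial>lborel) =
    (\<integral>\<^sup>+z. ennreal (((cmod (\<nu> l))^2 * (\<bar>l\<bar> ^ n)^2) * (lf n j (\<bar>l\<bar> * (norm (z::complex ^ 'n))^2 / 2) * lf n j (\<bar>l\<bar> * (norm z)^2 / 2))) \<partial>lborel)"
   by (intro nn_integral_cong) (simp add: K_def norm_mult norm_power power_mult_distrib power2_eq_square abs_mult mult_ac)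
  also have "... = ennreal (((cmod (\<nu> l))^2 * (\<bar>l\<bar> ^ n)^2) * ((2 * pi / \<bar>l\<bar>) ^ n / real ((j + n - 1) choose j)))"
  proof -
   have "has_bochner_integral lborel (\<lambda>z::complex ^ 'n. ((cmod (\<nu> l))^2 * (\<bar>l\<bar> ^ n)^2) * (lf n j (\<bar>l\<bar> * (norm z)^2 / 2) * lf n j (\<bar>l\<bar> * (norm z)^2 / 2)))
    (((cmod (\<nu> l))^2 * (\<bar>l\<bar> ^ n)^2) * ((2 * pi / \<bar>l\<bar>) ^ n / real ((j + n - 1) choose j)))"
    by (rule has_bochner_integral_mult_right[OF hb])
   then show ?thesis
    by (subst nn_integral_eq_integral) (auto simp: has_bochner_integral_iff)
  qed
  also have "((cmod (\<nu> l))^2 * (\<bar>l\<bar> ^ n)^2) * ((2 * pi / \<bar>l\<bar>) ^ n / real ((j + n - 1) choose j)) =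
    (cmod (\<nu> l))^2 * \<bar>l\<bar> ^ n * ((2 * pi) ^ n / real ((j + n - 1) choose j))"
   using l by (simp add: power_divide power2_eq_square)
  also have "... \<le> C"
   unfolding C_def using B[of l] l by (intro mult_right_mono mult_mono power_mono) auto
  finally have "(\<integral>\<^sup>+z. ennreal ((cmod (K (z, l)))^2) \<partial>lborel) \<le> ennreal C" by (auto intro: ennreal_leI)
  then show ?thesis using l by (auto simp: indicator_def abs_le_iff)
 qed
 have "(\<integral>\<^sup>+x. ennreal ((cmod (K x))^2) \<partial>lborel) = (\<integral>\<^sup>+l. \<integral>\<^sup>+z. ennreal ((cmod (K (z, l)))^2) \<partial>lborel \<partial>lborel)"
  by (rule nn_integral_heis) measurable
 also have "... \<le> (\<integral>\<^sup>+l. ennreal C * indicator {-\<bar>R\<bar>..\<bar>R\<bar>} l \<partial>lborel)" by (intro nn_integral_mono sec)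
 also have "... < \<infinity>"
  by (subst nn_integral_cmult_indicator) (auto simp: ennreal_mult_less_top)
 finally have fin: "(\<integral>\<^sup>+x. ennreal ((cmod (K x))^2) \<partial>lborel) < \<infinity>" .
 show "integrable lborel (\<lambda>x::'n heis. (cmod (\<nu> (snd x) * of_real (\<bar>snd x\<bar> ^ CARD('n) * lf CARD('n) j (\<bar>snd x\<bar> * (norm (fst x))^2 / 2))))^2)"
  unfolding n_def[symmetric] K_def[symmetric] by (rule integrableI_bounded) (use fin in auto)
 show "(\<lambda>x::'n heis. \<nu> (snd x) * of_real (\<bar>snd x\<bar> ^ CARD('n) * lf CARD('n) j (\<bar>snd x\<bar> * (norm (fst x))^2 / 2))) \<in> borel_measurable lborel"
  by measurable
qed

lemma heis_integral_snd:
 fixes h :: "'n::finite heis => 'b::{banach, second_countable_topology}"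
 assumes "integrable lborel h"
 shows "integrable lborel (\<lambda>l. LBINT z. h (z, l))"
  and "(LBINT l. LBINT z. h (z, l)) = (LBINT x. h x)"
  and "AE l in lborel. integrable lborel (\<lambda>z. h (z, l))"
proof -
 have "integrable ((lborel :: (complex ^ 'n) measure) \<Otimes>\<^sub>M (lborel :: real measure)) (\<lambda>(z, l). h (z, l))"
  using assms by (simp add: lborel_prod)
 note * = lborel_pair.integrable_snd[OF this] lborel_pair.integral_snd[OF this] lborel_pair.AE_integrable_snd[OF this]
 from * show "integrable lborel (\<lambda>l. LBINT z. h (z, l))"
  "(LBINT l. LBINT z. h (z, l)) = (LBINT x. h x)"
  "AE l in lborel. integrable lborel (\<lambda>z. h (z, l))"
  by (simp_all add: lborel_prod)
qed

lemma heis_section_measurable: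
 fixes f :: "'n::finite heis => complex"
 assumes "f \<in> borel_measurable borel"
 shows "(\<lambda>z. f (z, l)) \<in> borel_measurable borel"
proof -
 have "f \<in> borel_measurable ((borel :: (complex ^ 'n) measure) \<Otimes>\<^sub>M (borel :: real measure))"
  using assms by (simp add: borel_prod)
 then show ?thesis by (rule measurable_compose[rotated]) measurable
qed

text \<open>Up to a constant, a packet is the partial Fourier transform of nu(l) |l|^n times a
  Laguerre function. Orthogonality of f to packets thus says that |l|^n times the j-th Laguerre
  coefficient of g(., l) annihilates every test function on either half line. Countably many j share
  one null set of l.\<close>

lemma Laguerre_coefficients_vanish:
 fixes f g :: "'n::finite heis => complex"
 assumes f: "f \<in> L2_fun lborel" and g: "g \<in> L2_fun lborel"
  and orth: "\<And>sg ps j. \<bar>sg\<bar> = 1 ==> test_fun ps ==> support ps \<subseteq> {0<..} ==> l2_inner lborel f (pk sg ps j) = 0"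
  and fg: "\<And>s ka. pft s ka ==> l2_inner lborel f s = l2_inner lborel g ka"
 shows "AE l in lborel. l \<noteq> 0 --> (\<forall>j. (LBINT z. g (z, l) * of_real (lf CARD('n) j (\<bar>l\<bar> * (norm z)^2 / 2))) = 0)"
proof -
 define n where "n = CARD('n)"
 have n: "n > 0" by (simp add: n_def)
 have gm [measurable]: "g \<in> borel_measurable borel" using g by (simp add: L2_fun_def)
 define U where "U j l = (LBINT z. g (z, l) * of_real (lf n j (\<bar>l\<bar> * (norm (z::complex ^ 'n))^2 / 2)))" for j l
 define k where "k \<nu> j x = \<nu> (snd x) * of_real (\<bar>snd x\<bar> ^ n * lf n j (\<bar>snd x\<bar> * (norm (fst x))^2 / 2))" for \<nu> :: "real => complex" and j and x :: "'n heis"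
 have inner: "(LBINT z. g (z, l) * k \<nu> j (z, l)) = \<nu> l * (of_real (\<bar>l\<bar> ^ n) * U j l)" for \<nu> j l
  unfolding U_def k_def fst_conv snd_conv
  by (simp flip: integral_mult_right_zero add: mult_ac)
 have Um: "(\<lambda>l. of_real (\<bar>l\<bar> ^ n) * U j l) \<in> borel_measurable borel" for j
 proof -
  have g2: "g \<in> borel_measurable ((borel :: (complex ^ 'n) measure) \<Otimes>\<^sub>M (borel :: real measure))" by (simp add: borel_prod)
  have "(\<lambda>p :: real \<times> (complex ^ 'n). g (snd p, fst p)) \<in> borel_measurable (borel \<Otimes>\<^sub>M borel)"
   by (rule measurable_compose[OF _ g2]) measurable
  then have "(\<lambda>(l, z). g (z, l) * of_real (lf n j (\<bar>l\<bar> * (norm z)^2 / 2))) \<in> borel_measurable ((borel :: real measure) \<Otimes>\<^sub>M (borel :: (complex ^ 'n) measure))"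
   unfolding split_beta' by measurable
  also have "borel_measurable ((borel :: real measure) \<Otimes>\<^sub>M (borel :: (complex ^ 'n) measure)) = borel_measurable (borel \<Otimes>\<^sub>M lborel)"
   by (intro measurable_cong_sets sets_pair_measure_cong) auto
  finally have "U j \<in> borel_measurable borel" unfolding U_def[abs_def]
   by (rule lborel.borel_measurable_lebesgue_integral)
  then show ?thesis by measurable
 qed
 have half: "AE l in lborel. l \<in> S --> of_real (\<bar>l\<bar> ^ n) * U j l = 0"
  if S: "S = {0<..} \<and> sg = 1 \<or> S = {..<0} \<and> sg = -1" for S and sg :: real and j
 proof (rule fundamental_lemma)
  have sg: "\<bar>sg\<bar> = 1" and ss: "sg * sg = 1" using S by auto
  show "(\<lambda>l. of_real (\<bar>l\<bar> ^ n) * U j l) \<in> borel_measurable borel" by (rule Um)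
  show "open S" using S by auto
  show "integrable lborel (\<lambda>l. indicator (cbox a b) l *\<^sub>R (of_real (\<bar>l\<bar> ^ n) * U j l))" for a b
  proof -
   define \<nu> where "\<nu> l = complex_of_real (indicator (cbox a b) l)" for l
   have "k \<nu> j \<in> L2_fun lborel" unfolding k_def[abs_def] n_def
    by (rule kernel_L2[where B = 1 and R = "max \<bar>a\<bar> \<bar>b\<bar>"]) (auto simp: \<nu>_def indicator_def)
   from heis_integral_snd(1)[OF L2_fun_mult_integrable[OF g this]] show ?thesis
    unfolding inner by (simp add: \<nu>_def scaleR_conv_of_real)
  qed
  fix ph assume ph: "test_fun ph" "support ph \<subseteq> S"
  \<comment> \<open>Packets want a profile supported in positive l and enter the inner product
    conjugated; reflection by sg and conjugation translate the test function accordingly.\<close>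
  define ps where "ps l = cnj (ph (sg * l))" for l
  have ps: "test_fun ps" unfolding ps_def using test_fun_cnj[OF test_fun_affine[OF ph(1) sg, of 0]] by simp
  have ps0: "ps l = 0" if "l \<le> 0" for l
  proof -
   have "sg * l \<notin> support ph" using ph(2) S that by auto
   then show ?thesis by (simp add: ps_def not_in_support)
  qed
  have supp: "support ps \<subseteq> {0<..}"
  proof -
   have K: "compact ((\<lambda>y. sg * y) ` support ph)"
    using ph(1) by (intro compact_continuous_image continuous_intros) (simp add: test_fun_def')
   have "{l. ps l \<noteq> 0} \<subseteq> (\<lambda>y. sg * y) ` support ph"
   proof
    fix l assume "l \<in> {l. ps l \<noteq> 0}"
    then have "sg * l \<in> support ph" unfolding ps_def using not_in_support[of "sg * l" ph] by auto
    moreover have "l = sg * (sg * l)" using ss by (simp add: mult.assoc[symmetric])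
    ultimately show "l \<in> (\<lambda>y. sg * y) ` support ph" by blast
   qed
   then have "support ps \<subseteq> (\<lambda>y. sg * y) ` support ph"
    unfolding support_def[of ps] by (rule closure_minimal) (rule compact_imp_closed[OF K])
   also have "... \<subseteq> {0<..}" using ph(2) S by auto
   finally show ?thesis .
  qed
  define \<nu> where "\<nu> l = ps (sg * l)" for l
  define ka where "ka = k \<nu> j"
  have \<nu>c: "cnj (\<nu> l) = ph l" for l by (simp add: \<nu>_def ps_def ss mult.assoc[symmetric])
  have \<nu>: "test_fun \<nu>" unfolding \<nu>_def using test_fun_affine[OF ps sg, of 0] by simp
  have keq: "k \<nu> j (z, l) = ps (sg * l) * of_real ((sg * l) ^ n * lf n j ((sg * l) * (norm z)^2 / 2))" for z l
  proof (cases "sg * l \<le> 0")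
   case True then show ?thesis by (simp add: k_def \<nu>_def ps0)
  next
   case False
   then have "sg * l = \<bar>l\<bar>" using sg by (metis abs_mult abs_of_pos mult_1 not_le)
   then show ?thesis by (simp add: k_def \<nu>_def)
  qed
  obtain B where B: "\<And>x. cmod (\<nu> x) \<le> B" using test_fun_bound[OF \<nu>] by blast
  obtain R where R: "\<And>l. \<bar>l\<bar> > R ==> \<nu> l = 0" using test_fun_vanish[OF \<nu>] by (metis real_norm_def)
  have kaL: "ka \<in> L2_fun lborel" unfolding ka_def k_def[abs_def] n_def
   by (rule kernel_L2[OF _ B R]) (simp add: smooth_measurable test_fun_smooth \<nu>)
  define s where "s x = complex_of_real (1 / sqrt (2 * pi)) * ft (\<lambda>l. ka (fst x, l)) (snd x)" for x
  have "pft s ka" unfolding pft_def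
  proof (intro conjI allI kaL)
   show "test_fun (\<lambda>l. ka (z, l))" for z
    unfolding ka_def keq using test_fun_affine[OF test_fun_lf[OF ps, of n j "(norm z)^2"] sg, of 0] by simp
  qed (simp add: s_def[abs_def])
  have "s = (\<lambda>x. of_real (1 / sqrt (2 * pi) / pconst n j) * pk sg ps j x)"
  proof (rule ext)
   fix x :: "'n heis"
   have "ft (\<lambda>l. ka (fst x, l)) (snd x) = ft (\<lambda>l. ps l * of_real (l ^ n * lf n j (l * (norm (fst x))^2 / 2))) (sg * snd x)"
    unfolding ft_sign[OF sg] ka_def keq ..
   then show "s x = of_real (1 / sqrt (2 * pi) / pconst n j) * pk sg ps j x"
    unfolding s_def pk_integral[OF ps] n_def[symmetric] using pconst_pos[OF n, of j] by simp
  qed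
  then have "l2_inner lborel f s = 0"
   by (simp only: orth[OF sg ps supp, of j] l2_inner_scale_right mult_zero_right)
  then have "l2_inner lborel g ka = 0" using fg[OF \<open>pft s ka\<close>] by simp
  moreover have "l2_inner lborel g ka = (LBINT l. LBINT z. g (z, l) * cnj (ka (z, l)))"
   unfolding l2_inner_def by (rule heis_integral_snd(2)[symmetric, OF L2_inner_integrable[OF g kaL]])
  moreover have "(LBINT z. g (z, l) * cnj (ka (z, l))) = of_real (\<bar>l\<bar> ^ n) * U j l * ph l" for l
  proof -
   have "cnj (ka (z, l)) = k ph j (z, l)" for z by (simp add: ka_def k_def \<nu>c)
   then show ?thesis using inner[of l ph j] by (simp add: mult_ac)
  qed
  ultimately show "(LBINT l. of_real (\<bar>l\<bar> ^ n) * U j l * ph l) = 0" by simp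
 qed (simp_all add: lborel.sigma_finite_measure_axioms)
 have "AE l in lborel. \<forall>j. (l \<in> {0<..} --> of_real (\<bar>l\<bar> ^ n) * U j l = 0) \<and> (l \<in> {..<0} --> of_real (\<bar>l\<bar> ^ n) * U j l = 0)"
  unfolding AE_all_countable using half[of "{0<..}" 1] half[of "{..<0}" "-1"] by auto
 then show ?thesis
 proof eventually_elim
  case (elim l)
  show ?case
  proof (intro impI allI)
   fix j assume l: "l \<noteq> 0"
   then have "of_real (\<bar>l\<bar> ^ n) * U j l = 0" using elim[rule_format, of j] by (cases "l > 0") auto
   then show "(LBINT z. g (z, l) * of_real (lf CARD('n) j (\<bar>l\<bar> * (norm z)^2 / 2))) = 0"
    using l by (simp add: U_def n_def)
  qed
 qed
qed

section \<open>From Laguerre coefficients to functions of norm z and t\<close>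

lemma bounded_L2:
 fixes h :: "'a::euclidean_space => complex"
 assumes [measurable]: "h \<in> borel_measurable borel" and B: "\<And>x. cmod (h x) \<le> B" and R: "\<And>x. norm x > R ==> h x = 0"
 shows "h \<in> L2_fun lborel"
proof (rule L2_funI)
 show "integrable lborel (\<lambda>x. (cmod (h x))^2)"
 proof (rule Bochner_Integration.integrable_bound)
  show "integrable lborel (\<lambda>x::'a. B^2 * indicator (cball 0 R) x)"
   by (intro integrable_mult_right integrable_real_indicator) (use emeasure_lborel_cball_finite[of 0 R] in auto)
  show "AE x in lborel. norm ((cmod (h x))^2) \<le> norm (B^2 * indicator (cball 0 R) x)"
  proof (rule AE_I2)
   fix x show "norm ((cmod (h x))^2) \<le> norm (B^2 * indicator (cball 0 R) x)"
    using R[of x] power_mono[OF B[of x], of 2] by (cases "norm x > R") auto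
  qed
 qed measurable
qed measurable

text \<open>For almost every l the section g(., l) is orthogonal to indicators of bounded sets of
  |z|^2. Integrating over l against \<open>ps\<close> and returning through the partial Fourier
  isometry gives the claim for f. Here \<open>ps\<close> is any test function on the line: the
  restriction to half lines has disappeared because l = 0 is null.\<close>

lemma packet_orthogonal_products:
 fixes f :: "'n::finite heis => complex"
 assumes f: "f \<in> L2_fun lborel"
  and orth: "\<And>sg ps j. \<bar>sg\<bar> = 1 ==> test_fun ps ==> support ps \<subseteq> {0<..} ==> l2_inner lborel f (pk sg ps j) = 0"
  and A [measurable]: "A \<in> sets borel" and AR: "A \<subseteq> {..R}"
  and ps: "test_fun ps"
 shows "(LBINT x. f x * indicator A ((norm (fst x))^2) * cnj (ft ps (snd x))) = 0"
  and "integrable lborel (\<lambda>x. f x * indicator A ((norm (fst x))^2) * cnj (ft ps (snd x)))"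
proof -
 obtain g where g: "g \<in> L2_fun lborel" and fg: "\<And>s ka. pft s ka ==> l2_inner lborel f s = l2_inner lborel g ka"
  using pf.extension[OF f] unfolding L2_tendsto_def by blast
 have [measurable]: "g \<in> borel_measurable borel" using g by (simp add: L2_fun_def)
 have [measurable]: "ps \<in> borel_measurable borel" using smooth_measurable[OF test_fun_smooth[OF ps]] .
 have AEL: "AE l in lborel. (\<lambda>z. g (z, l)) \<in> L2_fun lborel"
  using heis_integral_snd(3)[OF L2_fun_integrable[OF g]]
  by eventually_elim (auto intro!: L2_funI heis_section_measurable)
 have AE0: "AE l in lborel. l \<noteq> (0::real)" by (rule AE_lborel_singleton)
 have lag0: "AE l in lborel. l \<noteq> 0 --> (\<forall>j. (LBINT z. g (z, l) * of_real (lf CARD('n) j (\<bar>l\<bar> * (norm z)^2 / 2))) = 0)"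
  by (rule Laguerre_coefficients_vanish[OF f g]) (fact orth, fact fg)
 have z: "AE l in lborel. (LBINT z. g (z, l) * indicator A ((norm z)^2)) = 0"
  using AEL AE0 lag0
 proof eventually_elim
  case (elim l)
  then show ?case by (intro radial_pairing_vanish[of _ "\<bar>l\<bar>", OF elim(1) _ _ A AR]) auto
 qed
 define ka where "ka x = indicator A ((norm (fst x))^2) * ps (snd x)" for x :: "'n heis"
 obtain B where B: "\<And>x. cmod (ps x) \<le> B" using test_fun_bound[OF ps] by blast
 have B0: "B \<ge> 0" using B[of 0] norm_ge_zero order_trans by blast
 obtain S where S: "\<And>x. norm x > S ==> ps x = 0" using test_fun_vanish[OF ps] by blast
 have kaL: "ka \<in> L2_fun lborel"
 proof (rule bounded_L2)
  show "ka \<in> borel_measurable borel" unfolding ka_def[abs_def] by measurable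
  show "cmod (ka x) \<le> B" for x using B[of "snd x"] B0 by (simp add: ka_def norm_mult indicator_def)
  fix x :: "'n heis" assume x: "norm x > sqrt \<bar>R\<bar> + \<bar>S\<bar>"
  show "ka x = 0"
  proof (rule ccontr)
   assume "ka x \<noteq> 0"
   then have "(norm (fst x))^2 \<in> A" "ps (snd x) \<noteq> 0" by (auto simp: ka_def indicator_def split: if_splits)
   then have "(norm (fst x))^2 \<le> \<bar>R\<bar>" "\<bar>snd x\<bar> \<le> \<bar>S\<bar>" using AR S[of "snd x"] by force+
   then have "norm (fst x) \<le> sqrt \<bar>R\<bar>" "\<bar>snd x\<bar> \<le> \<bar>S\<bar>" by (auto intro: real_le_rsqrt)
   moreover have "norm x \<le> norm (fst x) + \<bar>snd x\<bar>" using norm_Pair_le[of "fst x" "snd x"] by simp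
   ultimately show False using x by linarith
  qed
 qed
 define s where "s x = complex_of_real (1 / sqrt (2 * pi)) * ft (\<lambda>l. ka (fst x, l)) (snd x)" for x
 have p: "pft s ka" unfolding pft_def
 proof (intro conjI allI kaL)
  show "test_fun (\<lambda>l. ka (z, l))" for z unfolding ka_def fst_conv snd_conv by (rule test_fun_scale[OF ps])
 qed (simp add: s_def[abs_def])
 have s: "s x = of_real (1 / sqrt (2 * pi)) * (indicator A ((norm (fst x))^2) * ft ps (snd x))" for x
  by (simp add: s_def ka_def ft_def mult.assoc)
 have "l2_inner lborel f s = l2_inner lborel g ka" by (rule fg[OF p])
 also have "... = (LBINT l. LBINT z. g (z, l) * cnj (ka (z, l)))"
  unfolding l2_inner_def by (rule heis_integral_snd(2)[symmetric, OF L2_inner_integrable[OF g kaL]])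
 also have "... = (LINT l|(lborel :: real measure). 0)"
 proof (rule integral_cong_AE)
  show "AE l in lborel. (LBINT z. g (z, l) * cnj (ka (z, l))) = 0"
   using z
  proof eventually_elim
   case (elim l)
   have "(LBINT z. g (z, l) * cnj (ka (z, l))) = (LBINT z. cnj (ps l) * (g (z, l) * indicator A ((norm z)^2)))"
    by (intro Bochner_Integration.integral_cong refl) (simp add: ka_def indicator_def)
   then show ?case using elim by simp
  qed
  show "(\<lambda>l. LBINT z. g (z, l) * cnj (ka (z, l))) \<in> borel_measurable lborel"
   using heis_integral_snd(1)[OF L2_inner_integrable[OF g kaL]] by auto
 qed simp
 finally have fs: "l2_inner lborel f s = 0" by simp
 have c: "cnj (of_real (1 / sqrt (2 * pi)) * (indicator A y * w)) = of_real (1 / sqrt (2 * pi)) * (indicator A y * cnj w)" for y and w :: complex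
  by (simp add: indicator_def)
 have sL: "s \<in> L2_fun lborel" by (rule pf.left[OF p])
 have eq: "f x * cnj (s x) = of_real (1 / sqrt (2 * pi)) * (f x * indicator A ((norm (fst x))^2) * cnj (ft ps (snd x)))" for x
  unfolding s c by (simp only: mult_ac)
 have nz: "complex_of_real (1 / sqrt (2 * pi)) \<noteq> 0" by simp
 show "integrable lborel (\<lambda>x. f x * indicator A ((norm (fst x))^2) * cnj (ft ps (snd x)))"
  using L2_inner_integrable[OF f sL] unfolding eq integrable_const_mult_iff[OF nz] .
 show "(LBINT x. f x * indicator A ((norm (fst x))^2) * cnj (ft ps (snd x))) = 0"
  using fs nz unfolding l2_inner_def eq integral_mult_right_zero by simp
qed

text \<open>A nonnegative bump supported in |l| <= 1 / R has |l t| <= 1 there, so the real part of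
  its transform is at least cos 1 times its integral. This lets the Fourier factor be divided out on
  bounded t.\<close>

lemma ft_nonvanishing:
 assumes "R > 0"
 obtains ps c where "test_fun ps" "c > 0" "\<And>t. \<bar>t\<bar> \<le> R ==> c \<le> cmod (ft ps t)"
proof -
 obtain ph :: "real => real" where ph: "test_fun (\<lambda>x. complex_of_real (ph x))"
  "support (\<lambda>x. complex_of_real (ph x)) \<subseteq> cbox (- (1 / R)) (1 / R)"
  "\<And>x. 0 \<le> ph x" "\<And>x. ph x \<le> 1" "\<And>x. 0 < ph x \<longleftrightarrow> x \<in> box (- (1 / R)) (1 / R)"
  by (rule box_bump_exists[of "- (1 / R)" "1 / R"]) blast
 define ps where "ps x = complex_of_real (ph x)" for x
 have ps: "test_fun ps" unfolding ps_def by (rule ph(1))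
 have i: "integrable lborel ph"
  using test_fun_integrable_lborel[OF ps] unfolding ps_def by (simp only: complex_of_real_integrable_eq)
 define I where "I = (LBINT x. ph x)"
 have I: "I > 0"
 proof -
  have "I \<noteq> 0"
  proof
   assume "I = 0"
   then have "AE x in lborel. ph x = 0" using integral_nonneg_eq_0_iff_AE[OF i] ph(3) by (simp add: I_def)
   then have "AE x in lborel. x \<notin> box (- (1 / R)) (1 / R)"
    by eventually_elim (use ph(5) less_irrefl in metis)
   then have "emeasure lborel (box (- (1 / R)) (1 / R)) = 0"
    by (subst (asm) AE_iff_measurable[of "box (- (1 / R)) (1 / R)"]) auto
   then show False using assms by simp
  qed
  moreover have "I \<ge> 0" unfolding I_def using ph(3) by (intro Bochner_Integration.integral_nonneg) auto
  ultimately show ?thesis by simp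
 qed
 have "cos 1 * I \<le> cmod (ft ps t)" if t: "\<bar>t\<bar> \<le> R" for t
 proof -
  have ii: "integrable lborel (\<lambda>l. ps l * iexp (l * t))"
   using lap_integrable[OF ps, of "- (\<i> * of_real t)"] by (simp add: mult_ac)
  have re: "Re (ps l * iexp (l * t)) = ph l * cos (l * t)" for l
   by (simp add: ps_def Re_exp)
  have ir: "integrable lborel (\<lambda>l. ph l * cos (l * t))"
   using integrable_Re[OF ii] unfolding re .
  have "cos 1 * I = (LBINT l. ph l * cos 1)" by (simp add: I_def mult.commute)
  also have "... \<le> (LBINT l. ph l * cos (l * t))"
  proof (rule integral_mono)
   show "integrable lborel (\<lambda>l. ph l * cos 1)" using i by simp
   show "integrable lborel (\<lambda>l. ph l * cos (l * t))" by (rule ir)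
   show "ph l * cos 1 \<le> ph l * cos (l * t)" for l
   proof (cases "ph l = 0")
    case False
    then have "l \<in> box (- (1 / R)) (1 / R)" using ph(3,5) by (metis order_le_less)
    then have "\<bar>l\<bar> \<le> 1 / R" by auto
    then have "\<bar>l * t\<bar> \<le> 1 / R * R" unfolding abs_mult using t by (intro mult_mono) auto
    then have "\<bar>l * t\<bar> \<le> 1" using assms by simp
    then have "cos 1 \<le> cos \<bar>l * t\<bar>" using pi_gt3 by (intro cos_monotone_0_pi_le) auto
    then show ?thesis using ph(3)[of l] by (intro mult_left_mono) (simp_all add: cos_abs_real)
   qed simp
  qed
  also have "... = Re (ft ps t)" unfolding ft_def using integral_Re[OF ii] unfolding re by simp
  also have "... \<le> cmod (ft ps t)" by (rule complex_Re_le_cmod)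
  finally show ?thesis .
 qed
 moreover have "cos 1 * I > 0" using I pi_gt3 by (intro mult_pos_pos cos_gt_zero) auto
 ultimately show ?thesis using that ps by blast
qed

text \<open>Translating \<open>ps\<close> multiplies its transform by an exponential in t, so w
  integrates to 0 against every frequency. Fourier uniqueness in t then admits arbitrary functions
  of t, in particular the quotient of the indicator of B by the nonvanishing transform.\<close>

lemma packet_orthogonal_rectangles:
 fixes f :: "'n::finite heis => complex"
 assumes f: "f \<in> L2_fun lborel"
  and orth: "\<And>sg ps j. \<bar>sg\<bar> = 1 ==> test_fun ps ==> support ps \<subseteq> {0<..} ==> l2_inner lborel f (pk sg ps j) = 0"
  and A [measurable]: "A \<in> sets borel" and AR: "A \<subseteq> {..R}" and B [measurable]: "B \<in> sets borel" and BR: "B \<subseteq> {-R..R}" and R: "R > 0"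
 shows "(LBINT x. f x * indicator A ((norm (fst x))^2) * indicator B (snd x)) = 0"
proof -
 have [measurable]: "f \<in> borel_measurable borel" using f by (simp add: L2_fun_def)
 obtain ps c where ps: "test_fun ps" and c: "c > 0" "\<And>t. \<bar>t\<bar> \<le> R ==> c \<le> cmod (ft ps t)"
  by (rule ft_nonvanishing[OF R]) blast
 have [measurable]: "ft ps \<in> borel_measurable borel" by (rule ft_measurable[OF ps])
 define w where "w x = f x * indicator A ((norm (fst x))^2) * cnj (ft ps (snd x))" for x
 have wi: "integrable lborel w" unfolding w_def by (rule packet_orthogonal_products(2)[OF f orth A AR ps])
 have [measurable]: "w \<in> borel_measurable borel" using wi by auto
 have X: "snd \<in> borel_measurable (lborel :: 'n heis measure)" by measurable
 have four: "(LBINT x. w x * iexp (\<eta> * snd x)) = 0" for \<eta>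
 proof -
  have t: "test_fun (\<lambda>l. ps (1 * l + \<eta>))" by (rule test_fun_affine[OF ps]) simp
  have "w x * iexp (\<eta> * snd x) = f x * indicator A ((norm (fst x))^2) * cnj (ft (\<lambda>l. ps (1 * l + \<eta>)) (snd x))" for x
   unfolding ft_shift w_def by (simp add: exp_cnj mult_ac)
  then show ?thesis using packet_orthogonal_products(1)[OF f orth A AR t] by simp
 qed
 define ph where "ph t = indicator B t / cnj (ft ps t)" for t
 have phm: "ph \<in> borel_measurable borel" unfolding ph_def[abs_def] by measurable
 have "(LBINT x. w x * ph (snd x)) = 0"
 proof (rule integral_zero_compose[OF wi X phm])
  have phb: "cmod (ph t) \<le> 1 / c" for t
  proof (cases "t \<in> B")
   case True
   then have "c \<le> cmod (ft ps t)" using subsetD[OF BR] by (intro c(2)) fastforce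
   then show ?thesis using True c(1) by (simp add: ph_def norm_divide frac_le)
  qed (use c(1) in \<open>simp add: ph_def\<close>)
  show "integrable lborel (\<lambda>x. w x * ph (snd x))"
   by (rule integrable_mult_bounded[OF wi _ phb]) (use phm in measurable)
  fix C :: "real set" assume C: "C \<in> sets borel"
  have "(\<lambda>x. indicator C (snd x) *\<^sub>R w x) = (\<lambda>x. w x * indicator C (snd x))" by (auto simp: indicator_def)
  then show "(LBINT x. indicator C (snd x) *\<^sub>R w x) = 0"
   using fourier_uniqueness[OF wi X four C] by simp
 qed
 moreover have "w x * ph (snd x) = f x * indicator A ((norm (fst x))^2) * indicator B (snd x)" for x
 proof (cases "snd x \<in> B")
  case True
  then have "c \<le> cmod (ft ps (snd x))" using subsetD[OF BR] by (intro c(2)) fastforce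
  then have "ft ps (snd x) \<noteq> 0" using c(1) by auto
  then show ?thesis using True by (simp add: w_def ph_def)
 qed (simp add: ph_def)
 ultimately show ?thesis by simp
qed

definition rad :: "'n::finite heis => real \<times> real" where
 "rad x = ((norm (fst x))^2, snd x)"

lemma rad_measurable [measurable]: "rad \<in> borel_measurable borel"
 unfolding rad_def[abs_def] by (intro borel_measurable_continuous_onI continuous_intros)

text \<open>Rectangles generate the Borel sets of the plane, and integrals over preimages under
  \<open>rad\<close> extend from them by the Dynkin argument, then to functions. The window q makes
  f integrable and equals 1 wherever h (rad x) can be nonzero.\<close>

lemma packet_orthogonal_radial:
 fixes f :: "'n::finite heis => complex"
 assumes f: "f \<in> L2_fun lborel"
  and orth: "\<And>sg ps j. \<bar>sg\<bar> = 1 ==> test_fun ps ==> support ps \<subseteq> {0<..} ==> l2_inner lborel f (pk sg ps j) = 0"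
  and h: "h \<in> borel_measurable borel" and bd: "\<And>p. cmod (h p) \<le> C" and van: "\<And>x::'n heis. norm x > R ==> h (rad x) = 0"
 shows "(LBINT x. f x * h (rad x)) = 0"
proof -
 have [measurable]: "f \<in> borel_measurable borel" using f by (simp add: L2_fun_def)
 have [measurable]: "h \<in> borel_measurable borel" by (rule h)
 \<comment> \<open>Bounds both |z|^2 <= R^2 and |t| <= |R| on the ball of radius R, and is positive
   for every R.\<close>
 define S where "S = max (R^2) \<bar>R\<bar> + 1"
 have S: "S > 0" "R^2 \<le> S" "\<bar>R\<bar> \<le> S" by (auto simp: S_def)
 define q where "q x = complex_of_real (indicator {..S} ((norm (fst x))^2) * indicator {-S..S} (snd x))" for x :: "'n heis"
 have qL: "q \<in> L2_fun lborel"
 proof (rule bounded_L2)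
  show "q \<in> borel_measurable borel" unfolding q_def[abs_def] by measurable
  show "cmod (q x) \<le> 1" for x by (simp add: q_def indicator_def)
  fix x :: "'n heis" assume x: "norm x > sqrt S + S"
  show "q x = 0"
  proof (rule ccontr)
   assume "q x \<noteq> 0"
   then have "(norm (fst x))^2 \<le> S" "\<bar>snd x\<bar> \<le> S" by (auto simp: q_def indicator_def split: if_splits)
   then have "norm (fst x) \<le> sqrt S" "\<bar>snd x\<bar> \<le> S" by (auto intro: real_le_rsqrt)
   moreover have "norm x \<le> norm (fst x) + \<bar>snd x\<bar>" using norm_Pair_le[of "fst x" "snd x"] by simp
   ultimately show False using x by linarith
  qed
 qed
 define w where "w x = f x * q x" for x
 have wi: "integrable lborel w" unfolding w_def by (rule L2_fun_mult_integrable[OF f qL])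
 have [measurable]: "w \<in> borel_measurable borel" using wi by auto
 have wrect: "(LBINT x. indicator (A \<times> B) (rad x) *\<^sub>R w x) = 0" if "A \<in> sets borel" "B \<in> sets borel" for A B
 proof -
  have "(\<lambda>x. indicator (A \<times> B) (rad x) *\<^sub>R w x) = (\<lambda>x. f x * indicator (A \<inter> {..S}) ((norm (fst x))^2) * indicator (B \<inter> {-S..S}) (snd x))"
   by (auto simp: w_def q_def rad_def indicator_def)
  then show ?thesis
   using packet_orthogonal_rectangles[OF f orth _ _ _ _ S(1), of "A \<inter> {..S}" "B \<inter> {-S..S}"] that by simp
 qed
 have box: "box a b = {fst a<..<fst b} \<times> {snd a<..<snd b}" for a b :: "real \<times> real"
  by (cases a; cases b) (auto simp: mem_box Basis_prod_def)
 have wz: "(LBINT x. indicator D (rad x) *\<^sub>R w x) = 0" if D: "D \<in> sets borel" for D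
 proof (rule integral_zero_Dynkin[where E = "range (\<lambda>(a, b). box a b)" and N = borel, OF wi])
  show "rad \<in> lborel \<rightarrow>\<^sub>M borel" by measurable
  show "Int_stable (range (\<lambda>(a, b). box a (b :: real \<times> real)))"
   unfolding Int_stable_def by clarify (metis (mono_tags) box_Int_box case_prod_conv rangeI)
  show "sets borel = sigma_sets (space borel) (range (\<lambda>(a, b). box a (b :: real \<times> real)))"
   unfolding borel_eq_box by (simp add: sets_measure_of)
  show "(LBINT x. w x) = 0" using wrect[of UNIV UNIV] by simp
  show "(LBINT x. indicator E (rad x) *\<^sub>R w x) = 0" if "E \<in> range (\<lambda>(a, b). box a (b :: real \<times> real))" for E
  proof -
   obtain a b where "E = box a b" using \<open>E \<in> _\<close> by auto
   then show ?thesis unfolding box using wrect by simp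
  qed
  show "D \<in> sets borel" by (rule D)
 qed simp
 have "(LBINT x. w x * h (rad x)) = 0"
 proof (rule integral_zero_compose[OF wi _ h _ wz])
  show "rad \<in> lborel \<rightarrow>\<^sub>M borel" by measurable
  show "integrable lborel (\<lambda>x. w x * h (rad x))" by (rule integrable_mult_bounded[OF wi _ bd]) measurable
 qed
 moreover have "w x * h (rad x) = f x * h (rad x)" for x
 proof (cases "norm x > R")
  case True then show ?thesis using van by simp
 next
  case False
  have "norm (fst x) \<le> norm x" "\<bar>snd x\<bar> \<le> norm x" using norm_fst_le[of "fst x" "snd x"] norm_snd_le[of "snd x" "fst x"] by simp_all
  then have "norm (fst x) \<le> \<bar>R\<bar>" "\<bar>snd x\<bar> \<le> \<bar>R\<bar>" using False by auto
  then have "(norm (fst x))^2 \<le> R^2" "\<bar>snd x\<bar> \<le> S" using S power_mono[of "norm (fst x)" "\<bar>R\<bar>" 2] by auto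
  then show ?thesis using S by (auto simp: w_def q_def indicator_def abs_le_iff)
 qed
 ultimately show ?thesis by simp
qed

section \<open>Rotations and averages over balls\<close>

lemma integral_rot:
 fixes h :: "'n::finite heis => 'b::{banach, second_countable_topology}"
 assumes "unitary k" "h \<in> borel_measurable borel"
 shows "(LBINT x. h (rot k x)) = (LBINT x. h x)"
  and "integrable lborel (\<lambda>x. h (rot k x)) \<longleftrightarrow> integrable lborel h"
proof -
 have "(LBINT x. h x) = (LINT x|distr lborel borel (rot k). h x)" by (simp add: lborel_distr_rot[OF assms(1)])
 also have "... = (LBINT x. h (rot k x))" by (rule integral_distr) (use assms(2) in auto)
 finally show "(LBINT x. h (rot k x)) = (LBINT x. h x)" by simp
 have "integrable lborel h \<longleftrightarrow> integrable (distr lborel borel (rot k)) h" by (simp add: lborel_distr_rot[OF assms(1)])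
 also have "... \<longleftrightarrow> integrable lborel (\<lambda>x. h (rot k x))" by (rule integrable_distr_eq) (use assms(2) in auto)
 finally show "integrable lborel (\<lambda>x. h (rot k x)) \<longleftrightarrow> integrable lborel h" by simp
qed

lemma dist_rot: "unitary k ==> dist (rot k x) (rot k y) = dist x y"
 by (simp add: dist_norm norm_rot flip: linear_diff[OF linear_rot])

lemma rad_eq_rot:
 assumes "rad x = rad y"
 obtains k where "unitary k" "rot k x = y"
proof -
 have "norm (fst x) = norm (fst y)" "snd x = snd y" using assms by (auto simp: rad_def)
 then show ?thesis using unitary_transitive[of "fst x" "fst y"] that by (auto simp: rot_def prod_eq_iff)
qed

text \<open>h reads K off the points (sqrt r e, t), which meet every orbit because the unitary group
  is transitive on spheres. In general this section is a null set, so invariance has to hold at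
  every point.\<close>

lemma radial_factor:
 fixes K :: "'n::finite heis => complex"
 assumes K: "K \<in> borel_measurable borel" and inv: "\<And>k x. unitary k ==> K (rot k x) = K x"
 obtains h where "h \<in> borel_measurable borel" "\<And>x. K x = h (rad x)" "range h \<subseteq> range K"
proof -
 obtain i :: 'n where True by blast
 define e :: "complex ^ 'n" where "e = axis i 1"
 have e: "norm e = 1" by (simp add: e_def norm_vec_def L2_set_def axis_def if_distrib[of norm] if_distrib[of "\<lambda>x. x^2"] cong: if_cong)
 \<comment> \<open>The absolute value extends the profile to negative arguments, so that h is
   measurable on the whole plane with values among those of K.\<close>
 define h where "h p = K (sqrt \<bar>fst p\<bar> *\<^sub>R e, snd p)" for p :: "real \<times> real"
 have "(\<lambda>p :: real \<times> real. (sqrt \<bar>fst p\<bar> *\<^sub>R e, snd p)) \<in> borel_measurable borel"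
  by (intro borel_measurable_continuous_onI continuous_intros)
 then have "h \<in> borel_measurable borel" unfolding h_def[abs_def] by (rule measurable_compose[OF _ K])
 moreover have "K x = h (rad x)" for x
 proof -
  have "rad x = rad (sqrt \<bar>fst (rad x)\<bar> *\<^sub>R e, snd (rad x))" by (simp add: rad_def e)
  then obtain k where "unitary k" "rot k x = (sqrt \<bar>fst (rad x)\<bar> *\<^sub>R e, snd (rad x))" by (rule rad_eq_rot)
  then show ?thesis using inv[of k x] by (simp add: h_def)
 qed
 moreover have "range h \<subseteq> range K" by (auto simp: h_def)
 ultimately show ?thesis using that by blast
qed

lemma ball_sets [measurable]: "ball x r \<in> sets borel" "cball x r \<in> sets borel"
 by auto

text \<open>Unnormalised averages. Balls are used because unitary maps carry balls to balls.\<close>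

definition ball_int :: "real => ('a::euclidean_space => complex) => 'a => complex" where
 "ball_int ep f a = (LBINT x. f x * indicator (ball a ep) x)"

lemma ball_kernel_measurable:
 "(\<lambda>p. indicator (ball (snd p) ep) (fst p) :: complex) \<in> borel_measurable (borel \<Otimes>\<^sub>M (borel :: 'a::euclidean_space measure))"
proof -
 have "open {p :: 'a \<times> 'a. dist (snd p) (fst p) < ep}" by (intro open_Collect_less continuous_intros)
 then have "(indicator {p :: 'a \<times> 'a. dist (snd p) (fst p) < ep} :: _ => complex) \<in> borel_measurable borel"
  by (intro borel_measurable_indicator) auto
 also have "(indicator {p :: 'a \<times> 'a. dist (snd p) (fst p) < ep} :: _ => complex) = (\<lambda>p. indicator (ball (snd p) ep) (fst p))"
  by (auto simp: indicator_def)
 finally show ?thesis by (simp add: borel_prod)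
qed

lemma ball_int_measurable:
 fixes f :: "'a::euclidean_space => complex"
 assumes f: "f \<in> borel_measurable borel"
 shows "ball_int ep f \<in> borel_measurable borel"
proof -
 have [measurable]: "f \<in> borel_measurable borel" by (rule f)
 have "(\<lambda>p :: 'a \<times> 'a. indicator (ball (snd p) ep) (fst p) :: complex) \<in> borel_measurable (borel \<Otimes>\<^sub>M borel)"
  by (rule ball_kernel_measurable)
 then have "(\<lambda>p :: 'a \<times> 'a. indicator (ball (snd (snd p, fst p)) ep) (fst (snd p, fst p)) :: complex) \<in> borel_measurable (borel \<Otimes>\<^sub>M borel)"
  by (rule measurable_compose[rotated]) measurable
 then have [measurable]: "(\<lambda>p :: 'a \<times> 'a. indicator (ball (fst p) ep) (snd p) :: complex) \<in> borel_measurable (borel \<Otimes>\<^sub>M borel)"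
  by simp
 have "(\<lambda>p :: 'a \<times> 'a. f (snd p) * indicator (ball (fst p) ep) (snd p)) \<in> borel_measurable (borel \<Otimes>\<^sub>M borel)"
  by measurable
 also have "borel_measurable ((borel :: 'a measure) \<Otimes>\<^sub>M (borel :: 'a measure)) = borel_measurable (borel \<Otimes>\<^sub>M lborel)"
  by (intro measurable_cong_sets sets_pair_measure_cong) auto
 finally show ?thesis unfolding ball_int_def[abs_def]
  by (intro lborel.borel_measurable_lebesgue_integral) (simp add: split_beta')
qed

text \<open>The kernel is symmetric in the centre and the point, so averaging is its own transpose.
  The bounded support of c confines f to a ball, where it is integrable.\<close>

lemma ball_int_Fubini:
 fixes f c :: "'a::euclidean_space => complex"
 assumes f: "f \<in> L2_fun lborel" and c: "c \<in> borel_measurable borel"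
  and B: "\<And>x. cmod (c x) \<le> B" and R: "\<And>x. norm x > R ==> c x = 0"
 shows "(LBINT a. c a * ball_int ep f a) = (LBINT x. f x * ball_int ep c x)"
  and "integrable lborel (\<lambda>a. c a * ball_int ep f a)"
proof -
 have [measurable]: "f \<in> borel_measurable borel" "c \<in> borel_measurable borel" using f c by (auto simp: L2_fun_def)
 note [measurable] = ball_kernel_measurable
 have ind: "(\<lambda>x. indicator (cball 0 r) x :: complex) \<in> L2_fun (lborel :: 'a measure)" for r
  by (rule bounded_L2[where B = 1 and R = r]) (auto simp: indicator_def)
 have cL: "c \<in> L2_fun lborel" by (rule bounded_L2[OF c B R])
 have "integrable lborel (\<lambda>x. c x * indicator (cball 0 R) x)" by (rule L2_fun_mult_integrable[OF cL ind])
 also have "(\<lambda>x. c x * indicator (cball 0 R) x) = c"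
 proof (rule ext)
  show "c x * indicator (cball 0 R) x = c x" for x using R[of x] by (cases "norm x > R") auto
 qed
 finally have ci: "integrable lborel c" .
 have fi: "integrable lborel (\<lambda>x. f x * indicator (cball 0 (R + ep)) x)" by (rule L2_fun_mult_integrable[OF f ind])
 define h where "h x a = f x * c a * indicator (ball a ep) x" for x a
 have hi: "integrable (lborel \<Otimes>\<^sub>M lborel) (\<lambda>(x, a). h x a)"
 proof (rule integrable_product_bounded[OF _ _ fi ci, where C = 1])
  have "(\<lambda>(x, a). h x a) \<in> borel_measurable ((borel :: 'a measure) \<Otimes>\<^sub>M (borel :: 'a measure))"
   unfolding h_def split_beta' by measurable
  then show "(\<lambda>(x, a). h x a) \<in> borel_measurable ((lborel :: 'a measure) \<Otimes>\<^sub>M (lborel :: 'a measure))" unfolding lborel_pair_measurable .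
  fix x a
  have "h x a = f x * indicator (cball 0 (R + ep)) x * c a * indicator (ball a ep) x"
  proof (cases "c a = 0 \<or> x \<notin> ball a ep")
   case False
   then have "norm a \<le> R" using R[of a] by force
   moreover have "norm x \<le> norm a + dist a x" using norm_triangle_sub[of x a] by (simp add: dist_norm norm_minus_commute)
   ultimately have "x \<in> cball 0 (R + ep)" using False by (simp add: dist_norm)
   then show ?thesis by (simp add: h_def)
  qed (auto simp: h_def)
  then show "cmod (case (x, a) of (x, a) => h x a) \<le> 1 * (cmod (f x * indicator (cball 0 (R + ep)) x) * cmod (c a))"
   by (simp add: norm_mult indicator_def)
 qed (simp_all add: lborel.sigma_finite_measure_axioms)
 have 1: "(LBINT x. h x a) = c a * ball_int ep f a" for a
  by (simp add: h_def ball_int_def mult_ac flip: integral_mult_right_zero)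
 have 2: "(LBINT a. h x a) = f x * ball_int ep c x" for x
 proof -
  have "indicator (ball a ep) x = (indicator (ball x ep) a :: complex)" for a by (simp add: indicator_def dist_commute)
  then show ?thesis by (simp add: h_def ball_int_def mult_ac flip: integral_mult_right_zero)
 qed
 show "(LBINT a. c a * ball_int ep f a) = (LBINT x. f x * ball_int ep c x)"
  using lborel_pair.Fubini_integral[OF hi] by (simp only: 1 2)
 show "integrable lborel (\<lambda>a. c a * ball_int ep f a)"
  using lborel_pair.integrable_snd[OF hi] by (simp only: 1)
qed

lemma ball_int_bound:
 fixes c :: "'a::euclidean_space => complex"
 assumes c: "c \<in> borel_measurable borel" and B: "\<And>x. cmod (c x) \<le> B"
 shows "cmod (ball_int ep c x) \<le> B * measure lborel (ball (0 :: 'a) ep)"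
  and "integrable lborel (\<lambda>y. c y * indicator (ball x ep) y)"
proof -
 have [measurable]: "c \<in> borel_measurable borel" by (rule c)
 have m: "measure lborel (ball x ep) = measure lborel (ball (0 :: 'a) ep)"
 proof (cases "ep \<ge> 0")
  case True then show ?thesis by (simp add: content_ball)
 next
  case False then have "ball x ep = {}" "ball (0 :: 'a) ep = {}" by auto
  then show ?thesis by (simp only:)
 qed
 have fin: "emeasure lborel (ball x ep) < \<infinity>" by (rule emeasure_lborel_ball_finite)
 have gi: "integrable lborel (\<lambda>y. B * indicator (ball x ep) y)"
  by (intro integrable_mult_right integrable_real_indicator fin) simp
 have le: "cmod (c y * indicator (ball x ep) y) \<le> B * indicator (ball x ep) y" for y
  using B[of y] by (simp add: indicator_def)
 show i: "integrable lborel (\<lambda>y. c y * indicator (ball x ep) y)"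
  by (rule Bochner_Integration.integrable_bound[OF gi]) (measurable, intro AE_I2 order_trans[OF le], simp)
 have "cmod (ball_int ep c x) \<le> (LBINT y. B * indicator (ball x ep) y)"
  unfolding ball_int_def using i gi le by (intro order_trans[OF integral_norm_bound] integral_mono integrable_norm) auto
 also have "... = B * measure lborel (ball (0 :: 'a) ep)" by (simp add: m)
 finally show "cmod (ball_int ep c x) \<le> B * measure lborel (ball (0 :: 'a) ep)" .
qed

lemma ball_average_tendsto:
 fixes c :: "'a::euclidean_space => complex"
 assumes cc: "continuous_on UNIV c" and B: "\<And>x. cmod (c x) \<le> B" and ep: "ep \<longlonglongrightarrow> 0" "\<And>N. ep N > 0"
 shows "(\<lambda>N. ball_int (ep N) c x / measure lborel (ball (0 :: 'a) (ep N))) \<longlonglongrightarrow> c x"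
proof (rule LIMSEQ_I)
 fix r :: real assume r: "r > 0"
 have cm [measurable]: "c \<in> borel_measurable borel" using cc by (rule borel_measurable_continuous_onI)
 obtain d where d: "d > 0" "\<And>y. dist y x < d ==> dist (c y) (c x) < r / 2"
  using cc r unfolding continuous_on_iff by (metis UNIV_I half_gt_zero)
 obtain N0 where N0: "\<And>N. N \<ge> N0 ==> norm (ep N - 0) < d" using LIMSEQ_D[OF ep(1) d(1)] by blast
 have "norm (ball_int (ep N) c x / measure lborel (ball (0 :: 'a) (ep N)) - c x) < r" if "N \<ge> N0" for N
 proof -
  define V where "V = measure lborel (ball (0 :: 'a) (ep N))"
  have V: "V > 0" "measure lborel (ball x (ep N)) = V" using ep(2)[of N] by (simp_all add: V_def content_ball_pos content_ball)
  have dm: "(\<lambda>y. (c y - c x) * indicator (ball x (ep N)) y) \<in> borel_measurable lborel" by measurable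
  have gi: "integrable lborel (\<lambda>y. r / 2 * indicator (ball x (ep N)) y)"
   by (intro integrable_mult_right integrable_real_indicator) (simp_all add: emeasure_lborel_ball_finite[unfolded infinity_ennreal_def])
  have le: "cmod ((c y - c x) * indicator (ball x (ep N)) y) \<le> r / 2 * indicator (ball x (ep N)) y" for y
   using d(2)[of y] N0[OF that] ep(2)[of N] by (auto simp: indicator_def dist_norm norm_minus_commute intro: less_imp_le)
  have di: "integrable lborel (\<lambda>y. (c y - c x) * indicator (ball x (ep N)) y)"
   by (rule Bochner_Integration.integrable_bound[OF gi dm]) (intro AE_I2 order_trans[OF le], simp)
  have "cmod (LBINT y. (c y - c x) * indicator (ball x (ep N)) y) \<le> (LBINT y. r / 2 * indicator (ball x (ep N)) y)"
   using di gi le by (intro order_trans[OF integral_norm_bound] integral_mono integrable_norm) auto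
  also have "... = r / 2 * V" by (simp add: V)
  finally have 1: "cmod (LBINT y. (c y - c x) * indicator (ball x (ep N)) y) \<le> r / 2 * V" .
  have ix: "integrable lborel (\<lambda>y. c x * indicator (ball x (ep N)) y)" 
   using ball_int_bound(2)[of "\<lambda>y. c x" "cmod (c x)"] by simp
  have "(LBINT y. (c y - c x) * indicator (ball x (ep N)) y) = ball_int (ep N) c x - (LBINT y. c x * indicator (ball x (ep N)) y)"
   unfolding left_diff_distrib ball_int_def
   by (rule Bochner_Integration.integral_diff[OF ball_int_bound(2)[OF cm B] ix])
  also have "(LBINT y. c x * indicator (ball x (ep N)) y) = c x * of_real V"
  proof -
   have "(LBINT y. c x * indicator (ball x (ep N)) y) = (LBINT y. c x * complex_of_real (indicator (ball x (ep N)) y))"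
    by (intro Bochner_Integration.integral_cong refl) (simp add: indicator_def)
   then show ?thesis by (simp add: V(2))
  qed
  finally have "cmod (ball_int (ep N) c x - c x * of_real V) \<le> r / 2 * V" using 1 by simp
  moreover have "ball_int (ep N) c x / of_real V - c x = (ball_int (ep N) c x - c x * of_real V) / of_real V"
   using V(1) by (simp add: field_simps)
  ultimately have "cmod (ball_int (ep N) c x / of_real V - c x) \<le> r / 2"
   using V(1) by (simp add: norm_divide divide_le_eq)
  then show ?thesis using r by (simp add: V_def)
 qed
 then show "\<exists>N0. \<forall>N\<ge>N0. norm (ball_int (ep N) c x / measure lborel (ball (0 :: 'a) (ep N)) - c x) < r" by blast
qed

lemma ball_int_support:
 assumes R: "\<And>x. norm x > R ==> c x = 0" and x: "norm x > R + ep"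
 shows "ball_int ep c x = 0"
proof -
 have "c y * indicator (ball x ep) y = 0" for y
 proof (cases "y \<in> ball x ep")
  case True
  have "norm x \<le> norm y + dist x y" using norm_triangle_sub[of x y] by (simp add: dist_norm)
  then show ?thesis using x True R[of y] by simp
 qed simp
 then show ?thesis unfolding ball_int_def by (simp only: Bochner_Integration.integral_zero)
qed

lemma L2_test_zero:
 fixes f :: "'a::euclidean_space => complex"
 assumes f: "f \<in> L2_fun lborel" and zero: "\<And>ph. test_fun ph ==> (LBINT x. f x * ph x) = 0"
 shows "AE x in lborel. f x = 0"
proof -
 have "AE x in lborel. x \<in> UNIV --> f x = 0"
 proof (rule fundamental_lemma)
  show "integrable lborel (\<lambda>x. indicator (cbox a b) x *\<^sub>R f x)" for a b
  proof -
   have "bounded (cbox a b)" by (rule bounded_cbox)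
   then obtain r where r: "\<And>x. x \<in> cbox a b ==> norm x \<le> r" unfolding bounded_iff by blast
   have "(\<lambda>x. complex_of_real (indicator (cbox a b) x)) \<in> L2_fun lborel"
   proof (rule bounded_L2[where B = 1 and R = r])
    show "complex_of_real (indicator (cbox a b) x) = 0" if "norm x > r" for x
     using r[of x] that by (auto simp: indicator_def)
   qed (auto simp: indicator_def)
   from L2_fun_mult_integrable[OF this f] show ?thesis by (simp add: scaleR_conv_of_real)
  qed
 qed (use f zero in \<open>simp_all add: lborel.sigma_finite_measure_axioms L2_fun_def\<close>)
 then show ?thesis by simp
qed

text \<open>By symmetry the average is moved from f to the test function, whose averages converge to
  it by continuity; differentiation of integrals of f itself does not enter.\<close>

lemma AE_zero_ball_int:
 fixes f :: "'a::euclidean_space => complex"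
 assumes f: "f \<in> L2_fun lborel" and zero: "\<And>ep. ep > 0 ==> AE a in lborel. ball_int ep f a = 0"
 shows "AE x in lborel. f x = 0"
proof -
 have fm [measurable]: "f \<in> borel_measurable borel" using f by (simp add: L2_fun_def)
 have ind: "(\<lambda>x. indicator (cball 0 r) x :: complex) \<in> L2_fun (lborel :: 'a measure)" for r
  by (rule bounded_L2[where B = 1 and R = r]) (auto simp: indicator_def)
 show ?thesis
 proof (rule L2_test_zero[OF f])
  fix ph :: "'a => complex" assume ph: "test_fun ph"
  have phc: "continuous_on UNIV ph" by (rule smooth_continuous[OF test_fun_smooth[OF ph]])
  have phm [measurable]: "ph \<in> borel_measurable borel" by (rule smooth_measurable[OF test_fun_smooth[OF ph]])
  obtain B where B: "\<And>x. cmod (ph x) \<le> B" using test_fun_bound[OF ph] by blast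
  obtain R where R: "\<And>x. norm x > R ==> ph x = 0" using test_fun_vanish[OF ph] by blast
  define ep where "ep N = 1 / real (Suc N)" for N
  have ep: "ep \<longlonglongrightarrow> 0" "\<And>N. ep N > 0" "\<And>N. ep N \<le> 1" unfolding ep_def using LIMSEQ_Suc[OF lim_1_over_n] by auto
  define a where "a N x = ball_int (ep N) ph x / of_real (measure lborel (ball (0 :: 'a) (ep N)))" for N x
  have am [measurable]: "a N \<in> borel_measurable borel" for N
   unfolding a_def[abs_def] using ball_int_measurable[OF phm] by measurable
  have z: "(LBINT x. f x * a N x) = 0" for N
  proof -
   have "(LBINT x. f x * ball_int (ep N) ph x) = (LBINT a. ph a * ball_int (ep N) f a)"
    by (rule ball_int_Fubini(1)[OF f phm B R, symmetric])
   also have "... = (LINT a|(lborel :: 'a measure). 0)"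
   proof (rule integral_cong_AE)
    show "AE x in lborel. ph x * ball_int (ep N) f x = 0" using zero[OF ep(2)[of N]] by eventually_elim simp
   qed (use ball_int_measurable[OF fm] in measurable)
   finally show ?thesis by (simp add: a_def)
  qed
  have "(\<lambda>N. LBINT x. f x * a N x) \<longlonglongrightarrow> (LBINT x. f x * ph x)"
  proof (rule integral_dominated_convergence)
   show "integrable lborel (\<lambda>x. B * cmod (f x * indicator (cball 0 (R + 1)) x))"
    by (intro integrable_mult_right integrable_norm L2_fun_mult_integrable f ind)
   show "AE x in lborel. (\<lambda>N. f x * a N x) \<longlonglongrightarrow> f x * ph x"
    unfolding a_def by (intro AE_I2 tendsto_mult tendsto_const ball_average_tendsto[OF phc B ep(1,2)])
   show "AE x in lborel. norm (f x * a N x) \<le> B * cmod (f x * indicator (cball 0 (R + 1)) x)" for N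
   proof (rule AE_I2)
    fix x :: 'a
    have V: "measure lborel (ball (0 :: 'a) (ep N)) > 0" using ep(2)[of N] by (rule content_ball_pos)
    have B0: "B \<ge> 0" using B[of 0] norm_ge_zero order_trans by blast
    show "norm (f x * a N x) \<le> B * cmod (f x * indicator (cball 0 (R + 1)) x)"
    proof (cases "norm x > R + ep N")
     case True
     then show ?thesis using ball_int_support[OF R True] B0 by (simp add: a_def)
    next
     case False
     then have "x \<in> cball 0 (R + 1)" using ep(3)[of N] by simp
     moreover have "cmod (a N x) \<le> B"
      using ball_int_bound(1)[OF phm B, of "ep N" x] V by (simp add: a_def norm_divide divide_le_eq)
     ultimately show ?thesis using mult_left_mono[of "cmod (a N x)" B "cmod (f x)"] by (simp add: norm_mult mult.commute)
    qed
   qed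
  qed measurable
  then show "(LBINT x. f x * ph x) = 0" unfolding z by (simp add: LIMSEQ_const_iff)
 qed
qed

text \<open>Invariance almost everywhere becomes invariance at every point, since an average does
  not see null sets.\<close>

lemma ball_int_rot:
 fixes f :: "'n::finite heis => complex"
 assumes k: "unitary k" and f: "f \<in> borel_measurable borel" and inv: "AE x in lborel. f (rot k x) = f x"
 shows "ball_int ep f (rot k a) = ball_int ep f a"
proof -
 have [measurable]: "f \<in> borel_measurable borel" by (rule f)
 have "ball_int ep f (rot k a) = (LBINT x. f (rot k x) * indicator (ball (rot k a) ep) (rot k x))"
  unfolding ball_int_def by (rule integral_rot(1)[OF k, symmetric]) measurable
 also have "... = (LBINT x. f (rot k x) * indicator (ball a ep) x)"
  by (simp add: indicator_def dist_rot[OF k])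
 also have "... = ball_int ep f a" unfolding ball_int_def
 proof (rule integral_cong_AE)
  show "AE x in lborel. f (rot k x) * indicator (ball a ep) x = f x * indicator (ball a ep) x"
   using inv by eventually_elim simp
 qed measurable
 finally show ?thesis .
qed

lemma L2_rad_rot: "f \<in> L2_rad \<longleftrightarrow> f \<in> L2_fun lborel \<and> (\<forall>k. unitary k --> (AE x in lborel. f (rot k x) = f x))"
 by (simp add: L2_rad_def rot_def)

text \<open>The average A of f is paired with its own conjugate phase c, cut off to a ball, so that
  c A = |A|. Moving the average onto c gives a bounded, boundedly supported function that is
  invariant at every point, hence a function of |z|^2 and t, to which f is orthogonal. So A vanishes
  on every ball, for every radius of averaging.\<close>

lemma packet_total_radial:
 fixes f :: "'n::finite heis => complex"
 assumes f: "f \<in> L2_rad"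
  and orth: "\<And>sg ps j. \<bar>sg\<bar> = 1 ==> test_fun ps ==> support ps \<subseteq> {0<..} ==> l2_inner lborel f (pk sg ps j) = 0"
 shows "AE x in lborel. f x = 0"
proof (rule AE_zero_ball_int)
 show fL: "f \<in> L2_fun lborel" using f by (simp add: L2_rad_rot)
 have fm: "f \<in> borel_measurable borel" using fL by (simp add: L2_fun_def)
 fix ep :: real assume ep: "ep > 0"
 define A where "A = ball_int ep f"
 have Am [measurable]: "A \<in> borel_measurable borel" unfolding A_def by (rule ball_int_measurable[OF fm])
 have Arot: "A (rot k a) = A a" if "unitary k" for k a
  unfolding A_def using f that by (intro ball_int_rot fm) (auto simp: L2_rad_rot)
 have "AE a in lborel. norm a \<le> R --> A a = 0" for R
 proof -
  \<comment> \<open>Where A vanishes the quotient is 0 / 0 = 0; c inherits exact invariance from A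
    and is bounded by 1.\<close>
  define c where "c a = indicator (cball 0 R) a * (cnj (A a) / of_real (cmod (A a)))" for a
  have "(\<lambda>w. cnj w / of_real (cmod w)) \<in> borel_measurable borel" by measurable
  from measurable_compose[OF Am this] have cm [measurable]: "c \<in> borel_measurable borel"
   unfolding c_def[abs_def] by (intro borel_measurable_times borel_measurable_indicator) auto
  have cB: "cmod (c x) \<le> 1" for x by (simp add: c_def norm_mult norm_divide indicator_def)
  have cR: "c x = 0" if "norm x > R" for x using that by (simp add: c_def)
  have crot: "c (rot k a) = c a" if "unitary k" for k a
   using Arot[OF that] norm_rot[OF that] by (simp add: c_def indicator_def)
  have cA: "c a * A a = of_real (indicator (cball 0 R) a * cmod (A a))" for a
  proof (cases "A a = 0")
   case False
   have "cnj (A a) * A a = of_real (cmod (A a)) * of_real (cmod (A a))"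
    using complex_norm_square[of "A a"] by (simp add: power2_eq_square mult.commute)
   then show ?thesis using False by (simp add: c_def indicator_def)
  qed (simp add: c_def)
  define K where "K = ball_int ep c"
  have Km: "K \<in> borel_measurable borel" unfolding K_def by (rule ball_int_measurable[OF cm])
  have Krot: "K (rot k a) = K a" if "unitary k" for k a
   unfolding K_def using crot that by (intro ball_int_rot cm) auto
  obtain h where h: "h \<in> borel_measurable borel" "\<And>x. K x = h (rad x)" "range h \<subseteq> range K"
   using radial_factor[of K, OF Km Krot] by blast
  have "(LBINT x. f x * h (rad x)) = 0"
  proof (rule packet_orthogonal_radial[OF fL _ h(1)])
   show "cmod (h p) \<le> 1 * measure lborel (ball (0 :: 'n heis) ep)" for p
   proof -
    obtain x where "h p = K x" using h(3) by blast
    then show ?thesis using ball_int_bound(1)[OF cm cB, of ep x] by (simp only: K_def)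
   qed
   show "h (rad x) = 0" if "norm x > R + ep" for x :: "'n heis"
    using ball_int_support[of R c ep x, OF cR that] h(2)[of x] by (simp add: K_def)
  qed (fact orth)
  then have "(LBINT x. f x * ball_int ep c x) = 0" unfolding h(2)[symmetric] K_def .
  then have "(LBINT a. c a * A a) = 0"
   unfolding A_def using ball_int_Fubini(1)[OF fL cm cB cR] by simp
  moreover have "integrable lborel (\<lambda>a. c a * A a)" unfolding A_def by (rule ball_int_Fubini(2)[OF fL cm cB cR])
  ultimately have i: "integrable lborel (\<lambda>a. indicator (cball 0 R) a * cmod (A a))"
   and "(LBINT a. indicator (cball 0 R) a * cmod (A a)) = 0"
   unfolding cA complex_of_real_integrable_eq integral_complex_of_real by (simp_all del: of_real_mult)
  then have "AE a in lborel. indicator (cball 0 R) a * cmod (A a) = 0"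
   using integral_nonneg_eq_0_iff_AE[OF i] by auto
  then show ?thesis by eventually_elim (auto simp: indicator_def split: if_splits)
 qed
 then have "AE a in lborel. \<forall>R::nat. norm a \<le> real R --> A a = 0" unfolding AE_all_countable by blast
 then show "AE a in lborel. ball_int ep f a = 0"
  by eventually_elim (metis A_def real_arch_simple)
qed

subsection \<open>The Plancherel theorem\<close>

lemma L2_fun_rot:
 fixes f :: "'n::finite heis => complex"
 assumes k: "unitary k" and f: "f \<in> L2_fun lborel"
 shows "(\<lambda>x. f (rot k x)) \<in> L2_fun lborel" "L2_norm lborel (\<lambda>x. f (rot k x)) = L2_norm lborel f"
proof -
 have fm [measurable]: "f \<in> borel_measurable borel" using f by (simp add: L2_fun_def)
 have m: "(\<lambda>x. (cmod (f x))^2) \<in> borel_measurable borel" by measurable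
 show "(\<lambda>x. f (rot k x)) \<in> L2_fun lborel"
 proof (rule L2_funI)
  show "integrable lborel (\<lambda>x. (cmod (f (rot k x)))^2)"
   using integral_rot(2)[OF k m] L2_fun_integrable[OF f] by simp
 qed measurable
 show "L2_norm lborel (\<lambda>x. f (rot k x)) = L2_norm lborel f"
  unfolding L2_norm_def using integral_rot(1)[OF k m] by simp
qed

lemma L2_rad_limit:
 fixes f :: "'n::finite heis => complex"
 assumes s: "\<And>i. s i \<in> schwartz_rad" and lim: "L2_tendsto lborel s f"
 shows "f \<in> L2_rad"
 unfolding L2_rad_rot
proof (intro conjI allI impI)
 show f: "f \<in> L2_fun lborel" using lim by (simp add: L2_tendsto_def)
 fix k :: "complex ^ 'n ^ 'n" assume k: "unitary k"
 have sk: "s i (rot k x) = s i x" for i x using s[of i] k by (cases x) (simp add: schwartz_rad_def rot_def)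
 have sL: "s i \<in> L2_fun lborel" for i using lim by (simp add: L2_tendsto_def)
 have "L2_norm lborel (\<lambda>x. s i x - f (rot k x)) = L2_norm lborel (\<lambda>x. s i x - f x)" for i
  using L2_fun_rot(2)[OF k L2_fun_diff[OF sL[of i] f]] by (simp add: sk)
 then have "L2_tendsto lborel s (\<lambda>x. f (rot k x))"
  using lim L2_fun_rot(1)[OF k f] by (simp add: L2_tendsto_def)
 then show "AE x in lborel. f (rot k x) = f x" using lim by (rule L2_tendsto_unique_AE)
qed

lemma L2_rad_diff:
 fixes f g :: "'n::finite heis => complex"
 assumes f: "f \<in> L2_rad" and g: "g \<in> L2_rad"
 shows "(\<lambda>x. f x - g x) \<in> L2_rad"
 unfolding L2_rad_rot
proof (intro conjI allI impI)
 show "(\<lambda>x. f x - g x) \<in> L2_fun lborel" using f g by (intro L2_fun_diff) (simp_all add: L2_rad_rot)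
 fix k :: "complex ^ 'n ^ 'n" assume k: "unitary k"
 have "AE x in lborel. f (rot k x) = f x" "AE x in lborel. g (rot k x) = g x" using f g k by (simp_all add: L2_rad_rot)
 then show "AE x in lborel. f (rot k x) - g (rot k x) = f x - g x" by eventually_elim simp
qed

lemma L2_tendsto_cong_AE:
 assumes "L2_tendsto M s f" "g \<in> borel_measurable M" "AE x in M. g x = f x"
 shows "L2_tendsto M s g"
proof -
 have f: "f \<in> L2_fun M" and s: "\<And>k. s k \<in> L2_fun M" using assms(1) by (auto simp: L2_tendsto_def)
 have g: "g \<in> L2_fun M" by (rule L2_fun_cong_AE[OF assms(2) f assms(3)])
 have "L2_norm M (\<lambda>x. s k x - g x) = L2_norm M (\<lambda>x. s k x - f x)" for k
  using L2_fun_diff[OF s[of k] f] L2_fun_diff[OF s[of k] g] assms(3) by (intro L2_norm_cong_AE) (auto simp: L2_fun_def)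
 then show ?thesis using assms(1) s g by (simp add: L2_tendsto_def)
qed

text \<open>\<open>dual_transform f F\<close> says that F is the spherical transform of the radial part of f;
 it is meaningful for functions f that are not radial.\<close>

definition dual_transform :: "('n::finite heis => complex) => (real \<times> real => complex) => bool" where
 "dual_transform f F \<longleftrightarrow> f \<in> L2_fun lborel \<and> F \<in> L2_fun (plancherel CARD('n)) \<and>
   (\<forall>s t. packet s t --> l2_inner lborel f s = l2_inner (plancherel CARD('n)) F t)"

lemma dual_transform_L2:
 assumes "dual_transform (f :: 'n::finite heis => complex) F"
 shows "f \<in> L2_fun lborel" "F \<in> L2_fun (plancherel CARD('n))"
 using assms by (auto simp: dual_transform_def)

lemma dual_transform_inner:
 assumes "dual_transform (f :: 'n::finite heis => complex) F" "packet s t"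
 shows "l2_inner lborel f s = l2_inner (plancherel CARD('n)) F t"
 using assms by (auto simp: dual_transform_def)

lemma dual_transform_exists:
 assumes "f \<in> L2_fun lborel"
 shows "\<exists>F. dual_transform (f :: 'n::finite heis => complex) F"
 using pkt.extension[OF assms] assms unfolding dual_transform_def L2_tendsto_def by blast

lemma dual_transform_eqI:
 assumes n: "n > 0" and F: "loc_int n F" and G: "loc_int n G"
  and eq: "\<And>sg ps j. \<bar>sg\<bar> = 1 ==> test_fun ps ==> support ps \<subseteq> {0<..} ==>
   l2_inner (plancherel n) F (pks n sg ps j) = l2_inner (plancherel n) G (pks n sg ps j)"
 shows "AE p in plancherel n. F p = G p"
proof -
 have "AE p in plancherel n. (\<forall>j. on_branch n j p --> \<bar>snd p\<bar> \<in> UNIV) --> F p - G p = 0"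
 proof (rule packet_total_dual[OF n loc_int_diff[OF F G]])
  fix sg :: real and ps :: "real => complex" and j assume *: "\<bar>sg\<bar> = 1" "test_fun ps" "support ps \<subseteq> {0<..}"
  show "l2_inner (plancherel n) (\<lambda>p. F p - G p) (pks n sg ps j) = 0"
   using eq[OF *, of j] F G * unfolding l2_inner_def left_diff_distrib loc_int_def
   by (simp add: Bochner_Integration.integral_diff)
 qed simp
 then show ?thesis by simp
qed

lemma dual_transform_unique:
 assumes F: "dual_transform (f :: 'n::finite heis => complex) F" and G: "dual_transform f G"
 shows "AE p in plancherel CARD('n). F p = G p"
 using dual_transform_inner[OF F packet.gen] dual_transform_inner[OF G packet.gen]
 by (intro dual_transform_eqI loc_int_L2 dual_transform_L2[OF F] dual_transform_L2[OF G]) auto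

lemma dual_transform_cong_AE:
 assumes F: "dual_transform (f :: 'n::finite heis => complex) F" and g: "g \<in> L2_fun lborel"
  and fg: "AE x in lborel. f x = g x" and G: "G \<in> L2_fun (plancherel CARD('n))"
  and FG: "AE p in plancherel CARD('n). F p = G p"
 shows "dual_transform g G"
 unfolding dual_transform_def
proof (intro conjI allI impI g G)
 fix s :: "'n heis => complex" and t assume st: "packet s t"
 have "l2_inner lborel g s = l2_inner lborel f s"
  using fg g dual_transform_L2[OF F] pkt.left[OF st] by (intro l2_inner_cong_AE) (auto simp: L2_fun_def)
 also have "... = l2_inner (plancherel CARD('n)) F t" by (rule dual_transform_inner[OF F st])
 also have "... = l2_inner (plancherel CARD('n)) G t"
  using FG G dual_transform_L2[OF F] pkt.right[OF st] by (intro l2_inner_cong_AE) (auto simp: L2_fun_def)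
 finally show "l2_inner lborel g s = l2_inner (plancherel CARD('n)) G t" .
qed

lemma dual_transform_limit:
 assumes sF: "\<And>k. dual_transform (s k :: 'n::finite heis => complex) (t k)"
  and s: "L2_tendsto lborel s f" and t: "L2_tendsto (plancherel CARD('n)) t F"
 shows "dual_transform f F"
 unfolding dual_transform_def
proof (intro conjI allI impI)
 show "f \<in> L2_fun lborel" "F \<in> L2_fun (plancherel CARD('n))" using s t by (auto simp: L2_tendsto_def)
 fix a :: "'n heis => complex" and b assume ab: "packet a b"
 have "(\<lambda>k. l2_inner lborel (s k) a) \<longlonglongrightarrow> l2_inner lborel f a"
  by (rule L2_tendsto_inner[OF s pkt.left[OF ab]])
 moreover have "(\<lambda>k. l2_inner lborel (s k) a) \<longlonglongrightarrow> l2_inner (plancherel CARD('n)) F b"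
  unfolding dual_transform_inner[OF sF ab] by (rule L2_tendsto_inner[OF t pkt.right[OF ab]])
 ultimately show "l2_inner lborel f a = l2_inner (plancherel CARD('n)) F b" by (rule LIMSEQ_unique)
qed

lemma dual_transform_diff:
 assumes F: "dual_transform (f :: 'n::finite heis => complex) F" and G: "dual_transform g G"
 shows "dual_transform (\<lambda>x. f x - g x) (\<lambda>p. F p - G p)"
 unfolding dual_transform_def
proof (intro conjI allI impI L2_fun_diff dual_transform_L2[OF F] dual_transform_L2[OF G])
 fix s :: "'n heis => complex" and t assume st: "packet s t"
 show "l2_inner lborel (\<lambda>x. f x - g x) s = l2_inner (plancherel CARD('n)) (\<lambda>p. F p - G p) t"
  by (simp add: l2_inner_diff_left dual_transform_L2[OF F] dual_transform_L2[OF G] pkt.left[OF st] pkt.right[OF st]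
   dual_transform_inner[OF F st] dual_transform_inner[OF G st])
qed

lemma dual_transform_packet: "packet s t ==> dual_transform s t"
 unfolding dual_transform_def using pkt.left pkt.right pkt.inner by blast

text \<open>The transform defined by the integral has the same pairings with packets as the
  square-integrable F obtained by projection, so the two agree almost everywhere.
  Square-integrability of the integral transform is a consequence.\<close>

lemma dual_transform_schwartz:
 fixes s :: "'n::finite heis => complex"
 assumes s: "s \<in> schwartz_rad"
 shows "dual_transform s (spherical_transform s)"
proof -
 obtain F where F: "dual_transform s F" using dual_transform_exists[OF schwartz_rad_integrable(2)[OF s]] by blast
 have si: "integrable lborel s" by (rule schwartz_rad_integrable[OF s])
 have ae: "AE p in plancherel CARD('n). F p = spherical_transform s p"
 proof (rule dual_transform_eqI)
  fix sg :: real and ps :: "real => complex" and j assume *: "\<bar>sg\<bar> = 1" "test_fun ps" "support ps \<subseteq> {0<..}"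
  show "l2_inner (plancherel CARD('n)) F (pks CARD('n) sg ps j) =
    l2_inner (plancherel CARD('n)) (spherical_transform s) (pks CARD('n) sg ps j)"
   using dual_transform_inner[OF F packet.gen[OF *]] pk_pairing(1)[OF * si] by simp
 qed (simp_all add: loc_int_L2 dual_transform_L2[OF F] loc_int_transform si)
 have m: "spherical_transform s \<in> borel_measurable (plancherel CARD('n))"
  using loc_int_transform[OF si] by (simp add: loc_int_def)
 have "AE p in plancherel CARD('n). spherical_transform s p = F p" using ae by eventually_elim simp
 then have "spherical_transform s \<in> L2_fun (plancherel CARD('n))"
  by (rule L2_fun_cong_AE[OF m dual_transform_L2(2)[OF F]])
 then show ?thesis
  using ae by (intro dual_transform_cong_AE[OF F schwartz_rad_integrable(2)[OF s]]) auto
qed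

text \<open>The projection v of f on the closed span of packets is radial as a limit of radial
  functions; f - v is then radial and orthogonal to all packets, hence zero.\<close>

lemma packet_approximation:
 fixes f :: "'n::finite heis => complex"
 assumes f: "f \<in> L2_rad" and F: "dual_transform f F"
 obtains s t where "\<And>k. packet (s k) (t k)" "L2_tendsto lborel s f" "L2_tendsto (plancherel CARD('n)) t F"
proof -
 have fL: "f \<in> L2_fun lborel" by (rule dual_transform_L2[OF F])
 obtain s t v V where st: "\<And>k. packet (s k) (t k)" and s: "L2_tendsto lborel s v" and t: "L2_tendsto (plancherel CARD('n)) t V"
  and orth: "\<And>a b. packet a b ==> l2_inner lborel (\<lambda>x. f x - v x) a = 0"
  using pkt.extension[OF fL] by metis
 have v: "v \<in> L2_rad" by (rule L2_rad_limit[OF packet_schwartz_rad[OF st] s])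
 have "AE x in lborel. f x - v x = 0"
  by (rule packet_total_radial[OF L2_rad_diff[OF f v]]) (rule orth[OF packet.gen])
 then have fv: "AE x in lborel. f x = v x" by eventually_elim simp
 then have sf: "L2_tendsto lborel s f" using fL by (intro L2_tendsto_cong_AE[OF s]) (auto simp: L2_fun_def)
 have "dual_transform f V" by (rule dual_transform_limit[OF dual_transform_packet[OF st] sf t])
 then have "AE p in plancherel CARD('n). F p = V p" by (rule dual_transform_unique[OF F])
 then have "L2_tendsto (plancherel CARD('n)) t F" using dual_transform_L2(2)[OF F] by (intro L2_tendsto_cong_AE[OF t]) (auto simp: L2_fun_def)
 with st sf show ?thesis by (rule that)
qed

lemma dual_transform_isometry:
 fixes f :: "'n::finite heis => complex"
 assumes f: "f \<in> L2_rad" and F: "dual_transform f F"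
 shows "L2_norm lborel f = L2_norm (plancherel CARD('n)) F"
proof -
 obtain s t where st: "\<And>k. packet (s k) (t k)" and s: "L2_tendsto lborel s f" and t: "L2_tendsto (plancherel CARD('n)) t F"
  by (rule packet_approximation[OF f F]) blast
 have "(\<lambda>k. L2_norm lborel (s k)) \<longlonglongrightarrow> L2_norm lborel f" by (rule L2_tendsto_norm[OF s])
 moreover have "(\<lambda>k. L2_norm lborel (s k)) \<longlonglongrightarrow> L2_norm (plancherel CARD('n)) F"
  unfolding pkt.isometric[OF st] by (rule L2_tendsto_norm[OF t])
 ultimately show ?thesis by (rule LIMSEQ_unique)
qed

text \<open>The converse relation is projected: the resulting f has the pairings with packets that F
  prescribes, which is precisely \<open>dual_transform\<close>, and it is radial as a limit of
  packets.\<close>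

lemma dual_transform_surj:
 assumes F: "F \<in> L2_fun (plancherel CARD('n))"
 obtains f :: "'n::finite heis => complex" where "f \<in> L2_rad" "dual_transform f F"
proof -
 obtain t s V f where st: "\<And>k. packet (s k :: 'n heis => complex) (t k)" and t: "L2_tendsto (plancherel CARD('n)) t V" and s: "L2_tendsto lborel s f"
  and inner: "\<And>a b. packet b a ==> l2_inner (plancherel CARD('n)) F a = l2_inner lborel f b"
  using L2_isometry.extension[OF pkt.converse_isometry F] by metis
 have "f \<in> L2_rad" by (rule L2_rad_limit[OF packet_schwartz_rad[OF st] s])
 moreover have "dual_transform f F"
  using F s inner unfolding dual_transform_def L2_tendsto_def by auto
 ultimately show ?thesis by (rule that)
qed

text \<open>The set of limits is a single class. Any limit along radial Schwartz functions is a weak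
  transform of f, hence F almost everywhere; conversely packets approximate f, and their transforms,
  equal to the packet images almost everywhere, converge to every representative of F.\<close>

lemma spherical_transform_L2_class:
 fixes f :: "'n::finite heis => complex"
 assumes f: "f \<in> L2_rad" and F: "dual_transform f F"
 shows "spherical_transform_L2 (L2_class lborel f) = L2_class (plancherel CARD('n)) F"
proof (rule set_eqI)
 fix G
 show "G \<in> spherical_transform_L2 (L2_class lborel f) \<longleftrightarrow> G \<in> L2_class (plancherel CARD('n)) F"
 proof
  assume "G \<in> spherical_transform_L2 (L2_class lborel f)"
  then obtain g s where g: "g \<in> L2_fun lborel" "AE x in lborel. g x = f x" and s: "\<And>k. s k \<in> schwartz_rad" "L2_tendsto lborel s g"
   and G: "L2_tendsto (plancherel CARD('n)) (\<lambda>k. spherical_transform (s k)) G"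
   unfolding spherical_transform_L2_def L2_class_def by blast
  have GL: "G \<in> L2_fun (plancherel CARD('n))" using G by (simp add: L2_tendsto_def)
  have "dual_transform g G" by (rule dual_transform_limit[OF dual_transform_schwartz[OF s(1)] s(2) G])
  then have "dual_transform f G"
   by (rule dual_transform_cong_AE[OF _ dual_transform_L2(1)[OF F] g(2) GL]) simp
  then show "G \<in> L2_class (plancherel CARD('n)) F"
   using dual_transform_unique[OF _ F] GL by (simp add: L2_class_def)
 next
  assume "G \<in> L2_class (plancherel CARD('n)) F"
  then have G: "G \<in> L2_fun (plancherel CARD('n))" "AE p in plancherel CARD('n). G p = F p" by (auto simp: L2_class_def)
  obtain s t where st: "\<And>k. packet (s k) (t k)" and s: "L2_tendsto lborel s f" and t: "L2_tendsto (plancherel CARD('n)) t F"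
   by (rule packet_approximation[OF f F]) blast
  have tG: "L2_tendsto (plancherel CARD('n)) t G" using G by (intro L2_tendsto_cong_AE[OF t]) (auto simp: L2_fun_def)
  have sr: "s k \<in> schwartz_rad" for k by (rule packet_schwartz_rad[OF st])
  have TL: "spherical_transform (s k) \<in> L2_fun (plancherel CARD('n))" for k
   by (rule dual_transform_L2(2)[OF dual_transform_schwartz[OF sr]])
  have "L2_norm (plancherel CARD('n)) (\<lambda>p. spherical_transform (s k) p - G p) = L2_norm (plancherel CARD('n)) (\<lambda>p. t k p - G p)" for k
  proof (rule L2_norm_cong_AE)
   show "(\<lambda>p. spherical_transform (s k) p - G p) \<in> borel_measurable (plancherel CARD('n))"
    using L2_fun_diff[OF TL G(1)] by (simp add: L2_fun_def)
   show "(\<lambda>p. t k p - G p) \<in> borel_measurable (plancherel CARD('n))"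
    using L2_fun_diff[OF pkt.right[OF st] G(1)] by (simp add: L2_fun_def)
   show "AE p in plancherel CARD('n). spherical_transform (s k) p - G p = t k p - G p"
    using packet_transform_AE[OF st[of k]] by eventually_elim simp
  qed
  then have "L2_tendsto (plancherel CARD('n)) (\<lambda>k. spherical_transform (s k)) G"
   using tG TL by (simp add: L2_tendsto_def)
  moreover have "f \<in> L2_class lborel f" using dual_transform_L2(1)[OF F] by (simp add: L2_class_def)
  ultimately show "G \<in> spherical_transform_L2 (L2_class lborel f)"
   unfolding spherical_transform_L2_def using sr s by blast
 qed
qed

lemma L2_class_eqI:
 assumes "AE x in M. f x = g x"
 shows "L2_class M f = L2_class M g"
proof (rule set_eqI)
 fix h
 have "(AE x in M. h x = f x) \<longleftrightarrow> (AE x in M. h x = g x)"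
 proof
  assume "AE x in M. h x = f x"
  with assms show "AE x in M. h x = g x" by eventually_elim simp
 next
  assume "AE x in M. h x = g x"
  with assms show "AE x in M. h x = f x" by eventually_elim simp
 qed
 then show "h \<in> L2_class M f \<longleftrightarrow> h \<in> L2_class M g" by (simp add: L2_class_def)
qed

text \<open>Reduces a bijection between sets of classes to an equivalence of conditions on one pair
  (f, F).\<close>

lemma transform_bij_betw:
 fixes A :: "('n::finite heis => complex) set"
 assumes A: "A \<subseteq> L2_rad" and B: "B \<subseteq> L2_fun (plancherel CARD('n))"
  and AB: "\<And>f F. f \<in> L2_rad ==> dual_transform f F ==> f \<in> A \<longleftrightarrow> F \<in> B"
 shows "bij_betw spherical_transform_L2 (L2_class lborel ` A) (L2_class (plancherel CARD('n)) ` B)"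
proof (rule bij_betw_imageI)
 show "inj_on spherical_transform_L2 (L2_class lborel ` A)"
 proof (rule inj_onI, clarify)
  fix f g assume f: "f \<in> A" and g: "g \<in> A"
   and eq: "spherical_transform_L2 (L2_class lborel f) = spherical_transform_L2 (L2_class lborel g)"
  have fr: "f \<in> L2_rad" "g \<in> L2_rad" using f g A by auto
  then obtain F G where F: "dual_transform f F" and G: "dual_transform g G"
   using dual_transform_exists L2_rad_rot by metis
  have "L2_class (plancherel CARD('n)) F = L2_class (plancherel CARD('n)) G"
   using eq unfolding spherical_transform_L2_class[OF fr(1) F] spherical_transform_L2_class[OF fr(2) G] .
  moreover have "F \<in> L2_class (plancherel CARD('n)) F" using dual_transform_L2(2)[OF F] by (simp add: L2_class_def)
  ultimately have "AE p in plancherel CARD('n). F p - G p = 0" by (simp add: L2_class_def)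
  then have "L2_norm (plancherel CARD('n)) (\<lambda>p. F p - G p) = 0"
   using L2_norm_eq_0_iff[OF L2_fun_diff[OF dual_transform_L2(2)[OF F] dual_transform_L2(2)[OF G]]] by simp
  then have "L2_norm lborel (\<lambda>x. f x - g x) = 0"
   using dual_transform_isometry[OF L2_rad_diff[OF fr] dual_transform_diff[OF F G]] by simp
  then have "AE x in lborel. f x - g x = 0"
   using L2_norm_eq_0_iff[OF L2_fun_diff[OF dual_transform_L2(1)[OF F] dual_transform_L2(1)[OF G]]] by simp
  then have "AE x in lborel. f x = g x" by eventually_elim simp
  then show "L2_class lborel f = L2_class lborel g" by (rule L2_class_eqI)
 qed
 show "spherical_transform_L2 ` L2_class lborel ` A = L2_class (plancherel CARD('n)) ` B"
 proof (intro equalityI subsetI)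
  fix X assume "X \<in> spherical_transform_L2 ` L2_class lborel ` A"
  then obtain f where f: "f \<in> A" "X = spherical_transform_L2 (L2_class lborel f)" by auto
  have fr: "f \<in> L2_rad" using f A by auto
  then obtain F where F: "dual_transform f F" using dual_transform_exists L2_rad_rot by metis
  have "X = L2_class (plancherel CARD('n)) F" unfolding f(2) by (rule spherical_transform_L2_class[OF fr F])
  then show "X \<in> L2_class (plancherel CARD('n)) ` B" using AB[OF fr F] f(1) by auto
 next
  fix X assume "X \<in> L2_class (plancherel CARD('n)) ` B"
  then obtain F where F: "F \<in> B" "X = L2_class (plancherel CARD('n)) F" by auto
  have "F \<in> L2_fun (plancherel CARD('n))" using F B by auto
  then obtain f :: "'n heis => complex" where f: "f \<in> L2_rad" "dual_transform f F" by (rule dual_transform_surj)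
  have "X = spherical_transform_L2 (L2_class lborel f)" unfolding F(2) spherical_transform_L2_class[OF f] ..
  then show "X \<in> spherical_transform_L2 ` L2_class lborel ` A" using AB[OF f] F(1) by auto
 qed
qed

subsection \<open>The sublaplacian\<close>

text \<open>With \<open>ka = 1\<close> the operator \<open>zop ka j\<close> is the field \<open>Z\<^sub>j\<close>, with \<open>ka = -1\<close> it is its conjugate.\<close>

definition zc :: "real => complex => complex" where
 "zc ka w = of_real (Re w) - \<i> * of_real ka * of_real (Im w)"

definition zop :: "real => 'n => ('n::finite heis => complex) => 'n heis => complex" where
 "zop ka j ph x = (dir_deriv (axis j 1, 0) ph x - \<i> * of_real ka * dir_deriv (axis j \<i>, 0) ph x) / 2
   - \<i> * of_real ka / 4 * zc ka (fst x $ j) * dir_deriv (0, 1) ph x"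

definition sublap :: "('n::finite heis => complex) => 'n heis => complex" where
 "sublap ph x = - 2 * (\<Sum>j\<in>UNIV. zop 1 j (zop (-1) j ph) x + zop (-1) j (zop 1 j ph) x)"

lemma zc_simps: "zc 1 w = cnj w" "zc (-1) w = w"
 by (simp_all add: zc_def complex_eq_iff)

lemma zc_linear: "bounded_linear (\<lambda>x :: 'n::finite heis. zc ka (fst x $ j))"
proof -
 have "bounded_linear (zc ka)" unfolding zc_def[abs_def]
  by (intro bounded_linear_sub bounded_linear_compose[OF bounded_linear_of_real bounded_linear_Re]
    bounded_linear_const_mult bounded_linear_compose[OF bounded_linear_of_real bounded_linear_Im])
 then show ?thesis by (rule bounded_linear_compose[OF _ bounded_linear_compose[OF bounded_linear_vec_nth bounded_linear_fst]])
qed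

lemma smooth_zc: "smooth (\<lambda>x :: 'n::finite heis. zc ka (fst x $ j))"
 by (rule smooth_bounded_linear[OF zc_linear])

lemma dir_deriv_zc: "dir_deriv v (\<lambda>x :: 'n::finite heis. zc ka (fst x $ j)) x = zc ka (fst v $ j)"
 by (rule dir_deriv_eq[OF bounded_linear_imp_has_derivative[OF zc_linear]])

lemma zop_sum_form:
 "zop ka j ph = (\<lambda>x. 1 / 2 * dir_deriv (axis j 1, 0) ph x +
   ((- (\<i> * of_real ka / 2)) * dir_deriv (axis j \<i>, 0) ph x + (- (\<i> * of_real ka / 4)) * (zc ka (fst x $ j) * dir_deriv (0, 1) ph x)))"
 by (rule ext) (simp add: zop_def field_simps)

lemma smooth_zop: "smooth ph ==> smooth (zop ka j ph)"
 unfolding zop_sum_form by (intro smooth_add smooth_mult smooth_const smooth_dir_deriv smooth_zc)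

lemma test_fun_zop: "test_fun ph ==> test_fun (zop ka j ph)"
 unfolding zop_sum_form by (intro test_fun_add test_fun_scale test_fun_smooth_mult test_fun_dir_deriv smooth_zc)

lemma wave_zop: "wave sg ph ==> wave sg (zop ka j ph)"
 unfolding zop_sum_form by (intro wave.add wave.scale wave.linear wave_dir_deriv zc_linear)

lemma zop_mult:
 "smooth f ==> smooth g ==> zop ka j (\<lambda>x. f x * g x) = (\<lambda>x. f x * zop ka j g x + zop ka j f x * g x)"
 by (rule ext) (simp add: zop_def dir_deriv_mult field_simps)

lemma zop_add:
 "smooth f ==> smooth g ==> zop ka j (\<lambda>x. f x + g x) = (\<lambda>x. zop ka j f x + zop ka j g x)"
 by (rule ext) (simp add: zop_def dir_deriv_add field_simps)

lemma zop_scale: "smooth f ==> zop ka j (\<lambda>x. c * f x) = (\<lambda>x. c * zop ka j f x)"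
 by (rule ext) (simp add: zop_def dir_deriv_scale field_simps)

lemma dir_deriv_cnj: "smooth f ==> dir_deriv v (\<lambda>x. cnj (f x)) x = cnj (dir_deriv v f x)"
 by (rule dir_deriv_eq[OF bounded_linear.has_derivative[OF bounded_linear_cnj smooth_has_derivative]])

lemma zop_cnj: "smooth f ==> zop ka j (\<lambda>x. cnj (f x)) = (\<lambda>x. cnj (zop (- ka) j f x))"
 by (rule ext) (simp add: zop_def dir_deriv_cnj zc_def)

text \<open>The coefficient of the t-derivative depends on z only, so the field is divergence free
  and its transpose is its negative.\<close>

lemma integral_zop:
 fixes f g :: "'n::finite heis => complex"
 assumes f: "test_fun f" and g: "smooth g"
 shows "(LBINT x. zop ka j f x * g x) = - (LBINT x. f x * zop ka j g x)"
proof -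
 define D where "D a = (LBINT x. f x * dir_deriv (axis j a, 0) g x)" for a
 define T where "T = (LBINT x. f x * (zc ka (fst x $ j) * dir_deriv (0, 1) g x))"
 have i: "integrable lborel (\<lambda>x. dir_deriv v f x * g x)" "integrable lborel (\<lambda>x. f x * dir_deriv v g x)" for v
  by (intro test_fun_integrable_lborel test_fun_mult_smooth test_fun_dir_deriv smooth_dir_deriv f g)+
 have it: "integrable lborel (\<lambda>x. zc ka (fst x $ j) * dir_deriv (0, 1) f x * g x)"
  "integrable lborel (\<lambda>x. f x * (zc ka (fst x $ j) * dir_deriv (0, 1) g x))"
  by (intro test_fun_integrable_lborel test_fun_mult_smooth test_fun_smooth_mult smooth_mult test_fun_dir_deriv smooth_dir_deriv smooth_zc f g)+
 have t: "(LBINT x. zc ka (fst x $ j) * dir_deriv (0, 1) f x * g x) = - T"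
 proof -
  have e: "dir_deriv (0, 1) (\<lambda>x. zc ka (fst x $ j) * g x) x = zc ka (fst x $ j) * dir_deriv (0, 1) g x" for x
   by (simp add: dir_deriv_mult[OF smooth_zc g] dir_deriv_zc) (simp add: zc_def)
  have "(LBINT x. zc ka (fst x $ j) * dir_deriv (0, 1) f x * g x) =
    (LBINT x. dir_deriv (0, 1) f x * (zc ka (fst x $ j) * g x))" by (simp add: mult_ac)
  also have "... = - (LBINT x. f x * dir_deriv (0, 1) (\<lambda>x. zc ka (fst x $ j) * g x) x)"
   by (rule integral_by_parts[OF f smooth_mult[OF smooth_zc g]])
  finally show ?thesis unfolding e T_def .
 qed
 have "(LBINT x. zop ka j f x * g x) = (LBINT x. 1 / 2 * (dir_deriv (axis j 1, 0) f x * g x) +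
   ((- (\<i> * of_real ka / 2)) * (dir_deriv (axis j \<i>, 0) f x * g x) + (- (\<i> * of_real ka / 4)) * (zc ka (fst x $ j) * dir_deriv (0, 1) f x * g x)))"
  unfolding zop_sum_form by (simp add: field_simps)
 also have "... = 1 / 2 * (- D 1) + ((- (\<i> * of_real ka / 2)) * (- D \<i>) + (- (\<i> * of_real ka / 4)) * (- T))"
  unfolding D_def
  by (subst Bochner_Integration.integral_add integral_mult_right_zero | intro integrable_mult_right Bochner_Integration.integrable_add i it)+
   (simp only: integral_mult_right_zero t integral_by_parts[OF f g])
 finally have L: "(LBINT x. zop ka j f x * g x) = 1 / 2 * (- D 1) + ((- (\<i> * of_real ka / 2)) * (- D \<i>) + (- (\<i> * of_real ka / 4)) * (- T))" .
 have "(LBINT x. f x * zop ka j g x) = (LBINT x. 1 / 2 * (f x * dir_deriv (axis j 1, 0) g x) +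
   ((- (\<i> * of_real ka / 2)) * (f x * dir_deriv (axis j \<i>, 0) g x) + (- (\<i> * of_real ka / 4)) * (f x * (zc ka (fst x $ j) * dir_deriv (0, 1) g x))))"
  unfolding zop_sum_form by (simp add: field_simps)
 also have "... = 1 / 2 * D 1 + ((- (\<i> * of_real ka / 2)) * D \<i> + (- (\<i> * of_real ka / 4)) * T)"
  unfolding D_def T_def
  by (subst Bochner_Integration.integral_add integral_mult_right_zero | intro integrable_mult_right Bochner_Integration.integrable_add i it)+
   (simp only: integral_mult_right_zero)
 finally show ?thesis unfolding L by (simp add: algebra_simps)
qed

lemma zop_adjoint:
 fixes f g :: "'n::finite heis => complex"
 assumes f: "test_fun f" and g: "test_fun g"
 shows "l2_inner lborel (zop ka j f) g = - l2_inner lborel f (zop (- ka) j g)"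
 unfolding l2_inner_def using integral_zop[OF f smooth_cnj[OF test_fun_smooth[OF g]], of ka j]
 by (simp add: zop_cnj[OF test_fun_smooth[OF g]])

lemma test_fun_sum: "finite I ==> (\<And>i. i \<in> I ==> test_fun (f i)) ==> test_fun (\<lambda>x. \<Sum>i\<in>I. f i x)"
 by (induction I rule: finite_induct) (auto intro: test_fun_add)

lemma test_fun_sublap: "test_fun ph ==> test_fun (sublap ph)"
 unfolding sublap_def[abs_def] by (intro test_fun_scale test_fun_sum test_fun_add test_fun_zop) auto

lemma wave_sublap: "wave sg ph ==> wave sg (sublap ph)"
 unfolding sublap_def[abs_def] by (intro wave.scale wave_sum wave.add wave_zop) auto

lemma sublap_add: "smooth f ==> smooth g ==> sublap (\<lambda>x. f x + g x) = (\<lambda>x. sublap f x + sublap g x)"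
 by (rule ext) (simp add: sublap_def zop_add smooth_zop sum.distrib algebra_simps)

lemma sublap_scale: "smooth f ==> sublap (\<lambda>x. c * f x) = (\<lambda>x. c * sublap f x)"
 by (rule ext) (simp add: sublap_def zop_scale smooth_zop sum_distrib_left algebra_simps)

lemma sublap_sum: "finite I ==> (\<And>i. i \<in> I ==> smooth (f i)) ==> sublap (\<lambda>x. \<Sum>i\<in>I. f i x) = (\<lambda>x. \<Sum>i\<in>I. sublap (f i) x)"
proof (induction I rule: finite_induct)
 case empty
 have "sublap (\<lambda>x. 0 * 0) = (\<lambda>x. 0 * sublap (\<lambda>x. 0) x)" by (rule sublap_scale) simp
 then show ?case by simp
next
 case (insert i I)
 then show ?case by (simp add: sublap_add smooth_sum)
qed

lemma l2_inner_sum_left: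
 assumes "finite I" "\<And>i. i \<in> I ==> f i \<in> L2_fun M" "g \<in> L2_fun M"
 shows "l2_inner M (\<lambda>x. \<Sum>i\<in>I. f i x) g = (\<Sum>i\<in>I. l2_inner M (f i) g)"
 unfolding l2_inner_def sum_distrib_right
 by (rule Bochner_Integration.integral_sum) (use assms in \<open>auto intro: L2_inner_integrable\<close>)

lemma l2_inner_sum_right:
 assumes "finite I" "\<And>i. i \<in> I ==> f i \<in> L2_fun M" "g \<in> L2_fun M"
 shows "l2_inner M g (\<lambda>x. \<Sum>i\<in>I. f i x) = (\<Sum>i\<in>I. l2_inner M g (f i))"
 unfolding l2_inner_def cnj_sum sum_distrib_left
 by (rule Bochner_Integration.integral_sum) (use assms in \<open>auto intro: L2_inner_integrable\<close>)

lemma sublap_symmetric: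
 fixes f g :: "'n::finite heis => complex"
 assumes f: "test_fun f" and g: "test_fun g"
 shows "l2_inner lborel (sublap f) g = l2_inner lborel f (sublap g)"
proof -
 have a: "l2_inner lborel (zop ka j (zop (- ka) j f)) g = l2_inner lborel f (zop ka j (zop (- ka) j g))" for ka j
  using zop_adjoint[OF test_fun_zop[OF f] g, of ka j "- ka" j] zop_adjoint[OF f test_fun_zop[OF g], of "- ka" j "- ka" j] by simp
 note t = test_fun_L2[OF test_fun_zop[OF test_fun_zop]]
 show ?thesis unfolding sublap_def[abs_def] l2_inner_scale_left l2_inner_scale_right
  using a[of 1] a[of "-1"]
  by (simp add: l2_inner_sum_left l2_inner_sum_right l2_inner_add_left l2_inner_add_right L2_fun_add t f g test_fun_L2)
qed

text \<open>Distributions are arbitrary functionals here. Linearity on test functions is what allows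
  the operators, defined by duality piece by piece, to be collected into one differential operator
  on the test function.\<close>

definition distr_linear :: "'a::euclidean_space distr => bool" where
 "distr_linear T \<longleftrightarrow> (\<forall>ph ps. test_fun ph --> test_fun ps --> T (\<lambda>x. ph x + ps x) = T ph + T ps) \<and>
   (\<forall>c ph. test_fun ph --> T (\<lambda>x. c * ph x) = c * T ph)"

lemma distr_linear_add: "distr_linear T ==> test_fun ph ==> test_fun ps ==> T (\<lambda>x. ph x + ps x) = T ph + T ps"
 and distr_linear_scale: "distr_linear T ==> test_fun ph ==> T (\<lambda>x. c * ph x) = c * T ph"
 by (simp_all add: distr_linear_def)

lemma distr_linear_sum:
 assumes "distr_linear T" "finite I" "\<And>i. i \<in> I ==> test_fun (f i)"
 shows "T (\<lambda>x. \<Sum>i\<in>I. f i x) = (\<Sum>i\<in>I. T (f i))"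
 using assms(2,3)
proof (induction I rule: finite_induct)
 case empty
 have "T (\<lambda>x. 0 * 0) = 0 * T (\<lambda>x. 0)" by (rule distr_linear_scale[OF assms(1)]) simp
 then show ?case by simp
next
 case (insert i I)
 then show ?case by (simp add: distr_linear_add[OF assms(1)] test_fun_sum)
qed

lemma distr_Z_test:
 assumes T: "distr_linear T" and ph: "test_fun ph"
 shows "distr_Z j T ph = - T (zop 1 j ph)" "distr_Zbar j T ph = - T (zop (-1) j ph)"
proof -
 note s = test_fun_smooth[OF ph]
 have d: "dir_deriv (0, 1) (\<lambda>x. zc ka (fst x $ j) * ph x) = (\<lambda>x. zc ka (fst x $ j) * dir_deriv (0, 1) ph x)" for ka
  by (rule ext) (simp add: dir_deriv_mult[OF smooth_zc s] dir_deriv_zc, simp add: zc_def)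
 have T: "T (zop ka j ph) = 1 / 2 * T (dir_deriv (axis j 1, 0) ph) + ((- (\<i> * of_real ka / 2)) * T (dir_deriv (axis j \<i>, 0) ph)
   + (- (\<i> * of_real ka / 4)) * T (\<lambda>x. zc ka (fst x $ j) * dir_deriv (0, 1) ph x))" for ka
  unfolding zop_sum_form
  by (simp only: distr_linear_add[OF T] distr_linear_scale[OF T] test_fun_add test_fun_scale test_fun_smooth_mult test_fun_dir_deriv smooth_zc ph)
 show "distr_Z j T ph = - T (zop 1 j ph)"
  unfolding T distr_Z_def distr_deriv_def distr_mult_def using d[of 1] by (simp add: zc_simps field_simps)
 show "distr_Zbar j T ph = - T (zop (-1) j ph)"
  unfolding T distr_Zbar_def distr_deriv_def distr_mult_def using d[of "-1"] by (simp add: zc_simps field_simps)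
qed

lemma distr_linear_Z:
 assumes T: "distr_linear T"
 shows "distr_linear (distr_Z j T)" "distr_linear (distr_Zbar j T)"
 unfolding distr_linear_def
 by (auto simp: distr_Z_test[OF T] test_fun_add test_fun_scale zop_add zop_scale test_fun_smooth test_fun_zop
  distr_linear_add[OF T] distr_linear_scale[OF T])

text \<open>Transposition reverses the order of the two fields and changes the sign twice; the
  symmetrised sum is unaffected.\<close>

lemma sublaplacian_test:
 assumes T: "distr_linear T" and ph: "test_fun ph"
 shows "sublaplacian T ph = T (sublap ph)"
proof -
 have "distr_Z j (distr_Zbar j T) ph = T (zop (-1) j (zop 1 j ph))" "distr_Zbar j (distr_Z j T) ph = T (zop 1 j (zop (-1) j ph))" for j
  by (simp_all add: distr_Z_test distr_linear_Z T ph test_fun_zop)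
 moreover have "T (sublap ph) = - 2 * (\<Sum>j\<in>UNIV. T (zop 1 j (zop (-1) j ph)) + T (zop (-1) j (zop 1 j ph)))"
  unfolding sublap_def[abs_def]
  by (simp only: distr_linear_scale[OF T] distr_linear_sum[OF T] distr_linear_add[OF T] test_fun_sum test_fun_add test_fun_zop ph finite)
 ultimately show ?thesis by (simp add: sublaplacian_def add.commute)
qed

lemma distr_linear_sublaplacian:
 assumes T: "distr_linear T"
 shows "distr_linear (sublaplacian T)"
 unfolding distr_linear_def
 by (auto simp: sublaplacian_test[OF T] test_fun_add test_fun_scale sublap_add sublap_scale test_fun_smooth test_fun_sublap
  distr_linear_add[OF T] distr_linear_scale[OF T])

lemma sublaplacian_funpow:
 assumes T: "distr_linear T"
 shows "distr_linear ((sublaplacian ^^ j) T)"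
  and "test_fun ph ==> (sublaplacian ^^ Suc j) T ph = (sublaplacian ^^ j) T (sublap ph)"
proof -
 have lin: "distr_linear ((sublaplacian ^^ j) T)" for j
  by (induction j) (simp_all add: T distr_linear_sublaplacian)
 then show "distr_linear ((sublaplacian ^^ j) T)" .
 show "(sublaplacian ^^ Suc j) T ph = (sublaplacian ^^ j) T (sublap ph)" if "test_fun ph"
  using sublaplacian_test[OF lin that] by simp
qed

lemma distr_linear_of_fun:
 assumes f: "f \<in> L2_fun lborel"
 shows "distr_linear (distr_of_fun f)"
proof -
 have "integrable lborel (\<lambda>x. f x * ph x)" if "test_fun ph" for ph
  by (rule L2_fun_mult_integrable[OF f test_fun_L2[OF that]])
 then show ?thesis unfolding distr_linear_def distr_of_fun_def
  by (auto simp: distrib_left mult.left_commute)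
qed

lemma sublap_cnj: "smooth f ==> sublap (\<lambda>x. cnj (f x)) = (\<lambda>x. cnj (sublap f x))"
 by (rule ext) (simp add: sublap_def zop_cnj smooth_zop add.commute)

lemma sublap_mult:
 assumes f: "smooth f" and g: "smooth g"
 shows "sublap (\<lambda>x. f x * g x) = (\<lambda>x. f x * sublap g x +
  ((\<Sum>j\<in>UNIV. (- 4 * zop 1 j f x) * zop (-1) j g x + (- 4 * zop (-1) j f x) * zop 1 j g x) + sublap f x * g x))"
proof (rule ext)
 fix x
 have z: "zop a j (zop b j (\<lambda>x. f x * g x)) x = f x * zop a j (zop b j g) x + zop a j f x * zop b j g x
   + (zop b j f x * zop a j g x + zop a j (zop b j f) x * g x)" for a b j
  by (simp add: zop_mult[OF f g] zop_add zop_mult f g smooth_mult smooth_zop)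
 show "sublap (\<lambda>x. f x * g x) x = f x * sublap g x +
  ((\<Sum>j\<in>UNIV. (- 4 * zop 1 j f x) * zop (-1) j g x + (- 4 * zop (-1) j f x) * zop 1 j g x) + sublap f x * g x)"
  unfolding sublap_def z
  by (simp add: sum.distrib sum_subtractf sum_distrib_left sum_distrib_right sum_negf algebra_simps)
qed

text \<open>The group dilation: it scales the central variable quadratically, and the fields become
  homogeneous of degree 1. A cut-off dilated in this way acquires a factor ep per field, with no
  coefficient growing in x.\<close>

definition dil :: "real => 'n::finite heis => 'n heis" where
 "dil ep x = (ep *\<^sub>R fst x, ep^2 * snd x)"

lemma dil_linear: "bounded_linear (dil ep)"
 unfolding dil_def[abs_def]
 by (intro bounded_linear_Pair bounded_linear_scaleR_right[THEN bounded_linear_compose] bounded_linear_const_mult bounded_linear_fst bounded_linear_snd)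

lemma smooth_linear_compose:
 assumes "smooth g" "bounded_linear T"
 shows "smooth (\<lambda>x. g (T x))"
proof (rule smooth_coinduct[where P = "\<lambda>f. \<exists>g. smooth g \<and> f = (\<lambda>x. g (T x))"])
 show "\<exists>h. smooth h \<and> (\<lambda>x. g (T x)) = (\<lambda>x. h (T x))" using assms(1) by blast
 fix f assume "\<exists>g. smooth g \<and> f = (\<lambda>x. g (T x))"
 then obtain g where g: "smooth g" "f = (\<lambda>x. g (T x))" by blast
 show "\<exists>D. (\<forall>x. (f has_derivative D x) (at x)) \<and> (\<forall>v. \<exists>g. smooth g \<and> (\<lambda>x. D x v) = (\<lambda>x. g (T x)))"
 proof (intro exI[of _ "\<lambda>x v. dir_deriv (T v) g (T x)"] conjI allI)
  show "(f has_derivative (\<lambda>v. dir_deriv (T v) g (T x))) (at x)" for x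
   unfolding g(2) by (rule has_derivative_compose[OF bounded_linear_imp_has_derivative[OF assms(2)] smooth_has_derivative[OF g(1)]])
  show "\<exists>h. smooth h \<and> (\<lambda>x. dir_deriv (T v) g (T x)) = (\<lambda>x. h (T x))" for v
   using smooth_dir_deriv[OF g(1)] by blast
 qed
qed

lemma dir_deriv_linear_compose:
 assumes "smooth g" "bounded_linear T"
 shows "dir_deriv v (\<lambda>x. g (T x)) x = dir_deriv (T v) g (T x)"
 by (rule dir_deriv_eq[OF has_derivative_compose[OF bounded_linear_imp_has_derivative[OF assms(2)] smooth_has_derivative[OF assms(1)]]])

lemma zop_dil:
 assumes g: "smooth g"
 shows "zop ka j (\<lambda>x. g (dil ep x)) = (\<lambda>x. of_real ep * zop ka j g (dil ep x))"
proof (rule ext)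
 fix x
 have "dir_deriv (dil ep (axis j a, 0)) g y = of_real ep * dir_deriv (axis j a, 0) g y" for a :: complex and y
  using dir_deriv_direction_scale[OF g, of ep "(axis j a, 0)" y] by (simp add: dil_def)
 moreover have "dir_deriv (dil ep (0, 1)) g y = of_real (ep^2) * dir_deriv (0, 1) g y" for y
  using dir_deriv_direction_scale[OF g, of "ep^2" "(0, 1)" y] by (simp add: dil_def)
 moreover have "zc ka (fst (dil ep x) $ j) = of_real ep * zc ka (fst x $ j)" by (simp add: dil_def zc_def algebra_simps)
 ultimately show "zop ka j (\<lambda>x. g (dil ep x)) x = of_real ep * zop ka j g (dil ep x)"
  unfolding zop_def dir_deriv_linear_compose[OF g dil_linear]
  by (simp add: power2_eq_square field_simps)
qed

lemma sublap_dil: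
 assumes g: "smooth g"
 shows "sublap (\<lambda>x. g (dil ep x)) = (\<lambda>x. of_real (ep^2) * sublap g (dil ep x))"
proof (rule ext)
 fix x
 have "zop a j (zop b j (\<lambda>x. g (dil ep x))) x = of_real (ep^2) * zop a j (zop b j g) (dil ep x)" for a b j
  unfolding zop_dil[OF g] zop_scale[OF smooth_linear_compose[OF smooth_zop[OF g] dil_linear]] zop_dil[OF smooth_zop[OF g]]
  by (simp add: power2_eq_square)
 then show "sublap (\<lambda>x. g (dil ep x)) x = of_real (ep^2) * sublap g (dil ep x)"
  by (simp add: sublap_def sum_distrib_left algebra_simps)
qed

lemma test_fun_dil:
 assumes g: "test_fun g" and ep: "ep \<noteq> 0"
 shows "test_fun (\<lambda>x. g (dil ep x))"
proof (rule test_funI)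
 show "smooth (\<lambda>x. g (dil ep x))" by (rule smooth_linear_compose[OF test_fun_smooth[OF g] dil_linear])
 have inv: "dil (1 / ep) (dil ep x) = x" for x :: "'a heis" using ep by (simp add: dil_def power2_eq_square)
 have "compact (support g)" using g by (simp add: test_fun_def')
 then show K: "compact (dil (1 / ep) ` support g)"
  by (intro compact_continuous_image linear_continuous_on dil_linear)
 have "{x. g (dil ep x) \<noteq> 0} \<subseteq> dil (1 / ep) ` support g"
 proof
  fix x assume "x \<in> {x. g (dil ep x) \<noteq> 0}"
  then have "dil ep x \<in> support g" using not_in_support[of "dil ep x" g] by auto
  then show "x \<in> dil (1 / ep) ` support g" using inv[of x] by (metis image_eqI)
 qed
 then show "support (\<lambda>x. g (dil ep x)) \<subseteq> dil (1 / ep) ` support g"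
  unfolding support_def[of "\<lambda>x. g (dil ep x)"] by (rule closure_minimal) (rule compact_imp_closed[OF K])
qed

text \<open>The monomials of which \<open>pk\<close> is composed; the sublaplacian acts within their
  span. Multiplying \<open>ps\<close> by its variable, as \<open>mv\<close> does, is minus the
  derivative in the Laplace variable.\<close>

definition ev :: "real => nat => (real => complex) => 'n::finite heis => complex" where
 "ev sg m ps x = of_real ((norm (fst x))^2) ^ m * lap ps (hw sg x)"

abbreviation mv :: "(real => complex) => real => complex" where
 "mv ps \<equiv> (\<lambda>l. of_real l * ps l)"

lemma ev_wave: "test_fun ps ==> support ps \<subseteq> {0<..} ==> wave sg (ev sg m ps)"
 unfolding ev_def[abs_def] by (intro wave_norm_power wave.base)

lemma inner_axis_complex:
 fixes z :: "complex ^ 'n::finite"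
 shows "z \<bullet> axis j 1 = Re (z $ j)" "z \<bullet> axis j \<i> = Im (z $ j)"
 by (simp_all add: inner_axis inner_complex_def)

lemma normsq_has_derivative:
 "((\<lambda>x :: 'n::finite heis. complex_of_real ((norm (fst x))^2)) has_derivative (\<lambda>v. 2 * of_real (fst x \<bullet> fst v))) (at x)"
proof -
 have "((\<lambda>x :: 'n heis. 4 * hw 0 x) has_derivative (\<lambda>v. 4 * (of_real (fst x \<bullet> fst v / 2) - \<i> * of_real (0 * snd v)))) (at x)"
  by (rule has_derivative_mult_right[OF hw_has_derivative])
 then show ?thesis by (simp add: hw_def)
qed

lemma zop_normsq: "zop ka j (\<lambda>x :: 'n::finite heis. complex_of_real ((norm (fst x))^2)) x = zc ka (fst x $ j)"
 unfolding zop_def dir_deriv_eq[OF normsq_has_derivative] by (simp add: inner_axis_complex zc_def field_simps)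

lemma zop_const: "zop ka j (\<lambda>x. c) x = 0"
 by (simp add: zop_def dir_deriv_eq[OF has_derivative_const])

lemma zop_power:
 assumes f: "smooth f"
 shows "zop ka j (\<lambda>x. f x ^ m) x = of_nat m * f x ^ (m - 1) * zop ka j f x"
proof (induction m)
 case (Suc m)
 have "zop ka j (\<lambda>x. f x * f x ^ m) x = f x * zop ka j (\<lambda>x. f x ^ m) x + zop ka j f x * f x ^ m"
  by (simp add: zop_mult[OF f smooth_power[OF f]])
 also have "... = of_nat (Suc m) * f x ^ m * zop ka j f x"
  unfolding Suc by (cases m) (simp_all add: algebra_simps)
 finally show ?case by simp
qed (simp add: zop_const)

text \<open>For ka = sg the factor vanishes: one of the two conjugate fields annihilates every
  function of this form, which is why no second derivative in the Laplace variable will appear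
  below.\<close>

lemma zop_lap:
 assumes "test_fun ps"
 shows "zop ka j (\<lambda>x :: 'n::finite heis. lap ps (hw sg x)) x =
  - of_real ((1 - ka * sg) / 4) * zc ka (fst x $ j) * lap (mv ps) (hw sg x)"
 by (simp add: zop_def dir_deriv_eq[OF lap_hw_has_derivative[OF assms]] inner_axis_complex zc_def field_simps)

lemma zop_ev:
 assumes ps: "test_fun ps" "support ps \<subseteq> {0<..}"
 shows "zop ka j (ev sg m ps :: 'n::finite heis => complex) = (\<lambda>x. zc ka (fst x $ j) *
  (of_nat m * ev sg (m - 1) ps x + (- of_real ((1 - ka * sg) / 4)) * ev sg m (mv ps) x))"
proof (rule ext)
 fix x :: "'n heis"
 define U where "U x = complex_of_real ((norm (fst x))^2)" for x :: "'n heis"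
 have U: "smooth U"
 proof -
  have "U = (\<lambda>x. \<Sum>j\<in>UNIV. zc 1 (fst x $ j) * zc (-1) (fst x $ j))"
   by (rule ext) (simp add: U_def zc_simps norm_vec_def L2_set_def sum_nonneg complex_norm_square mult.commute del: of_real_power)
  then show ?thesis by (auto intro!: smooth_sum smooth_mult smooth_zc)
 qed
 have W: "smooth (\<lambda>x :: 'n heis. lap ps (hw sg x))" by (rule wave_smooth[OF wave.base[OF ps]])
 have "zop ka j (ev sg m ps) x = zop ka j (\<lambda>x. U x ^ m * lap ps (hw sg x)) x" by (simp add: ev_def[abs_def] U_def)
 also have "... = U x ^ m * zop ka j (\<lambda>x. lap ps (hw sg x)) x + zop ka j (\<lambda>x. U x ^ m) x * lap ps (hw sg x)"
  by (simp add: zop_mult[OF smooth_power[OF U] W])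
 also have "zop ka j (\<lambda>x. U x ^ m) x = of_nat m * U x ^ (m - 1) * zc ka (fst x $ j)"
  unfolding zop_power[OF U] by (simp only: U_def[abs_def] zop_normsq)
 finally show "zop ka j (ev sg m ps) x = zc ka (fst x $ j) *
   (of_nat m * ev sg (m - 1) ps x + (- of_real ((1 - ka * sg) / 4)) * ev sg m (mv ps) x)"
  unfolding zop_lap[OF ps(1)] ev_def U_def[symmetric] by (simp add: algebra_simps)
qed

lemma mv_props: "test_fun ps ==> test_fun (mv ps)" "test_fun ps ==> support ps \<subseteq> S ==> support (mv ps) \<subseteq> S"
 using test_fun_mult_var by blast+

text \<open>The term with two factors \<open>mv\<close> carries (1 + ka sg)(1 - ka sg), which is 0
  since both signs square to 1. What is left is a two-term expression in the power of |z|^2.\<close>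

lemma zop_zop_ev:
 fixes x :: "'n::finite heis"
 assumes ps: "test_fun ps" "support ps \<subseteq> {0<..}" and ka: "ka * ka = 1" and sg: "sg * sg = 1"
 shows "zop ka j (zop (- ka) j (ev sg m ps)) x =
  of_real ((cmod (fst x $ j))^2) * (of_nat m * of_nat (m - 1) * ev sg (m - 2) ps x - of_nat m * ev sg (m - 1) (mv ps) x / 2)
   + of_nat m * ev sg (m - 1) ps x - of_real ((1 + ka * sg) / 4) * ev sg m (mv ps) x"
proof -
 define H where "H x = of_nat m * ev sg (m - 1) ps x + (- of_real ((1 + ka * sg) / 4)) * ev sg m (mv ps) x" for x :: "'n heis"
 note ps' = mv_props(1)[OF ps(1)] mv_props(2)[OF ps]
 have s: "smooth (ev sg i ps :: 'n heis => complex)" "smooth (ev sg i (mv ps) :: 'n heis => complex)" for i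
  by (rule wave_smooth[OF ev_wave[OF ps]], rule wave_smooth[OF ev_wave[OF ps']])
 have sH: "smooth H" unfolding H_def[abs_def] by (intro smooth_add smooth_mult smooth_const s)
 define z where "z = fst x $ j"
 have zz: "zop ka j (\<lambda>x :: 'n heis. zc (- ka) (fst x $ j)) x = 1"
  unfolding zop_def dir_deriv_zc using ka by (simp add: zc_def axis_def complex_eq_iff)
 have zcc: "zc (- ka) z * zc ka z = of_real ((cmod z)^2)"
 proof -
  have "zc (- ka) z * zc ka z = of_real (Re z * Re z + (ka * ka) * (Im z * Im z))"
   by (simp add: zc_def complex_eq_iff algebra_simps)
  then show ?thesis unfolding cmod_power2 by (simp only: ka power2_eq_square mult_1_left)
 qed
 have "zop (- ka) j (ev sg m ps) = (\<lambda>x :: 'n heis. zc (- ka) (fst x $ j) * H x)"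
  unfolding zop_ev[OF ps] H_def by simp
 then have "zop ka j (zop (- ka) j (ev sg m ps)) x = zc (- ka) z * zop ka j H x + H x"
  by (simp add: zop_mult[OF smooth_zc sH] zz z_def)
 also have "zop ka j H x = zc ka z * (of_nat m * (of_nat (m - 1) * ev sg (m - 2) ps x + (- of_real ((1 - ka * sg) / 4)) * ev sg (m - 1) (mv ps) x)
   + (- of_real ((1 + ka * sg) / 4)) * (of_nat m * ev sg (m - 1) (mv ps) x + (- of_real ((1 - ka * sg) / 4)) * ev sg m (mv (mv ps)) x))"
  unfolding H_def[abs_def] zop_add[OF smooth_mult[OF smooth_const s(1)] smooth_mult[OF smooth_const s(2)]] zop_scale[OF s(1)] zop_scale[OF s(2)]
   zop_ev[OF ps] zop_ev[OF ps'] z_def[symmetric]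
  by (simp add: distrib_left right_diff_distrib mult.left_commute numeral_2_eq_2)
 also have "... = zc ka z * (of_nat m * of_nat (m - 1) * ev sg (m - 2) ps x - of_nat m * ev sg (m - 1) (mv ps) x / 2)"
 proof -
  define t where "t = complex_of_real (ka * sg)"
  have "t * t = of_real ((ka * ka) * (sg * sg))" unfolding t_def of_real_mult[symmetric] by (simp add: mult_ac)
  then have t: "t * t = 1" by (simp add: ka sg)
  have "(of_nat m * (a + (- ((1 - t) / 4)) * b) + (- ((1 + t) / 4)) * (of_nat m * b + (- ((1 - t) / 4)) * c))
    = of_nat m * a - of_nat m * b / 2" for a b c :: complex
  proof -
   have 0: "(1 + t) * (1 - t) = 0" using t by (simp add: algebra_simps)
   have "of_nat m * (a + (- ((1 - t) / 4)) * b) + (- ((1 + t) / 4)) * (of_nat m * b + (- ((1 - t) / 4)) * c)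
    = of_nat m * a - of_nat m * b / 2 + ((1 + t) * (1 - t)) * c / 16" by (simp add: field_simps)
   then show ?thesis unfolding 0 by simp
  qed
  from this[of "of_nat (m - 1) * ev sg (m - 2) ps x" "ev sg (m - 1) (mv ps) x" "ev sg m (mv (mv ps)) x"]
  show ?thesis by (simp add: t_def mult.assoc)
 qed
 also have "zc (- ka) z * (zc ka z * (of_nat m * of_nat (m - 1) * ev sg (m - 2) ps x - of_nat m * ev sg (m - 1) (mv ps) x / 2)) =
   of_real ((cmod z)^2) * (of_nat m * of_nat (m - 1) * ev sg (m - 2) ps x - of_nat m * ev sg (m - 1) (mv ps) x / 2)"
  by (simp only: zcc mult.assoc[symmetric])
 finally show ?thesis unfolding H_def z_def by simp
qed

text \<open>The coefficients (1 + sg) / 4 and (1 - sg) / 4 from the two orders of the fields add up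
  to 1 / 2, so the result does not depend on sg; summing over coordinates turns |z_j|^2 into |z|^2
  and raises the power by one.\<close>

lemma sublap_ev:
 fixes x :: "'n::finite heis"
 assumes ps: "test_fun ps" "support ps \<subseteq> {0<..}" and sg: "sg * sg = 1"
 shows "sublap (ev sg m ps) x = of_nat (2 * m + CARD('n)) * ev sg m (mv ps) x
  - 4 * of_nat m * (of_nat (m - 1) + of_nat CARD('n)) * ev sg (m - 1) ps x"
proof -
 define U where "U = complex_of_real ((norm (fst x))^2)"
 define a where "a = of_nat m * of_nat (m - 1) * ev sg (m - 2) ps x - of_nat m * ev sg (m - 1) (mv ps) x / 2"
 define b where "b = of_nat m * ev sg (m - 1) ps x"
 define c where "c = ev sg m (mv ps) x"
 have lin: "(u * a + b - s * c) + (u * a + b - t * c) = u * (2 * a) + (2 * b - c / 2)" if "s + t = 1 / 2" for u s t :: complex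
 proof -
  have "(u * a + b - s * c) + (u * a + b - t * c) = u * (2 * a) + (2 * b - (s + t) * c)" by (simp add: algebra_simps)
  then show ?thesis unfolding that by simp
 qed
 have m1: "(- 1) * (- 1) = (1 :: real)" by simp
 have half: "of_real ((1 + 1 * sg) / 4) + of_real ((1 + (- 1) * sg) / 4) = (1 / 2 :: complex)"
  unfolding of_real_add[symmetric] by (simp add: field_simps)
 have z1: "zop 1 j (zop (-1) j (ev sg m ps)) x = of_real ((cmod (fst x $ j))^2) * a + b - of_real ((1 + 1 * sg) / 4) * c" for j
  unfolding a_def b_def c_def by (rule zop_zop_ev[OF ps mult_1_left sg])
 have z2: "zop (-1) j (zop 1 j (ev sg m ps)) x = of_real ((cmod (fst x $ j))^2) * a + b - of_real ((1 + (- 1) * sg) / 4) * c" for j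
  using zop_zop_ev[OF ps m1 sg, of j m x] unfolding a_def b_def c_def minus_minus .
 have "zop 1 j (zop (-1) j (ev sg m ps)) x + zop (-1) j (zop 1 j (ev sg m ps)) x =
   of_real ((cmod (fst x $ j))^2) * (2 * a) + (2 * b - c / 2)" for j
  unfolding z1 z2 by (rule lin[OF half])
 then have "sublap (ev sg m ps) x = - 2 * (\<Sum>j\<in>UNIV. of_real ((cmod (fst x $ j))^2) * (2 * a) + (2 * b - c / 2))"
  by (simp only: sublap_def)
 also have "(\<Sum>j\<in>UNIV. of_real ((cmod (fst x $ j))^2) * (2 * a) + (2 * b - c / 2)) = U * (2 * a) + of_nat CARD('n) * (2 * b - c / 2)"
 proof -
  have "(norm (fst x))^2 = (\<Sum>j\<in>UNIV. (cmod (fst x $ j))^2)" by (simp add: norm_vec_def L2_set_def sum_nonneg)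
  then have "U = (\<Sum>j\<in>UNIV. of_real ((cmod (fst x $ j))^2))" by (simp add: U_def del: of_real_power)
  then show ?thesis by (simp add: sum.distrib sum_distrib_right)
 qed
 also have "U * (2 * a) = 2 * of_nat (m - 1) * b - of_nat m * c"
 proof -
  \<comment> \<open>Subtraction is truncated: at m = 0 the lowered exponent is still 0, and it is
    the factor \<open>of_nat m\<close> that makes the identity true.\<close>
  have 1: "of_nat m * (U * ev sg (m - 1) (mv ps) x) = of_nat m * c"
   by (cases m) (simp_all add: c_def ev_def U_def)
  have 2: "of_nat m * of_nat (m - 1) * (U * ev sg (m - 2) ps x) = of_nat (m - 1) * b"
  proof (cases "m \<le> 1")
   case True then show ?thesis by (cases m) (auto simp: b_def)
  next
   case False
   then obtain k where "m = Suc (Suc k)" by (metis One_nat_def not_less_eq_eq not0_implies_Suc le0)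
   then show ?thesis by (simp add: b_def ev_def U_def)
  qed
  have "U * (2 * a) = 2 * (of_nat m * of_nat (m - 1) * (U * ev sg (m - 2) ps x)) - of_nat m * (U * ev sg (m - 1) (mv ps) x)"
   by (simp add: a_def algebra_simps)
  then show ?thesis unfolding 1 2 by simp
 qed
 also have "- 2 * (2 * of_nat (m - 1) * b - of_nat m * c + of_nat CARD('n) * (2 * b - c / 2)) =
   of_nat (2 * m + CARD('n)) * c - 4 * (of_nat (m - 1) + of_nat CARD('n)) * b"
  by (simp add: field_simps)
 finally show ?thesis by (simp only: b_def c_def mult.assoc mult.left_commute)
qed

text \<open>The Laguerre differential equation, read as a recurrence for coefficients.\<close>

lemma lagc_Suc:
 assumes "n > 0"
 shows "real (Suc m) * (real m + real n) * lagc n j (Suc m) = (real m - real j) * lagc n j m"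
proof -
 have e: "x * y * (A * d / ((x * C) * (B * y))) = d * (A / (C * B))" if "x \<noteq> 0" "y \<noteq> 0" for x y A B C d :: real
  using that by (simp add: field_simps)
 have "lagc n j (Suc m) = pochhammer (- real j) m * (real m - real j) / ((real (Suc m) * fact m) * (pochhammer (real n) m * (real m + real n)))"
  by (simp add: lagc_def pochhammer_Suc add.commute)
 then show ?thesis using e[of "real (Suc m)" "real m + real n"] assms by (simp add: lagc_def)
qed

lemma lap_scale: "lap (\<lambda>l. c * ps l) w = c * lap ps w"
 by (simp add: lap_def mult.assoc)

text \<open>The lowering terms of degree m + 1 meet the terms of degree m, and the recurrence for
  \<open>lagc\<close> replaces 2m + n by 2j + n throughout: each spherical function in the packet is
  an eigenfunction with eigenvalue l (2j + n), the first coordinate of the fan.\<close>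

lemma sublap_pk:
 assumes ps: "test_fun ps" "support ps \<subseteq> {0<..}" and sg: "\<bar>sg\<bar> = 1"
 shows "sublap (pk sg ps j :: 'n::finite heis => complex) = pk sg (\<lambda>l. of_real (real (2 * j + CARD('n)) * l) * ps l) j"
proof (rule ext)
 fix x :: "'n heis"
 define n where "n = CARD('n)"
 have n: "n > 0" by (simp add: n_def)
 have sg2: "sg * sg = 1" using sg by (auto simp: abs_if split: if_splits)
 define w where "w k = (\<lambda>l. of_real l ^ k * ps l)" for k :: nat
 have w: "test_fun (w k)" "support (w k) \<subseteq> {0<..}" for k
  unfolding w_def using test_fun_mult_power[OF ps(1), of k] ps(2) by auto
 have mw: "mv (w k) = w (Suc k)" for k by (auto simp: w_def mult.assoc)
 define c where "c m = pconst n j * lagc n j m / 2 ^ m" for m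
 have pk: "pk sg ps j = (\<lambda>x :: 'n heis. \<Sum>m\<le>j. of_real (c m) * ev sg m (w (n + m)) x)"
  by (rule ext) (simp add: pk_def ev_def c_def w_def n_def)
 have sm: "smooth (ev sg m (w k) :: 'n heis => complex)" for m k by (rule wave_smooth[OF ev_wave[OF w]])
 define W where "W m k = ev sg m (w k) x" for m k
 define d where "d m = of_real (c m) * (4 * of_nat m * (of_nat (m - 1) + of_nat n) * W (m - 1) (n + m))" for m
 have "sublap (pk sg ps j) x = (\<Sum>m\<le>j. of_real (c m) * sublap (ev sg m (w (n + m))) x)"
 proof -
  have "sublap (\<lambda>x :: 'n heis. \<Sum>m\<le>j. of_real (c m) * ev sg m (w (n + m)) x) = (\<lambda>x. \<Sum>m\<le>j. sublap (\<lambda>x. of_real (c m) * ev sg m (w (n + m)) x) x)"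
   by (rule sublap_sum) (auto intro!: smooth_mult sm)
  then show ?thesis unfolding pk sublap_scale[OF sm] by (rule fun_cong)
 qed
 also have "... = (\<Sum>m\<le>j. of_real (c m) * (of_nat (2 * m + n) * W m (Suc (n + m))) - d m)"
  by (intro sum.cong refl) (simp only: sublap_ev[OF w sg2] mw W_def d_def n_def[symmetric] right_diff_distrib)
 also have "... = (\<Sum>m\<le>j. of_real (c m) * (of_nat (2 * m + n) * W m (Suc (n + m)))) - (\<Sum>m\<le>j. d m)"
  by (rule sum_subtractf)
 \<comment> \<open>The shift is free at both ends: d 0 has the factor m = 0, and d (Suc j) contains
   a Laguerre coefficient beyond the degree.\<close>
 also have "(\<Sum>m\<le>j. d m) = (\<Sum>m\<le>j. d (Suc m))"
 proof -
  have "(\<Sum>m\<le>Suc j. d m) = d 0 + (\<Sum>m\<le>j. d (Suc m))" by (rule sum.atMost_Suc_shift)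
  moreover have "d (Suc j) = 0" "d 0 = 0" by (simp_all add: d_def c_def lagc_eq_0)
  ultimately show ?thesis by simp
 qed
 also have "(\<Sum>m\<le>j. of_real (c m) * (of_nat (2 * m + n) * W m (Suc (n + m)))) - (\<Sum>m\<le>j. d (Suc m)) =
   (\<Sum>m\<le>j. of_real (c m) * (of_nat (2 * j + n) * W m (Suc (n + m))))"
  unfolding sum_subtractf[symmetric]
 proof (intro sum.cong refl)
  fix m
  have "c m * real (2 * m + n) - c (Suc m) * (4 * real (Suc m) * (real m + real n)) = c m * real (2 * j + n)"
  proof -
   have "c (Suc m) * (4 * real (Suc m) * (real m + real n)) = pconst n j / 2 ^ m * 2 * (real (Suc m) * (real m + real n) * lagc n j (Suc m))"
    unfolding c_def power_Suc by (simp only: times_divide_eq_left times_divide_eq_right divide_divide_eq_left) (simp add: field_simps)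
   also have "... = c m * 2 * (real m - real j)" unfolding lagc_Suc[OF n] by (simp add: c_def)
   finally show ?thesis by (simp add: algebra_simps)
  qed
  then have "complex_of_real (c m * real (2 * m + n) - c (Suc m) * (4 * real (Suc m) * (real m + real n))) = of_real (c m * real (2 * j + n))"
   by (simp only:)
  then have e: "of_real (c m) * of_nat (2 * m + n) - of_real (c (Suc m)) * (4 * of_nat (Suc m) * (of_nat m + of_nat n)) =
    of_real (c m) * (of_nat (2 * j + n) :: complex)"
   by (simp only: of_real_diff of_real_mult of_real_of_nat_eq of_real_numeral of_real_add)
  show "of_real (c m) * (of_nat (2 * m + n) * W m (Suc (n + m))) - d (Suc m) = of_real (c m) * (of_nat (2 * j + n) * W m (Suc (n + m)))"
   using arg_cong[OF e, of "\<lambda>y. y * W m (Suc (n + m))"]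
   by (simp only: d_def diff_Suc_1 add_Suc_right left_diff_distrib mult.assoc)
 qed
 also have "... = pk sg (\<lambda>l. of_real (real (2 * j + n) * l) * ps l) j x"
 proof -
  have "(\<lambda>l. of_real l ^ k * (of_real (real (2 * j + n) * l) * ps l)) = (\<lambda>l. of_nat (2 * j + n) * w (Suc k) l)" for k
   by (auto simp: w_def mult_ac)
  then show ?thesis
   unfolding pk_def n_def[symmetric] c_def W_def ev_def
   by (intro sum.cong refl) (simp only: lap_scale add_Suc_right mult.left_commute)
 qed
 finally show "sublap (pk sg ps j) x = pk sg (\<lambda>l. of_real (real (2 * j + CARD('n)) * l) * ps l) j x" by (simp add: n_def)
qed

text \<open>g is the sublaplacian of f in the weak sense; with the sesquilinear pairing no
  conjugation appears on the test function, as the operator commutes with conjugation.\<close>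

definition weak_pair :: "('n::finite heis => complex) => ('n heis => complex) => bool" where
 "weak_pair f g \<longleftrightarrow> f \<in> L2_fun lborel \<and> g \<in> L2_fun lborel \<and>
   (\<forall>ph. test_fun ph --> l2_inner lborel g ph = l2_inner lborel f (sublap ph))"

lemma l2_inner_bounded_limit:
 assumes f: "f \<in> L2_fun M" and s: "s \<in> L2_fun M" and q: "\<And>N::nat. q N \<in> borel_measurable M"
  and B: "\<And>N x. cmod (q N x) \<le> B" and lim: "\<And>x. (\<lambda>N. q N x) \<longlonglongrightarrow> c" and c': "c' = cnj c"
 shows "(\<lambda>N. l2_inner M f (\<lambda>x. q N x * s x)) \<longlonglongrightarrow> c' * l2_inner M f s"
proof -
 have [measurable]: "f \<in> borel_measurable M" "s \<in> borel_measurable M" "\<And>N. q N \<in> borel_measurable M" using f s q by (auto simp: L2_fun_def)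
 have "(\<lambda>N. LINT x|M. f x * cnj (q N x * s x)) \<longlonglongrightarrow> (LINT x|M. f x * cnj (c * s x))"
 proof (rule integral_dominated_convergence)
  show "integrable M (\<lambda>x. B * cmod (f x * s x))" by (intro integrable_mult_right integrable_norm L2_fun_mult_integrable f s)
  show "AE x in M. (\<lambda>N. f x * cnj (q N x * s x)) \<longlonglongrightarrow> f x * cnj (c * s x)" by (intro AE_I2 tendsto_intros lim)
  show "AE x in M. norm (f x * cnj (q N x * s x)) \<le> B * cmod (f x * s x)" for N
  proof (rule AE_I2)
   fix x
   have "norm (f x * cnj (q N x * s x)) = cmod (q N x) * cmod (f x * s x)" by (simp add: norm_mult)
   also have "... \<le> B * cmod (f x * s x)" by (intro mult_right_mono B) auto
   finally show "norm (f x * cnj (q N x * s x)) \<le> B * cmod (f x * s x)" .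
  qed
 qed measurable
 also have "(LINT x|M. f x * cnj (c * s x)) = c' * l2_inner M f s"
  using l2_inner_scale_right[of M f c s] c' by (simp add: l2_inner_def)
 finally show ?thesis by (simp add: l2_inner_def)
qed

lemma L2_fun_bounded_mult:
 assumes "s \<in> L2_fun M" "q \<in> borel_measurable M" "\<And>x. cmod (q x) \<le> B"
 shows "(\<lambda>x. q x * s x) \<in> L2_fun M"
proof (rule L2_fun_dominated[OF _ assms(1), where C = B])
 show "(\<lambda>x. q x * s x) \<in> borel_measurable M" using assms by (auto simp: L2_fun_def)
 show "AE x in M. cmod (q x * s x) \<le> B * cmod (s x)" using assms(3) by (auto simp: norm_mult intro!: mult_right_mono)
qed

text \<open>Waves are not compactly supported, so they are cut off by a bump composed with shrinking
  dilations. Errors from differentiating the cut-off are of order ep against functions bounded by a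
  wave, and vanish in the limit.\<close>

lemma weak_pair_wave:
 fixes f g :: "'n::finite heis => complex"
 assumes fg: "weak_pair f g" and sg: "\<bar>sg\<bar> = 1" and s: "wave sg s"
 shows "l2_inner lborel g s = l2_inner lborel f (sublap s)"
proof -
 have f: "f \<in> L2_fun lborel" and g: "g \<in> L2_fun lborel" using fg by (auto simp: weak_pair_def)
 have sL: "s' \<in> L2_fun lborel" if "wave sg s'" for s' :: "'n heis => complex"
  by (rule schwartz_integrable(2)[OF wave_schwartz[OF sg that]])
 have ss: "smooth s" by (rule wave_smooth[OF s])
 obtain ph :: "'n heis => real" where ph: "test_fun (\<lambda>x. complex_of_real (ph x))" "\<And>x. 0 < ph x \<longleftrightarrow> x \<in> box (- One) One"
  by (rule box_bump_exists[of "- One" One]) blast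
 define q where "q x = complex_of_real (1 / ph 0) * of_real (ph x)" for x
 have "ph 0 > 0" using ph(2)[of 0] by (simp add: mem_box)
 then have q0: "q 0 = 1" by (simp add: q_def)
 have qt: "test_fun q" unfolding q_def by (rule test_fun_scale[OF ph(1)])
 have qs: "smooth q" by (rule test_fun_smooth[OF qt])
 define ep where "ep N = 1 / real (Suc N)" for N
 have ep: "ep \<longlonglongrightarrow> 0" "\<And>N. ep N > 0" "\<And>N. ep N \<le> 1" unfolding ep_def using LIMSEQ_Suc[OF lim_1_over_n] by auto
 have dm: "(\<lambda>x. h (dil (ep N) x)) \<in> borel_measurable lborel" if "test_fun h" for h :: "'n heis => complex" and N
  using smooth_measurable[OF smooth_linear_compose[OF test_fun_smooth[OF that] dil_linear]] by simp
 have small: "(\<lambda>x. c * (of_real (r N) * h (dil (ep N) x)) * s' x) \<in> L2_fun lborel \<and>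
   (\<lambda>N. l2_inner lborel f (\<lambda>x. c * (of_real (r N) * h (dil (ep N) x)) * s' x)) \<longlonglongrightarrow> 0"
  if h: "test_fun h" and s': "wave sg s'" and r: "r \<longlonglongrightarrow> 0" "\<And>N. \<bar>r N\<bar> \<le> 1" for c h s' r N
 proof -
  obtain C where C: "C \<ge> 0" "\<And>x. cmod (h x) \<le> C" using test_fun_bound[OF h] by blast
  have b: "cmod (c * (of_real (r N) * h (dil (ep N) x))) \<le> cmod c * C" for N x
   using mult_mono[OF r(2)[of N] C(2)[of "dil (ep N) x"]] C(1) by (simp add: norm_mult mult_left_mono)
  have m: "(\<lambda>x. c * (of_real (r N) * h (dil (ep N) x))) \<in> borel_measurable lborel" for N
   using dm[OF h, of N] by (intro borel_measurable_times borel_measurable_const) auto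
  have l: "(\<lambda>N. c * (of_real (r N) * h (dil (ep N) x))) \<longlonglongrightarrow> 0" for x
  proof (rule Lim_null_comparison)
   show "\<forall>\<^sub>F N in sequentially. norm (c * (of_real (r N) * h (dil (ep N) x))) \<le> cmod c * (\<bar>r N\<bar> * C)"
    by (intro always_eventually allI) (simp add: norm_mult mult_left_mono C)
   show "(\<lambda>N. cmod c * (\<bar>r N\<bar> * C)) \<longlonglongrightarrow> 0"
    using tendsto_mult_right_zero[OF tendsto_mult_left_zero[OF tendsto_rabs_zero[OF r(1)], of C], of "cmod c"] .
  qed
  show ?thesis
   using L2_fun_bounded_mult[OF sL[OF s'] m b] l2_inner_bounded_limit[OF f sL[OF s'] m b l, of 0] by simp
 qed
 define X where "X N x = q (dil (ep N) x)" for N x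
 have Xt: "test_fun (X N)" for N unfolding X_def by (rule test_fun_dil[OF qt]) (use ep(2)[of N] in auto)
 obtain C where C: "\<And>x. cmod (q x) \<le> C" using test_fun_bound[OF qt] by blast
 have Xm: "X N \<in> borel_measurable lborel" for N unfolding X_def[abs_def] by (rule dm[OF qt])
 have XC: "cmod (X N x) \<le> C" for N x unfolding X_def by (rule C)
 have Xl: "(\<lambda>N. X N x) \<longlonglongrightarrow> 1" for x
 proof -
  have "(\<lambda>N. dil (ep N) x) \<longlonglongrightarrow> (0 *\<^sub>R fst x, 0^2 * snd x)" unfolding dil_def by (intro tendsto_intros ep(1))
  then have "(\<lambda>N. q (dil (ep N) x)) \<longlonglongrightarrow> q (0 *\<^sub>R fst x, 0^2 * snd x)"
   by (rule continuous_on_tendsto_compose[OF smooth_continuous[OF qs, of UNIV]]) auto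
  then show ?thesis by (simp add: X_def q0 flip: zero_prod_def)
 qed
 have e1: "\<bar>ep N\<bar> \<le> 1" "\<bar>(ep N)^2\<bar> \<le> 1" for N using ep(2,3)[of N] by (auto simp: power_le_one)
 have e2: "(\<lambda>N. (ep N)^2) \<longlonglongrightarrow> 0" using tendsto_power[OF ep(1), of 2] by simp
 \<comment> \<open>Only the first term keeps both derivatives on s. The others carry ep or ep^2
   times a bounded function of the dilated variable, with the remaining field, if any, applied to
   s.\<close>
 have prod: "sublap (\<lambda>x. X N x * s x) = (\<lambda>x. X N x * sublap s x +
   ((\<Sum>j\<in>UNIV. (- 4 * (of_real (ep N) * zop 1 j q (dil (ep N) x))) * zop (-1) j s x
    + (- 4 * (of_real (ep N) * zop (-1) j q (dil (ep N) x))) * zop 1 j s x) + 1 * (of_real ((ep N)^2) * sublap q (dil (ep N) x)) * s x))" for N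
  unfolding X_def sublap_mult[OF smooth_linear_compose[OF qs dil_linear] ss] zop_dil[OF qs] sublap_dil[OF qs] by simp
 have sm: "(\<lambda>x. - 4 * (of_real (ep N) * zop ka j q (dil (ep N) x)) * zop (- ka) j s x) \<in> L2_fun lborel"
  "(\<lambda>N. l2_inner lborel f (\<lambda>x. - 4 * (of_real (ep N) * zop ka j q (dil (ep N) x)) * zop (- ka) j s x)) \<longlonglongrightarrow> 0" for ka j N
  using small[of "zop ka j q" "zop (- ka) j s" ep "-4" N, OF test_fun_zop[OF qt] wave_zop[OF s] ep(1) e1(1)] by simp_all
 have sm2: "(\<lambda>x. 1 * (of_real ((ep N)^2) * sublap q (dil (ep N) x)) * s x) \<in> L2_fun lborel"
  "(\<lambda>N. l2_inner lborel f (\<lambda>x. 1 * (of_real ((ep N)^2) * sublap q (dil (ep N) x)) * s x)) \<longlonglongrightarrow> 0" for N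
  using small[of "sublap q" s "\<lambda>N. (ep N)^2" 1 N, OF test_fun_sublap[OF qt] s e2 e1(2)] by simp_all
 have XL: "(\<lambda>x. X N x * sublap s x) \<in> L2_fun lborel" for N
  by (rule L2_fun_bounded_mult[OF sL[OF wave_sublap[OF s]] Xm XC])
 have L2s: "(\<lambda>x. \<Sum>i\<in>I. h i x) \<in> L2_fun lborel" if "finite I" "\<And>i. i \<in> I ==> h i \<in> L2_fun lborel" for I :: "'n set" and h :: "'n => 'n heis => complex"
  using that by (induction I rule: finite_induct) (auto intro: L2_fun_add)
 define E where "E ka j N x = - 4 * (of_real (ep N) * zop ka j q (dil (ep N) x)) * zop (- ka) j s x" for ka j N x
 define H where "H N x = 1 * (of_real ((ep N)^2) * sublap q (dil (ep N) x)) * s x" for N x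
 have "(\<lambda>N. l2_inner lborel f (\<lambda>x. X N x * sublap s x) +
   ((\<Sum>j\<in>UNIV. l2_inner lborel f (E 1 j N) + l2_inner lborel f (E (-1) j N)) + l2_inner lborel f (H N)))
   \<longlonglongrightarrow> 1 * l2_inner lborel f (sublap s) + ((\<Sum>j\<in>(UNIV :: 'n set). 0 + 0) + 0)"
  unfolding E_def[abs_def] H_def[abs_def]
  by (intro tendsto_add tendsto_sum sm sm2 l2_inner_bounded_limit[OF f sL[OF wave_sublap[OF s]] Xm XC Xl]) auto
 also have "(\<lambda>N. l2_inner lborel f (\<lambda>x. X N x * sublap s x) +
   ((\<Sum>j\<in>UNIV. l2_inner lborel f (E 1 j N) + l2_inner lborel f (E (-1) j N)) + l2_inner lborel f (H N)))
   = (\<lambda>N. l2_inner lborel f (sublap (\<lambda>x. X N x * s x)))"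
 proof (rule ext)
  fix N
  have S: "E ka j N \<in> L2_fun lborel" "H N \<in> L2_fun lborel" for ka j
   unfolding E_def[abs_def] H_def[abs_def] by (rule sm sm2)+
  have p: "sublap (\<lambda>x. X N x * s x) = (\<lambda>x. X N x * sublap s x + ((\<Sum>j\<in>UNIV. E 1 j N x + E (-1) j N x) + H N x))"
   unfolding prod E_def H_def by simp
  show "l2_inner lborel f (\<lambda>x. X N x * sublap s x) +
   ((\<Sum>j\<in>UNIV. l2_inner lborel f (E 1 j N) + l2_inner lborel f (E (-1) j N)) + l2_inner lborel f (H N))
   = l2_inner lborel f (sublap (\<lambda>x. X N x * s x))"
   unfolding p using XL[of N] S f
   by (simp add: l2_inner_add_right l2_inner_sum_right L2_fun_add L2s)
 qed
 also have "(\<lambda>N. l2_inner lborel f (sublap (\<lambda>x. X N x * s x))) = (\<lambda>N. l2_inner lborel g (\<lambda>x. X N x * s x))"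
  using fg test_fun_mult_smooth[OF Xt ss] by (auto simp: weak_pair_def)
 finally have "(\<lambda>N. l2_inner lborel g (\<lambda>x. X N x * s x)) \<longlonglongrightarrow> l2_inner lborel f (sublap s)" by simp
 moreover have "(\<lambda>N. l2_inner lborel g (\<lambda>x. X N x * s x)) \<longlonglongrightarrow> 1 * l2_inner lborel g s"
  by (rule l2_inner_bounded_limit[OF g sL[OF s] Xm XC Xl]) simp
 ultimately show ?thesis by (simp add: LIMSEQ_unique)
qed

lemma fst_measurable_fan: "(\<lambda>p. complex_of_real (fst p)) \<in> borel_measurable (fan_borel n)"
proof (rule measurable_restrict_space1)
 show "(\<lambda>p :: real \<times> real. complex_of_real (fst p)) \<in> borel_measurable borel" by measurable
qed

text \<open>The eigenvalue of the sublaplacian on packets becomes multiplication by the real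
  coordinate xi on the fan and moves over to F. Since xi F is not known beforehand to be
  square-integrable, the comparison with G takes place in \<open>loc_int\<close>.\<close>

lemma weak_pair_transform:
 fixes f g :: "'n::finite heis => complex"
 assumes fg: "weak_pair f g" and F: "dual_transform f F" and G: "dual_transform g G"
 shows "AE p in plancherel CARD('n). G p = of_real (fst p) * F p"
proof -
 define n where "n = CARD('n)"
 have n: "n > 0" by (simp add: n_def)
 have FL: "F \<in> L2_fun (plancherel n)" unfolding n_def by (rule dual_transform_L2[OF F])
 have GL: "G \<in> L2_fun (plancherel n)" unfolding n_def by (rule dual_transform_L2[OF G])
 have key: "integrable (plancherel n) (\<lambda>p. of_real (fst p) * F p * cnj (pks n sg ps j p)) \<and>
   l2_inner (plancherel n) G (pks n sg ps j) = l2_inner (plancherel n) (\<lambda>p. of_real (fst p) * F p) (pks n sg ps j)"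
  if *: "\<bar>sg\<bar> = 1" "test_fun ps" "support ps \<subseteq> {0<..}" for sg ps j
 proof -
  define ps' where "ps' l = of_real (real (2 * j + n) * l) * ps l" for l
  have p': "ps' = (\<lambda>l. of_nat (2 * j + n) * mv ps l)" by (auto simp: ps'_def)
  have pp: "\<bar>sg\<bar> = 1" "test_fun ps'" "support ps' \<subseteq> {0<..}"
   unfolding p' using *(1) test_fun_scale[OF mv_props(1)[OF *(2)]]
    support_mult_right[of "\<lambda>l. of_nat (2 * j + n)" "mv ps"] mv_props(2)[OF *(2,3)] by auto
  have pe: "pks n sg ps' j p = of_real (fst p) * pks n sg ps j p" for p
  proof (cases "fst p = \<bar>snd p\<bar> * real (2 * j + n) \<and> sg * snd p > 0")
   case True
   then have "sg * snd p = \<bar>snd p\<bar>" using *(1) by (metis abs_mult abs_of_pos mult_1)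
   then show ?thesis using True by (simp add: pks_def ps'_def mult.commute)
  next
   case False
   then show ?thesis using positive_support_zero[OF *(3)] by (auto simp: pks_def ps'_def)
  qed
  have e: "(\<lambda>p. of_real (fst p) * F p * cnj (pks n sg ps j p)) = (\<lambda>p. F p * cnj (pks n sg ps' j p))"
   by (rule ext) (simp add: pe)
  have "l2_inner (plancherel n) G (pks n sg ps j) = l2_inner lborel g (pk sg ps j)"
   unfolding n_def by (rule dual_transform_inner[OF G packet.gen[OF *], symmetric])
  also have "... = l2_inner lborel f (sublap (pk sg ps j))"
   by (rule weak_pair_wave[OF fg *(1) pk_wave[OF *(2,3)]])
  also have "... = l2_inner lborel f (pk sg ps' j)"
   unfolding sublap_pk[OF *(2,3,1)] ps'_def[abs_def] n_def ..
  also have "... = l2_inner (plancherel n) F (pks n sg ps' j)"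
   unfolding n_def by (rule dual_transform_inner[OF F packet.gen[OF pp[unfolded n_def]]])
  finally show ?thesis
   using L2_inner_integrable[OF FL pks_L2[OF n pp]] unfolding e l2_inner_def[of _ "\<lambda>p. of_real (fst p) * F p"] l2_inner_def[of _ F] by blast
 qed
 have "(\<lambda>p :: real \<times> real. complex_of_real (fst p)) \<in> borel_measurable (fan_borel n)" by (rule fst_measurable_fan)
 then have "loc_int n (\<lambda>p. of_real (fst p) * F p)"
  using FL key unfolding loc_int_def by (auto simp: L2_fun_def)
 from dual_transform_eqI[OF n loc_int_L2[OF n GL] this] key show ?thesis unfolding n_def by blast
qed

subsection \<open>The spectral radius\<close>

lemma L2_norm_mono:
 assumes f: "f \<in> L2_fun M" and g: "g \<in> L2_fun M" and le: "AE x in M. cmod (f x) \<le> cmod (g x)"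
 shows "L2_norm M f \<le> L2_norm M g"
 unfolding L2_norm_def
proof (rule real_sqrt_le_mono, rule integral_mono_AE)
 show "AE x in M. (cmod (f x))^2 \<le> (cmod (g x))^2" using le by eventually_elim (simp add: power_mono)
qed (use f g in \<open>simp_all add: L2_fun_integrable\<close>)

text \<open>It suffices that one of the two functions is radial: that one is approximated by
  packets, while the other enters only through its pairings with them.\<close>

lemma dual_transform_inner_radial:
 fixes f h :: "'n::finite heis => complex"
 assumes f: "f \<in> L2_rad" and F: "dual_transform f F" and H: "dual_transform h H"
 shows "l2_inner lborel f h = l2_inner (plancherel CARD('n)) F H"
proof -
 obtain s t where st: "\<And>k. packet (s k) (t k)" and s: "L2_tendsto lborel s f" and t: "L2_tendsto (plancherel CARD('n)) t F"
  by (rule packet_approximation[OF f F]) blast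
 have e: "l2_inner lborel (s k) h = l2_inner (plancherel CARD('n)) (t k) H" for k
  using dual_transform_inner[OF H st[of k]] by (metis l2_inner_commute)
 have "(\<lambda>k. l2_inner lborel (s k) h) \<longlonglongrightarrow> l2_inner lborel f h" by (rule L2_tendsto_inner[OF s dual_transform_L2(1)[OF H]])
 moreover have "(\<lambda>k. l2_inner lborel (s k) h) \<longlonglongrightarrow> l2_inner (plancherel CARD('n)) F H"
  unfolding e by (rule L2_tendsto_inner[OF t dual_transform_L2(2)[OF H]])
 ultimately show ?thesis by (rule LIMSEQ_unique)
qed

text \<open>For non-radial h only an inequality can hold, as H sees the radial part alone. It
  follows by pairing h with the radial function that has the same transform.\<close>

lemma dual_transform_norm_le:
 fixes h :: "'n::finite heis => complex"
 assumes H: "dual_transform h H"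
 shows "L2_norm (plancherel CARD('n)) H \<le> L2_norm lborel h"
proof -
 define N where "N = L2_norm (plancherel CARD('n)) H"
 obtain f :: "'n heis => complex" where f: "f \<in> L2_rad" "dual_transform f H" by (rule dual_transform_surj[OF dual_transform_L2(2)[OF H]])
 have "complex_of_real (N^2) = l2_inner lborel f h"
  unfolding N_def l2_inner_self[symmetric] by (rule dual_transform_inner_radial[OF f H, symmetric])
 then have "N^2 = cmod (l2_inner lborel f h)" by (metis norm_of_real abs_power2)
 also have "... \<le> L2_norm lborel f * L2_norm lborel h" by (rule l2_Cauchy_Schwarz[OF dual_transform_L2(1)[OF f(2)] dual_transform_L2(1)[OF H]])
 also have "L2_norm lborel f = N" unfolding N_def by (rule dual_transform_isometry[OF f])
 finally have "N * N \<le> N * L2_norm lborel h" by (simp add: power2_eq_square)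
 moreover have "N \<ge> 0" by (simp add: N_def)
 ultimately have "N \<le> L2_norm lborel h" by (cases "N = 0") auto
 then show ?thesis by (simp add: N_def)
qed

lemma weak_pair_test: "test_fun ph ==> weak_pair ph (sublap ph)"
 unfolding weak_pair_def by (auto intro: test_fun_L2 test_fun_sublap sublap_symmetric)

lemma l2_inner_distr: "l2_inner lborel g ph = distr_of_fun g (\<lambda>x. cnj (ph x))"
 by (simp add: l2_inner_def distr_of_fun_def)

text \<open>Translates the bilinear distributional condition on all powers into a chain of
  sesquilinear one-step conditions, which the transform can follow by induction.\<close>

lemma sublaplacian_powers_iff:
 fixes f :: "'n::finite heis => complex"
 assumes f: "f \<in> L2_fun lborel" and g: "\<And>j. g j \<in> L2_fun lborel"
 shows "(\<forall>j. distr_eq ((sublaplacian ^^ j) (distr_of_fun f)) (distr_of_fun (g j))) \<longleftrightarrow>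
  (AE x in lborel. f x = g 0 x) \<and> (\<forall>j. weak_pair (g j) (g (Suc j)))"
  (is "?L \<longleftrightarrow> ?R")
proof
 note step = sublaplacian_funpow(2)[OF distr_linear_of_fun[OF f]]
 {
  assume L: ?L
  have "AE x in lborel. f x - g 0 x = 0"
  proof (rule L2_test_zero[OF L2_fun_diff[OF f g]])
   fix ph :: "'n heis => complex" assume ph: "test_fun ph"
   have "(LBINT x. f x * ph x) = (LBINT x. g 0 x * ph x)"
    using L[rule_format, of 0] ph by (simp add: distr_eq_def distr_of_fun_def)
   then show "(LBINT x. (f x - g 0 x) * ph x) = 0"
    using L2_fun_mult_integrable[OF f test_fun_L2[OF ph]] L2_fun_mult_integrable[OF g test_fun_L2[OF ph]]
    by (simp add: left_diff_distrib)
  qed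
  then have "AE x in lborel. f x = g 0 x" by eventually_elim simp
  moreover have "weak_pair (g j) (g (Suc j))" for j
   unfolding weak_pair_def
  proof (intro conjI g allI impI)
   fix ph :: "'n heis => complex" assume ph: "test_fun ph"
   have "l2_inner lborel (g (Suc j)) ph = (sublaplacian ^^ Suc j) (distr_of_fun f) (\<lambda>x. cnj (ph x))"
    using L test_fun_cnj[OF ph] unfolding l2_inner_distr distr_eq_def by metis
   also have "... = (sublaplacian ^^ j) (distr_of_fun f) (\<lambda>x. cnj (sublap ph x))"
    unfolding step[OF test_fun_cnj[OF ph]] sublap_cnj[OF test_fun_smooth[OF ph]] ..
   also have "... = l2_inner lborel (g j) (sublap ph)"
    using L test_fun_cnj[OF test_fun_sublap[OF ph]] unfolding l2_inner_distr distr_eq_def by metis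
   finally show "l2_inner lborel (g (Suc j)) ph = l2_inner lborel (g j) (sublap ph)" .
  qed
  ultimately show ?R by blast
 next
  assume R: ?R
  show ?L
  proof
   fix j
   show "distr_eq ((sublaplacian ^^ j) (distr_of_fun f)) (distr_of_fun (g j))"
   proof (induction j)
    case 0
    show ?case unfolding distr_eq_def distr_of_fun_def funpow_0
    proof (intro allI impI integral_cong_AE)
     fix ph :: "'n heis => complex" assume ph: "test_fun ph"
     show "(\<lambda>x. f x * ph x) \<in> borel_measurable lborel" "(\<lambda>x. g 0 x * ph x) \<in> borel_measurable lborel"
      using L2_fun_mult_integrable[OF f test_fun_L2[OF ph]] L2_fun_mult_integrable[OF g test_fun_L2[OF ph]] by auto
     show "AE x in lborel. f x * ph x = g 0 x * ph x" using conjunct1[OF R] by eventually_elim simp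
    qed
   next
    case (Suc j)
    show ?case unfolding distr_eq_def
    proof (intro allI impI)
     fix ph :: "'n heis => complex" assume ph: "test_fun ph"
     note c = test_fun_cnj[OF ph]
     have "(sublaplacian ^^ Suc j) (distr_of_fun f) ph = (sublaplacian ^^ j) (distr_of_fun f) (sublap ph)" by (rule step[OF ph])
     also have "... = distr_of_fun (g j) (sublap ph)" using Suc test_fun_sublap[OF ph] by (simp add: distr_eq_def)
     also have "... = l2_inner lborel (g j) (sublap (\<lambda>x. cnj (ph x)))"
      unfolding l2_inner_distr sublap_cnj[OF test_fun_smooth[OF ph]] by simp
     also have "... = l2_inner lborel (g (Suc j)) (\<lambda>x. cnj (ph x))" using R c by (simp add: weak_pair_def)
     also have "... = distr_of_fun (g (Suc j)) ph" unfolding l2_inner_distr by simp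
     finally show "(sublaplacian ^^ Suc j) (distr_of_fun f) ph = distr_of_fun (g (Suc j)) ph" .
    qed
   qed
  qed
 }
qed

lemma weak_pair_powers_transform:
 fixes g :: "nat => 'n::finite heis => complex"
 assumes w: "\<And>j. weak_pair (g j) (g (Suc j))" and F: "dual_transform (g 0) F"
 obtains G where "\<And>j. dual_transform (g j) (G j)" "\<And>j. AE p in plancherel CARD('n). G j p = of_real (fst p) ^ j * F p"
proof -
 have "\<exists>G. dual_transform (g j) G" for j using w[of j] dual_transform_exists by (auto simp: weak_pair_def)
 then obtain G where G: "\<And>j. dual_transform (g j) (G j)" by metis
 have "AE p in plancherel CARD('n). G j p = of_real (fst p) ^ j * F p" for j
 proof (induction j)
  case 0
  show ?case using dual_transform_unique[OF G F] by simp
 next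
  case (Suc j)
  from Suc weak_pair_transform[OF w G G, of j] show ?case by eventually_elim simp
 qed
 with G show ?thesis by (rule that)
qed

definition cut :: "real => (real \<times> real => complex) => real \<times> real => complex" where
 "cut c F p = (if fst p > c then F p else 0)"

lemma cut_L2:
 assumes F: "F \<in> L2_fun (plancherel n)"
 shows "cut c F \<in> L2_fun (plancherel n)"
proof (rule L2_fun_dominated[OF _ F, where C = 1])
 have "Measurable.pred (fan_borel n) (\<lambda>p. fst p > c)"
  by (rule measurable_restrict_space1) measurable
 then show "cut c F \<in> borel_measurable (plancherel n)"
  using F unfolding cut_def[abs_def] by (auto simp: L2_fun_def)
 show "AE p in plancherel n. cmod (cut c F p) \<le> 1 * cmod (F p)" by (auto simp: cut_def)
qed

lemma cut_zero_iff:
 assumes F: "F \<in> L2_fun (plancherel n)"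
 shows "L2_norm (plancherel n) (cut c F) = 0 \<longleftrightarrow> (AE p in plancherel n. fst p > c --> F p = 0)"
 unfolding L2_norm_eq_0_iff[OF cut_L2[OF F]] cut_def by (intro AE_cong) auto

lemma power_lower_bound:
 assumes F: "F \<in> L2_fun (plancherel n)" and G: "G \<in> L2_fun (plancherel n)"
  and GF: "AE p in plancherel n. G p = of_real (fst p) ^ j * F p" and c: "c \<ge> 0"
 shows "c ^ j * L2_norm (plancherel n) (cut c F) \<le> L2_norm (plancherel n) G"
proof -
 have "L2_norm (plancherel n) (\<lambda>p. of_real (c ^ j) * cut c F p) \<le> L2_norm (plancherel n) G"
 proof (rule L2_norm_mono[OF L2_fun_scale[OF cut_L2[OF F]] G])
  show "AE p in plancherel n. cmod (of_real (c ^ j) * cut c F p) \<le> cmod (G p)"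
   using GF
  proof eventually_elim
   case (elim p)
   show ?case
   proof (cases "fst p > c")
    case True
    then have "c ^ j * cmod (F p) \<le> fst p ^ j * cmod (F p)" using c by (intro mult_right_mono power_mono) auto
    then show ?thesis using elim True c by (simp add: cut_def norm_mult norm_power)
   qed (simp add: cut_def)
  qed
 qed
 then show ?thesis using c by (simp only: L2_norm_scale norm_of_real power_abs abs_of_nonneg)
qed

text \<open>If F had mass m > 0 beyond c, then c^j m <= a j for all j, and j-th roots give c <= r.
  The majorant a is present because the functions representing the powers need not be radial, so
  their norms only dominate those on the fan.\<close>

lemma root_limit_cut:
 assumes F: "F \<in> L2_fun (plancherel n)" and G: "\<And>j. G j \<in> L2_fun (plancherel n)"
  and GF: "\<And>j. AE p in plancherel n. G j p = of_real (fst p) ^ j * F p"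
  and le: "\<And>j. L2_norm (plancherel n) (G j) \<le> a j" and lim: "(\<lambda>j. root j (a j)) \<longlonglongrightarrow> r" and c: "c \<ge> 0" "c > r"
 shows "AE p in plancherel n. fst p > c --> F p = 0"
proof (rule ccontr)
 assume "\<not> ?thesis"
 then have m: "L2_norm (plancherel n) (cut c F) > 0" using cut_zero_iff[OF F, of c] L2_norm_nonneg[of "plancherel n" "cut c F"] by linarith
 define m where "m = L2_norm (plancherel n) (cut c F)"
 have m0: "m > 0" using m by (simp add: m_def)
 have "(\<lambda>j. c * root j m) \<longlonglongrightarrow> c * 1" by (intro tendsto_mult tendsto_const LIMSEQ_root_const m0)
 then have "c * 1 \<le> r"
 proof (rule LIMSEQ_le[OF _ lim])
  \<comment> \<open>\<open>root 0\<close> is 0 by convention, so the comparison of roots starts at j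
    = 1.\<close>
  have "c * root j m \<le> root j (a j)" if "j \<ge> 1" for j
  proof -
   have "c ^ j * m \<le> a j" unfolding m_def using power_lower_bound[OF F G GF c(1)] le by (rule order_trans)
   then have "root j (c ^ j * m) \<le> root j (a j)" using that by simp
   then show ?thesis using that c(1) by (simp add: real_root_mult real_root_power_cancel)
  qed
  then show "\<exists>N. \<forall>j\<ge>N. c * root j m \<le> root j (a j)" by blast
 qed
 then show False using c by simp
qed

lemma AE_fst_gt:
 assumes "\<And>c. c > r ==> AE p in M. fst p > c --> F p = (0 :: complex)"
 shows "AE p in M. fst p > (r :: real) --> F p = 0"
proof -
 have "AE p in M. \<forall>N::nat. fst p > r + 1 / real (Suc N) --> F p = 0"
  unfolding AE_all_countable using assms by simp
 then show ?thesis
 proof eventually_elim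
  case (elim p)
  show ?case
  proof
   assume "r < fst p"
   then obtain N where "1 / real (Suc N) < fst p - r" using nat_approx_posE[of "fst p - r"] by auto
   then show "F p = 0" using elim by (auto simp: algebra_simps)
  qed
 qed
qed

text \<open>The limit is the least essential bound r of xi where F does not vanish. It bounds the
  norm of G j by r^j times that of F, while for c < r the part of F beyond c gives c^j times a
  positive constant from below.\<close>

lemma root_limit_exists:
 assumes F: "F \<in> L2_fun (plancherel n)" and G: "\<And>j. G j \<in> L2_fun (plancherel n)"
  and GF: "\<And>j. AE p in plancherel n. G j p = of_real (fst p) ^ j * F p"
  and \<rho>: "\<rho> \<ge> 0" "AE p in plancherel n. fst p > \<rho> --> F p = 0"
 shows "\<exists>r. (\<lambda>j. root j (L2_norm (plancherel n) (G j))) \<longlonglongrightarrow> r \<and> r \<le> \<rho>"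
proof -
 define S where "S = {c. c \<ge> 0 \<and> (AE p in plancherel n. fst p > c --> F p = 0)}"
 define r where "r = Inf S"
 have S: "\<rho> \<in> S" "bdd_below S" using \<rho> by (auto simp: S_def intro: bdd_belowI[of _ 0])
 have r\<rho>: "r \<le> \<rho>" unfolding r_def by (rule cInf_lower[OF S])
 have r0: "r \<ge> 0" unfolding r_def using S(1) by (intro cInf_greatest) (auto simp: S_def)
 have rz: "AE p in plancherel n. fst p > r --> F p = 0"
 proof (rule AE_fst_gt)
  fix c assume "c > r"
  then obtain d where "d \<in> S" "d < c" unfolding r_def using cInf_less_iff[of S c] S by auto
  then have "AE p in plancherel n. fst p > d --> F p = 0" by (simp add: S_def)
  then show "AE p in plancherel n. fst p > c --> F p = 0" by eventually_elim (use \<open>d < c\<close> in auto)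
 qed
 have pos: "AE p in plancherel n. fst p \<ge> 0" by (rule AE_I2) (auto simp: space_plancherel fan_def)
 have up: "L2_norm (plancherel n) (G j) \<le> r ^ j * L2_norm (plancherel n) F" for j
 proof -
  have "L2_norm (plancherel n) (G j) \<le> L2_norm (plancherel n) (\<lambda>p. of_real (r ^ j) * F p)"
  proof (rule L2_norm_mono[OF G L2_fun_scale[OF F]])
   show "AE p in plancherel n. cmod (G j p) \<le> cmod (of_real (r ^ j) * F p)"
    using GF[of j] rz pos
   proof eventually_elim
    case (elim p)
    show ?case
    proof (cases "fst p > r")
     case False
     then have "fst p ^ j * cmod (F p) \<le> r ^ j * cmod (F p)" using elim by (intro mult_right_mono power_mono) auto
     then show ?thesis using elim r0 by (simp add: norm_mult norm_power)
    qed (use elim in simp)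
   qed
  qed
  then show ?thesis using r0 by (simp only: L2_norm_scale norm_of_real power_abs abs_of_nonneg)
 qed
 have root0: "root j (L2_norm (plancherel n) (G j)) \<ge> 0" for j by (rule real_root_ge_zero) simp
 \<comment> \<open>Roots of a positive constant tend to 1, so the norm of F must be positive for the
   squeeze; if it is 0, all the norms are 0.\<close>
 have "(\<lambda>j. root j (L2_norm (plancherel n) (G j))) \<longlonglongrightarrow> (if L2_norm (plancherel n) F = 0 then 0 else r)"
 proof (cases "L2_norm (plancherel n) F = 0")
  case True
  then have "L2_norm (plancherel n) (G j) = 0" for j using up[of j] by (simp add: antisym)
  then show ?thesis using True by simp
 next
  case False
  then have F0: "L2_norm (plancherel n) F > 0" using L2_norm_nonneg[of "plancherel n" F] by linarith
  have "(\<lambda>j. root j (L2_norm (plancherel n) (G j))) \<longlonglongrightarrow> r"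
  proof (rule order_tendstoI)
   fix a assume a: "a < r"
   show "\<forall>\<^sub>F j in sequentially. a < root j (L2_norm (plancherel n) (G j))"
   proof (cases "a < 0")
    case True
    then show ?thesis by (intro always_eventually allI) (rule less_le_trans[OF _ root0])
   next
    case False
    define c where "c = (a + r) / 2"
    have c: "a < c" "c < r" "c \<ge> 0" using a False by (auto simp: c_def)
    have "c \<notin> S" using cInf_lower[of c S] S(2) c(2) by (auto simp: r_def)
    then have m: "L2_norm (plancherel n) (cut c F) > 0" using cut_zero_iff[OF F, of c] c(3) L2_norm_nonneg[of "plancherel n" "cut c F"]
     unfolding S_def by (metis (mono_tags) mem_Collect_eq order_le_less)
    have "(\<lambda>j. c * root j (L2_norm (plancherel n) (cut c F))) \<longlonglongrightarrow> c * 1" by (intro tendsto_mult tendsto_const LIMSEQ_root_const m)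
    then have "\<forall>\<^sub>F j in sequentially. a < c * root j (L2_norm (plancherel n) (cut c F))" using c(1) by (intro order_tendstoD(1)) auto
    then show ?thesis using eventually_ge_at_top[of 1]
    proof eventually_elim
     case (elim j)
     have "root j (c ^ j * L2_norm (plancherel n) (cut c F)) \<le> root j (L2_norm (plancherel n) (G j))"
      using elim power_lower_bound[OF F G GF c(3), of j] by simp
     then show ?case using elim c(3) by (simp add: real_root_mult real_root_power_cancel)
    qed
   qed
  next
   fix a assume a: "r < a"
   have "(\<lambda>j. r * root j (L2_norm (plancherel n) F)) \<longlonglongrightarrow> r * 1" by (intro tendsto_mult tendsto_const LIMSEQ_root_const F0)
   then have "\<forall>\<^sub>F j in sequentially. r * root j (L2_norm (plancherel n) F) < a" using a by (intro order_tendstoD(2)) auto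
   then show "\<forall>\<^sub>F j in sequentially. root j (L2_norm (plancherel n) (G j)) < a" using eventually_ge_at_top[of 1]
   proof eventually_elim
    case (elim j)
    have "root j (L2_norm (plancherel n) (G j)) \<le> root j (r ^ j * L2_norm (plancherel n) F)" using elim up[of j] by simp
    then show ?case using elim r0 by (simp add: real_root_mult real_root_power_cancel)
   qed
  qed
  then show ?thesis using False by simp
 qed
 then show ?thesis using r\<rho> \<rho>(1) by (intro exI[of _ "if L2_norm (plancherel n) F = 0 then 0 else r"]) simp
qed

text \<open>For the direction from the fan to the group, g j is the radial inverse transform of xi^j
  F, which is square-integrable because xi is bounded where F lives. The weak equations must hold
  for all test functions, also non-radial ones; they follow since a test function and its
  sublaplacian have transforms that differ by the factor xi.\<close>

lemma spectral_condition_iff: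
 fixes f :: "'n::finite heis => complex"
 assumes f: "f \<in> L2_rad" and F: "dual_transform f F" and \<rho>: "\<rho> \<ge> 0"
 shows "(\<exists>g. (\<forall>j. g j \<in> L2_fun lborel \<and>
      distr_eq ((sublaplacian ^^ j) (distr_of_fun f)) (distr_of_fun (g j))) \<and>
     (\<exists>r. (\<lambda>j. root j (L2_norm lborel (g j))) \<longlonglongrightarrow> r \<and> r \<le> \<rho>)) \<longleftrightarrow>
  (AE p in plancherel CARD('n). fst p > \<rho> --> F p = 0)"
  (is "?L \<longleftrightarrow> ?R")
proof
 have fL: "f \<in> L2_fun lborel" and FL: "F \<in> L2_fun (plancherel CARD('n))" using dual_transform_L2[OF F] by auto
 {
  assume ?L
  then obtain g r where g: "\<And>j. g j \<in> L2_fun lborel" and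
   d: "\<forall>j. distr_eq ((sublaplacian ^^ j) (distr_of_fun f)) (distr_of_fun (g j))" and
   r: "(\<lambda>j. root j (L2_norm lborel (g j))) \<longlonglongrightarrow> r" "r \<le> \<rho>" by blast
  have fg: "AE x in lborel. f x = g 0 x" and w: "\<And>j. weak_pair (g j) (g (Suc j))"
   using d unfolding sublaplacian_powers_iff[OF fL g] by auto
  have "dual_transform (g 0) F" by (rule dual_transform_cong_AE[OF F g fg FL]) simp
  then obtain G where G: "\<And>j. dual_transform (g j) (G j)" and GF: "\<And>j. AE p in plancherel CARD('n). G j p = of_real (fst p) ^ j * F p"
   using weak_pair_powers_transform[of g F, OF w] by blast
  show ?R
  proof (rule AE_fst_gt)
   fix c assume "c > \<rho>"
   then show "AE p in plancherel CARD('n). fst p > c --> F p = 0"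
    using r \<rho> by (intro root_limit_cut[OF FL dual_transform_L2(2)[OF G] GF dual_transform_norm_le[OF G] r(1)]) auto
  qed
 next
  assume R: ?R
  define G where "G j p = of_real (fst p) ^ j * F p" for j p
  have pos: "AE p in plancherel CARD('n). fst p \<ge> 0" by (rule AE_I2) (auto simp: space_plancherel fan_def)
  have GL: "G j \<in> L2_fun (plancherel CARD('n))" for j
  proof (rule L2_fun_dominated[OF _ FL, where C = "\<rho> ^ j"])
   show "G j \<in> borel_measurable (plancherel CARD('n))"
    using fst_measurable_fan[of "CARD('n)"] FL unfolding G_def[abs_def] by (auto simp: L2_fun_def)
   show "AE p in plancherel CARD('n). cmod (G j p) \<le> \<rho> ^ j * cmod (F p)"
    using R pos
   proof eventually_elim
    case (elim p)
    show ?case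
    proof (cases "fst p > \<rho>")
     case False
     then have "fst p ^ j * cmod (F p) \<le> \<rho> ^ j * cmod (F p)" using elim by (intro mult_right_mono power_mono) auto
     then show ?thesis using elim by (simp add: G_def norm_mult norm_power)
    qed (use elim in \<open>simp add: G_def\<close>)
   qed
  qed
  \<comment> \<open>For j = 0 the representative is f itself, not merely a function with the same
    transform, so the 0-th condition holds exactly.\<close>
  have "\<exists>h. h \<in> L2_rad \<and> dual_transform h (G j) \<and> (j = 0 --> h = f)" for j
  proof (cases "j = 0")
   case True
   have "G 0 = F" by (simp add: G_def[abs_def])
   then show ?thesis using f F True by auto
  next
   case False
   obtain h :: "'n heis => complex" where "h \<in> L2_rad" "dual_transform h (G j)" by (rule dual_transform_surj[OF GL])
   then show ?thesis using False by blast
  qed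
  then obtain g where g: "\<And>j. g j \<in> L2_rad" "\<And>j. dual_transform (g j) (G j)" "g 0 = f" by metis
  have gL: "g j \<in> L2_fun lborel" for j by (rule dual_transform_L2(1)[OF g(2)])
  have w: "weak_pair (g j) (g (Suc j))" for j
   unfolding weak_pair_def
  proof (intro conjI gL allI impI)
   fix ph :: "'n heis => complex" assume ph: "test_fun ph"
   obtain P where P: "dual_transform ph P" using dual_transform_exists[OF test_fun_L2[OF ph]] by blast
   obtain Q where Q: "dual_transform (sublap ph) Q" using dual_transform_exists[OF test_fun_L2[OF test_fun_sublap[OF ph]]] by blast
   have QP: "AE p in plancherel CARD('n). Q p = of_real (fst p) * P p" by (rule weak_pair_transform[OF weak_pair_test[OF ph] P Q])
   have "l2_inner lborel (g (Suc j)) ph = l2_inner (plancherel CARD('n)) (G (Suc j)) P"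
    by (rule dual_transform_inner_radial[OF g(1,2) P])
   also have "... = l2_inner (plancherel CARD('n)) (G j) Q"
    unfolding l2_inner_def
   proof (rule integral_cong_AE)
    show "(\<lambda>p. G (Suc j) p * cnj (P p)) \<in> borel_measurable (plancherel CARD('n))"
     using L2_inner_integrable[OF GL dual_transform_L2(2)[OF P]] by (rule borel_measurable_integrable)
    show "(\<lambda>p. G j p * cnj (Q p)) \<in> borel_measurable (plancherel CARD('n))"
     using L2_inner_integrable[OF GL dual_transform_L2(2)[OF Q]] by (rule borel_measurable_integrable)
    show "AE p in plancherel CARD('n). G (Suc j) p * cnj (P p) = G j p * cnj (Q p)"
     using QP by eventually_elim (simp add: G_def)
   qed
   also have "... = l2_inner lborel (g j) (sublap ph)" by (rule dual_transform_inner_radial[OF g(1,2) Q, symmetric])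
   finally show "l2_inner lborel (g (Suc j)) ph = l2_inner lborel (g j) (sublap ph)" .
  qed
  have "\<forall>j. distr_eq ((sublaplacian ^^ j) (distr_of_fun f)) (distr_of_fun (g j))"
   unfolding sublaplacian_powers_iff[OF fL gL] using w g(3) by simp
  moreover have "\<exists>r. (\<lambda>j. root j (L2_norm lborel (g j))) \<longlonglongrightarrow> r \<and> r \<le> \<rho>"
   unfolding dual_transform_isometry[OF g(1,2)]
   by (rule root_limit_exists[OF FL GL _ \<rho> R]) (simp add: G_def)
  ultimately show ?L using gL by blast
 }
qed

subsection \<open>The support radius\<close>

lemma fan_sets: "fan n \<in> sets borel"
proof -
 have "fan n = (\<Union>j. {p. on_branch n j p}) \<union> ({p. snd p = 0} \<inter> {p. 0 \<le> fst p})"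
  by (auto simp: fan_def on_branch_def)
 moreover have "closed {p :: real \<times> real. snd p = 0}" "closed {p :: real \<times> real. 0 \<le> fst p}"
  by (intro closed_Collect_eq closed_Collect_le continuous_intros)+
 ultimately show ?thesis using on_branch_sets by (auto intro!: sets.Un sets.Int)
qed

lemma AE_on_branch:
 assumes "n > 0"
 shows "AE p in plancherel n. \<exists>j. on_branch n j p"
proof (rule AE_plancherelI[OF _ _ assms])
 have [measurable]: "Measurable.pred borel (on_branch n j)" for j
  using on_branch_sets[of n j] by (simp add: pred_def)
 show "Measurable.pred (fan_borel n) (\<lambda>p. \<exists>j. on_branch n j p)"
  by (rule measurable_restrict_space1) measurable
 show "AE ta in lborel. ta \<noteq> 0 --> (\<exists>i. on_branch n i (fb n j 1 ta))" for j
  by (intro AE_I2) (auto simp: on_branch_def fb_def)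
qed

lemma emeasure_branch_finite:
 assumes n: "n > 0"
 shows "emeasure (plancherel n) ({p. on_branch n j p \<and> \<bar>snd p\<bar> \<le> k} \<inter> fan n) < \<infinity>"
proof -
 define A where "A = {p :: real \<times> real. \<bar>snd p\<bar> \<le> k} \<inter> fan n"
 have "closed {p :: real \<times> real. \<bar>snd p\<bar> \<le> k}" by (intro closed_Collect_le continuous_intros)
 then have A: "A \<in> sets (fan_borel n)" by (auto simp: A_def sets_restrict_space)
 have O: "{p. on_branch n j p} \<inter> fan n \<in> sets (fan_borel n)" using on_branch_sets[of n j] by (auto simp: sets_restrict_space)
 have bm: "(indicator {p. on_branch n j p} :: real \<times> real => ennreal) \<in> borel_measurable (fan_borel n)"
  by (intro measurable_restrict_space1 borel_measurable_indicator on_branch_sets)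
 have fbm: "fb n j 1 \<in> borel \<rightarrow>\<^sub>M fan_borel n" by (rule fb_measurable) simp
 have fA: "fb n j 1 -` A \<in> sets borel" using measurable_sets[OF fbm A] by simp
 have "{p. on_branch n j p \<and> \<bar>snd p\<bar> \<le> k} \<inter> fan n = ({p. on_branch n j p} \<inter> fan n) \<inter> A" by (auto simp: A_def)
 then have "emeasure (plancherel n) ({p. on_branch n j p \<and> \<bar>snd p\<bar> \<le> k} \<inter> fan n) =
   (\<integral>\<^sup>+p. indicator (({p. on_branch n j p} \<inter> fan n) \<inter> A) p \<partial>plancherel n)"
  using O A by (simp add: sets_plancherel)
 also have "... = (\<integral>\<^sup>+p. indicator {p. on_branch n j p} p * indicator A p \<partial>plancherel n)"
  by (intro nn_integral_cong) (auto simp: indicator_def space_plancherel)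
 also have "... = emeasure (density (plancherel n) (indicator {p. on_branch n j p})) A"
  by (rule emeasure_density[symmetric]) (use A bm in \<open>simp_all add: sets_plancherel\<close>)
 also have "... = emeasure (density lborel (\<lambda>ta. ennreal (pconst n j * \<bar>ta\<bar> ^ n))) (fb n j 1 -` A)"
  unfolding density_branch[OF n] using fbm A by (subst emeasure_distr) auto
 also have "... = (\<integral>\<^sup>+ta. ennreal (pconst n j * \<bar>ta\<bar> ^ n) * indicator (fb n j 1 -` A) ta \<partial>lborel)"
  using fA by (subst emeasure_density) auto
 also have "... \<le> (\<integral>\<^sup>+ta. ennreal (pconst n j * \<bar>k\<bar> ^ n) * indicator {-\<bar>k\<bar>..\<bar>k\<bar>} ta \<partial>lborel)"
 proof (rule nn_integral_mono)
  fix ta :: real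
  show "ennreal (pconst n j * \<bar>ta\<bar> ^ n) * indicator (fb n j 1 -` A) ta \<le> ennreal (pconst n j * \<bar>k\<bar> ^ n) * indicator {-\<bar>k\<bar>..\<bar>k\<bar>} ta"
  proof (cases "\<bar>ta\<bar> \<le> k")
   case True
   then have "pconst n j * \<bar>ta\<bar> ^ n \<le> pconst n j * \<bar>k\<bar> ^ n"
    using pconst_pos[OF n, of j] by (intro mult_left_mono power_mono) auto
   then have "ennreal (pconst n j * \<bar>ta\<bar> ^ n) \<le> ennreal (pconst n j * \<bar>k\<bar> ^ n)" by (rule ennreal_leI)
   moreover have "ta \<in> {-\<bar>k\<bar>..\<bar>k\<bar>}" using True by auto
   ultimately show ?thesis by (simp add: indicator_def)
  next
   case False
   then have "ta \<notin> fb n j 1 -` A" by (auto simp: A_def fb_def)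
   then show ?thesis by simp
  qed
 qed
 also have "... < \<infinity>" by (subst nn_integral_cmult_indicator) (auto simp: ennreal_mult_less_top)
 finally show ?thesis .
qed

text \<open>The Plancherel measure lives on the fan; pushed into the plane it becomes a Borel
  measure to which the fundamental lemma, with its boxes, applies.\<close>

abbreviation fan_inclusion_measure :: "nat => (real \<times> real) measure" where
 "fan_inclusion_measure n \<equiv> distr (plancherel n) borel (\<lambda>p. p)"

lemma fan_inclusion_measurable: "(\<lambda>p. p) \<in> plancherel n \<rightarrow>\<^sub>M borel"
proof -
 have "(\<lambda>p. p) \<in> fan_borel n \<rightarrow>\<^sub>M borel" by (rule measurable_restrict_space1) simp
 also have "fan_borel n \<rightarrow>\<^sub>M borel = plancherel n \<rightarrow>\<^sub>M borel" by (rule measurable_cong_sets) (simp_all add: sets_plancherel)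
 finally show ?thesis .
qed

lemma emeasure_fan_inclusion:
 assumes "A \<in> sets borel"
 shows "emeasure (fan_inclusion_measure n) A = emeasure (plancherel n) (A \<inter> fan n)"
 by (subst emeasure_distr[OF fan_inclusion_measurable assms]) (simp add: space_plancherel)

text \<open>The plane is exhausted by bounded pieces of branches, of finite measure, together with
  the complement of all branches, which is null.\<close>

lemma sigma_finite_fan_inclusion:
 assumes n: "n > 0"
 shows "sigma_finite_measure (fan_inclusion_measure n)"
proof
 define B where "B j k = {p. on_branch n j p \<and> \<bar>snd p\<bar> \<le> real k}" for j k
 define C where "C = - (\<Union>j. {p. on_branch n j p})"
 have B: "B j k \<in> sets borel" for j k
 proof -
  have "closed {p :: real \<times> real. \<bar>snd p\<bar> \<le> real k}" by (intro closed_Collect_le continuous_intros)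
  then have "{p. on_branch n j p} \<inter> {p. \<bar>snd p\<bar> \<le> real k} \<in> sets borel" using on_branch_sets by (intro sets.Int) auto
  then show ?thesis by (simp add: B_def Collect_conj_eq)
 qed
 have C: "C \<in> sets borel" unfolding C_def using on_branch_sets by (intro borel_comp sets.countable_UN) auto
 have "emeasure (plancherel n) (C \<inter> fan n) = 0"
 proof -
  have S: "C \<inter> fan n \<in> sets (plancherel n)" using C by (auto simp: sets_plancherel sets_restrict_space)
  have "AE p in plancherel n. p \<notin> C \<inter> fan n" using AE_on_branch[OF n] by eventually_elim (auto simp: C_def)
  then show ?thesis using S by (subst (asm) AE_iff_measurable[OF S]) (auto simp: space_plancherel)
 qed
 then have C0: "emeasure (fan_inclusion_measure n) C = 0" by (simp add: emeasure_fan_inclusion[OF C])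
 have Bf: "emeasure (fan_inclusion_measure n) (B j k) \<noteq> \<infinity>" for j k
 proof -
  have "emeasure (fan_inclusion_measure n) (B j k) < \<infinity>"
   unfolding emeasure_fan_inclusion[OF B] unfolding B_def by (rule emeasure_branch_finite[OF n])
  then show ?thesis by simp
 qed
 show "\<exists>A. countable A \<and> A \<subseteq> sets (fan_inclusion_measure n) \<and> \<Union>A = space (fan_inclusion_measure n) \<and>
   (\<forall>a\<in>A. emeasure (fan_inclusion_measure n) a \<noteq> \<infinity>)"
 proof (intro exI[of _ "insert C (range (\<lambda>(j, k). B j k))"] conjI)
  show "countable (insert C (range (\<lambda>(j, k). B j k)))" by simp
  show "insert C (range (\<lambda>(j, k). B j k)) \<subseteq> sets (fan_inclusion_measure n)" using B C by auto
  show "\<Union> (insert C (range (\<lambda>(j, k). B j k))) = space (fan_inclusion_measure n)"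
  proof -
   have "p \<in> C \<or> (\<exists>j k. p \<in> B j k)" for p
    using real_arch_simple[of "\<bar>snd p\<bar>"] by (auto simp: C_def B_def)
   then show ?thesis by fastforce
  qed
  show "\<forall>a\<in>insert C (range (\<lambda>(j, k). B j k)). emeasure (fan_inclusion_measure n) a \<noteq> \<infinity>"
   using C0 Bf by auto
 qed
qed

text \<open>Away from the axis \<open>ta = 0\<close> a box meets only finitely many branches.\<close>

lemma emeasure_cbox_finite:
 assumes n: "n > 0" and off: "cbox a b \<subseteq> {p :: real \<times> real. snd p \<noteq> 0}"
 shows "emeasure (fan_inclusion_measure n) (cbox a b) < \<infinity>"
proof (cases "cbox a b = {}")
 case False
 have "\<exists>p0\<in>cbox a b. \<forall>p\<in>cbox a b. \<bar>snd p0\<bar> \<le> \<bar>snd p\<bar>"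
  by (rule continuous_attains_inf[OF compact_cbox False]) (intro continuous_intros)
 then obtain p0 where p0: "p0 \<in> cbox a b" "\<And>p. p \<in> cbox a b ==> \<bar>snd p0\<bar> \<le> \<bar>snd p\<bar>" by blast
 define \<delta> where "\<delta> = \<bar>snd p0\<bar>"
 have \<delta>: "\<delta> > 0" using p0(1) off by (auto simp: \<delta>_def)
 obtain R where R: "\<And>p. p \<in> cbox a b ==> norm p \<le> R" using bounded_cbox[of a b] unfolding bounded_iff by blast
 obtain J :: nat where J: "R / \<delta> \<le> real J" using real_arch_simple by blast
 define B where "B j = {p. on_branch n j p \<and> \<bar>snd p\<bar> \<le> R} \<inter> fan n" for j
 have sub: "cbox a b \<inter> fan n \<subseteq> (\<Union>j\<le>J. B j)"
 proof
  fix p assume p: "p \<in> cbox a b \<inter> fan n"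
  then have s: "snd p \<noteq> 0" "\<delta> \<le> \<bar>snd p\<bar>" using off p0(2) by (auto simp: \<delta>_def)
  have nr: "\<bar>fst p\<bar> \<le> R" "\<bar>snd p\<bar> \<le> R"
   using R[of p] p norm_fst_le[of "fst p" "snd p"] norm_snd_le[of "snd p" "fst p"] by auto
  obtain j where j: "fst p = \<bar>snd p\<bar> * real (2 * j + n)" using p s by (auto simp: fan_def)
  have "\<delta> * real j \<le> \<bar>snd p\<bar> * real (2 * j + n)" using s \<delta> by (intro mult_mono) auto
  also have "... \<le> R" using nr j by simp
  finally have "real j \<le> R / \<delta>" using \<delta> by (simp add: field_simps)
  then have "j \<le> J" using J by simp
  then show "p \<in> (\<Union>j\<le>J. B j)" using p s j nr by (auto simp: B_def on_branch_def)
 qed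
 have BS: "B j \<in> sets (plancherel n)" for j
 proof -
  have "closed {p :: real \<times> real. \<bar>snd p\<bar> \<le> R}" by (intro closed_Collect_le continuous_intros)
  then have "{p. on_branch n j p} \<inter> {p. \<bar>snd p\<bar> \<le> R} \<in> sets borel" using on_branch_sets by (intro sets.Int) auto
  then show ?thesis by (auto simp: B_def Collect_conj_eq sets_plancherel sets_restrict_space)
 qed
 have "emeasure (fan_inclusion_measure n) (cbox a b) \<le> emeasure (plancherel n) (\<Union>j\<le>J. B j)"
  using sub BS by (simp add: emeasure_fan_inclusion emeasure_mono)
 also have "... \<le> (\<Sum>j\<le>J. emeasure (plancherel n) (B j))"
  using BS by (intro emeasure_subadditive_finite) auto
 also have "... < \<infinity>"
  using emeasure_branch_finite[OF n] by (simp add: B_def ennreal_sum_less_top less_top[symmetric])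
 finally show ?thesis .
qed simp

lemma fan_extension_measurable:
 fixes F :: "real \<times> real => complex"
 assumes "F \<in> borel_measurable (fan_borel n)"
 shows "(\<lambda>p. indicator (fan n) p *\<^sub>R F p) \<in> borel_measurable borel"
 using assms fan_sets[of n] borel_measurable_restrict_space_iff[of "fan n" borel F] by simp

text \<open>Every point off the support has a neighbourhood whose test functions F annihilates;
  countably many of these cover W. Since W avoids frequency 0, closed boxes in it have finite
  measure, and there square-integrability of F implies integrability.\<close>

lemma distr_supp_AE:
 fixes F :: "real \<times> real => complex"
 assumes n: "n > 0" and F: "F \<in> L2_fun (plancherel n)" and W: "open W" "W \<subseteq> {p. snd p \<noteq> 0}"
  and off: "W \<inter> distr_supp (\<lambda>ph. LINT p|plancherel n. F p * ph p) = {}"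
 shows "AE p in plancherel n. p \<in> W --> F p = 0"
proof -
 define u where "u p = indicator (fan n) p *\<^sub>R F p" for p
 have Fm: "F \<in> borel_measurable (fan_borel n)" using F by (simp add: L2_fun_def)
 have um [measurable]: "u \<in> borel_measurable borel" unfolding u_def by (rule fan_extension_measurable[OF Fm])
 have ue: "u p = F p" if "p \<in> fan n" for p using that by (simp add: u_def)
 define V where "V = {U. open U \<and> U \<subseteq> W \<and> (\<forall>ph. test_fun ph --> support ph \<subseteq> U --> (LINT p|plancherel n. F p * ph p) = 0)}"
 have cover: "W \<subseteq> \<Union>V"
 proof
  fix p assume p: "p \<in> W"
  then have "p \<notin> distr_supp (\<lambda>ph. LINT p|plancherel n. F p * ph p)" using off by blast
  then obtain U where U: "open U" "p \<in> U"
   "\<And>ph. test_fun ph ==> support ph \<subseteq> U ==> (LINT p|plancherel n. F p * ph p) = 0"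
   unfolding distr_supp_def support_def by blast
  then have "U \<inter> W \<in> V" using W(1) by (auto simp: V_def)
  then show "p \<in> \<Union>V" using p U(2) by blast
 qed
 have "open S" if "S \<in> V" for S using that by (simp add: V_def)
 then obtain V' where V': "V' \<subseteq> V" "countable V'" "\<Union>V' = \<Union>V" by (rule Lindelof) blast
 have "AE p in fan_inclusion_measure n. p \<in> U --> u p = 0" if "U \<in> V'" for U
 proof (rule fundamental_lemma[OF sigma_finite_fan_inclusion[OF n] _ um])
  have UV: "U \<in> V" using that V'(1) by blast
  then show "open U" by (simp add: V_def)
  show "integrable (fan_inclusion_measure n) (\<lambda>p. indicator (cbox a b) p *\<^sub>R u p)" if "cbox a b \<subseteq> U" for a b
  proof -
   have "cbox a b \<subseteq> {p. snd p \<noteq> 0}" using that UV W(2) by (auto simp: V_def)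
   then have fin: "emeasure (plancherel n) (cbox a b \<inter> fan n) < \<infinity>"
    using emeasure_cbox_finite[OF n] by (metis emeasure_fan_inclusion borel_closed closed_cbox)
   have S: "cbox a b \<inter> fan n \<in> sets (plancherel n)" by (auto simp: sets_plancherel sets_restrict_space)
   have "(\<lambda>p. complex_of_real (indicator (cbox a b \<inter> fan n) p)) \<in> L2_fun (plancherel n)"
   proof (rule L2_funI)
    have "(\<lambda>p. (cmod (complex_of_real (indicator (cbox a b \<inter> fan n) p)))^2) = (indicator (cbox a b \<inter> fan n) :: real \<times> real => real)"
     by (auto simp: indicator_def)
    then show "integrable (plancherel n) (\<lambda>p. (cmod (complex_of_real (indicator (cbox a b \<inter> fan n) p)))^2)"
     using S fin by simp
    show "(\<lambda>p. complex_of_real (indicator (cbox a b \<inter> fan n) p)) \<in> borel_measurable (plancherel n)"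
     using measurable_compose[OF borel_measurable_indicator[OF S], of complex_of_real borel] by simp
   qed
   then have "integrable (plancherel n) (\<lambda>p. complex_of_real (indicator (cbox a b \<inter> fan n) p) * F p)"
    by (rule L2_fun_mult_integrable[OF _ F])
   also have "?this \<longleftrightarrow> integrable (plancherel n) (\<lambda>p. indicator (cbox a b) p *\<^sub>R u p)"
    by (rule Bochner_Integration.integrable_cong) (auto simp: space_plancherel ue indicator_def)
   finally show ?thesis by (subst integrable_distr_eq[OF fan_inclusion_measurable]) auto
  qed
  fix ph :: "real \<times> real => complex" assume ph: "test_fun ph" "support ph \<subseteq> U"
  have [measurable]: "ph \<in> borel_measurable borel" by (rule smooth_measurable[OF test_fun_smooth[OF ph(1)]])
  have "(LINT p|fan_inclusion_measure n. u p * ph p) = (LINT p|plancherel n. u p * ph p)"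
   by (rule integral_distr[OF fan_inclusion_measurable]) measurable
  also have "... = (LINT p|plancherel n. F p * ph p)"
   by (rule Bochner_Integration.integral_cong) (auto simp: space_plancherel ue)
  also have "... = 0" using UV ph by (simp add: V_def)
  finally show "(LINT p|fan_inclusion_measure n. u p * ph p) = 0" .
 qed simp
 then have "AE p in fan_inclusion_measure n. \<forall>U\<in>V'. p \<in> U --> u p = 0"
  by (subst AE_ball_countable[OF V'(2)]) blast
 then have "AE p in fan_inclusion_measure n. p \<in> W --> u p = 0"
  by eventually_elim (use cover V'(3) in blast)
 then have "AE p in plancherel n. p \<in> W --> u p = 0" by (rule AE_distrD[OF fan_inclusion_measurable])
 then show ?thesis using AE_space by eventually_elim (auto simp: space_plancherel ue)
qed

text \<open>On the fan xi is nonnegative, so the absolute value in the support radius and the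
  one-sided condition on F agree.\<close>

lemma supp_radius_le_iff:
 fixes F :: "real \<times> real => complex"
 assumes n: "n > 0" and F: "F \<in> L2_fun (plancherel n)" and \<rho>: "\<rho> \<ge> 0"
 shows "supp_radius n F \<le> ennreal \<rho> \<longleftrightarrow> (AE p in plancherel n. fst p > \<rho> --> F p = 0)"
proof -
 define S where "S = distr_supp (\<lambda>ph. LINT p|plancherel n. F p * ph p)"
 have "supp_radius n F \<le> ennreal \<rho> \<longleftrightarrow> (\<forall>p\<in>S. \<bar>fst p\<bar> \<le> \<rho>)"
  unfolding supp_radius_def S_def[symmetric] using \<rho> by (auto simp: SUP_le_iff split_beta)
 also have "... \<longleftrightarrow> (AE p in plancherel n. fst p > \<rho> --> F p = 0)"
 proof
  assume S: "\<forall>p\<in>S. \<bar>fst p\<bar> \<le> \<rho>"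
  \<comment> \<open>The axis of frequency 0 is removed because boxes were shown to have finite
    measure only away from it; it is a null set, so the conclusion is not affected.\<close>
  define W where "W = {p :: real \<times> real. \<rho> < fst p} \<inter> - {p. snd p = 0}"
  have "AE p in plancherel n. p \<in> W --> F p = 0"
  proof (rule distr_supp_AE[OF n F])
   have "open {p :: real \<times> real. \<rho> < fst p}" by (intro open_Collect_less continuous_intros)
   moreover have "closed {p :: real \<times> real. snd p = 0}" by (intro closed_Collect_eq continuous_intros)
   ultimately show "open W" unfolding W_def by (intro open_Int open_Compl)
   show "W \<inter> distr_supp (\<lambda>ph. LINT p|plancherel n. F p * ph p) = {}"
    using S unfolding S_def[symmetric] by (force simp: W_def)
  qed (auto simp: W_def)
  then show "AE p in plancherel n. fst p > \<rho> --> F p = 0"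
   using AE_on_branch[OF n] by eventually_elim (auto simp: W_def on_branch_def)
 next
  assume z: "AE p in plancherel n. fst p > \<rho> --> F p = 0"
  show "\<forall>p\<in>S. \<bar>fst p\<bar> \<le> \<rho>"
  proof (rule ballI, rule ccontr)
   fix p assume p: "p \<in> S" "\<not> \<bar>fst p\<bar> \<le> \<rho>"
   define U where "U = {q :: real \<times> real. \<rho> < \<bar>fst q\<bar>}"
   have "open U" unfolding U_def by (intro open_Collect_less continuous_intros)
   moreover have "p \<in> U" using p by (simp add: U_def)
   ultimately obtain ph where ph: "test_fun ph" "support ph \<subseteq> U" "(LINT p|plancherel n. F p * ph p) \<noteq> 0"
    using p(1) unfolding S_def distr_supp_def support_def by blast
   have "(LINT p|plancherel n. F p * ph p) = (LINT p|plancherel n. 0)"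
   proof (rule integral_cong_AE)
    show "AE q in plancherel n. F q * ph q = 0"
     using z AE_space
    proof eventually_elim
     case (elim q)
     have "fst q \<ge> 0" using elim by (auto simp: space_plancherel fan_def)
     then show ?case using elim ph(2) not_in_support[of q ph] by (cases "q \<in> support ph") (auto simp: U_def)
    qed
    have "ph \<in> borel_measurable (fan_borel n)"
     by (intro measurable_restrict_space1 smooth_measurable test_fun_smooth ph(1))
    then show "(\<lambda>p. F p * ph p) \<in> borel_measurable (plancherel n)" using F by (auto simp: L2_fun_def)
   qed simp
   then show False using ph(3) by simp
  qed
 qed
 finally show ?thesis .
qed

theorem theorem8p7:
  fixes \<rho> :: real
  assumes "\<rho> \<ge> 0"
  shows "bij_betw
    (spherical_transform_L2 :: ((complex ^ 'n::finite) \<times> real \<Rightarrow> complex) set \<Rightarrow> (real \<times> real \<Rightarrow> complex) set)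
    (spectral_radius_space \<rho>) (supp_radius_space CARD('n) \<rho>)"
  unfolding spectral_radius_space_def supp_radius_space_def
proof (rule transform_bij_betw)
  fix f :: "'n heis \<Rightarrow> complex" and F assume f: "f \<in> L2_rad" and F: "dual_transform f F"
  have FL: "F \<in> L2_fun (plancherel CARD('n))" by (rule dual_transform_L2[OF F])
  have n: "CARD('n) > 0" by simp
  show "f \<in> {f \<in> L2_rad. \<exists>g. (\<forall>j. g j \<in> L2_fun lborel \<and>
            distr_eq ((sublaplacian ^^ j) (distr_of_fun f)) (distr_of_fun (g j))) \<and>
         (\<exists>r. (\<lambda>j. root j (L2_norm lborel (g j))) \<longlonglongrightarrow> r \<and> r \<le> \<rho>)} \<longleftrightarrow>
      F \<in> {F \<in> L2_fun (plancherel CARD('n)). supp_radius CARD('n) F \<le> ennreal \<rho>}"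
    unfolding mem_Collect_eq spectral_condition_iff[OF f F assms] supp_radius_le_iff[OF n FL assms]
    using f FL by blast
qed auto

end
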